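(* Let $1\leq p_1,p_2\leq\infty$ and let $p$ be defined by $\frac{1}{p}=\frac{1}{p_1}+\frac{1}{p_2}$. Let $\mathfrak{M}$ be the bilinear spherical maximal function on $\mathbb{R}^d$, $$\mathfrak{M}(f,g)(x)=\sup_{t>0}\left|\int_{\mathbb{S}^{2d-1}}f(x-ty_1)\,g(x-ty_2)\,d\sigma(y_1,y_2)\right|,\qquad x\in\mathbb{R}^d.$$ (1) ($d=1$) If $1\leq p\leq\infty$ and either $p_1=2$ or $p_2=2$, then $\mathfrak{M}$ is bounded from $L^{p_1,1}(\mathbb{R})\times L^{p_2,1}(\mathbb{R})$ to $L^{p,\infty}(\mathbb{R})$. (2) ($d=2$) If $1<p_1,p_2<2$ and $p=\frac23$ (that is, $\frac{1}{p_1}+\frac{1}{p_2}=\frac32$), then $\mathfrak{M}$ is bounded from $L^{p_1,1}(\mathbb{R}^2)\times L^{p_2,1}(\mathbb{R}^2)$ to $L^{\frac{2}{3},\infty}(\mathbb{R}^2)$.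
   Context: Here $\sigma$ is the surface measure on the unit sphere $\mathbb{S}^{2d-1}\subset\mathbb{R}^{2d}=\mathbb{R}^d\times\mathbb{R}^d$, and points of $\mathbb{S}^{2d-1}$ are written $(y_1,y_2)$ with $y_1,y_2\in\mathbb{R}^d$. $L^{p,s}$ denotes the Lorentz space; $L^{\infty,1}$ and $L^{\infty,\infty}$ are interpreted as $L^\infty$. An operator $T$ is bounded from $X\times Y$ to $Z$ if there is a constant $C$ with $\|T(f,g)\|_Z\le C\|f\|_X\|g\|_Y$ for all $f\in X$, $g\in Y$. *)

theory Defs
  imports "HOL-Analysis.Analysis" "HOL-Probability.Essential_Supremum"
begin

section \<open>Lorentz spaces\<close>

text \<open>Only the size of a function enters its Lorentz (quasi-)norm, so the norm is defined for
  functions with values in \<open>[0, \<infinity>]\<close>. This also covers maximal functions, which may be infinite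
  at some points.\<close>

definition distribution_fun :: "'a measure \<Rightarrow> ('a \<Rightarrow> ennreal) \<Rightarrow> ennreal \<Rightarrow> ennreal" where
  "distribution_fun M u l = emeasure M {x \<in> space M. l < u x}"

definition decr_rearrangement :: "'a measure \<Rightarrow> ('a \<Rightarrow> ennreal) \<Rightarrow> real \<Rightarrow> ennreal" where
  "decr_rearrangement M u t = Inf {l. distribution_fun M u l \<le> ennreal t}"

text \<open>\<open>x\<^sup>a\<close> for \<open>x \<in> [0, \<infinity>]\<close>; it is used for \<open>a > 0\<close> only.\<close>

definition ennreal_rpow :: "ennreal \<Rightarrow> real \<Rightarrow> ennreal" where
  "ennreal_rpow x a = (if x = \<infinity> then \<infinity> else ennreal (enn2real x powr a))"

text \<open>For \<open>p < \<infinity>\<close> the quasi-norm is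
  \<open>(\<integral>\<^sub>0\<^sup>\<infinity> (t\<^bsup>1/p\<^esup> u\<^sup>*(t))\<^sup>s dt/t)\<^bsup>1/s\<^esup>\<close>, respectively \<open>sup\<^bsub>t>0\<^esub> t\<^bsup>1/p\<^esup> u\<^sup>*(t)\<close> for \<open>s = \<infinity>\<close>.
  By convention both \<open>L\<^bsup>\<infinity>,1\<^esup>\<close> and \<open>L\<^bsup>\<infinity>,\<infinity>\<^esup>\<close> are \<open>L\<^sup>\<infinity>\<close>; the integral formula would make
  \<open>L\<^bsup>\<infinity>,1\<^esup>\<close> trivial.\<close>

definition lorentz_norm :: "ennreal \<Rightarrow> ennreal \<Rightarrow> 'a measure \<Rightarrow> ('a \<Rightarrow> ennreal) \<Rightarrow> ennreal" where
  "lorentz_norm p s M u =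
    (if p = \<infinity> \<and> (s = 1 \<or> s = \<infinity>) then esssup M u
     else if s = \<infinity> then
       (SUP t\<in>{0<..}. ennreal (t powr enn2real (1 / p)) * decr_rearrangement M u t)
     else
       ennreal_rpow
         (\<integral>\<^sup>+ t\<in>{0<..}.
            ennreal_rpow (ennreal (t powr enn2real (1 / p)) * decr_rearrangement M u t) (enn2real s)
              * ennreal (1 / t) \<partial>lborel)
         (1 / enn2real s))"

definition lorentz_space :: "ennreal \<Rightarrow> ennreal \<Rightarrow> 'a measure \<Rightarrow> ('a \<Rightarrow> ennreal) set" where
  "lorentz_space p s M = {u \<in> borel_measurable M. lorentz_norm p s M u < \<infinity>}"

abbreviation magnitude :: "('a \<Rightarrow> complex) \<Rightarrow> 'a \<Rightarrow> ennreal" where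
  "magnitude f \<equiv> (\<lambda>x. ennreal (norm (f x)))"

definition clorentz_space :: "ennreal \<Rightarrow> ennreal \<Rightarrow> 'a measure \<Rightarrow> ('a \<Rightarrow> complex) set" where
  "clorentz_space p s M = {f \<in> borel_measurable M. magnitude f \<in> lorentz_space p s M}"

text \<open>Boundedness of a bilinear maximal operator from \<open>L\<^bsup>p1,s1\<^esup> \<times> L\<^bsup>p2,s2\<^esup>\<close> to \<open>L\<^bsup>p,s\<^esup>\<close> over
  Lebesgue measure. Membership in the target space includes measurability of \<open>T f g\<close>.\<close>

definition lorentz_bounded ::
  "(('a::euclidean_space \<Rightarrow> complex) \<Rightarrow> ('a \<Rightarrow> complex) \<Rightarrow> 'a \<Rightarrow> ennreal) \<Rightarrow>
    ennreal \<times> ennreal \<Rightarrow> ennreal \<times> ennreal \<Rightarrow> ennreal \<times> ennreal \<Rightarrow> bool" where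
  "lorentz_bounded T = (\<lambda>(p1, s1) (p2, s2) (p, s).
    \<exists>C::real. 0 \<le> C \<and>
      (\<forall>f \<in> clorentz_space p1 s1 lebesgue. \<forall>g \<in> clorentz_space p2 s2 lebesgue.
        T f g \<in> lorentz_space p s lebesgue \<and>
        lorentz_norm p s lebesgue (T f g) \<le>
          ennreal C * lorentz_norm p1 s1 lebesgue (magnitude f)
            * lorentz_norm p2 s2 lebesgue (magnitude g)))"

section \<open>The bilinear spherical maximal function\<close>

text \<open>Surface measure on the unit sphere of an \<open>n\<close>-dimensional Euclidean space, from polar
  coordinates: \<open>\<sigma>(A) = n \<cdot> |{x. 0 < |x| \<le> 1, x/|x| \<in> A}|\<close>, where \<open>x/|x|\<close> is \<^term>\<open>sgn x\<close>.
  It is completed so that compositions with Lebesgue measurable functions remain measurable.\<close>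

definition surface_measure :: "'a::euclidean_space measure" where
  "surface_measure = completion (scale_measure (of_nat DIM('a))
     (distr (restrict_space lborel (cball 0 1 - {0})) (restrict_space borel (sphere 0 1)) sgn))"

text \<open>The product type \<open>'a \<times> 'a\<close> carries the Euclidean norm, so the sphere below is the unit
  sphere of \<open>\<real>\<^bsup>2d\<^esup>\<close> with \<open>d = DIM('a)\<close>. Where the integral does not exist, its modulus is
  counted as \<open>\<infinity>\<close>, not as the default value 0 of the Bochner integral.\<close>

definition bilinear_sph_avg ::
  "('a::euclidean_space \<Rightarrow> complex) \<Rightarrow> ('a \<Rightarrow> complex) \<Rightarrow> real \<Rightarrow> 'a \<Rightarrow> ennreal" where
  "bilinear_sph_avg f g t x =
    (if integrable surface_measure (\<lambda>(y1, y2). f (x - t *\<^sub>R y1) * g (x - t *\<^sub>R y2))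
     then ennreal (norm (LINT (y1, y2)|surface_measure. f (x - t *\<^sub>R y1) * g (x - t *\<^sub>R y2)))
     else \<infinity>)"

definition bilinear_sph_max ::
  "('a::euclidean_space \<Rightarrow> complex) \<Rightarrow> ('a \<Rightarrow> complex) \<Rightarrow> 'a \<Rightarrow> ennreal" where
  "bilinear_sph_max f g x = (SUP t\<in>{0<..}. bilinear_sph_avg f g t x)"

end

theory Submission
  imports Defs "HOL-Probability.Probability"
begin

text \<open>
  A function in \<open>L\<^bsup>p,1\<^esup>\<close> is dominated by a sum \<open>\<Sum> a\<^sub>i 1\<^bsub>A\<^sub>i\<^esub>\<close> with \<open>\<Sum> a\<^sub>i |A\<^sub>i|\<^bsup>1/p\<^esup>\<close> at most a
  multiple of its norm, and weak \<open>L\<^bsup>p\<^esup>\<close> is summable for such series when \<open>p > 1\<close>. So it suffices to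
  bound the bilinear average of \<open>1\<^sub>A\<close> and \<open>1\<^sub>B\<close> by a product \<open>U(A) V(B)\<close>, uniformly in \<open>t\<close>, where
  \<open>U\<close> and \<open>V\<close> map indicators to weak \<open>L\<^bsup>p1\<^esup>\<close> and weak \<open>L\<^bsup>p2\<^esup>\<close>; the weak spaces then multiply.

  For \<open>d = 1\<close> the average over the circle is at most \<open>C (M 1\<^sub>A)\<^bsup>1/2\<^esup> (M 1\<^sub>B)\<^bsup>1/2\<^esup>\<close> with the
  Hardy--Littlewood maximal function \<open>M\<close>, and \<open>M 1\<^sub>B \<le> 1\<close> allows any smaller exponent for one factor.

  For \<open>d = 2\<close> the sphere is sliced by \<open>s = |y\<^sub>1|\<^sup>2\<close>, which is uniformly distributed, into products of
  circles of radii \<open>\<surd>s\<close> and \<open>\<surd>(1 - s)\<close>. Hoelder's inequality in \<open>s\<close> with exponents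
  \<open>1/q = 2/p1 - 1\<close> and \<open>1/q' = 2/p2 - 1\<close> separates \<open>A\<close> and \<open>B\<close> and leaves the power means
  \<open>sup\<^sub>t (\<integral>\<^sub>0\<^sup>1 a(t\<^sup>2s)\<^sup>q ds)\<^bsup>1/q\<^esup>\<close>, where \<open>a(u)\<close> is the average of \<open>1\<^sub>A\<close> over the circle of radius
  \<open>\<surd>u\<close> about \<open>x\<close>. As a function of \<open>\<tau> = ln u\<close>, the average \<open>a\<close> has half a derivative in \<open>L\<^sup>2(dx d\<tau>)\<close>.
  Where \<open>M 1\<^sub>A \<le> h\<close>, the mean of \<open>a\<close> over an interval of length \<open>2\<^bsup>-N\<^esup> \<approx> h\<^bsup>1/2\<^esup>\<close> is \<open>O(h\<^bsup>1/2\<^esup>)\<close>, and the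
  dyadic differences between \<open>a\<close> and this mean are controlled in \<open>L\<^sup>2\<close> off a set of measure
  \<open>O(|A|/h)\<close>; this yields the power means as operators of restricted weak type
  \<open>(2q/(q + 1), 2q/(q + 1)) = (p1, p1)\<close>.
\<close>

section \<open>The Hardy--Littlewood maximal function of a set\<close>

text \<open>The target can fail to be normable: L^{1,\<infinity>} occurs for d = 1 and
  L^{2/3,\<infinity>} for d = 2, so the double series over the layers of f and g cannot be summed
  there. This forces the factored bound for indicators: it leaves two single series, each summed in
  a weak space of exponent above 1, where integrals over sets of finite measure replace a norm. A
  second obstacle is measurability of a supremum over uncountably many t. It is met by truncation to
  finitely many layers, because averages of bounded functions are continuous in x. For d = 2 the
  half derivative comes from an exact correlation formula rather than a Fourier transform: two
  circular averages correlate through the chord between their circles, and moving the log radius by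
  \<eta> changes the log chord, up to \<eta>/2, by at most ln(1 + \<eta>^2/(2 - 2 cos \<psi>)),
  whose mean over \<psi> is O(\<eta>). The scale h^(1/2) balances the bound 2^N h for means of
  length 2^(-N) against the mean-square error 2^(-N) |A|. For q > 2 one scale is not enough, and a
  geometrically weighted chain of finer scales is used.\<close>

definition hl_max :: "'a::euclidean_space set \<Rightarrow> 'a \<Rightarrow> real" where
  "hl_max A x = (SUP r\<in>{0<..}. measure lborel (A \<inter> ball x r) / measure lborel (ball x r))"

lemma measure_lborel_ball:
  fixes x :: "'a::euclidean_space"
  assumes "r > 0"
  shows "measure lborel (ball x r) = r ^ DIM('a) * measure lborel (ball (0::'a) 1)"
  using content_ball_conv_unit_ball[of r x] assms by (simp add: measure_completion)

lemma measure_lborel_ball_pos: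
  fixes x :: "'a::euclidean_space"
  shows "r > 0 \<Longrightarrow> 0 < measure lborel (ball x r)"
  using content_ball_pos[of r x] by (simp add: measure_completion)

lemma fmeasurable_lborel_ball: "ball (x::'a::euclidean_space) r \<in> fmeasurable lborel"
  by (rule fmeasurableI) (simp, rule emeasure_lborel_ball_finite)

lemma finite_lborel_Int_ball:
  fixes x :: "'a::euclidean_space"
  assumes "A \<in> sets borel"
  shows "A \<inter> ball x r \<in> fmeasurable lborel"
proof -
  have "ball x r \<inter> A \<in> fmeasurable lborel"
    by (rule fmeasurable_Int_fmeasurable) (use assms fmeasurable_lborel_ball in auto)
  then show ?thesis by (simp only: Int_commute)
qed

lemma hl_ratio_le_1:
  fixes x :: "'a::euclidean_space"
  assumes "A \<in> sets borel" "r > 0"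
  shows "measure lborel (A \<inter> ball x r) / measure lborel (ball x r) \<le> 1"
proof -
  have "measure lborel (A \<inter> ball x r) \<le> measure lborel (ball x r)"
    by (rule measure_mono_fmeasurable) (use assms fmeasurable_lborel_ball in auto)
  then show ?thesis using measure_lborel_ball_pos[OF assms(2), of x] by simp
qed

lemma hl_max_bdd:
  fixes x :: "'a::euclidean_space"
  assumes "A \<in> sets borel"
  shows "bdd_above ((\<lambda>r. measure lborel (A \<inter> ball x r) / measure lborel (ball x r)) ` {0<..})"
  by (rule bdd_aboveI[of _ 1]) (use hl_ratio_le_1[OF assms] in auto)

lemma measure_Int_ball_le_hl_max:
  fixes x :: "'a::euclidean_space"
  assumes "A \<in> sets borel" "r > 0"
  shows "measure lborel (A \<inter> ball x r) \<le> hl_max A x * measure lborel (ball x r)"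
proof -
  have "measure lborel (A \<inter> ball x r) / measure lborel (ball x r) \<le> hl_max A x"
    unfolding hl_max_def by (rule cSUP_upper[OF _ hl_max_bdd[OF assms(1)]]) (use assms in auto)
  then show ?thesis using measure_lborel_ball_pos[OF assms(2), of x] by (simp add: field_simps)
qed

lemma hl_max_nonneg:
  fixes x :: "'a::euclidean_space"
  assumes "A \<in> sets borel"
  shows "0 \<le> hl_max A x"
proof -
  have "0 \<le> hl_max A x * measure lborel (ball x 1)"
    using measure_Int_ball_le_hl_max[OF assms, of 1 x] measure_nonneg[of lborel "A \<inter> ball x 1"] by linarith
  then show ?thesis using mult_neg_pos[OF _ measure_lborel_ball_pos[OF zero_less_one, of x], of "hl_max A x"]
    by linarith
qed

lemma hl_max_le_1:
  fixes x :: "'a::euclidean_space"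
  assumes "A \<in> sets borel"
  shows "hl_max A x \<le> 1"
  unfolding hl_max_def by (rule cSUP_least) (use hl_ratio_le_1[OF assms] in auto)

lemma less_hl_maxE:
  fixes x :: "'a::euclidean_space"
  assumes "A \<in> sets borel" "l < hl_max A x"
  obtains r where "r > 0" "l * measure lborel (ball x r) < measure lborel (A \<inter> ball x r)"
proof -
  obtain r where r: "r > 0" "l < measure lborel (A \<inter> ball x r) / measure lborel (ball x r)"
    using assms(2) unfolding hl_max_def by (subst (asm) less_cSUP_iff[OF _ hl_max_bdd[OF assms(1)]]) auto
  then show thesis using that[of r] measure_lborel_ball_pos[of r x] by (simp add: field_simps)
qed

text \<open>A ball on which A has density above \<open>l\<close> keeps this property after a slight
  enlargement of the denominator, and the enlarged ball about any nearby centre contains the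
  original one.\<close>

lemma open_less_hl_max:
  fixes A :: "'a::euclidean_space set"
  assumes A: "A \<in> sets borel"
  shows "open {x. l < hl_max A x}"
proof (rule openI)
  fix x assume "x \<in> {x. l < hl_max A x}"
  then obtain r where r: "r > 0" "l * measure lborel (ball x r) < measure lborel (A \<inter> ball x r)"
    using less_hl_maxE[OF A] by blast
  define \<omega> where "\<omega> = measure lborel (ball (0::'a) 1)"
  have "((\<lambda>s. l * (s ^ DIM('a) * \<omega>)) \<longlongrightarrow> l * (r ^ DIM('a) * \<omega>)) (at_right r)"
    by (intro tendsto_intros)
  moreover have "l * (r ^ DIM('a) * \<omega>) < measure lborel (A \<inter> ball x r)"
    using r measure_lborel_ball[of r x] by (simp add: \<omega>_def)
  ultimately have "eventually (\<lambda>s. l * (s ^ DIM('a) * \<omega>) < measure lborel (A \<inter> ball x r)) (at_right r)"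
    by (rule order_tendstoD(2))
  moreover have "eventually (\<lambda>s. r < s) (at_right r)" by (simp add: eventually_at_right_less)
  ultimately have "\<exists>s. r < s \<and> l * (s ^ DIM('a) * \<omega>) < measure lborel (A \<inter> ball x r)"
    using eventually_happens'[OF trivial_limit_at_right_real eventually_conj] by fast
  then obtain s where s: "r < s" "l * (s ^ DIM('a) * \<omega>) < measure lborel (A \<inter> ball x r)" by blast
  have sr: "s > 0" using s r by linarith
  have "y \<in> {x. l < hl_max A x}" if y: "dist x y < s - r" for y
  proof -
    have "A \<inter> ball x r \<subseteq> A \<inter> ball y s"
    proof
      fix z assume "z \<in> A \<inter> ball x r"
      then show "z \<in> A \<inter> ball y s"
        using y dist_triangle[of y z x] by (simp add: dist_commute)
    qed
    then have "measure lborel (A \<inter> ball x r) \<le> measure lborel (A \<inter> ball y s)"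
      by (rule measure_mono_fmeasurable) (use A finite_lborel_Int_ball[OF A] in auto)
    also have "\<dots> \<le> hl_max A y * measure lborel (ball y s)"
      by (rule measure_Int_ball_le_hl_max[OF A]) (use s r in auto)
    finally have "l * measure lborel (ball y s) < hl_max A y * measure lborel (ball y s)"
      using s(2) unfolding \<omega>_def[symmetric] measure_lborel_ball[OF sr, of y] by linarith
    moreover have "0 < measure lborel (ball y s)" by (rule measure_lborel_ball_pos) (use s r in auto)
    ultimately have "l < hl_max A y" by (simp only: mult_less_cancel_right_pos)
    then show ?thesis by simp
  qed
  then show "\<exists>e>0. ball x e \<subseteq> {x. l < hl_max A x}"
    using s(1) by (intro exI[of _ "s - r"]) auto
qed

lemma borel_measurable_hl_max [measurable]:
  assumes "A \<in> sets borel"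
  shows "hl_max A \<in> borel_measurable borel"
  by (rule borel_measurableI_greater) (use open_less_hl_max[OF assms] in auto)

text \<open>Vitali covering: the superlevel set is covered by fivefold enlargements of disjoint
  balls, on each of which A has density above \<open>l\<close>. The enlargement is the source of
  \<open>5 ^ DIM('a)\<close>.\<close>

theorem hl_max_weak_type:
  fixes A :: "'a::euclidean_space set"
  assumes A: "A \<in> sets borel" "emeasure lborel A < \<infinity>" and l: "l > 0"
  shows "emeasure lborel {x. l < hl_max A x} \<le> ennreal (5 ^ DIM('a) * measure lborel A / l)"
proof -
  have fA: "A \<in> fmeasurable lborel" using A by (simp add: fmeasurable_def)
  define \<omega> where "\<omega> = measure lborel (ball (0::'a) 1)"
  have \<omega>: "\<omega> > 0" unfolding \<omega>_def by (rule measure_lborel_ball_pos) simp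
  define E where "E = {x. l < hl_max A x}"
  have "\<forall>x\<in>E. \<exists>r>0. l * measure lborel (ball x r) < measure lborel (A \<inter> ball x r)"
    using less_hl_maxE[OF A(1)] unfolding E_def by blast
  from bchoice[OF this] obtain r where r: "\<And>x. x \<in> E \<Longrightarrow> r x > 0"
    "\<And>x. x \<in> E \<Longrightarrow> l * measure lborel (ball x (r x)) < measure lborel (A \<inter> ball x (r x))"
    by auto
  \<comment> \<open>The covering lemma needs bounded radii. A radius above 1 is at most its own d-th
    power, and \<open>l\<close> times the volume of the ball is at most the measure of A.\<close>
  define B where "B = max 1 (measure lborel A / (l * \<omega>))"
  have rB: "0 < r x \<and> r x \<le> B" if "x \<in> E" for x
  proof (cases "r x \<le> 1")
    case False
    have "r x = r x ^ 1" by simp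
    also have "\<dots> \<le> r x ^ DIM('a)" by (rule power_increasing) (use False in auto)
    finally have "l * (r x * \<omega>) \<le> l * measure lborel (ball x (r x))"
      using measure_lborel_ball[of "r x" x] r(1)[OF that] l \<omega> by (simp add: \<omega>_def)
    also have "\<dots> \<le> measure lborel A"
      by (rule less_imp_le, rule less_le_trans[OF r(2)[OF that]], rule measure_mono_fmeasurable)
         (use A fA in auto)
    finally show ?thesis using l \<omega> r(1)[OF that] by (simp add: B_def field_simps le_max_iff_disj)
  qed (use r(1)[OF that] in \<open>simp add: B_def\<close>)
  have "E \<subseteq> (\<Union>x\<in>E. ball x (r x))" using r(1) by auto
  from Vitali_covering_lemma_balls[OF this rB] obtain C where C: "countable C" "C \<subseteq> E"
    "pairwise (\<lambda>i j. disjnt (ball i (r i)) (ball j (r j))) C"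
    "E \<subseteq> (\<Union>i\<in>C. ball i (5 * r i))"
    by blast
  \<comment> \<open>Finite subfamilies suffice: \<open>measure_UN_bound\<close> carries the bound
    over to the countable union.\<close>
  have fin: "measure lborel (\<Union>i\<in>F. ball i (5 * r i)) \<le> 5 ^ DIM('a) * measure lborel A / l"
    if F: "F \<subseteq> C" "finite F" for F
  proof -
    have rF: "r i > 0" if "i \<in> F" for i using that F C r(1) by auto
    have "measure lborel (\<Union>i\<in>F. ball i (5 * r i)) \<le> (\<Sum>i\<in>F. measure lborel (ball i (5 * r i)))"
      by (rule measure_UNION_le) (use F in auto)
    also have "\<dots> = (\<Sum>i\<in>F. 5 ^ DIM('a) * measure lborel (ball i (r i)))"
    proof (rule sum.cong)
      fix i assume "i \<in> F"
      then show "measure lborel (ball i (5 * r i)) = 5 ^ DIM('a) * measure lborel (ball i (r i))"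
        using measure_lborel_ball[of "5 * r i" i] measure_lborel_ball[of "r i" i] rF[of i]
        by (simp add: power_mult_distrib)
    qed simp
    also have "\<dots> \<le> (\<Sum>i\<in>F. 5 ^ DIM('a) * (measure lborel (A \<inter> ball i (r i)) / l))"
    proof (rule sum_mono, rule mult_left_mono)
      fix i assume "i \<in> F"
      then have "i \<in> E" using F C by auto
      from r(2)[OF this] show "measure lborel (ball i (r i)) \<le> measure lborel (A \<inter> ball i (r i)) / l"
        using l by (simp add: field_simps)
    qed simp
    also have "\<dots> = 5 ^ DIM('a) * (\<Sum>i\<in>F. measure lborel (A \<inter> ball i (r i))) / l"
      by (simp add: sum_distrib_left sum_divide_distrib)
    also have "(\<Sum>i\<in>F. measure lborel (A \<inter> ball i (r i))) = measure lborel (\<Union>i\<in>F. A \<inter> ball i (r i))"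
    proof (rule measure_UNION'[symmetric])
      show "pairwise (\<lambda>i j. disjnt (A \<inter> ball i (r i)) (A \<inter> ball j (r j))) F"
        using pairwise_subset[OF C(3) F(1)] by (auto simp: pairwise_def disjnt_def)
    qed (use F finite_lborel_Int_ball[OF A(1)] in auto)
    also have "\<dots> \<le> measure lborel A"
      by (rule measure_mono_fmeasurable, blast)
         (use F A fA in \<open>simp_all del: UN_simps add: sets.finite_UN\<close>)
    finally show ?thesis using l by (simp add: divide_right_mono)
  qed
  have b: "\<And>i. i \<in> C \<Longrightarrow> ball i (5 * r i) \<in> fmeasurable lborel"
    by (rule fmeasurable_lborel_ball)
  have f: "(\<Union>i\<in>C. ball i (5 * r i)) \<in> fmeasurable lborel"
    by (rule fmeasurable_UN_bound[OF C(1) b fin])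
  have "emeasure lborel E \<le> emeasure lborel (\<Union>i\<in>C. ball i (5 * r i))"
    by (rule emeasure_mono[OF C(4)]) (use f in auto)
  also have "\<dots> = measure lborel (\<Union>i\<in>C. ball i (5 * r i))"
    using f by (simp add: emeasure_eq_measure2)
  also have "\<dots> \<le> ennreal (5 ^ DIM('a) * measure lborel A / l)"
    by (rule ennreal_leI) (rule measure_UN_bound[OF C(1) b fin])
  finally show ?thesis unfolding E_def .
qed

section \<open>Weak-type bounds and sums in weak Lebesgue spaces\<close>

text \<open>Says that the decreasing rearrangement of F at m is at most X m^(-\<theta>), that is, F
  has weak L^{1/\<theta>} quasi-norm at most X. Indexing by the measure m instead of the level keeps
  \<theta> = 0 meaningful: it is an essential bound by X.\<close>

definition weak_bdd :: "real \<Rightarrow> ('a::euclidean_space \<Rightarrow> ennreal) \<Rightarrow> real \<Rightarrow> bool" where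
  "weak_bdd \<theta> F X \<longleftrightarrow> (\<forall>m>0. emeasure lborel {x. ennreal (X * m powr -\<theta>) < F x} \<le> ennreal m)"

lemma weak_bddD: "weak_bdd \<theta> F X \<Longrightarrow> m > 0 \<Longrightarrow> emeasure lborel {x. ennreal (X * m powr -\<theta>) < F x} \<le> ennreal m"
  unfolding weak_bdd_def by blast

lemma weak_bdd_mono:
  assumes "weak_bdd \<theta> F X" "X \<le> Y" and [measurable]: "F \<in> borel_measurable borel"
  shows "weak_bdd \<theta> F Y"
  unfolding weak_bdd_def
proof safe
  fix m :: real assume m: "m > 0"
  have "emeasure lborel {x. ennreal (Y * m powr -\<theta>) < F x} \<le> emeasure lborel {x. ennreal (X * m powr -\<theta>) < F x}"
    by (rule emeasure_mono) (use assms(2) in \<open>auto elim!: le_less_trans[rotated] intro!: ennreal_leI mult_right_mono\<close>)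
  then show "emeasure lborel {x. ennreal (Y * m powr -\<theta>) < F x} \<le> ennreal m"
    using weak_bddD[OF assms(1) m] by simp
qed

lemma weak_bdd_cmult:
  assumes "weak_bdd \<theta> F X" "a > 0" "X \<ge> 0"
  shows "weak_bdd \<theta> (\<lambda>x. ennreal a * F x) (a * X)"
  unfolding weak_bdd_def
proof safe
  fix m :: real assume m: "m > 0"
  have "ennreal (a * X * m powr -\<theta>) < ennreal a * F x \<longleftrightarrow> ennreal (X * m powr -\<theta>) < F x" for x
  proof -
    have "ennreal (a * X * m powr -\<theta>) = ennreal a * ennreal (X * m powr -\<theta>)"
      using assms by (simp add: ennreal_mult[symmetric] mult.assoc)
    then show ?thesis using assms(2)
      by (simp add: not_le[symmetric] ennreal_mult_le_mult_iff)
  qed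
  then show "emeasure lborel {x. ennreal (a * X * m powr -\<theta>) < ennreal a * F x} \<le> ennreal m"
    using weak_bddD[OF assms(1) m] by simp
qed

text \<open>The superlevel set is an increasing union of those at slightly higher thresholds. This
  permits arguments with a positive slack, which \<open>weak_bdd_suminf\<close> uses to admit terms
  whose constant is 0.\<close>

lemma weak_bdd_limit:
  fixes F :: "'a::euclidean_space \<Rightarrow> ennreal"
  assumes "\<And>e. e > 0 \<Longrightarrow> weak_bdd \<theta> F (X + e)" "X \<ge> 0" and [measurable]: "F \<in> borel_measurable borel"
  shows "weak_bdd \<theta> F X"
  unfolding weak_bdd_def
proof safe
  fix m :: real assume m: "m > 0"
  define E where "E n = {x. ennreal ((X + 1 / Suc n) * m powr -\<theta>) < F x}" for n :: nat
  have E: "E n \<in> sets lborel" for n unfolding E_def by measurable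
  have inc: "incseq E"
    unfolding incseq_Suc_iff E_def
    by (auto elim!: le_less_trans[rotated] intro!: ennreal_leI mult_right_mono simp: field_simps)
  have "{x. ennreal (X * m powr -\<theta>) < F x} \<subseteq> (\<Union>n. E n)"
  proof safe
    fix x assume *: "ennreal (X * m powr -\<theta>) < F x"
    then obtain y where y: "ennreal (X * m powr -\<theta>) < y" "y < F x" using dense by blast
    then have "y \<noteq> \<top>" using top.not_eq_extremum by force
    then obtain r where r: "y = ennreal r" "r \<ge> 0" by (metis ennreal_cases infinity_ennreal_def)
    have mp: "m powr -\<theta> > 0" using m by simp
    have "X * m powr -\<theta> < r" using y r assms(2) by (simp add: ennreal_less_iff)
    then have "X < r / m powr -\<theta>" using mp by (simp add: pos_less_divide_eq)
    then obtain n where n: "1 / Suc n < r / m powr -\<theta> - X" using nat_approx_posE[of "r / m powr -\<theta> - X"] by auto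
    then have "(X + 1 / Suc n) * m powr -\<theta> < r" using mp by (simp add: pos_less_divide_eq[symmetric] del:
        minus_mult_right powr_minus)
    then have "x \<in> E n" unfolding E_def using y r(1)
      by (auto intro!: le_less_trans[OF ennreal_leI[OF less_imp_le] y(2)[unfolded r(1)]])
    then show "x \<in> (\<Union>n. E n)" by blast
  qed
  then have "emeasure lborel {x. ennreal (X * m powr -\<theta>) < F x} \<le> emeasure lborel (\<Union>n. E n)"
    using E by (intro emeasure_mono) auto
  also have "\<dots> = (SUP n. emeasure lborel (E n))"
    by (rule SUP_emeasure_incseq[symmetric]) (use E inc in auto)
  also have "\<dots> \<le> ennreal m"
    by (rule SUP_least) (use weak_bddD[OF assms(1) m] in \<open>simp add: E_def\<close>)
  finally show "emeasure lborel {x. ennreal (X * m powr -\<theta>) < F x} \<le> ennreal m" .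
qed

text \<open>The value of the layer-cake series in \<open>nn_integral_weak_bdd\<close>; its ratio
  2^\<theta>/2 is below 1 because \<theta> < 1.\<close>

definition weak_const :: "real \<Rightarrow> real" where
  "weak_const \<theta> = 1 + 2 powr \<theta> / (1 - 2 powr \<theta> / 2)"

text \<open>Heights up to c = X e^(-\<theta>) contribute at most c e. Above them, the set where u
  exceeds c b^k has measure at most e/2^k, so the layers form a geometric series. Integrals over
  sets are additive in u, which distribution functions are not, and this makes infinite sums
  tractable.\<close>

lemma nn_integral_weak_bdd:
  fixes u :: "'a::euclidean_space \<Rightarrow> ennreal"
  assumes u: "weak_bdd \<theta> u X" "X > 0" and [measurable]: "u \<in> borel_measurable borel"
    and \<theta>: "0 < \<theta>" "\<theta> < 1"
    and [measurable]: "E \<in> sets borel" and E: "emeasure lborel E = ennreal e" "e > 0"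
  shows "(\<integral>\<^sup>+x\<in>E. u x \<partial>lborel) \<le> ennreal (weak_const \<theta> * X * e powr (1 - \<theta>))"
proof -
  define c where "c = X * e powr -\<theta>"
  define b where "b = 2 powr \<theta>"
  have c: "c > 0" unfolding c_def using assms by simp
  have b: "1 < b" "b < 2" unfolding b_def using \<theta> powr_less_mono[of \<theta> 1 2] by auto
  have bk: "b ^ k = (1 / 2 ^ k) powr -\<theta>" for k
  proof -
    have "(2::real) powr (- real k) = 1 / 2 powr real k" by (rule powr_minus_divide)
    also have "\<dots> = 1 / 2 ^ k" by (subst powr_realpow) auto
    finally have "(1 / 2 ^ k :: real) = 2 powr (- real k)" by (rule sym)
    then have "(1 / 2 ^ k :: real) powr -\<theta> = 2 powr (\<theta> * real k)" by (simp add: powr_powr mult.commute)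
    moreover have "b ^ k = b powr real k" using b powr_realpow[of b k] by linarith
    ultimately show ?thesis by (simp add: b_def powr_powr)
  qed
  \<comment> \<open>A value in the range from c b^k to c b^(k+1) is absorbed by the k-th term. The
    bound is proved for real minorants r of \<open>u x\<close>, because \<open>u x\<close> may be
    infinite.\<close>
  have pw: "u x \<le> ennreal c + (\<Sum>k. ennreal (c * b ^ Suc k) * indicator {x. ennreal (c * b ^ k) < u x} x)"
    (is "_ \<le> ennreal c + ?S x") for x
  proof -
    have *: "ennreal r \<le> ennreal c + ?S x" if r: "ennreal r \<le> u x" for r
    proof (cases "r \<le> c")
      case True
      then have "ennreal r \<le> ennreal c" by (rule ennreal_leI)
      then show ?thesis by (rule add_increasing2[OF zero_le])
    next
      case False
      obtain n where "r / c < b ^ n" using real_arch_pow[OF b(1)] by blast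
      then have ex: "r \<le> c * b ^ n" using c by (simp add: field_simps)
      define N where "N = (LEAST n. r \<le> c * b ^ n)"
      have N: "r \<le> c * b ^ N" unfolding N_def by (rule LeastI[of _ n]) (rule ex)
      obtain k where k: "N = Suc k" using False N by (cases N) auto
      have "\<not> r \<le> c * b ^ k" using not_less_Least[of k "\<lambda>n. r \<le> c * b ^ n"] k by (simp add: N_def)
      then have "ennreal (c * b ^ k) < ennreal r" using c b by (simp add: ennreal_less_iff)
      with r have "ennreal (c * b ^ k) < u x" by simp
      then have "ennreal r \<le> ennreal (c * b ^ Suc k) * indicator {x. ennreal (c * b ^ k) < u x} x"
        using N k by (simp add: ennreal_leI)
      also have "\<dots> = (\<Sum>j\<in>{k}. ennreal (c * b ^ Suc j) * indicator {x. ennreal (c * b ^ j) < u x} x)"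
        by (simp only: sum.insert finite.emptyI sum.empty empty_iff add_0_right simp_thms if_False not_False_eq_True)
      also have "\<dots> \<le> ?S x" by (rule sum_le_suminf) auto
      also have "\<dots> \<le> ennreal c + ?S x" by simp
      finally show ?thesis .
    qed
    show ?thesis
    proof (cases "u x")
      case (real r) then show ?thesis using * by simp
    next
      \<comment> \<open>A finite right-hand side s would contradict the bound for r = s + 1.\<close>
      case top
      show ?thesis
      proof (rule ccontr)
        assume "\<not> ?thesis"
        then have lt: "ennreal c + ?S x < u x" by (simp only: not_le)
        have nt: "ennreal c + ?S x \<noteq> \<top>" by (rule less_imp_neq[OF less_le_trans[OF lt top_greatest]])
        obtain s where s: "ennreal c + ?S x = ennreal s" "s \<ge> 0"
          by (cases "ennreal c + ?S x" rule: ennreal_cases) (use nt that in blast)+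
        have "ennreal (s + 1) \<le> ennreal s" using *[of "s + 1"] s top by simp
        then show False using s(2) by simp
      qed
    qed
  qed
  have "(\<integral>\<^sup>+x\<in>E. u x \<partial>lborel) \<le> (\<integral>\<^sup>+x. ennreal c * indicator E x +
      (\<Sum>k. ennreal (c * b ^ Suc k) * indicator {x. ennreal (c * b ^ k) < u x} x) \<partial>lborel)"
    by (rule nn_integral_mono) (use pw in \<open>auto split: split_indicator\<close>)
  also have "\<dots> = ennreal c * emeasure lborel E +
      (\<Sum>k. ennreal (c * b ^ Suc k) * emeasure lborel {x. ennreal (c * b ^ k) < u x})"
    by (subst nn_integral_add, simp, simp, subst nn_integral_suminf, simp)
       (auto simp: nn_integral_cmult_indicator)
  also have "(\<Sum>k. ennreal (c * b ^ Suc k) * emeasure lborel {x. ennreal (c * b ^ k) < u x})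
      \<le> (\<Sum>k. ennreal (c * b * e * (b / 2) ^ k))"
  proof (rule suminf_le)
    fix k
    have "c * b ^ k = X * (e / 2 ^ k) powr -\<theta>"
      using bk[of k] E(2) powr_mult[of e "1 / 2 ^ k" "-\<theta>"] by (simp add: c_def)
    then have "emeasure lborel {x. ennreal (c * b ^ k) < u x} \<le> ennreal (e / 2 ^ k)"
      using weak_bddD[OF u(1), of "e / 2 ^ k"] E(2) by simp
    then have "ennreal (c * b ^ Suc k) * emeasure lborel {x. ennreal (c * b ^ k) < u x} \<le> ennreal (c * b ^ Suc k) *
        ennreal (e / 2 ^ k)"
      by (rule mult_left_mono) simp
    also have "\<dots> = ennreal (c * b * e * (b / 2) ^ k)"
      using c b E(2) by (simp add: ennreal_mult[symmetric] power_divide mult_ac)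
    finally show "ennreal (c * b ^ Suc k) * emeasure lborel {x. ennreal (c * b ^ k) < u x} \<le> ennreal (c * b * e * (b / 2) ^ k)" .
  qed auto
  also have "(\<Sum>k. ennreal (c * b * e * (b / 2) ^ k)) = ennreal (c * b * e * (1 / (1 - b / 2)))"
    using b c E(2) by (intro suminf_ennreal_eq sums_mult geometric_sums) auto
  also have "ennreal c * emeasure lborel E + ennreal (c * b * e * (1 / (1 - b / 2)))
      = ennreal (c * e + c * b * e * (1 / (1 - b / 2)))"
    using b c E by (simp add: ennreal_mult[symmetric] flip: ennreal_plus)
  also have "c * e + c * b * e * (1 / (1 - b / 2)) = weak_const \<theta> * X * e powr (1 - \<theta>)"
  proof -
    have "e powr (1 - \<theta>) = e * e powr -\<theta>" using E(2) powr_add[of e 1 "-\<theta>"] by simp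
    then show ?thesis by (simp add: weak_const_def c_def b_def[symmetric] algebra_simps)
  qed
  finally show ?thesis by (simp add: add_left_mono)
qed

lemma weak_const_pos: "0 < \<theta> \<Longrightarrow> \<theta> < 1 \<Longrightarrow> weak_const \<theta> > 0"
  using powr_less_mono[of \<theta> 1 2] by (simp add: weak_const_def add_pos_nonneg)

text \<open>If the superlevel set had measure above m, then integrating the sum over a part E of it
  with measure e > m would give m^(-\<theta>) \<le> e^(-\<theta>), which is false for \<theta> >
  0.\<close>

lemma weak_bdd_suminf_pos:
  fixes u :: "nat \<Rightarrow> 'a::euclidean_space \<Rightarrow> ennreal"
  assumes u: "\<And>i. weak_bdd \<theta> (u i) (X i)" "\<And>i. X i > 0" and [measurable]: "\<And>i. u i \<in> borel_measurable borel"
    and \<theta>: "0 < \<theta>" "\<theta> < 1" and Y: "(\<Sum>i. ennreal (X i)) \<le> ennreal Y"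
  shows "weak_bdd \<theta> (\<lambda>x. \<Sum>i. u i x) (weak_const \<theta> * Y)"
  unfolding weak_bdd_def
proof safe
  fix m :: real assume m: "m > 0"
  let ?C = "weak_const \<theta>"
  have C: "?C > 0" by (rule weak_const_pos[OF \<theta>])
  have "ennreal (X 0) = (\<Sum>i\<in>{0}. ennreal (X i))" by simp
  also have "\<dots> \<le> (\<Sum>i. ennreal (X i))" by (rule sum_le_suminf) auto
  finally have "ennreal (X 0) \<le> ennreal Y" using Y by simp
  then have Ypos: "Y > 0" using u(2)[of 0] by (simp add: ennreal_le_iff2)
  define S where "S = {x. ennreal (?C * Y * m powr -\<theta>) < (\<Sum>i. u i x)}"
  have S[measurable]: "S \<in> sets borel" unfolding S_def by measurable
  show "emeasure lborel S \<le> ennreal m"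
  proof (rule ccontr)
    assume "\<not> emeasure lborel S \<le> ennreal m"
    then have gt: "ennreal m < emeasure lborel S" by simp
    \<comment> \<open>The superlevel set may have infinite measure; the integral bound needs a part
      of finite measure still above m.\<close>
    obtain E where E: "E \<in> sets borel" "E \<subseteq> S" "ennreal m < emeasure lborel E" "emeasure lborel E < \<infinity>"
    proof (cases "emeasure lborel S = \<infinity>")
      case True
      show ?thesis
        by (rule lborel.approx_PInf_emeasure_with_finite[of S m]) (use True that in auto)
    next
      case False
      then show ?thesis using that[of S] gt by (simp add: less_top)
    qed
    note [measurable] = E(1)
    obtain e where e: "emeasure lborel E = ennreal e" "e \<ge> 0"
      using E(4) by (metis ennreal_cases less_irrefl infinity_ennreal_def)
    have me: "m < e" using E(3) e m by (simp add: ennreal_less_iff)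
    have "ennreal (?C * Y * m powr -\<theta> * e) = (\<integral>\<^sup>+x. ennreal (?C * Y * m powr -\<theta>) * indicator E x \<partial>lborel)"
      using e C Ypos by (simp add: nn_integral_cmult_indicator ennreal_mult)
    also have "\<dots> \<le> (\<integral>\<^sup>+x. (\<Sum>i. u i x * indicator E x) \<partial>lborel)"
      by (rule nn_integral_mono) (use E(2) in \<open>auto simp: S_def split: split_indicator\<close>)
    also have "\<dots> = (\<Sum>i. \<integral>\<^sup>+x\<in>E. u i x \<partial>lborel)"
      by (rule nn_integral_suminf) measurable
    also have "\<dots> \<le> (\<Sum>i. ennreal (?C * e powr (1 - \<theta>)) * ennreal (X i))"
    proof (rule suminf_le)
      fix i
      have "(\<integral>\<^sup>+x\<in>E. u i x \<partial>lborel) \<le> ennreal (?C * X i * e powr (1 - \<theta>))"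
        by (rule nn_integral_weak_bdd[OF u(1) u(2) _ \<theta> _ e(1)]) (use me m E in auto)
      also have "\<dots> = ennreal (?C * e powr (1 - \<theta>)) * ennreal (X i)"
        using C u(2)[of i] by (simp add: ennreal_mult[symmetric] mult_ac)
      finally show "(\<integral>\<^sup>+x\<in>E. u i x \<partial>lborel) \<le> ennreal (?C * e powr (1 - \<theta>)) * ennreal (X i)" .
    qed auto
    also have "\<dots> \<le> ennreal (?C * e powr (1 - \<theta>)) * ennreal Y"
      by (simp add: mult_left_mono[OF Y])
    also have "\<dots> = ennreal (?C * Y * e powr (1 - \<theta>))"
      using C Ypos by (simp add: ennreal_mult[symmetric] mult_ac)
    finally have "?C * Y * m powr -\<theta> * e \<le> ?C * Y * e powr (1 - \<theta>)"
      using C Ypos by (simp add: ennreal_le_iff)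
    also have "e powr (1 - \<theta>) = e * e powr -\<theta>" using me m powr_add[of e 1 "-\<theta>"] by simp
    finally have "?C * Y * e * m powr -\<theta> \<le> ?C * Y * e * e powr -\<theta>" by (simp only: mult_ac)
    moreover have "?C * Y * e > 0" using C Ypos me m by simp
    ultimately have "m powr -\<theta> \<le> e powr -\<theta>" by (rule mult_left_le_imp_le)
    moreover have "e powr -\<theta> < m powr -\<theta>" using me m \<theta> by (intro powr_less_mono2_neg) auto
    ultimately show False by simp
  qed
qed

lemma weak_bdd_suminf:
  fixes u :: "nat \<Rightarrow> 'a::euclidean_space \<Rightarrow> ennreal"
  assumes u: "\<And>i. weak_bdd \<theta> (u i) (X i)" "\<And>i. X i \<ge> 0" and [measurable]: "\<And>i. u i \<in> borel_measurable borel"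
    and \<theta>: "0 < \<theta>" "\<theta> < 1" and Y: "(\<Sum>i. ennreal (X i)) \<le> ennreal Y" "Y \<ge> 0"
  shows "weak_bdd \<theta> (\<lambda>x. \<Sum>i. u i x) (weak_const \<theta> * Y)"
proof (rule weak_bdd_limit)
  fix e :: real assume e: "e > 0"
  define e' where "e' = e / weak_const \<theta>"
  have C: "weak_const \<theta> > 0" by (rule weak_const_pos[OF \<theta>])
  have e': "e' > 0" using e C by (simp add: e'_def)
  have "weak_bdd \<theta> (\<lambda>x. \<Sum>i. u i x) (weak_const \<theta> * (Y + e'))"
  \<comment> \<open>Adding \<open>e' / 2 ^ Suc i\<close> to the i-th constant makes all constants
    positive and raises their sum by exactly \<open>e'\<close>.\<close>
  proof (rule weak_bdd_suminf_pos[where X = "\<lambda>i. X i + e' * (1/2) ^ Suc i"])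
    show "weak_bdd \<theta> (u i) (X i + e' * (1/2) ^ Suc i)" for i
      by (rule weak_bdd_mono[OF u(1)]) (use e' in auto)
    have "(\<Sum>i. ennreal (X i + e' * (1/2) ^ Suc i)) = (\<Sum>i. ennreal (X i) + ennreal (e' * (1/2) ^ Suc i))"
      using u(2) e' by (intro suminf_cong ennreal_plus) auto
    also have "\<dots> = (\<Sum>i. ennreal (X i)) + (\<Sum>i. ennreal (e' * (1/2) ^ Suc i))"
      by (rule suminf_add[symmetric]) auto
    also have "(\<Sum>i. ennreal (e' * (1/2) ^ Suc i)) = ennreal (e' * 1)"
      by (rule suminf_ennreal_eq, use e' in simp, rule sums_mult[OF power_half_series])
    finally show "(\<Sum>i. ennreal (X i + e' * (1/2) ^ Suc i)) \<le> ennreal (Y + e')"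
      using Y e' by (simp add: add_right_mono)
    show "X i + e' * (1/2) ^ Suc i > 0" for i using u(2)[of i] e' by (simp add: add_nonneg_pos)
  qed (use \<theta> in auto)
  then show "weak_bdd \<theta> (\<lambda>x. \<Sum>i. u i x) (weak_const \<theta> * Y + e)"
    using C by (simp add: e'_def distrib_left)
qed (use Y weak_const_pos[OF \<theta>] in auto)

lemma weak_bdd_AE_finite:
  fixes F :: "'a::euclidean_space \<Rightarrow> ennreal"
  assumes "weak_bdd \<theta> F X" and [measurable]: "F \<in> borel_measurable borel"
  shows "AE x in lborel. F x < \<infinity>"
proof -
  have "emeasure lborel {x. F x = \<infinity>} \<le> 0"
  proof (rule ennreal_le_epsilon)
    fix e :: real assume e: "0 < e"
    have "emeasure lborel {x. F x = \<infinity>} \<le> emeasure lborel {x. ennreal (X * e powr -\<theta>) < F x}"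
      by (rule emeasure_mono) auto
    then show "emeasure lborel {x. F x = \<infinity>} \<le> 0 + ennreal e"
      using weak_bddD[OF assms(1) e] by simp
  qed
  then have "AE x in lborel. \<not> F x = \<infinity>"
    by (intro AE_I[of _ _ "{x. F x = \<infinity>}"]) auto
  then show ?thesis by (simp add: less_top)
qed

text \<open>A product exceeds the product of two thresholds only where one of the factors exceeds
  its own. No triangle inequality is involved, so the exponent of the product may drop to 1 or
  below.\<close>

lemma weak_bdd_mult:
  fixes F :: "'a::euclidean_space \<Rightarrow> ennreal"
  assumes F: "weak_bdd \<theta>1 F X" "X \<ge> 0" and G: "weak_bdd \<theta>2 G Y" "Y \<ge> 0"
    and [measurable]: "F \<in> borel_measurable borel" "G \<in> borel_measurable borel" and m: "m > 0"
  shows "emeasure lborel {x. ennreal (X * Y * m powr -(\<theta>1 + \<theta>2)) < F x * G x} \<le> ennreal (2 * m)"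
proof -
  let ?A = "{x. ennreal (X * m powr -\<theta>1) < F x}" and ?B = "{x. ennreal (Y * m powr -\<theta>2) < G x}"
  have "X * Y * m powr -(\<theta>1 + \<theta>2) = (X * m powr -\<theta>1) * (Y * m powr -\<theta>2)"
    by (simp add: powr_add[of m "-\<theta>1" "-\<theta>2", simplified])
  then have eq: "ennreal (X * Y * m powr -(\<theta>1 + \<theta>2)) = ennreal (X * m powr -\<theta>1) * ennreal (Y * m powr -\<theta>2)"
    using ennreal_mult[of "X * m powr -\<theta>1" "Y * m powr -\<theta>2"] F(2) G(2) by (simp only: mult_nonneg_nonneg powr_ge_zero)
  have "{x. ennreal (X * Y * m powr -(\<theta>1 + \<theta>2)) < F x * G x} \<subseteq> ?A \<union> ?B"
    unfolding eq by (auto simp: not_less intro: mult_mono) (meson mult_mono not_less zero_le)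
  then have "emeasure lborel {x. ennreal (X * Y * m powr -(\<theta>1 + \<theta>2)) < F x * G x} \<le> emeasure lborel (?A \<union> ?B)"
    by (rule emeasure_mono) simp
  also have "\<dots> \<le> emeasure lborel ?A + emeasure lborel ?B"
    by (rule emeasure_subadditive) simp_all
  also have "\<dots> \<le> ennreal m + ennreal m"
    by (rule add_mono) (use weak_bddD F G m in blast)+
  also have "\<dots> = ennreal (2 * m)" using m by (simp flip: ennreal_plus)
  finally show ?thesis .
qed

text \<open>The two exceptional sets of \<open>weak_bdd_mult\<close> each get half of the measure t;
  the threshold at t/2 instead of t produces the factor 2^(\<theta>1 + \<theta>2).\<close>

lemma lorentz_norm_weak_product:
  fixes F :: "'a::euclidean_space \<Rightarrow> ennreal"
  assumes F: "weak_bdd \<theta>1 F X" "X \<ge> 0" and G: "weak_bdd \<theta>2 G Y" "Y \<ge> 0"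
    and [measurable]: "F \<in> borel_measurable borel" "G \<in> borel_measurable borel"
    and H[measurable]: "H \<in> borel_measurable lebesgue" and AE: "AE x in lebesgue. H x \<le> F x * G x"
    and p: "p \<noteq> \<infinity>" "enn2real (1 / p) = \<theta>1 + \<theta>2"
  shows "lorentz_norm p \<infinity> lebesgue H \<le> ennreal (2 powr (\<theta>1 + \<theta>2) * (X * Y))"
proof -
  let ?\<theta> = "\<theta>1 + \<theta>2"
  have "ennreal (t powr ?\<theta>) * decr_rearrangement lebesgue H t \<le> ennreal (2 powr ?\<theta> * (X * Y))" if t: "t > 0" for t
  proof -
    let ?l = "X * Y * (t / 2) powr -?\<theta>"
    have "distribution_fun lebesgue H (ennreal ?l) \<le> emeasure lebesgue {x. ennreal ?l < F x * G x}"
      unfolding distribution_fun_def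
    proof (rule emeasure_mono_AE)
      show "AE x in lebesgue. x \<in> {x \<in> space lebesgue. ennreal ?l < H x} \<longrightarrow> x \<in> {x. ennreal ?l < F x * G x}"
        using AE by eventually_elim (auto intro: less_le_trans)
    qed (measurable, simp add: pred_def)
    also have "\<dots> = emeasure lborel {x. ennreal ?l < F x * G x}"
      by simp
    also have "\<dots> \<le> ennreal t"
      using weak_bdd_mult[OF F G, of "t / 2"] t by simp
    finally have "decr_rearrangement lebesgue H t \<le> ennreal ?l"
      unfolding decr_rearrangement_def by (intro Inf_lower) simp
    then have "ennreal (t powr ?\<theta>) * decr_rearrangement lebesgue H t \<le> ennreal (t powr ?\<theta>) * ennreal ?l"
      by (rule mult_left_mono) simp
    also have "\<dots> = ennreal (2 powr ?\<theta> * (X * Y))"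
    proof -
      have "t powr ?\<theta> * (t / 2) powr -?\<theta> = 2 powr ?\<theta>"
        using t unfolding powr_minus by (simp add: powr_divide)
      then have "t powr ?\<theta> * ?l = 2 powr ?\<theta> * (X * Y)" by (metis mult.assoc mult.commute)
      then show ?thesis using F G by (simp add: ennreal_mult[symmetric])
    qed
    finally show ?thesis .
  qed
  then show ?thesis using p unfolding lorentz_norm_def by (auto intro!: SUP_least)
qed

section \<open>Dyadic layers of a function and its L^{p,1} norm\<close>

section \<open>Layer decomposition of Lorentz functions\<close>

lemma sum_two_powr_int_le:
  fixes K :: "int set"
  assumes "finite K" "\<forall>k\<in>K. k \<le> M"
  shows "(\<Sum>k\<in>K. 2 powr real_of_int k) \<le> 2 * 2 powr real_of_int M"
  using assms
proof (induction K arbitrary: M rule: finite_linorder_max_induct)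
  case (insert b A)
  have "(\<Sum>k\<in>A. 2 powr real_of_int k) \<le> 2 * 2 powr real_of_int (b - 1)"
    by (rule insert.IH) (use insert.hyps in auto)
  also have "\<dots> = 2 powr real_of_int b" by (simp add: powr_diff)
  finally have "(\<Sum>k\<in>insert b A. 2 powr real_of_int k) \<le> 2 * 2 powr real_of_int b"
    using insert.hyps by (subst sum.insert) auto
  also have "\<dots> \<le> 2 * 2 powr real_of_int M" using insert.prems by simp
  finally show ?case .
qed simp

lemma term_le_suminf: "f i \<le> (\<Sum>i. f i :: ennreal)"
  using sum_le_suminf[of f "{i}"] by simp

lemma le_decr_rearrangement:
  fixes u :: "'a \<Rightarrow> ennreal"
  assumes [measurable]: "u \<in> borel_measurable M" and "ennreal t < emeasure M {x \<in> space M. l < u x}"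
  shows "l \<le> decr_rearrangement M u t"
  unfolding decr_rearrangement_def
proof (rule Inf_greatest)
  fix y assume "y \<in> {l. distribution_fun M u l \<le> ennreal t}"
  then have y: "emeasure M {x \<in> space M. y < u x} \<le> ennreal t" by (simp add: distribution_fun_def)
  show "l \<le> y"
  proof (rule ccontr)
    assume "\<not> l \<le> y"
    then have "emeasure M {x \<in> space M. l < u x} \<le> emeasure M {x \<in> space M. y < u x}"
      by (intro emeasure_mono) auto
    with assms y show False by simp
  qed
qed

lemma lorentz_norm_1:
  assumes "p \<ge> 1"
  shows "lorentz_norm (ennreal p) 1 M u =
    (\<integral>\<^sup>+ t\<in>{0<..}. ennreal (t powr (1 / p)) * decr_rearrangement M u t * ennreal (1 / t) \<partial>lborel)"
proof -
  have *: "ennreal_rpow x 1 = x" for x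
    by (cases x) (simp_all add: ennreal_rpow_def)
  have "1 / ennreal p = ennreal (1 / p)" using assms divide_ennreal[of 1 p] by simp
  then have "enn2real (1 / ennreal p) = 1 / p" using assms by simp
  then show ?thesis by (simp add: lorentz_norm_def *)
qed

text \<open>For p \<ge> 1 the weight t^(1/p - 1) is nonincreasing, so it is at least its value at r
  throughout the interval.\<close>

lemma nn_integral_lorentz_weight_ge:
  assumes "r > 0" "p \<ge> 1"
  shows "ennreal (r powr (1 / p)) \<le> (\<integral>\<^sup>+ t\<in>{0<..<r}. ennreal (t powr (1 / p)) * ennreal (1 / t) \<partial>lborel)"
proof -
  have "ennreal (r powr (1 / p)) = (\<integral>\<^sup>+ t. ennreal (r powr (1 / p) / r) * indicator {0<..<r} t \<partial>lborel)"
    using assms by (simp add: nn_integral_cmult_indicator ennreal_mult[symmetric])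
  also have "\<dots> \<le> (\<integral>\<^sup>+ t\<in>{0<..<r}. ennreal (t powr (1 / p)) * ennreal (1 / t) \<partial>lborel)"
  proof (rule nn_integral_mono)
    fix t
    show "ennreal (r powr (1 / p) / r) * indicator {0<..<r} t
      \<le> ennreal (t powr (1 / p)) * ennreal (1 / t) * indicator {0<..<r} t"
    proof (cases "t \<in> {0<..<r}")
      case True
      have "r powr (1 / p - 1) \<le> t powr (1 / p - 1)"
        by (rule powr_mono2') (use True assms in auto)
      then have "r powr (1 / p) / r \<le> t powr (1 / p) * (1 / t)"
        using True assms by (simp add: powr_diff)
      then show ?thesis using True by (simp add: ennreal_mult[symmetric] ennreal_leI)
    qed simp
  qed
  finally show ?thesis .
qed

text \<open>For each t the levels 2^k with t below the measure of \<open>D k\<close> all lie below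
  the decreasing rearrangement at t, and a geometric sum of them is at most twice the largest.
  Integrating against t^(1/p - 1) turns each level into 2^k times the (1/p)-th power of the measure
  of \<open>D k\<close>. The enumeration \<open>int_decode\<close> makes the sum over all integers a
  series.\<close>

lemma lorentz_level_sum:
  fixes u :: "'a::euclidean_space \<Rightarrow> ennreal"
  defines "D \<equiv> \<lambda>k::int. {x. ennreal (2 powr real_of_int k) < u x}"
  assumes p: "p \<ge> 1" and [measurable]: "u \<in> borel_measurable lebesgue"
    and fin: "lorentz_norm (ennreal p) 1 lebesgue u < \<infinity>"
  shows "emeasure lebesgue (D k) < \<infinity>"
    and "(\<Sum>i. ennreal (2 powr real_of_int (int_decode i) * measure lebesgue (D (int_decode i)) powr (1 / p)))
          \<le> 2 * lorentz_norm (ennreal p) 1 lebesgue u"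
proof -
  define N where "N = lorentz_norm (ennreal p) 1 lebesgue u"
  define w where "w t = ennreal (t powr (1 / p)) * ennreal (1 / t)" for t :: real
  have [measurable]: "w \<in> borel_measurable borel" unfolding w_def by measurable
  define J where "J k = {t. 0 < t \<and> ennreal t < emeasure lebesgue (D k)}" for k
  have [measurable]: "J k \<in> sets borel" for k unfolding J_def by measurable
  have lv: "ennreal (2 powr real_of_int k) \<le> decr_rearrangement lebesgue u t" if "t \<in> J k" for k t
  proof (rule le_decr_rearrangement)
    have "{x \<in> space lebesgue. ennreal (2 powr real_of_int k) < u x} = D k" by (simp add: D_def)
    then show "ennreal t < emeasure lebesgue {x \<in> space lebesgue. ennreal (2 powr real_of_int k) < u x}"
      using that by (simp only: J_def mem_Collect_eq)
  qed fact
  have pw: "(\<Sum>i. ennreal (2 powr real_of_int (int_decode i) / 2) * indicator (J (int_decode i)) t)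
      \<le> decr_rearrangement lebesgue u t" for t
    unfolding suminf_eq_SUP
  proof (rule SUP_least)
    fix n
    define K where "K = int_decode ` {i. i < n \<and> t \<in> J (int_decode i)}"
    have fK: "finite K" unfolding K_def by simp
    have "(\<Sum>i<n. ennreal (2 powr real_of_int (int_decode i) / 2) * indicator (J (int_decode i)) t)
        = (\<Sum>i | i < n \<and> t \<in> J (int_decode i). ennreal (2 powr real_of_int (int_decode i) / 2))"
      by (rule sum.mono_neutral_cong_right) (auto simp: indicator_def)
    also have "\<dots> = (\<Sum>k\<in>K. ennreal (2 powr real_of_int k / 2))"
      unfolding K_def by (subst sum.reindex[OF inj_int_decode]) simp
    also have "\<dots> = ennreal ((\<Sum>k\<in>K. 2 powr real_of_int k) / 2)"
      by (simp add: sum_ennreal sum_divide_distrib)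
    also have "\<dots> \<le> decr_rearrangement lebesgue u t"
    proof (cases "K = {}")
      case False
      have "(\<Sum>k\<in>K. 2 powr real_of_int k) \<le> 2 * 2 powr real_of_int (Max K)"
        by (rule sum_two_powr_int_le) (use fK in auto)
      then have "ennreal ((\<Sum>k\<in>K. 2 powr real_of_int k) / 2) \<le> ennreal (2 powr real_of_int (Max K))"
        by (intro ennreal_leI) simp
      also have "\<dots> \<le> decr_rearrangement lebesgue u t"
        by (rule lv) (use Max_in[OF fK False] in \<open>auto simp: K_def\<close>)
      finally show ?thesis .
    qed simp
    finally show "(\<Sum>i<n. ennreal (2 powr real_of_int (int_decode i) / 2) * indicator (J (int_decode i)) t)
      \<le> decr_rearrangement lebesgue u t" .
  qed
  have main: "(\<Sum>i. ennreal (2 powr real_of_int (int_decode i) / 2) * (\<integral>\<^sup>+ t\<in>J (int_decode i). w t \<partial>lborel)) \<le> N"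
  proof -
    have "(\<Sum>i. ennreal (2 powr real_of_int (int_decode i) / 2) * (\<integral>\<^sup>+ t\<in>J (int_decode i). w t \<partial>lborel))
        = (\<integral>\<^sup>+ t. (\<Sum>i. ennreal (2 powr real_of_int (int_decode i) / 2) * (w t * indicator (J (int_decode i)) t)) \<partial>lborel)"
      by (subst nn_integral_suminf) (simp_all add: nn_integral_cmult)
    also have "\<dots> \<le> (\<integral>\<^sup>+ t\<in>{0<..}. ennreal (t powr (1 / p)) * decr_rearrangement lebesgue u t * ennreal (1 / t) \<partial>lborel)"
    proof (rule nn_integral_mono)
      fix t
      show "(\<Sum>i. ennreal (2 powr real_of_int (int_decode i) / 2) * (w t * indicator (J (int_decode i)) t))
        \<le> ennreal (t powr (1 / p)) * decr_rearrangement lebesgue u t * ennreal (1 / t) * indicator {0<..} t"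
      proof (cases "t > 0")
        case True
        have "(\<Sum>i. ennreal (2 powr real_of_int (int_decode i) / 2) * (w t * indicator (J (int_decode i)) t))
          = w t * (\<Sum>i. ennreal (2 powr real_of_int (int_decode i) / 2) * indicator (J (int_decode i)) t)"
          by (subst ennreal_suminf_cmult[symmetric]) (simp add: mult_ac)
        also have "\<dots> \<le> w t * decr_rearrangement lebesgue u t" by (rule mult_left_mono[OF pw]) simp
        finally show ?thesis using True by (simp add: w_def mult_ac)
      next
        case False
        then have "indicator (J k) t = (0::ennreal)" for k by (auto simp: J_def indicator_def)
        then show ?thesis by simp
      qed
    qed
    finally show ?thesis unfolding N_def lorentz_norm_1[OF p] .
  qed
  have term_ge: "ennreal (r powr (1 / p)) \<le> (\<integral>\<^sup>+ t\<in>J k. w t \<partial>lborel)"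
    if "r > 0" "ennreal r \<le> emeasure lebesgue (D k)" for r k
  proof -
    have "ennreal (r powr (1 / p)) \<le> (\<integral>\<^sup>+ t\<in>{0<..<r}. w t \<partial>lborel)"
      unfolding w_def by (rule nn_integral_lorentz_weight_ge[OF that(1) p])
    also have "\<dots> \<le> (\<integral>\<^sup>+ t\<in>J k. w t \<partial>lborel)"
    proof (rule nn_integral_mono)
      fix t
      have "t \<in> J k" if "t \<in> {0<..<r}"
        using that \<open>ennreal r \<le> emeasure lebesgue (D k)\<close> less_le_trans[of "ennreal t" "ennreal r"]
        by (simp add: J_def ennreal_less_iff)
      then show "w t * indicator {0<..<r} t \<le> w t * indicator (J k) t"
        by (simp split: split_indicator)
    qed
    finally show ?thesis .
  qed
  show D: "emeasure lebesgue (D k) < \<infinity>" for k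
  proof (rule ccontr)
    assume "\<not> ?thesis"
    then have top: "emeasure lebesgue (D k) = \<infinity>"
      by (simp only: infinity_ennreal_def top.not_eq_extremum[symmetric] not_not)
    obtain n where n: "N = ennreal n" "n \<ge> 0"
      using fin unfolding N_def by (metis ennreal_cases less_irrefl infinity_ennreal_def)
    define c where "c = 2 powr real_of_int k / 2"
    have c: "c > 0" by (simp add: c_def)
    \<comment> \<open>With this r the term of level k alone would be at least n + 1, while the whole
      series is at most n.\<close>
    define r where "r = ((n + 1) / c) powr p"
    have r: "r > 0" "r powr (1 / p) = (n + 1) / c" using n c p by (simp_all add: r_def powr_powr)
    obtain i where i: "k = int_decode i" using surj_int_decode by (metis surjD)
    have "ennreal (n + 1) = ennreal c * ennreal (r powr (1 / p))"
      using n c by (simp add: r ennreal_mult[symmetric])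
    also have "\<dots> \<le> ennreal c * (\<integral>\<^sup>+ t\<in>J k. w t \<partial>lborel)"
      by (rule mult_left_mono[OF term_ge]) (use r top in auto)
    also have "\<dots> \<le> (\<Sum>i. ennreal (2 powr real_of_int (int_decode i) / 2) * (\<integral>\<^sup>+ t\<in>J (int_decode i). w t \<partial>lborel))"
      unfolding c_def i
      by (rule term_le_suminf[where i = i])
    also have "\<dots> \<le> ennreal n" using main n by simp
    finally show False using n by simp
  qed
  have "(\<Sum>i. ennreal (2 powr real_of_int (int_decode i) * measure lebesgue (D (int_decode i)) powr (1 / p)))
    \<le> (\<Sum>i. 2 * (ennreal (2 powr real_of_int (int_decode i) / 2) * (\<integral>\<^sup>+ t\<in>J (int_decode i). w t \<partial>lborel)))"
  proof (rule suminf_le)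
    fix i
    let ?k = "int_decode i" let ?m = "measure lebesgue (D ?k)"
    show "ennreal (2 powr real_of_int ?k * ?m powr (1 / p)) \<le> 2 * (ennreal (2 powr real_of_int ?k / 2) * (\<integral>\<^sup>+ t\<in>J ?k. w
        t \<partial>lborel))"
    proof (cases "?m = 0")
      case False
      then have m: "?m > 0" using measure_nonneg[of lebesgue "D ?k"] by linarith
      have "emeasure lebesgue (D ?k) = ennreal ?m"
        using D[of ?k] by (intro emeasure_eq_ennreal_measure) auto
      then have "ennreal (?m powr (1 / p)) \<le> (\<integral>\<^sup>+ t\<in>J ?k. w t \<partial>lborel)"
        by (intro term_ge[OF m]) simp
      then have "2 * (ennreal (2 powr real_of_int ?k / 2) * ennreal (?m powr (1 / p))) \<le> 2 * (ennreal (2 powr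
          real_of_int ?k / 2) * (\<integral>\<^sup>+ t\<in>J ?k. w t \<partial>lborel))"
        by (intro mult_left_mono) auto
      moreover have "2 * (ennreal (2 powr real_of_int ?k / 2) * ennreal (?m powr (1 / p))) = ennreal (2 powr real_of_int
          ?k * ?m powr (1 / p))"
      proof -
        have "2 * (ennreal (2 powr real_of_int ?k / 2) * ennreal (?m powr (1 / p))) = ennreal 2 * (ennreal (2 powr
            real_of_int ?k / 2) * ennreal (?m powr (1 / p)))"
          by simp
        also have "\<dots> = ennreal (2 * (2 powr real_of_int ?k / 2 * ?m powr (1 / p)))"
          by (simp only: ennreal_mult[symmetric] powr_ge_zero mult_nonneg_nonneg divide_nonneg_nonneg zero_le_numeral)
        finally show ?thesis by simp
      qed
      ultimately show ?thesis by simp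
    qed simp
  qed auto
  also have "\<dots> = 2 * (\<Sum>i. ennreal (2 powr real_of_int (int_decode i) / 2) * (\<integral>\<^sup>+ t\<in>J (int_decode i). w t \<partial>lborel))"
    by (rule ennreal_suminf_cmult)
  also have "\<dots> \<le> 2 * N" by (rule mult_left_mono[OF main]) simp
  finally show "(\<Sum>i. ennreal (2 powr real_of_int (int_decode i) * measure lebesgue (D (int_decode i)) powr (1 / p)))
          \<le> 2 * lorentz_norm (ennreal p) 1 lebesgue u" unfolding N_def .
qed

text \<open>The last conjunct bounds f on each layer, so that f restricted to finitely many layers
  is a bounded function; \<open>majorized_truncate\<close> depends on this.\<close>

definition majorized :: "('a::euclidean_space \<Rightarrow> complex) \<Rightarrow> (nat \<Rightarrow> real) \<Rightarrow> (nat \<Rightarrow> 'a set) \<Rightarrow> bool" where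
  "majorized f a A \<longleftrightarrow> (\<forall>i. 0 \<le> a i \<and> A i \<in> sets borel) \<and>
     (\<forall>x. magnitude f x \<le> (\<Sum>i. ennreal (a i) * indicator (A i) x)) \<and> (\<forall>i. \<forall>x\<in>A i. norm (f x) \<le> a i)"

lemma lebesgue_complex_AE_borel:
  fixes f :: "'a::euclidean_space \<Rightarrow> complex"
  assumes [measurable]: "f \<in> borel_measurable lebesgue"
  obtains f' where "f' \<in> borel_measurable borel" "AE x in lborel. f x = f' x"
proof -
  have "(\<lambda>x. Re (f x)) \<in> borel_measurable lebesgue" "(\<lambda>x. Im (f x)) \<in> borel_measurable lebesgue" by measurable
  then obtain g h where g: "g \<in> borel_measurable lborel" "AE x in lborel. Re (f x) = g x"
    and h: "h \<in> borel_measurable lborel" "AE x in lborel. Im (f x) = h x"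
    using completion_ex_borel_measurable_real[of _ lborel] by metis
  have [measurable]: "g \<in> borel_measurable borel" "h \<in> borel_measurable borel" using g h by simp_all
  have "(\<lambda>x. complex_of_real (g x) + \<i> * complex_of_real (h x)) \<in> borel_measurable borel" by measurable
  moreover have "AE x in lborel. f x = complex_of_real (g x) + \<i> * complex_of_real (h x)"
    using g(2) h(2) by eventually_elim (auto simp: complex_eq_iff)
  ultimately show thesis by (rule that)
qed

text \<open>The sets \<open>A i\<close> are the dyadic shells of a Borel representative, each
  contained up to a null set in a superlevel set of \<open>lorentz_level_sum\<close>. Of the factor
  4, one 2 is the ratio between the ends of a shell and the other comes from the level sum.\<close>

lemma lorentz_majorized:
  fixes f :: "'a::euclidean_space \<Rightarrow> complex"
  assumes p: "p \<ge> 1" and f: "f \<in> clorentz_space (ennreal p) 1 lebesgue"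
  obtains f' a A where "f' \<in> borel_measurable borel" "AE x in lborel. f x = f' x" "majorized f' a A"
    "\<And>i. 0 < a i" "\<And>i. emeasure lborel (A i) < \<infinity>"
    "(\<Sum>i. ennreal (a i * measure lborel (A i) powr (1 / p))) \<le> ennreal (4 * enn2real (lorentz_norm (ennreal p) 1
        lebesgue (magnitude f)))"
proof -
  have [measurable]: "f \<in> borel_measurable lebesgue" and fin: "lorentz_norm (ennreal p) 1 lebesgue (magnitude f) < \<infinity>"
    using f by (auto simp: clorentz_space_def lorentz_space_def)
  obtain f' where f'[measurable]: "f' \<in> borel_measurable borel" and AE: "AE x in lborel. f x = f' x"
    using lebesgue_complex_AE_borel[of f] by auto
  have AEl: "AE x in lebesgue. f x = f' x" using AE by (rule AE_completion)
  define D where "D k = {x. ennreal (2 powr real_of_int k) < magnitude f x}" for k :: int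
  have [measurable]: "D k \<in> sets lebesgue" for k
  proof -
    have "magnitude f \<in> borel_measurable lebesgue" by measurable
    from measurable_sets[OF this, of "{ennreal (2 powr real_of_int k)<..}"]
    have "magnitude f -` {ennreal (2 powr real_of_int k)<..} \<in> sets lebesgue" by simp
    moreover have "magnitude f -` {ennreal (2 powr real_of_int k)<..} = D k" unfolding D_def by auto
    ultimately show ?thesis by (simp only:)
  qed
  note lev = lorentz_level_sum[OF p _ fin, folded D_def]
  define k where "k i = real_of_int (int_decode i)" for i
  define A where "A i = {x. 2 powr k i < norm (f' x) \<and> norm (f' x) \<le> 2 * 2 powr k i}" for i
  have A[measurable]: "A i \<in> sets borel" for i unfolding A_def by measurable
  have Al: "A i \<in> sets lebesgue" for i using A[of i] by simp
  have le: "emeasure lebesgue (A i) \<le> emeasure lebesgue (D (int_decode i))" for i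
  proof (rule emeasure_mono_AE)
    show "AE x in lebesgue. x \<in> A i \<longrightarrow> x \<in> D (int_decode i)"
      using AEl by eventually_elim (simp add: A_def D_def k_def ennreal_less_iff)
  qed fact
  have finA: "emeasure lborel (A i) < \<infinity>" for i
    using le[of i] lev(1)[of "int_decode i"] by (simp add: le_less_trans)
  have mle: "measure lborel (A i) \<le> measure lebesgue (D (int_decode i))" for i
  proof -
    have "measure lborel (A i) = measure lebesgue (A i)" by (simp add: measure_completion)
    also have "\<dots> \<le> measure lebesgue (D (int_decode i))"
      unfolding measure_def by (rule enn2real_mono[OF le]) (use lev(1)[of "int_decode i"] in simp)
    finally show ?thesis .
  qed
  have "majorized f' (\<lambda>i. 2 * 2 powr k i) A"
    unfolding majorized_def
  proof (intro conjI allI ballI)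
    fix x show "magnitude f' x \<le> (\<Sum>i. ennreal (2 * 2 powr k i) * indicator (A i) x)"
    proof (cases "f' x = 0")
      case False
      \<comment> \<open>Ceiling minus one, not floor: the shells are open below and closed
        above.\<close>
      define j where "j = \<lceil>log 2 (norm (f' x))\<rceil> - 1"
      have n: "norm (f' x) = 2 powr log 2 (norm (f' x))" using False by simp
      have "real_of_int j < log 2 (norm (f' x))" "log 2 (norm (f' x)) \<le> 1 + real_of_int j"
        unfolding j_def by linarith+
      then have "2 powr real_of_int j < norm (f' x)" "norm (f' x) \<le> 2 powr (1 + real_of_int j)"
        by (subst n, simp, subst n, simp)
      moreover obtain i where "j = int_decode i" using surj_int_decode by (metis surjD)
      ultimately have x: "x \<in> A i" by (simp add: A_def k_def powr_add)
      then have "magnitude f' x \<le> ennreal (2 * 2 powr k i) * indicator (A i) x"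
        by (simp add: A_def ennreal_leI)
      also have "\<dots> \<le> (\<Sum>i. ennreal (2 * 2 powr k i) * indicator (A i) x)"
        by (rule term_le_suminf)
      finally show ?thesis .
    qed simp
  qed (auto simp: A_def)
  note maj = this
  have "(\<Sum>i. ennreal (2 * 2 powr k i * measure lborel (A i) powr (1 / p))) \<le> ennreal (4 * enn2real (lorentz_norm
      (ennreal p) 1 lebesgue (magnitude f)))"
  proof -
    have "(\<Sum>i. ennreal (2 * 2 powr k i * measure lborel (A i) powr (1 / p)))
      \<le> (\<Sum>i. 2 * ennreal (2 powr real_of_int (int_decode i) * measure lebesgue (D (int_decode i)) powr (1 / p)))"
    proof (rule suminf_le)
      fix i
      have "2 * 2 powr k i * measure lborel (A i) powr (1 / p) \<le> 2 * (2 powr real_of_int (int_decode i) * measure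
          lebesgue (D (int_decode i)) powr (1 / p))"
        using powr_mono2[OF _ _ mle[of i], of "1 / p"] p by (simp add: k_def)
      then have "ennreal (2 * 2 powr k i * measure lborel (A i) powr (1 / p)) \<le> ennreal (2 * (2 powr real_of_int
          (int_decode i) * measure lebesgue (D (int_decode i)) powr (1 / p)))"
        by (rule ennreal_leI)
      then show "ennreal (2 * 2 powr k i * measure lborel (A i) powr (1 / p)) \<le> 2 * ennreal (2 powr real_of_int
          (int_decode i) * measure lebesgue (D (int_decode i)) powr (1 / p))"
        by (simp add: ennreal_mult)
    qed auto
    also have "\<dots> = 2 * (\<Sum>i. ennreal (2 powr real_of_int (int_decode i) * measure lebesgue (D (int_decode i)) powr (1 / p)))"
      by (rule ennreal_suminf_cmult)
    also have "\<dots> \<le> 2 * (2 * lorentz_norm (ennreal p) 1 lebesgue (magnitude f))"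
      by (rule mult_left_mono[OF lev(2)]) auto
    also have "\<dots> = ennreal (4 * enn2real (lorentz_norm (ennreal p) 1 lebesgue (magnitude f)))"
      using fin by (simp add: ennreal_mult less_top mult.assoc[symmetric])
    finally show ?thesis .
  qed
  then show thesis by (intro that[OF f' AE maj _ finA]) simp_all
qed

text \<open>A restricted weak-type bound for U makes the weak constant of the i-th term proportional
  to the i-th term of the discretised L^{p,1} norm, so the constants are summable exactly when the
  norm is finite.\<close>

lemma weak_bdd_majorant:
  fixes U :: "'a::euclidean_space set \<Rightarrow> 'a \<Rightarrow> ennreal"
  assumes U: "\<And>A. A \<in> sets borel \<Longrightarrow> U A \<in> borel_measurable borel"
    and wk: "\<And>A. A \<in> sets borel \<Longrightarrow> emeasure lborel A < \<infinity> \<Longrightarrow> weak_bdd \<theta> (U A) (c * measure lborel A powr \<theta>)"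
    and \<theta>: "0 < \<theta>" "\<theta> < 1" and c: "c \<ge> 0"
    and A: "\<And>i. A i \<in> sets borel" "\<And>i. emeasure lborel (A i) < \<infinity>" "\<And>i. 0 < a i"
    and s: "(\<Sum>i. ennreal (a i * measure lborel (A i) powr \<theta>)) \<le> ennreal N" "N \<ge> 0"
  shows "weak_bdd \<theta> (\<lambda>x. \<Sum>i. ennreal (a i) * U (A i) x) (weak_const \<theta> * (c * N))"
proof (rule weak_bdd_suminf[where X = "\<lambda>i. a i * (c * measure lborel (A i) powr \<theta>)"])
  show "weak_bdd \<theta> (\<lambda>x. ennreal (a i) * U (A i) x) (a i * (c * measure lborel (A i) powr \<theta>))" for i
    by (rule weak_bdd_cmult[OF wk]) (use A c in auto)
  show "(\<lambda>x. ennreal (a i) * U (A i) x) \<in> borel_measurable borel" for i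
    using U[OF A(1)[of i]] by measurable
  have "(\<Sum>i. ennreal (a i * (c * measure lborel (A i) powr \<theta>))) = (\<Sum>i. ennreal c * ennreal (a i * measure lborel (A i) powr \<theta>))"
    using c A(3) by (intro suminf_cong) (simp add: ennreal_mult[symmetric] less_imp_le mult_ac)
  also have "\<dots> = ennreal c * (\<Sum>i. ennreal (a i * measure lborel (A i) powr \<theta>))"
    by (rule ennreal_suminf_cmult)
  also have "\<dots> \<le> ennreal c * ennreal N" by (rule mult_left_mono[OF s(1)]) simp
  also have "\<dots> = ennreal (c * N)" using c s by (simp add: ennreal_mult)
  finally show "(\<Sum>i. ennreal (a i * (c * measure lborel (A i) powr \<theta>))) \<le> ennreal (c * N)" .
  show "0 \<le> a i * (c * measure lborel (A i) powr \<theta>)" for i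
    using c A(3)[of i] by simp
qed (use \<theta> c s in auto)

section \<open>Integration over the sphere\<close>

text \<open>The surface measure before completion: Borel functions are measurable for it, and Fubini
  arguments stay within Borel sets.\<close>

definition sph :: "'a::euclidean_space measure" where
  "sph = scale_measure (of_nat DIM('a))
     (distr (restrict_space lborel (cball 0 1 - {0})) (restrict_space borel (sphere 0 1)) sgn)"

lemma surface_measure_eq: "surface_measure = completion sph"
  by (simp add: surface_measure_def sph_def)

lemma sets_sph [measurable_cong]: "sets sph = sets (restrict_space borel (sphere 0 1))"
  by (simp add: sph_def)

lemma sgn_measurable_sphere:
  "sgn \<in> restrict_space lborel (cball 0 1 - {0::'a::euclidean_space}) \<rightarrow>\<^sub>M restrict_space borel (sphere 0 1)"
proof (rule measurable_restrict_space2)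
  show "sgn \<in> space (restrict_space lborel (cball 0 1 - {0})) \<rightarrow> sphere 0 (1::real)"
    by (auto simp: space_restrict_space norm_sgn)
  have "sgn = (\<lambda>x::'a. x /\<^sub>R norm x)" by (simp add: sgn_div_norm fun_eq_iff)
  also have "\<dots> \<in> borel_measurable borel" by measurable
  finally show "sgn \<in> restrict_space lborel (cball 0 1 - {0}) \<rightarrow>\<^sub>M borel"
    by (intro measurable_restrict_space1) simp
qed

lemma borel_measurable_sph: "f \<in> borel \<rightarrow>\<^sub>M N \<Longrightarrow> f \<in> sph \<rightarrow>\<^sub>M N"
  by (subst measurable_cong_sets[OF sets_sph refl]) (rule measurable_restrict_space1)

lemma borel_measurable_sgn [measurable]: "sgn \<in> borel_measurable (borel :: 'a::euclidean_space measure)"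
proof -
  have "sgn = (\<lambda>x::'a. x /\<^sub>R norm x)" by (simp add: sgn_div_norm fun_eq_iff)
  also have "\<dots> \<in> borel_measurable borel" by measurable
  finally show ?thesis .
qed

lemma nn_integral_sph:
  fixes f :: "'a::euclidean_space \<Rightarrow> ennreal"
  assumes f[measurable]: "f \<in> borel_measurable borel"
  shows "(\<integral>\<^sup>+y. f y \<partial>sph) = of_nat DIM('a) * (\<integral>\<^sup>+z\<in>cball 0 1 - {0}. f (sgn z) \<partial>lborel)"
proof -
  have "(\<integral>\<^sup>+y. f y \<partial>sph) = of_nat DIM('a) * (\<integral>\<^sup>+y. f y \<partial>distr (restrict_space lborel (cball 0 1 - {0})) (restrict_space
      borel (sphere 0 1)) sgn)"
    unfolding sph_def by (rule nn_integral_scale_measure) (simp, rule measurable_restrict_space1[OF f])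
  also have "(\<integral>\<^sup>+y. f y \<partial>distr (restrict_space lborel (cball 0 1 - {0})) (restrict_space borel (sphere 0 1)) sgn)
     = (\<integral>\<^sup>+z. f (sgn z) \<partial>restrict_space lborel (cball 0 1 - {0}))"
    by (rule nn_integral_distr[OF sgn_measurable_sphere]) (simp, rule measurable_restrict_space1[OF f])
  also have "\<dots> = (\<integral>\<^sup>+z\<in>cball 0 1 - {0}. f (sgn z) \<partial>lborel)"
    by (rule nn_integral_restrict_space) simp
  finally show ?thesis .
qed

lemma finite_measure_sph: "finite_measure (sph :: 'a::euclidean_space measure)"
proof
  have "emeasure (sph :: 'a measure) (space sph) = (\<integral>\<^sup>+y. 1 \<partial>(sph :: 'a measure))" by simp
  also have "\<dots> = of_nat DIM('a) * (\<integral>\<^sup>+z\<in>cball 0 1 - {0::'a}. 1 \<partial>lborel)"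
    by (rule nn_integral_sph) simp
  finally have eq: "emeasure (sph :: 'a measure) (space sph) = of_nat DIM('a) * (\<integral>\<^sup>+z\<in>cball 0 1 - {0::'a}. 1 \<partial>lborel)" .
  have "(\<integral>\<^sup>+z\<in>cball 0 1 - {0::'a}. 1 \<partial>lborel) = emeasure lborel (cball 0 1 - {0::'a})" by simp
  also have "\<dots> \<le> emeasure lborel (cball 0 (1::real) :: 'a set)" by (rule emeasure_mono) auto
  also have "\<dots> < \<infinity>" by (rule emeasure_lborel_cball_finite)
  finally have "of_nat DIM('a) * (\<integral>\<^sup>+z\<in>cball 0 1 - {0::'a}. 1 \<partial>lborel) < \<infinity>"
    by (intro ennreal_mult_less_top[THEN iffD2, folded infinity_ennreal_def]) (simp_all add: of_nat_less_top)
  then show "emeasure (sph :: 'a measure) (space sph) \<noteq> \<infinity>"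
    unfolding eq by (rule less_imp_neq)
qed

section \<open>Absolute continuity of the projected surface measure and its consequences\<close>

lemma nn_integral_affine:
  fixes f :: "'a::euclidean_space \<Rightarrow> ennreal"
  assumes [measurable]: "f \<in> borel_measurable borel" and c: "c \<noteq> 0"
  shows "(\<integral>\<^sup>+z. f z \<partial>lborel) = ennreal (\<bar>c\<bar> ^ DIM('a)) * (\<integral>\<^sup>+z. f (x + c *\<^sub>R z) \<partial>lborel)"
  by (subst lborel_affine[OF c, of x])
     (simp add: nn_integral_density nn_integral_distr nn_integral_cmult)

lemma completion_measurable_AE_cong:
  assumes g: "g \<in> M \<rightarrow>\<^sub>M N" and AE: "AE x in M. f x = g x" and f: "f \<in> space M \<rightarrow> space N"
  shows "f \<in> completion M \<rightarrow>\<^sub>M N"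
proof (rule measurableI)
  fix A assume A: "A \<in> sets N"
  have "AE x in completion M. f x = g x" using AE by (rule AE_completion)
  then have "AE x in completion M. x \<in> g -` A \<inter> space M \<longleftrightarrow> x \<in> f -` A \<inter> space M"
    by eventually_elim auto
  moreover have "g -` A \<inter> space M \<in> sets (completion M)"
    using measurable_sets[OF g A] by simp
  ultimately show "f -` A \<inter> space (completion M) \<in> sets (completion M)"
    by (subst space_completion) (rule completion.in_sets_AE, auto)
qed (use f in auto)


text \<open>A quantitative form of absolute continuity of the image of the surface measure under a projection;
  the \<open>e\<close> makes room for the unbounded density in dimension one.\<close>

definition ac_proj :: "('b::euclidean_space \<Rightarrow> 'a::euclidean_space) \<Rightarrow> bool" where
  "ac_proj \<pi> \<longleftrightarrow> \<pi> \<in> borel_measurable borel \<and>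
    (\<forall>e>0. \<exists>C\<ge>0. \<forall>h\<in>borel_measurable borel. (\<forall>z. h z \<le> 1) \<longrightarrow>
      (\<integral>\<^sup>+y. h (\<pi> y) \<partial>sph) \<le> ennreal e + ennreal C * (\<integral>\<^sup>+z\<in>cball 0 1. h z \<partial>lborel))"

lemma ac_projE:
  fixes \<pi> :: "'b::euclidean_space \<Rightarrow> 'a::euclidean_space"
  assumes "ac_proj \<pi>" "e > 0"
  obtains C where "C \<ge> 0" "\<And>h. h \<in> borel_measurable borel \<Longrightarrow> (\<And>z. h z \<le> 1) \<Longrightarrow>
      (\<integral>\<^sup>+y. h (\<pi> y) \<partial>sph) \<le> ennreal e + ennreal C * (\<integral>\<^sup>+z\<in>cball 0 1. h z \<partial>lborel)"
  using assms unfolding ac_proj_def by blast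

text \<open>The projected measure of a null set is at most e for every e. The conclusion holds for
  every x and every t > 0, so passing to Borel representatives of f and g does not change any
  average, even after the supremum over t.\<close>

lemma ac_proj_null:
  fixes \<pi> :: "'b::euclidean_space \<Rightarrow> 'a::euclidean_space"
  assumes ac: "ac_proj \<pi>" and N: "N \<in> null_sets lborel" and t: "t > 0"
  shows "AE y in sph. x - t *\<^sub>R \<pi> y \<notin> N"
proof -
  have [measurable]: "N \<in> sets borel" using N by (simp add: null_sets_def)
  have [measurable]: "\<pi> \<in> borel_measurable borel" using ac by (simp add: ac_proj_def)
  define h :: "'a \<Rightarrow> ennreal" where "h z = indicator N (x + (-t) *\<^sub>R z)" for z
  have [measurable]: "h \<in> borel_measurable borel" unfolding h_def by measurable
  have "(\<integral>\<^sup>+z. indicator N z \<partial>lborel) = ennreal (\<bar>-t\<bar> ^ DIM('a)) * (\<integral>\<^sup>+z. h z \<partial>lborel)"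
    unfolding h_def by (rule nn_integral_affine) (use t in auto)
  moreover have "(\<integral>\<^sup>+z. indicator N z \<partial>lborel) = 0" using N by (simp add: null_sets_def)
  ultimately have h0: "(\<integral>\<^sup>+z. h z \<partial>lborel) = 0" using t by simp
  have "(\<integral>\<^sup>+z\<in>cball 0 1. h z \<partial>lborel) \<le> (\<integral>\<^sup>+z. h z \<partial>lborel)"
    by (rule nn_integral_mono) (simp split: split_indicator)
  then have h1: "(\<integral>\<^sup>+z\<in>cball 0 1. h z \<partial>lborel) = 0" using h0 by simp
  have "(\<integral>\<^sup>+y. h (\<pi> y) \<partial>sph) \<le> 0"
  proof (rule ennreal_le_epsilon)
    fix e :: real assume "0 < e"
    from ac_projE[OF ac this] obtain C where "\<And>h. h \<in> borel_measurable borel \<Longrightarrow> (\<And>z. h z \<le> 1) \<Longrightarrow>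
      (\<integral>\<^sup>+y. h (\<pi> y) \<partial>sph) \<le> ennreal e + ennreal C * (\<integral>\<^sup>+z\<in>cball 0 1. h z \<partial>lborel)" by blast
    from this[of h] show "(\<integral>\<^sup>+y. h (\<pi> y) \<partial>sph) \<le> 0 + ennreal e"
      using h1 by (simp add: h_def indicator_def)
  qed
  then have "(\<integral>\<^sup>+y. h (\<pi> y) \<partial>sph) = 0" by simp
  then have "AE y in sph. h (\<pi> y) = 0"
    by (subst (asm) nn_integral_0_iff_AE) (auto intro: borel_measurable_sph)
  then show ?thesis by eventually_elim (auto simp: h_def indicator_def split: if_splits)
qed

lemma ennreal_tendsto_0I:
  fixes F :: "'b \<Rightarrow> ennreal"
  assumes "\<And>e. e > 0 \<Longrightarrow> eventually (\<lambda>n. F n \<le> ennreal e) G"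
  shows "(F \<longlongrightarrow> 0) G"
proof (rule order_tendstoI)
  fix a :: ennreal assume "0 < a"
  then obtain e where e: "0 < e" "ennreal e < a"
    by (metis dense ennreal_cases ennreal_less_zero_iff not_less top_greatest)
  show "eventually (\<lambda>n. F n < a) G"
    using assms[OF e(1)] by eventually_elim (use e(2) in auto)
qed simp

text \<open>Continuity of translations in L^1, transported to the sphere. On a ball, f is close in
  L^1 to a bounded continuous function; absolute continuity of the projection turns this into
  closeness on the sphere, and for the continuous function dominated convergence applies.\<close>

lemma ac_proj_continuous_L1:
  fixes \<pi> :: "'b::euclidean_space \<Rightarrow> 'a::euclidean_space" and f :: "'a \<Rightarrow> complex"
  assumes ac: "ac_proj \<pi>" and f[measurable]: "f \<in> borel_measurable borel"
    and B: "B > 0" "\<And>z. norm (f z) \<le> B" and t: "t > 0" and X: "X \<longlonglongrightarrow> x"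
  shows "(\<lambda>n. \<integral>\<^sup>+y. ennreal (norm (f (X n - t *\<^sub>R \<pi> y) - f (x - t *\<^sub>R \<pi> y))) \<partial>sph) \<longlonglongrightarrow> 0"
proof (rule ennreal_tendsto_0I)
  fix \<epsilon> :: real assume \<epsilon>: "\<epsilon> > 0"
  have \<pi>[measurable]: "\<pi> \<in> borel_measurable borel" using ac by (simp add: ac_proj_def)
  have "f \<in> borel_measurable lebesgue" by (rule measurable_completion) simp
  then have "f measurable_on UNIV" by (rule lebesgue_measurable_imp_measurable_on) simp
  then obtain N g where N: "negligible N" and g: "\<And>k. continuous_on UNIV (g k)"
    and lim: "\<And>z. z \<notin> N \<Longrightarrow> (\<lambda>k. g k z) \<longlonglongrightarrow> f z"
    unfolding measurable_on_def by auto
  \<comment> \<open>The radial retraction onto the disc of radius B keeps the continuous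
    approximants bounded without disturbing their limit f.\<close>
  define \<rho> where "\<rho> z = (1 / max 1 (norm z / B)) *\<^sub>R z" for z :: complex
  have \<rho>c: "continuous_on UNIV \<rho>" unfolding \<rho>_def by (intro continuous_intros) (use B(1) in auto)
  have \<rho>B: "norm (\<rho> z) \<le> B" for z
    using B(1) by (auto simp: \<rho>_def max_def field_simps)
  have \<rho>id: "\<rho> z = z" if "norm z \<le> B" for z
    using B(1) that by (simp add: \<rho>_def max_def field_simps)
  define G where "G k z = \<rho> (g k z)" for k z
  have Gc: "continuous_on UNIV (G k)" for k
    unfolding G_def using continuous_on_compose2[OF \<rho>c g] by auto
  then have G[measurable]: "G k \<in> borel_measurable borel" for k by (rule borel_measurable_continuous_onI)
  have GB: "norm (G k z) \<le> B" for k z by (simp add: G_def \<rho>B)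
  have Glim: "(\<lambda>k. G k z) \<longlonglongrightarrow> f z" if "z \<notin> N" for z
    using continuous_on_tendsto_compose[OF \<rho>c lim[OF that]] \<rho>id[OF B(2)] by (simp add: G_def)
  \<comment> \<open>Two approximation errors of size 2 B (2 e) = \<epsilon>/4 each leave
    \<epsilon>/2 for the continuous part.\<close>
  define e where "e = \<epsilon> / (16 * B)"
  have e: "e > 0" using \<epsilon> B by (simp add: e_def)
  obtain C where C: "C \<ge> 0" and acC: "\<And>h. h \<in> borel_measurable borel \<Longrightarrow> (\<And>z. h z \<le> 1) \<Longrightarrow>
      (\<integral>\<^sup>+y. h (\<pi> y) \<partial>sph) \<le> ennreal e + ennreal C * (\<integral>\<^sup>+z\<in>cball 0 1. h z \<partial>lborel)"
    using ac_projE[OF ac e] by metis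
  \<comment> \<open>Division by 2 B brings the integrand below 1, as \<open>ac_proj\<close>
    requires; the ball of radius 1 + t contains all points x' - t z with x' within 1 of x and z in
    the unit ball.\<close>
  define H where "H k z = ennreal (norm (f z - G k z) / (2 * B)) * indicator (cball x (1 + t)) z" for k z
  have [measurable]: "cball x (1 + t) \<in> sets borel" by simp
  have [measurable]: "H k \<in> borel_measurable borel" for k
  proof -
    have "(\<lambda>z. ennreal (norm (f z - G k z) / (2 * B))) \<in> borel_measurable borel" by measurable
    then show ?thesis unfolding H_def by (intro borel_measurable_times_ennreal borel_measurable_indicator) simp_all
  qed
  have fG: "norm (f z - G k z) / (2 * B) \<le> 1" for z k
    using norm_triangle_ineq4[of "f z" "G k z"] B(2)[of z] GB[of k z] B(1) by simp
  have "(\<lambda>k. \<integral>\<^sup>+z. H k z \<partial>lborel) \<longlonglongrightarrow> (\<integral>\<^sup>+z. 0 \<partial>(lborel :: 'a measure))"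
  proof (rule nn_integral_dominated_convergence[where u = H and u' = "\<lambda>_. 0" and w = "indicator (cball x (1 + t))"])
    show "AE z in lborel. H j z \<le> indicator (cball x (1 + t)) z" for j
      using fG by (auto simp: H_def split: split_indicator intro!: AE_I2)
    show "(\<integral>\<^sup>+z. indicator (cball x (1 + t)) z \<partial>lborel) < \<infinity>"
      using emeasure_lborel_cball_finite[of x "1 + t"] by simp
    have "AE z in lebesgue. z \<notin> N"
      using N by (auto simp: negligible_iff_null_sets intro: AE_not_in)
    then have "AE z in lborel. z \<notin> N" by (simp add: AE_completion_iff)
    then show "AE z in lborel. (\<lambda>k. H k z) \<longlonglongrightarrow> 0"
    proof eventually_elim
      case (elim z)
      have "(\<lambda>k. ennreal (norm (f z - G k z) / (2 * B))) \<longlonglongrightarrow> ennreal (norm (f z - f z) / (2 * B))"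
        by (intro tendsto_intros Glim[OF elim]) (use B in auto)
      then show ?case by (simp add: H_def split: split_indicator)
    qed
  qed auto
  then have H0: "(\<lambda>k. \<integral>\<^sup>+z. H k z \<partial>lborel) \<longlonglongrightarrow> 0" by simp
  \<comment> \<open>The power of t is the Jacobian of z \<mapsto> x' - t z.\<close>
  define c where "c = C / t ^ DIM('a)"
  have c: "c \<ge> 0" using C t by (simp add: c_def)
  have "eventually (\<lambda>k. (\<integral>\<^sup>+z. H k z \<partial>lborel) < ennreal (e / (c + 1))) sequentially"
    by (rule order_tendstoD(2)[OF H0]) (use e c in simp)
  then obtain k where k: "(\<integral>\<^sup>+z. H k z \<partial>lborel) < ennreal (e / (c + 1))"
    using eventually_happens'[OF sequentially_bot] by auto
  have close: "(\<integral>\<^sup>+y. ennreal (norm (f (x' - t *\<^sub>R \<pi> y) - G k (x' - t *\<^sub>R \<pi> y))) \<partial>sph) \<le> ennreal (2 * B * (2 * e))"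
    if x': "dist x' x \<le> 1" for x'
  proof -
    define h where "h z = ennreal (norm (f (x' + (-t) *\<^sub>R z) - G k (x' + (-t) *\<^sub>R z)) / (2 * B))" for z
    have [measurable]: "h \<in> borel_measurable borel" unfolding h_def by measurable
    have "(\<integral>\<^sup>+z\<in>cball 0 1. h z \<partial>lborel) \<le> (\<integral>\<^sup>+z. H k (x' + (-t) *\<^sub>R z) \<partial>lborel)"
    proof (rule nn_integral_mono)
      fix z
      have "x' + (-t) *\<^sub>R z \<in> cball x (1 + t)" if "z \<in> cball 0 1"
      proof -
        have "dist x (x' + (-t) *\<^sub>R z) \<le> dist x x' + dist x' (x' + (-t) *\<^sub>R z)" by (rule dist_triangle)
        also have "dist x' (x' + (-t) *\<^sub>R z) = t * norm z" using t by (simp add: dist_norm)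
        also have "t * norm z \<le> t" using t that by simp
        finally show ?thesis using x' by (simp add: dist_commute)
      qed
      then show "h z * indicator (cball 0 1) z \<le> H k (x' + (-t) *\<^sub>R z)"
        by (simp add: h_def H_def split: split_indicator)
    qed
    also have "\<dots> = ennreal (1 / t ^ DIM('a)) * (ennreal (\<bar>-t\<bar> ^ DIM('a)) * (\<integral>\<^sup>+z. H k (x' + (-t) *\<^sub>R z) \<partial>lborel))"
      using t by (simp add: mult.assoc[symmetric] ennreal_mult[symmetric])
    also have "ennreal (\<bar>-t\<bar> ^ DIM('a)) * (\<integral>\<^sup>+z. H k (x' + (-t) *\<^sub>R z) \<partial>lborel) = (\<integral>\<^sup>+z. H k z \<partial>lborel)"
      by (rule nn_integral_affine[symmetric]) (use t in auto)
    finally have st: "(\<integral>\<^sup>+z\<in>cball 0 1. h z \<partial>lborel) \<le> ennreal (1 / t ^ DIM('a)) * (\<integral>\<^sup>+z. H k z \<partial>lborel)" .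
    have "ennreal C * (\<integral>\<^sup>+z\<in>cball 0 1. h z \<partial>lborel) \<le> ennreal C * (ennreal (1 / t ^ DIM('a)) * ennreal (e / (c + 1)))"
      by (rule mult_left_mono[OF order_trans[OF st mult_left_mono[OF less_imp_le[OF k] zero_le]] zero_le])
    also have "\<dots> = ennreal (c * (e / (c + 1)))"
      using C t e c by (simp add: ennreal_mult[symmetric] c_def)
    also have "\<dots> \<le> ennreal e" using c e by (intro ennreal_leI) (simp add: field_simps)
    finally have "ennreal C * (\<integral>\<^sup>+z\<in>cball 0 1. h z \<partial>lborel) \<le> ennreal e" .
    moreover have "(\<integral>\<^sup>+y. h (\<pi> y) \<partial>sph) \<le> ennreal e + ennreal C * (\<integral>\<^sup>+z\<in>cball 0 1. h z \<partial>lborel)"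
      by (rule acC) (use fG in \<open>auto simp: h_def\<close>)
    ultimately have "(\<integral>\<^sup>+y. h (\<pi> y) \<partial>sph) \<le> ennreal e + ennreal e"
      by (meson add_left_mono order_trans)
    then have *: "(\<integral>\<^sup>+y. h (\<pi> y) \<partial>sph) \<le> ennreal (2 * e)" using e by (simp flip: ennreal_plus)
    have "(\<integral>\<^sup>+y. ennreal (norm (f (x' - t *\<^sub>R \<pi> y) - G k (x' - t *\<^sub>R \<pi> y))) \<partial>sph) = (\<integral>\<^sup>+y. ennreal (2 * B) * h (\<pi> y) \<partial>sph)"
      using B(1) by (intro nn_integral_cong) (simp add: h_def ennreal_mult[symmetric])
    also have "\<dots> = ennreal (2 * B) * (\<integral>\<^sup>+y. h (\<pi> y) \<partial>sph)"
      by (rule nn_integral_cmult) (rule borel_measurable_sph, measurable)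
    also have "\<dots> \<le> ennreal (2 * B) * ennreal (2 * e)" by (rule mult_left_mono[OF *]) simp
    also have "\<dots> = ennreal (2 * B * (2 * e))" by (rule ennreal_mult[symmetric]) (use B e in auto)
    finally show ?thesis .
  qed
  have "(\<lambda>n. \<integral>\<^sup>+y. ennreal (norm (G k (X n - t *\<^sub>R \<pi> y) - G k (x - t *\<^sub>R \<pi> y))) \<partial>sph) \<longlonglongrightarrow> (\<integral>\<^sup>+y. 0 \<partial>(sph :: 'b measure))"
  proof (rule nn_integral_dominated_convergence[where w = "\<lambda>_. ennreal (2 * B)"])
    interpret finite_measure "sph :: 'b measure" by (rule finite_measure_sph)
    show "(\<integral>\<^sup>+y. ennreal (2 * B) \<partial>(sph :: 'b measure)) < \<infinity>"
      using emeasure_finite[of "space (sph :: 'b measure)"]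
      by (simp add: ennreal_mult_eq_top_iff top.not_eq_extremum[symmetric])
    show "AE y in sph. ennreal (norm (G k (X j - t *\<^sub>R \<pi> y) - G k (x - t *\<^sub>R \<pi> y))) \<le> ennreal (2 * B)" for j
    proof (rule AE_I2, rule ennreal_leI)
      fix y
      show "norm (G k (X j - t *\<^sub>R \<pi> y) - G k (x - t *\<^sub>R \<pi> y)) \<le> 2 * B"
        using norm_triangle_ineq4[of "G k (X j - t *\<^sub>R \<pi> y)" "G k (x - t *\<^sub>R \<pi> y)"]
          GB[of k "X j - t *\<^sub>R \<pi> y"] GB[of k "x - t *\<^sub>R \<pi> y"] by linarith
    qed
    show "AE y in sph. (\<lambda>n. ennreal (norm (G k (X n - t *\<^sub>R \<pi> y) - G k (x - t *\<^sub>R \<pi> y)))) \<longlonglongrightarrow> 0"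
    proof (rule AE_I2)
      fix y
      have "(\<lambda>n. G k (X n - t *\<^sub>R \<pi> y)) \<longlonglongrightarrow> G k (x - t *\<^sub>R \<pi> y)"
        by (rule continuous_on_tendsto_compose[OF Gc]) (auto intro!: tendsto_intros X)
      then have "(\<lambda>n. ennreal (norm (G k (X n - t *\<^sub>R \<pi> y) - G k (x - t *\<^sub>R \<pi> y)))) \<longlonglongrightarrow> ennreal (norm (G k (x - t *\<^sub>R \<pi> y)
          - G k (x - t *\<^sub>R \<pi> y)))"
        by (intro tendsto_intros)
      then show "(\<lambda>n. ennreal (norm (G k (X n - t *\<^sub>R \<pi> y) - G k (x - t *\<^sub>R \<pi> y)))) \<longlonglongrightarrow> 0" by simp
    qed
  qed (auto intro!: borel_measurable_sph)
  then have "eventually (\<lambda>n. (\<integral>\<^sup>+y. ennreal (norm (G k (X n - t *\<^sub>R \<pi> y) - G k (x - t *\<^sub>R \<pi> y))) \<partial>sph) < ennreal (\<epsilon> /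
      2)) sequentially"
    by (intro order_tendstoD(2)) (use \<epsilon> in auto)
  moreover have "eventually (\<lambda>n. dist (X n) x < 1) sequentially" using X by (rule tendstoD) simp
  ultimately show "eventually (\<lambda>n. (\<integral>\<^sup>+y. ennreal (norm (f (X n - t *\<^sub>R \<pi> y) - f (x - t *\<^sub>R \<pi> y))) \<partial>sph) \<le> ennreal \<epsilon>)
      sequentially"
  proof eventually_elim
    case (elim n)
    let ?I = "\<lambda>F. (\<integral>\<^sup>+y. ennreal (norm (F y :: complex)) \<partial>(sph :: 'b measure))"
    let ?a = "\<lambda>y. f (X n - t *\<^sub>R \<pi> y) - G k (X n - t *\<^sub>R \<pi> y)" and ?b = "\<lambda>y. G k (X n - t *\<^sub>R \<pi> y) - G k (x - t *\<^sub>R \<pi> y)"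
      and ?c = "\<lambda>y. f (x - t *\<^sub>R \<pi> y) - G k (x - t *\<^sub>R \<pi> y)"
    have "?I (\<lambda>y. f (X n - t *\<^sub>R \<pi> y) - f (x - t *\<^sub>R \<pi> y)) \<le> (\<integral>\<^sup>+y. ennreal (norm (?a y)) + (ennreal (norm (?b y)) +
        ennreal (norm (?c y))) \<partial>sph)"
    proof (rule nn_integral_mono)
      fix y
      have eq: "f (X n - t *\<^sub>R \<pi> y) - f (x - t *\<^sub>R \<pi> y) = ?a y + (?b y - ?c y)" by simp
      have "norm (f (X n - t *\<^sub>R \<pi> y) - f (x - t *\<^sub>R \<pi> y)) \<le> norm (?a y) + (norm (?b y) + norm (?c y))"
        unfolding eq using norm_triangle_ineq[of "?a y" "?b y - ?c y"] norm_triangle_ineq4[of "?b y" "?c y"] by linarith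
      then show "ennreal (norm (f (X n - t *\<^sub>R \<pi> y) - f (x - t *\<^sub>R \<pi> y))) \<le> ennreal (norm (?a y)) + (ennreal (norm (?b
          y)) + ennreal (norm (?c y)))"
        by (simp add: ennreal_leI flip: ennreal_plus)
    qed
    also have "\<dots> = ?I ?a + (?I ?b + ?I ?c)"
      by (subst nn_integral_add; (subst nn_integral_add)?) (auto intro!: borel_measurable_sph)
    also have "\<dots> \<le> ennreal (2 * B * (2 * e)) + (ennreal (\<epsilon> / 2) + ennreal (2 * B * (2 * e)))"
      using elim by (intro add_mono close less_imp_le) auto
    also have "\<dots> = ennreal (2 * B * (2 * e) + (\<epsilon> / 2 + 2 * B * (2 * e)))"
      using \<epsilon> B e by (simp flip: ennreal_plus)
    also have "2 * B * (2 * e) + (\<epsilon> / 2 + 2 * B * (2 * e)) = \<epsilon>" using B by (simp add: e_def)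
    finally show ?case .
  qed
qed

section \<open>Transfer from indicators, including measurability of the maximal function\<close>

section \<open>From indicator functions to Lorentz functions\<close>

definition sph_form ::
  "('a::euclidean_space \<Rightarrow> ennreal) \<Rightarrow> ('a \<Rightarrow> ennreal) \<Rightarrow> real \<Rightarrow> 'a \<Rightarrow> ennreal" where
  "sph_form h k t x = (\<integral>\<^sup>+y. h (x - t *\<^sub>R fst y) * k (x - t *\<^sub>R snd y) \<partial>sph)"

lemma borel_measurable_fst_snd [measurable]:
  "(fst :: 'a::euclidean_space \<times> 'b::euclidean_space \<Rightarrow> 'a) \<in> borel_measurable borel"
  "(snd :: 'a \<times> 'b \<Rightarrow> 'b) \<in> borel_measurable borel"
  by (auto intro!: borel_measurable_continuous_onI continuous_intros)

lemma measurable_shift_proj: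
  fixes \<pi> :: "'b::euclidean_space \<Rightarrow> 'a::euclidean_space"
  assumes [measurable]: "h \<in> borel \<rightarrow>\<^sub>M N" "\<pi> \<in> borel_measurable borel"
  shows "(\<lambda>y. h (x - t *\<^sub>R \<pi> y)) \<in> sph \<rightarrow>\<^sub>M N"
  by (rule borel_measurable_sph) measurable

text \<open>The form is bilinear and positive, so both series can be pulled out; the factored bound
  for single pairs of sets then turns the double series into a product of two single ones.\<close>

lemma sph_form_suminf_le:
  fixes A B :: "nat \<Rightarrow> 'a::euclidean_space set"
  assumes A[measurable]: "\<And>i. A i \<in> sets borel" "\<And>i. B i \<in> sets borel"
    and h: "\<And>z. h z \<le> (\<Sum>i. ennreal (a i) * indicator (A i) z)"
    and k: "\<And>z. k z \<le> (\<Sum>i. ennreal (b i) * indicator (B i) z)"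
    and K: "\<And>i j. sph_form (indicator (A i)) (indicator (B j)) t x \<le> u i * v j"
  shows "sph_form h k t x \<le> (\<Sum>i. ennreal (a i) * u i) * (\<Sum>j. ennreal (b j) * v j)"
proof -
  have f[measurable]: "(\<lambda>y. indicator (A i) (x - t *\<^sub>R fst y) :: ennreal) \<in> borel_measurable (sph :: ('a \<times> 'a) measure)" for i
    by (rule measurable_shift_proj) auto
  have g[measurable]: "(\<lambda>y. indicator (B i) (x - t *\<^sub>R snd y) :: ennreal) \<in> borel_measurable (sph :: ('a \<times> 'a) measure)" for i
    by (rule measurable_shift_proj) auto
  have "sph_form h k t x \<le> (\<integral>\<^sup>+y. (\<Sum>i. ennreal (a i) * indicator (A i) (x - t *\<^sub>R fst y)) *
      (\<Sum>j. ennreal (b j) * indicator (B j) (x - t *\<^sub>R snd y)) \<partial>sph)"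
    unfolding sph_form_def by (intro nn_integral_mono mult_mono h k) auto
  also have "\<dots> = (\<integral>\<^sup>+y. (\<Sum>i. \<Sum>j. (ennreal (a i) * ennreal (b j)) *
      (indicator (A i) (x - t *\<^sub>R fst y) * indicator (B j) (x - t *\<^sub>R snd y))) \<partial>sph)"
    by (intro nn_integral_cong, subst ennreal_suminf_multc[symmetric], intro suminf_cong,
        subst ennreal_suminf_cmult[symmetric], intro suminf_cong) (simp add: mult_ac)
  also have "\<dots> = (\<Sum>i. \<integral>\<^sup>+y. (\<Sum>j. (ennreal (a i) * ennreal (b j)) *
      (indicator (A i) (x - t *\<^sub>R fst y) * indicator (B j) (x - t *\<^sub>R snd y))) \<partial>sph)"
    by (rule nn_integral_suminf) measurable
  also have "\<dots> = (\<Sum>i. \<Sum>j. \<integral>\<^sup>+y. (ennreal (a i) * ennreal (b j)) *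
      (indicator (A i) (x - t *\<^sub>R fst y) * indicator (B j) (x - t *\<^sub>R snd y)) \<partial>sph)"
    by (intro arg_cong[where f = suminf] ext nn_integral_suminf) measurable
  also have "\<dots> = (\<Sum>i. \<Sum>j. (ennreal (a i) * ennreal (b j)) * sph_form (indicator (A i)) (indicator (B j)) t x)"
    unfolding sph_form_def by (intro arg_cong[where f = suminf] ext nn_integral_cmult) measurable
  also have "\<dots> \<le> (\<Sum>i. \<Sum>j. (ennreal (a i) * ennreal (b j)) * (u i * v j))"
    by (intro suminf_le mult_left_mono K) auto
  also have "\<dots> = (\<Sum>i. \<Sum>j. (ennreal (a i) * u i) * (ennreal (b j) * v j))"
    by (simp add: mult_ac)
  also have "\<dots> = (\<Sum>i. ennreal (a i) * u i) * (\<Sum>j. ennreal (b j) * v j)"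
    by simp
  finally show ?thesis .
qed

lemma AE_lborel_proj:
  fixes \<pi> :: "'b::euclidean_space \<Rightarrow> 'a::euclidean_space"
  assumes ac: "ac_proj \<pi>" and P: "AE z in lborel. P z" and t: "t > 0"
  shows "AE y in sph. P (x - t *\<^sub>R \<pi> y)"
proof -
  obtain N where N: "N \<in> null_sets lborel" "{z \<in> space lborel. \<not> P z} \<subseteq> N"
    using P unfolding eventually_ae_filter by blast
  have "AE y in sph. x - t *\<^sub>R \<pi> y \<notin> N" by (rule ac_proj_null[OF ac N(1) t])
  then show ?thesis by eventually_elim (use N(2) in auto)
qed

text \<open>Both the integrability test and the value survive the passage to Borel representatives
  and to the uncompleted measure, at every point x.\<close>

lemma bilinear_sph_avg_AE_cong:
  fixes f g :: "'a::euclidean_space \<Rightarrow> complex"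
  assumes ac: "ac_proj (fst :: 'a \<times> 'a \<Rightarrow> 'a)" "ac_proj (snd :: 'a \<times> 'a \<Rightarrow> 'a)" and t: "t > 0"
    and [measurable]: "f' \<in> borel_measurable borel" "g' \<in> borel_measurable borel"
    and AE: "AE z in lborel. f z = f' z" "AE z in lborel. g z = g' z"
  shows "bilinear_sph_avg f g t x =
    (if integrable sph (\<lambda>y. f' (x - t *\<^sub>R fst y) * g' (x - t *\<^sub>R snd y))
     then ennreal (norm (LINT y|sph. f' (x - t *\<^sub>R fst y) * g' (x - t *\<^sub>R snd y))) else \<infinity>)"
proof -
  define F where "F = (\<lambda>(y1, y2). f (x - t *\<^sub>R y1) * g (x - t *\<^sub>R y2))"
  define G where "G = (\<lambda>y. f' (x - t *\<^sub>R fst y) * g' (x - t *\<^sub>R snd y))"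
  have G[measurable]: "G \<in> borel_measurable (sph :: ('a \<times> 'a) measure)"
    unfolding G_def by (intro borel_measurable_times measurable_shift_proj) auto
  have FG: "AE y in sph. F y = G y"
    using AE_lborel_proj[OF ac(1) AE(1) t, of x] AE_lborel_proj[OF ac(2) AE(2) t, of x]
    by eventually_elim (auto simp: F_def G_def split: prod.splits)
  have F: "F \<in> borel_measurable (completion sph)"
    by (rule completion_measurable_AE_cong[OF G FG]) auto
  have G': "G \<in> borel_measurable (completion sph)" by (rule measurable_completion[OF G])
  have FG': "AE y in completion sph. F y = G y" by (rule AE_completion[OF FG])
  have "integrable (completion sph) F \<longleftrightarrow> integrable sph G"
    using integrable_cong_AE[OF F G' FG'] integrable_completion[OF G] by simp
  moreover have "integral\<^sup>L (completion sph) F = integral\<^sup>L sph G"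
    using integral_cong_AE[OF F G' FG'] integral_completion[OF G] by simp
  ultimately show ?thesis
    unfolding bilinear_sph_avg_def surface_measure_eq F_def[symmetric] by (simp add: G_def)
qed

lemma ennreal_tendsto_0_sandwich:
  fixes F G :: "nat \<Rightarrow> ennreal"
  assumes "G \<longlonglongrightarrow> 0" "\<And>n. F n \<le> G n"
  shows "F \<longlonglongrightarrow> 0"
  by (rule tendsto_sandwich[of "\<lambda>_. 0" F sequentially G]) (use assms in auto)

text \<open>The difference of the products at two points splits into one factor difference times a
  bounded function, twice; each part tends to 0 by \<open>ac_proj_continuous_L1\<close>.\<close>

lemma continuous_sph_avg:
  fixes f g :: "'a::euclidean_space \<Rightarrow> complex"
  assumes ac: "ac_proj (fst :: 'a \<times> 'a \<Rightarrow> 'a)" "ac_proj (snd :: 'a \<times> 'a \<Rightarrow> 'a)" and t: "t > 0"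
    and [measurable]: "f \<in> borel_measurable borel" "g \<in> borel_measurable borel"
    and B: "B > 0" "\<And>z. norm (f z) \<le> B" "\<And>z. norm (g z) \<le> B"
  shows "integrable sph (\<lambda>y. f (x - t *\<^sub>R fst y) * g (x - t *\<^sub>R snd y))"
    and "continuous_on UNIV (\<lambda>x. LINT y|sph. f (x - t *\<^sub>R fst y) * g (x - t *\<^sub>R snd y))"
proof -
  interpret finite_measure "sph :: ('a \<times> 'a) measure" by (rule finite_measure_sph)
  define F where "F x y = f (x - t *\<^sub>R fst y) * g (x - t *\<^sub>R snd y)" for x y
  have m1[measurable]: "(\<lambda>y. f (x - t *\<^sub>R fst y)) \<in> borel_measurable (sph :: ('a \<times> 'a) measure)" for x
    by (rule measurable_shift_proj) auto
  have m2[measurable]: "(\<lambda>y. g (x - t *\<^sub>R snd y)) \<in> borel_measurable (sph :: ('a \<times> 'a) measure)" for x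
    by (rule measurable_shift_proj) auto
  have F[measurable]: "F x \<in> borel_measurable sph" for x unfolding F_def by measurable
  have int: "integrable sph (F x)" for x
    by (rule integrable_const_bound[of _ "B * B"])
       (use B in \<open>auto simp: F_def norm_mult intro!: AE_I2 mult_mono less_imp_le[OF B(1)]\<close>)
  from int[of x] show "integrable sph (\<lambda>y. f (x - t *\<^sub>R fst y) * g (x - t *\<^sub>R snd y))" by (simp add: F_def[abs_def])
  have "isCont (\<lambda>x. LINT y|sph. F x y) x" for x
    unfolding continuous_at_sequentially o_def
  proof (intro allI impI)
    fix X assume X: "X \<longlonglongrightarrow> x"
    let ?D1 = "\<lambda>n. \<integral>\<^sup>+y. ennreal (norm (f (X n - t *\<^sub>R fst y) - f (x - t *\<^sub>R fst y))) \<partial>(sph :: ('a \<times> 'a) measure)"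
    let ?D2 = "\<lambda>n. \<integral>\<^sup>+y. ennreal (norm (g (X n - t *\<^sub>R snd y) - g (x - t *\<^sub>R snd y))) \<partial>(sph :: ('a \<times> 'a) measure)"
    have D: "?D1 \<longlonglongrightarrow> 0" "?D2 \<longlonglongrightarrow> 0"
      by (rule ac_proj_continuous_L1[where f = f, OF ac(1) _ B(1,2) t X], simp,
          rule ac_proj_continuous_L1[where f = g, OF ac(2) _ B(1,3) t X], simp)
    have le: "ennreal (norm ((LINT y|sph. F (X n) y) - (LINT y|sph. F x y))) \<le> ennreal B * (?D1 n + ?D2 n)" for n
    proof -
      have "(LINT y|sph. F (X n) y) - (LINT y|sph. F x y) = (LINT y|sph. F (X n) y - F x y)"
        using int by simp
      then have "ennreal (norm ((LINT y|sph. F (X n) y) - (LINT y|sph. F x y))) \<le> (\<integral>\<^sup>+y. norm (F (X n) y - F x y) \<partial>sph)"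
        using integral_norm_bound_ennreal[of sph "\<lambda>y. F (X n) y - F x y"] int by simp
      also have "\<dots> \<le> (\<integral>\<^sup>+y. ennreal B * (ennreal (norm (f (X n - t *\<^sub>R fst y) - f (x - t *\<^sub>R fst y))) + ennreal (norm (g
          (X n - t *\<^sub>R snd y) - g (x - t *\<^sub>R snd y)))) \<partial>sph)"
      proof (rule nn_integral_mono)
        fix y :: "'a \<times> 'a"
        let ?df = "f (X n - t *\<^sub>R fst y) - f (x - t *\<^sub>R fst y)" and ?dg = "g (X n - t *\<^sub>R snd y) - g (x - t *\<^sub>R snd y)"
        have "F (X n) y - F x y = ?df * g (X n - t *\<^sub>R snd y) + f (x - t *\<^sub>R fst y) * ?dg"
          by (simp add: F_def algebra_simps)
        then have "norm (F (X n) y - F x y) \<le> norm (?df * g (X n - t *\<^sub>R snd y)) + norm (f (x - t *\<^sub>R fst y) * ?dg)"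
          by (simp only: norm_triangle_ineq)
        also have "\<dots> \<le> norm ?df * B + B * norm ?dg"
          unfolding norm_mult by (intro add_mono mult_left_mono mult_right_mono B) auto
        finally have "norm (F (X n) y - F x y) \<le> B * (norm ?df + norm ?dg)" by (simp add: algebra_simps)
        then show "ennreal (norm (F (X n) y - F x y)) \<le> ennreal B * (ennreal (norm ?df) + ennreal (norm ?dg))"
          using B(1) by (simp add: ennreal_leI flip: ennreal_plus ennreal_mult)
      qed
      also have "\<dots> = ennreal B * (?D1 n + ?D2 n)"
        by (subst nn_integral_cmult, measurable, subst nn_integral_add, measurable)
      finally show ?thesis .
    qed
    have "(\<lambda>n. ennreal B * (?D1 n + ?D2 n)) \<longlonglongrightarrow> ennreal B * (0 + 0)"
      by (rule ennreal_tendsto_cmult[OF _ tendsto_add[OF D]]) simp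
    then have "(\<lambda>n. ennreal (norm ((LINT y|sph. F (X n) y) - (LINT y|sph. F x y)))) \<longlonglongrightarrow> 0"
      by (intro ennreal_tendsto_0_sandwich[OF _ le]) simp
    then have "(\<lambda>n. norm ((LINT y|sph. F (X n) y) - (LINT y|sph. F x y))) \<longlonglongrightarrow> 0"
      by (simp add: ennreal_0[symmetric] del: ennreal_0)
    then show "(\<lambda>n. LINT y|sph. F (X n) y) \<longlonglongrightarrow> (LINT y|sph. F x y)"
      using LIM_zero_iff tendsto_norm_zero_iff by blast
  qed
  then show "continuous_on UNIV (\<lambda>x. LINT y|sph. f (x - t *\<^sub>R fst y) * g (x - t *\<^sub>R snd y))"
    unfolding F_def by (intro continuous_at_imp_continuous_on) auto
qed

text \<open>An uncountable supremum of continuous functions is lower semicontinuous: its superlevel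
  sets are unions of open sets.\<close>

lemma borel_measurable_SUP_continuous:
  fixes F :: "real \<Rightarrow> 'a::euclidean_space \<Rightarrow> complex"
  assumes "\<And>t. t > 0 \<Longrightarrow> continuous_on UNIV (F t)"
  shows "(\<lambda>x. SUP t\<in>{0<..}. ennreal (norm (F t x))) \<in> borel_measurable borel"
proof (rule borel_measurableI_greater)
  fix c :: ennreal
  have "{x \<in> space borel. c < (SUP t\<in>{0<..}. ennreal (norm (F t x)))} = (\<Union>t\<in>{0<..}. {x. c < ennreal (norm (F t x))})"
    by (auto simp: less_SUP_iff)
  also have "open \<dots>"
  proof (intro open_UN ballI)
    fix t :: real assume t: "t \<in> {0<..}"
    have "continuous_on UNIV (\<lambda>x. ennreal (norm (F t x)))"
      using assms t by (intro continuous_on_ennreal continuous_on_norm) auto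
    then show "open {x. c < ennreal (norm (F t x))}"
      by (intro open_Collect_less continuous_on_const)
  qed
  finally show "{x \<in> space borel. c < (SUP t\<in>{0<..}. ennreal (norm (F t x)))} \<in> sets borel" by simp
qed

lemma suminf_tail_tendsto_0:
  fixes f :: "nat \<Rightarrow> ennreal"
  assumes "(\<Sum>i. f i) < \<infinity>"
  shows "(\<lambda>n. \<Sum>i. f (i + n)) \<longlonglongrightarrow> 0"
proof -
  have "f i \<noteq> \<infinity>" for i using term_le_suminf[of f i] assms by auto
  then have f: "f i = ennreal (enn2real (f i))" for i by (simp add: less_top)
  have s: "summable (\<lambda>i. enn2real (f i))"
    by (rule summable_suminf_not_top) (use assms f in auto)
  have "(\<lambda>n. ennreal (\<Sum>i. enn2real (f (i + n)))) \<longlonglongrightarrow> ennreal 0"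
  proof (intro tendsto_ennrealI)
    have "(\<lambda>n. (\<Sum>i. enn2real (f i)) - (\<Sum>i<n. enn2real (f i))) \<longlonglongrightarrow> (\<Sum>i. enn2real (f i)) - (\<Sum>i. enn2real (f i))"
      by (intro tendsto_intros summable_LIMSEQ s)
    then show "(\<lambda>n. \<Sum>i. enn2real (f (i + n))) \<longlonglongrightarrow> 0"
      by (simp add: suminf_minus_initial_segment[OF s])
  qed
  moreover have "ennreal (\<Sum>i. enn2real (f (i + n))) = (\<Sum>i. f (i + n))" for n
    using suminf_ennreal2[of "\<lambda>i. enn2real (f (i + n))"] summable_ignore_initial_segment[OF s, of n]
    by (simp add: f[symmetric])
  ultimately show ?thesis by simp
qed


text \<open>The truncation is either f or 0 at each point. Where it is 0, the first n layers miss
  the point, so the remaining layers alone majorize f there.\<close>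

lemma majorized_truncate:
  assumes f: "majorized f a A"
  defines "F \<equiv> \<lambda>n z. if z \<in> (\<Union>i<n. A i) then f z else 0"
  shows "norm (F n z) \<le> (\<Sum>i<n. a i)"
    and "ennreal (norm (F n z)) \<le> (\<Sum>i. ennreal (a i) * indicator (A i) z)"
    and "ennreal (norm (f z - F n z)) \<le> (\<Sum>i. ennreal (a (i + n)) * indicator (A (i + n)) z)"
proof -
  have a: "a i \<ge> 0" for i using f by (simp add: majorized_def)
  have m: "ennreal (norm (f z)) \<le> (\<Sum>i. ennreal (a i) * indicator (A i) z)" using f by (simp add: majorized_def)
  show "norm (F n z) \<le> (\<Sum>i<n. a i)"
  proof (cases "z \<in> (\<Union>i<n. A i)")
    case True
    then obtain i where i: "i < n" "z \<in> A i" by auto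
    then have "norm (f z) \<le> a i" using f by (auto simp: majorized_def)
    also have "\<dots> \<le> (\<Sum>i<n. a i)" by (rule member_le_sum) (use i a in auto)
    finally show ?thesis using True by (simp add: F_def)
  qed (use a in \<open>auto simp: F_def intro: sum_nonneg\<close>)
  show "ennreal (norm (F n z)) \<le> (\<Sum>i. ennreal (a i) * indicator (A i) z)"
    using m by (simp add: F_def)
  show "ennreal (norm (f z - F n z)) \<le> (\<Sum>i. ennreal (a (i + n)) * indicator (A (i + n)) z)"
  proof (cases "z \<in> (\<Union>i<n. A i)")
    case False
    have "(\<Sum>i. ennreal (a i) * indicator (A i) z) = (\<Sum>i. ennreal (a (i + n)) * indicator (A (i + n)) z) + (\<Sum>i<n. ennreal
        (a i) * indicator (A i) z)"
      by (rule suminf_offset) simp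
    also have "(\<Sum>i<n. ennreal (a i) * indicator (A i) z) = 0"
      using False by (intro sum.neutral) auto
    finally show ?thesis using m False by (simp add: F_def)
  qed (simp add: F_def)
qed

text \<open>The bound comes from \<open>sph_form_suminf_le\<close>. Measurability comes from
  truncation: the maximal functions of the truncated pairs are Borel and converge almost everywhere,
  because the truncation error is bounded by tails of convergent series uniformly in t.\<close>

lemma bilinear_sph_max_majorant:
  fixes f g :: "'a::euclidean_space \<Rightarrow> complex" and U V :: "'a set \<Rightarrow> 'a \<Rightarrow> ennreal"
  assumes ac: "ac_proj (fst :: 'a \<times> 'a \<Rightarrow> 'a)" "ac_proj (snd :: 'a \<times> 'a \<Rightarrow> 'a)"
    and UV: "\<And>A B t x. A \<in> sets borel \<Longrightarrow> B \<in> sets borel \<Longrightarrow> t > 0 \<Longrightarrow>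
        sph_form (indicator A) (indicator B) t x \<le> U A x * V B x"
    and Um: "\<And>A. A \<in> sets borel \<Longrightarrow> U A \<in> borel_measurable borel" "\<And>A. A \<in> sets borel \<Longrightarrow> V A \<in> borel_measurable borel"
    and f'[measurable]: "f' \<in> borel_measurable borel" "g' \<in> borel_measurable borel"
    and AE: "AE z in lborel. f z = f' z" "AE z in lborel. g z = g' z"
    and maj: "majorized f' a A" "majorized g' b B"
    and fin: "AE x in lborel. (\<Sum>i. ennreal (a i) * U (A i) x) < \<infinity>" "AE x in lborel. (\<Sum>i. ennreal (b i) * V (B i) x) < \<infinity>"
  shows "bilinear_sph_max f g \<in> borel_measurable lebesgue"
    and "AE x in lebesgue. bilinear_sph_max f g x \<le> (\<Sum>i. ennreal (a i) * U (A i) x) * (\<Sum>i. ennreal (b i) * V (B i) x)"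
proof -
  define \<Phi> where "\<Phi> x = (\<Sum>i. ennreal (a i) * U (A i) x)" for x
  define \<Psi> where "\<Psi> x = (\<Sum>i. ennreal (b i) * V (B i) x)" for x
  have A[measurable]: "A i \<in> sets borel" "B i \<in> sets borel" for i using maj by (auto simp: majorized_def)
  note [measurable] = Um(1)[OF A(1)] Um(2)[OF A(2)]
  have [measurable]: "\<Phi> \<in> borel_measurable borel" "\<Psi> \<in> borel_measurable borel"
    unfolding \<Phi>_def \<Psi>_def by measurable
  define F where "F n z = (if z \<in> (\<Union>i<n. A i) then f' z else 0)" for n z
  define G where "G n z = (if z \<in> (\<Union>i<n. B i) then g' z else 0)" for n z
  have FG[measurable]: "F n \<in> borel_measurable borel" "G n \<in> borel_measurable borel" for n
    unfolding F_def G_def by (intro measurable_If_set; simp)+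
  note trF = majorized_truncate[OF maj(1), folded F_def] and trG = majorized_truncate[OF maj(2), folded G_def]
  define av where "av u v t x = (LINT y|sph. u (x - t *\<^sub>R fst y) * v (x - t *\<^sub>R snd y) :: complex)"
    for u v :: "'a \<Rightarrow> complex" and t x
  define S where "S n x = (SUP t\<in>{0<..}. ennreal (norm (av (F n) (G n) t x)))" for n x
  define Bn where "Bn n = 1 + (\<Sum>i<n. a i) + (\<Sum>i<n. b i)" for n
  have ab: "a i \<ge> 0" "b i \<ge> 0" for i using maj by (auto simp: majorized_def)
  have s0: "0 \<le> (\<Sum>i<n. a i)" "0 \<le> (\<Sum>i<n. b i)" for n using ab by (auto intro: sum_nonneg)
  have Bn: "Bn n > 0" "norm (F n z) \<le> Bn n" "norm (G n z) \<le> Bn n" for n z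
    using s0[of n] trF(1)[of n z] trG(1)[of n z] unfolding Bn_def by linarith+
  have intn: "integrable sph (\<lambda>y. F n (x - t *\<^sub>R fst y) * G n (x - t *\<^sub>R snd y))" if "t > 0" for n t x
    by (rule continuous_sph_avg(1)[OF ac that FG Bn])
  have Sm[measurable]: "S n \<in> borel_measurable borel" for n
    unfolding S_def av_def by (rule borel_measurable_SUP_continuous) (rule continuous_sph_avg(2)[OF ac _ FG Bn])
  have sf: "sph_form h k t x \<le> (\<Sum>i. ennreal (a' i) * U (A' i) x) * (\<Sum>j. ennreal (b' j) * V (B' j) x)"
    if "t > 0" "\<And>i. A' i \<in> sets borel" "\<And>i. B' i \<in> sets borel" "\<And>z. h z \<le> (\<Sum>i. ennreal (a' i) * indicator (A' i) z)"
      "\<And>z. k z \<le> (\<Sum>i. ennreal (b' i) * indicator (B' i) z)" for h k t x a' A' b' B'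
    by (rule sph_form_suminf_le[OF that(2,3,4,5) UV[OF that(2,3,1)]])
  have majf: "magnitude f' z \<le> (\<Sum>i. ennreal (a i) * indicator (A i) z)" "magnitude g' z \<le> (\<Sum>i. ennreal (b i) * indicator
      (B i) z)" for z
    using maj by (auto simp: majorized_def)
  have form_eq: "(\<integral>\<^sup>+y. ennreal (norm (u (x - t *\<^sub>R fst y) * v (x - t *\<^sub>R snd y))) \<partial>sph) = sph_form (magnitude u)
      (magnitude v) t x"
    for u v :: "'a \<Rightarrow> complex" and t x
    unfolding sph_form_def by (simp add: norm_mult ennreal_mult)
  have ms: "(\<lambda>y. u (x - t *\<^sub>R fst y) * v (x - t *\<^sub>R snd y)) \<in> borel_measurable (sph :: ('a \<times> 'a) measure)"
    if [measurable]: "u \<in> borel_measurable borel" "v \<in> borel_measurable borel" for u v :: "'a \<Rightarrow> complex" and t x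
    by (intro borel_measurable_times measurable_shift_proj) auto
  \<comment> \<open>Error of replacing first f and then g by its truncation; t does not occur in it,
    so it survives the supremum over t.\<close>
  define \<delta> where "\<delta> n x = (\<Sum>i. ennreal (a (i + n)) * U (A (i + n)) x) * \<Psi> x + \<Phi> x * (\<Sum>i. ennreal (b (i + n)) * V (B (i +
      n)) x)" for n x
  \<comment> \<open>On this set of full measure the product of the majorants is finite, hence every
    average there exists as a genuine integral and the value \<infinity> for non-integrable averages
    does not arise.\<close>
  define good where "good = {x. \<Phi> x < \<infinity> \<and> \<Psi> x < \<infinity>}"
  have [measurable]: "good \<in> sets borel" unfolding good_def by measurable
  have AEgood: "AE x in lborel. x \<in> good"
    using fin by eventually_elim (simp add: good_def \<Phi>_def \<Psi>_def)
  have int: "integrable sph (\<lambda>y. f' (x - t *\<^sub>R fst y) * g' (x - t *\<^sub>R snd y))"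
    and bd: "ennreal (norm (av f' g' t x)) \<le> \<Phi> x * \<Psi> x" if "x \<in> good" "t > 0" for x t
  proof -
    have le: "sph_form (magnitude f') (magnitude g') t x \<le> \<Phi> x * \<Psi> x"
      unfolding \<Phi>_def \<Psi>_def by (rule sf[OF that(2) A(1) A(2) majf])
    show int: "integrable sph (\<lambda>y. f' (x - t *\<^sub>R fst y) * g' (x - t *\<^sub>R snd y))"
      by (rule integrableI_bounded[OF ms[OF f']], subst form_eq)
         (use le that in \<open>auto simp: good_def ennreal_mult_less_top intro: le_less_trans\<close>)
    show "ennreal (norm (av f' g' t x)) \<le> \<Phi> x * \<Psi> x"
      using integral_norm_bound_ennreal[OF int] le unfolding form_eq av_def by (rule order_trans)
  qed
  have avg_eq: "bilinear_sph_avg f g t x = ennreal (norm (av f' g' t x))" if "x \<in> good" "t > 0" for x t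
    using bilinear_sph_avg_AE_cong[OF ac that(2) f' AE, of x] int[OF that] by (simp add: av_def)
  have max_eq: "bilinear_sph_max f g x = (SUP t\<in>{0<..}. ennreal (norm (av f' g' t x)))" if "x \<in> good" for x
    unfolding bilinear_sph_max_def using avg_eq[OF that] by (intro SUP_cong) auto
  have max_le: "bilinear_sph_max f g x \<le> \<Phi> x * \<Psi> x" if "x \<in> good" for x
    unfolding max_eq[OF that] by (rule SUP_least) (use bd[OF that] in auto)
  have diff: "ennreal (norm (av f' g' t x - av (F n) (G n) t x)) \<le> \<delta> n x" if x: "x \<in> good" and t: "t > 0" for x t n
  proof -
    let ?h = "\<lambda>y. (f' (x - t *\<^sub>R fst y) - F n (x - t *\<^sub>R fst y)) * g' (x - t *\<^sub>R snd y)"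
    let ?k = "\<lambda>y. F n (x - t *\<^sub>R fst y) * (g' (x - t *\<^sub>R snd y) - G n (x - t *\<^sub>R snd y))"
    have mh: "?h \<in> borel_measurable (sph :: ('a \<times> 'a) measure)" "?k \<in> borel_measurable (sph :: ('a \<times> 'a) measure)"
      using ms[of "\<lambda>z. f' z - F n z" g' x t] ms[of "F n" "\<lambda>z. g' z - G n z" x t] by simp_all
    have eq: "av f' g' t x - av (F n) (G n) t x = (LINT y|sph. f' (x - t *\<^sub>R fst y) * g' (x - t *\<^sub>R snd y) - F n (x - t
        *\<^sub>R fst y) * G n (x - t *\<^sub>R snd y))"
      unfolding av_def by (rule Bochner_Integration.integral_diff[OF int[OF x t] intn[OF t], symmetric])
    have "ennreal (norm (av f' g' t x - av (F n) (G n) t x))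
      \<le> (\<integral>\<^sup>+y. ennreal (norm (f' (x - t *\<^sub>R fst y) * g' (x - t *\<^sub>R snd y) - F n (x - t *\<^sub>R fst y) * G n (x - t *\<^sub>R snd y))) \<partial>sph)"
      unfolding eq by (rule integral_norm_bound_ennreal) (rule Bochner_Integration.integrable_diff[OF int[OF x t] intn[OF t]])
    also have "\<dots> \<le> (\<integral>\<^sup>+y. ennreal (norm (?h y)) + ennreal (norm (?k y)) \<partial>sph)"
    proof (rule nn_integral_mono)
      fix y :: "'a \<times> 'a"
      have e: "f' (x - t *\<^sub>R fst y) * g' (x - t *\<^sub>R snd y) - F n (x - t *\<^sub>R fst y) * G n (x - t *\<^sub>R snd y) = ?h y + ?k y"
        by (simp add: algebra_simps)
      show "ennreal (norm (f' (x - t *\<^sub>R fst y) * g' (x - t *\<^sub>R snd y) - F n (x - t *\<^sub>R fst y) * G n (x - t *\<^sub>R snd y)))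
          \<le> ennreal (norm (?h y)) + ennreal (norm (?k y))"
        unfolding e by (subst ennreal_plus[symmetric], simp, simp, rule ennreal_leI, rule norm_triangle_ineq)
    qed
    also have "\<dots> = (\<integral>\<^sup>+y. ennreal (norm (?h y)) \<partial>sph) + (\<integral>\<^sup>+y. ennreal (norm (?k y)) \<partial>sph)"
      by (rule nn_integral_add) (use mh in auto)
    also have "(\<integral>\<^sup>+y. ennreal (norm (?h y)) \<partial>sph) = sph_form (magnitude (\<lambda>z. f' z - F n z)) (magnitude g') t x"
      by (rule form_eq)
    also have "(\<integral>\<^sup>+y. ennreal (norm (?k y)) \<partial>sph) = sph_form (magnitude (F n)) (magnitude (\<lambda>z. g' z - G n z)) t x"
      by (rule form_eq)
    also have "sph_form (magnitude (\<lambda>z. f' z - F n z)) (magnitude g') t x + sph_form (magnitude (F n)) (magnitude (\<lambda>z.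
        g' z - G n z)) t x \<le> \<delta> n x"
      unfolding \<delta>_def \<Phi>_def \<Psi>_def by (intro add_mono sf t A trF trG majf)
    finally show ?thesis .
  qed
  have \<delta>0: "(\<lambda>n. \<delta> n x) \<longlonglongrightarrow> 0" if "x \<in> good" for x
  proof -
    have fin: "\<Phi> x < \<infinity>" "\<Psi> x < \<infinity>" using that by (auto simp: good_def)
    have "(\<lambda>n. \<Psi> x * (\<Sum>i. ennreal (a (i + n)) * U (A (i + n)) x)) \<longlonglongrightarrow> \<Psi> x * 0"
      by (rule ennreal_tendsto_cmult[OF _ suminf_tail_tendsto_0]) (use fin in \<open>auto simp: \<Phi>_def\<close>)
    moreover have "(\<lambda>n. \<Phi> x * (\<Sum>i. ennreal (b (i + n)) * V (B (i + n)) x)) \<longlonglongrightarrow> \<Phi> x * 0"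
      by (rule ennreal_tendsto_cmult[OF _ suminf_tail_tendsto_0]) (use fin in \<open>auto simp: \<Psi>_def\<close>)
    ultimately have "(\<lambda>n. \<Psi> x * (\<Sum>i. ennreal (a (i + n)) * U (A (i + n)) x) + \<Phi> x * (\<Sum>i. ennreal (b (i + n)) * V (B (i +
        n)) x)) \<longlonglongrightarrow> \<Psi> x * 0 + \<Phi> x * 0"
      by (rule tendsto_add)
    then show ?thesis unfolding \<delta>_def by (simp add: mult.commute)
  qed
  have Slim: "(\<lambda>n. S n x) \<longlonglongrightarrow> bilinear_sph_max f g x" if x: "x \<in> good" for x
  proof (rule tendsto_sandwich)
    let ?M = "bilinear_sph_max f g x"
    have M: "?M \<noteq> \<infinity>"
    proof -
      have "\<Phi> x * \<Psi> x < \<infinity>" using x by (simp add: good_def ennreal_mult_less_top)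
      then have "?M < \<infinity>" by (rule le_less_trans[OF max_le[OF x]])
      then show ?thesis by (rule less_imp_neq)
    qed
    have tri: "ennreal (norm p) \<le> ennreal (norm q) + ennreal (norm (p - q))" for p q :: complex
    proof -
      have "norm p \<le> norm q + norm (p - q)" using norm_triangle_ineq[of q "p - q"] by simp
      then have "ennreal (norm p) \<le> ennreal (norm q + norm (p - q))" by (rule ennreal_leI)
      then show ?thesis by (subst (asm) ennreal_plus) simp_all
    qed
    show "eventually (\<lambda>n. S n x \<le> ?M + \<delta> n x) sequentially"
    proof (rule always_eventually, rule allI, unfold S_def, rule SUP_least)
      fix n and t :: real assume "t \<in> {0<..}"
      then have t: "t > 0" by simp
      have "ennreal (norm (av (F n) (G n) t x)) \<le> ennreal (norm (av f' g' t x)) + ennreal (norm (av f' g' t x - av (F n)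
          (G n) t x))"
        using tri[of "av (F n) (G n) t x" "av f' g' t x"] by (simp only: norm_minus_commute)
      also have "\<dots> \<le> ?M + \<delta> n x"
        unfolding max_eq[OF x] by (intro add_mono diff[OF x t] SUP_upper) (use t in auto)
      finally show "ennreal (norm (av (F n) (G n) t x)) \<le> ?M + \<delta> n x" .
    qed
    have "?M \<le> S n x + \<delta> n x" for n
      unfolding max_eq[OF x]
    proof (rule SUP_least)
      fix t :: real assume "t \<in> {0<..}"
      then have t: "t > 0" by simp
      have "ennreal (norm (av f' g' t x)) \<le> ennreal (norm (av (F n) (G n) t x)) + ennreal (norm (av f' g' t x - av (F n)
          (G n) t x))"
        by (rule tri)
      also have "\<dots> \<le> S n x + \<delta> n x"
        unfolding S_def by (intro add_mono diff[OF x t] SUP_upper) (use t in auto)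
      finally show "ennreal (norm (av f' g' t x)) \<le> S n x + \<delta> n x" .
    qed
    then show "eventually (\<lambda>n. ?M - \<delta> n x \<le> S n x) sequentially"
      using M by (intro always_eventually allI) (simp add: ennreal_minus_le_iff add.commute)
    have "(\<lambda>n. ?M + \<delta> n x) \<longlonglongrightarrow> ?M + 0" by (intro tendsto_add tendsto_const \<delta>0[OF x])
    then show "(\<lambda>n. ?M + \<delta> n x) \<longlonglongrightarrow> ?M" by simp
    have "(\<lambda>n. ?M - \<delta> n x) \<longlonglongrightarrow> ?M - 0"
      by (rule tendsto_diff_ennreal[OF tendsto_const \<delta>0[OF x]]) (use M in auto)
    then show "(\<lambda>n. ?M - \<delta> n x) \<longlonglongrightarrow> ?M" by simp
  qed
  \<comment> \<open>Cutting off to \<open>good\<close> gives convergence at every point, so L is an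
    honest limit of Borel functions; the maximal function differs from L only on a null set.\<close>
  define L where "L x = indicator good x * bilinear_sph_max f g x" for x
  have "L \<in> borel_measurable lborel"
  proof (rule borel_measurable_LIMSEQ_order)
    show "(\<lambda>n. indicator good x * S n x) \<longlonglongrightarrow> L x" for x
      using Slim[of x] by (auto simp: L_def split: split_indicator)
  qed measurable
  moreover have "AE x in lborel. bilinear_sph_max f g x = L x"
    using AEgood by eventually_elim (simp add: L_def)
  ultimately show "bilinear_sph_max f g \<in> borel_measurable lebesgue"
    by (rule completion_measurable_AE_cong) auto
  have "AE x in lebesgue. x \<in> good" by (rule AE_completion[OF AEgood])
  then show "AE x in lebesgue. bilinear_sph_max f g x \<le> (\<Sum>i. ennreal (a i) * U (A i) x) * (\<Sum>i. ennreal (b i) * V (B i) x)"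
    by eventually_elim (use max_le in \<open>simp add: \<Phi>_def \<Psi>_def\<close>)
qed


text \<open>The reduction shared by both dimensions. The majorants enter as hypotheses
  \<open>maj1\<close> and \<open>maj2\<close>, not through restricted weak type, so that an infinite
  exponent, where a single layer of infinite measure is used, is covered as well.\<close>

lemma lorentz_bounded_bilinear_sph_max:
  fixes U V :: "'a::euclidean_space set \<Rightarrow> 'a \<Rightarrow> ennreal"
  assumes ac: "ac_proj (fst :: 'a \<times> 'a \<Rightarrow> 'a)" "ac_proj (snd :: 'a \<times> 'a \<Rightarrow> 'a)"
    and UV: "\<And>A B t x. A \<in> sets borel \<Longrightarrow> B \<in> sets borel \<Longrightarrow> t > 0 \<Longrightarrow>
        sph_form (indicator A) (indicator B) t x \<le> U A x * V B x"
    and Um: "\<And>A. A \<in> sets borel \<Longrightarrow> U A \<in> borel_measurable borel" "\<And>A. A \<in> sets borel \<Longrightarrow> V A \<in> borel_measurable borel"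
    and c: "c1 \<ge> 0" "c2 \<ge> 0"
    and maj1: "\<And>f. f \<in> clorentz_space p1 1 lebesgue \<Longrightarrow> \<exists>f' a A. f' \<in> borel_measurable borel \<and>
      (AE x in lborel. f x = f' x) \<and> majorized f' a A \<and>
      weak_bdd \<theta>1 (\<lambda>x. \<Sum>i. ennreal (a i) * U (A i) x) (c1 * enn2real (lorentz_norm p1 1 lebesgue (magnitude f)))"
    and maj2: "\<And>f. f \<in> clorentz_space p2 1 lebesgue \<Longrightarrow> \<exists>f' a A. f' \<in> borel_measurable borel \<and>
      (AE x in lborel. f x = f' x) \<and> majorized f' a A \<and>
      weak_bdd \<theta>2 (\<lambda>x. \<Sum>i. ennreal (a i) * V (A i) x) (c2 * enn2real (lorentz_norm p2 1 lebesgue (magnitude f)))"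
    and p: "p \<noteq> \<infinity>" "enn2real (1 / p) = \<theta>1 + \<theta>2"
  shows "lorentz_bounded (bilinear_sph_max :: ('a \<Rightarrow> complex) \<Rightarrow> ('a \<Rightarrow> complex) \<Rightarrow> 'a \<Rightarrow> ennreal) (p1, 1) (p2, 1) (p, \<infinity>)"
proof -
  define C where "C = 2 powr (\<theta>1 + \<theta>2) * (c1 * c2)"
  have C: "0 \<le> C" using c by (simp add: C_def)
  have "bilinear_sph_max f g \<in> lorentz_space p \<infinity> lebesgue \<and>
        lorentz_norm p \<infinity> lebesgue (bilinear_sph_max f g) \<le>
          ennreal C * lorentz_norm p1 1 lebesgue (magnitude f) * lorentz_norm p2 1 lebesgue (magnitude g)"
    if f: "f \<in> clorentz_space p1 1 lebesgue" and g: "g \<in> clorentz_space p2 1 lebesgue" for f g :: "'a \<Rightarrow> complex"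
  proof -
    define Nf where "Nf = enn2real (lorentz_norm p1 1 lebesgue (magnitude f))"
    define Ng where "Ng = enn2real (lorentz_norm p2 1 lebesgue (magnitude g))"
    have nf: "lorentz_norm p1 1 lebesgue (magnitude f) = ennreal Nf" "Nf \<ge> 0"
      using f by (auto simp: Nf_def clorentz_space_def lorentz_space_def)
    have ng: "lorentz_norm p2 1 lebesgue (magnitude g) = ennreal Ng" "Ng \<ge> 0"
      using g by (auto simp: Ng_def clorentz_space_def lorentz_space_def)
    obtain f' a A where f'[measurable]: "f' \<in> borel_measurable borel" and fAE: "AE x in lborel. f x = f' x"
      and mf: "majorized f' a A" and wf: "weak_bdd \<theta>1 (\<lambda>x. \<Sum>i. ennreal (a i) * U (A i) x) (c1 * Nf)"
      using maj1[OF f] unfolding Nf_def by blast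
    obtain g' b B where g'[measurable]: "g' \<in> borel_measurable borel" and gAE: "AE x in lborel. g x = g' x"
      and mg: "majorized g' b B" and wg: "weak_bdd \<theta>2 (\<lambda>x. \<Sum>i. ennreal (b i) * V (B i) x) (c2 * Ng)"
      using maj2[OF g] unfolding Ng_def by blast
    have AB: "A i \<in> sets borel" "B i \<in> sets borel" for i using mf mg by (auto simp: majorized_def)
    note [measurable] = Um(1)[OF AB(1)] Um(2)[OF AB(2)]
    have m\<Phi>: "(\<lambda>x. \<Sum>i. ennreal (a i) * U (A i) x) \<in> borel_measurable borel"
      and m\<Psi>: "(\<lambda>x. \<Sum>i. ennreal (b i) * V (B i) x) \<in> borel_measurable borel" by measurable
    note main = bilinear_sph_max_majorant[OF ac UV Um f' g' fAE gAE mf mg weak_bdd_AE_finite[OF wf m\<Phi>]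
        weak_bdd_AE_finite[OF wg m\<Psi>]]
    have le: "lorentz_norm p \<infinity> lebesgue (bilinear_sph_max f g) \<le> ennreal (2 powr (\<theta>1 + \<theta>2) * ((c1 * Nf) * (c2 * Ng)))"
      by (rule lorentz_norm_weak_product[OF wf _ wg _ m\<Phi> m\<Psi> main p]) (use c nf ng in auto)
    also have "2 powr (\<theta>1 + \<theta>2) * ((c1 * Nf) * (c2 * Ng)) = C * Nf * Ng" by (simp add: C_def)
    also have "ennreal (C * Nf * Ng) = ennreal C * ennreal Nf * ennreal Ng"
      using C nf ng by (simp add: ennreal_mult)
    finally have le': "lorentz_norm p \<infinity> lebesgue (bilinear_sph_max f g) \<le> ennreal C * ennreal Nf * ennreal Ng" .
    have "lorentz_norm p \<infinity> lebesgue (bilinear_sph_max f g) < \<infinity>"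
      by (rule le_less_trans[OF le]) simp
    then have "bilinear_sph_max f g \<in> lorentz_space p \<infinity> lebesgue"
      unfolding lorentz_space_def using main(1) by blast
    then show ?thesis unfolding nf(1) ng(1) using le' by blast
  qed
  then show ?thesis unfolding lorentz_bounded_def using C by auto
qed

lemma majorant_finite_exponent:
  fixes U :: "'a::euclidean_space set \<Rightarrow> 'a \<Rightarrow> ennreal"
  assumes p: "p > 1" and f: "f \<in> clorentz_space (ennreal p) 1 lebesgue" and c: "c \<ge> 0"
    and Um: "\<And>A. A \<in> sets borel \<Longrightarrow> U A \<in> borel_measurable borel"
    and wk: "\<And>A. A \<in> sets borel \<Longrightarrow> emeasure lborel A < \<infinity> \<Longrightarrow> weak_bdd (1 / p) (U A) (c * measure lborel A powr (1 / p))"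
  shows "\<exists>f' a A. f' \<in> borel_measurable borel \<and> (AE x in lborel. f x = f' x) \<and> majorized f' a A \<and>
      weak_bdd (1 / p) (\<lambda>x. \<Sum>i. ennreal (a i) * U (A i) x)
        (weak_const (1 / p) * (c * 4) * enn2real (lorentz_norm (ennreal p) 1 lebesgue (magnitude f)))"
proof -
  obtain f' a A where fa: "f' \<in> borel_measurable borel" "AE x in lborel. f x = f' x" "majorized f' a A"
    "\<And>i. 0 < a i" "\<And>i. emeasure lborel (A i) < \<infinity>"
    "(\<Sum>i. ennreal (a i * measure lborel (A i) powr (1 / p))) \<le> ennreal (4 * enn2real (lorentz_norm (ennreal p) 1
        lebesgue (magnitude f)))"
    using lorentz_majorized[OF less_imp_le[OF p] f] by blast
  have "A i \<in> sets borel" for i using fa(3) by (simp add: majorized_def)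
  then have "weak_bdd (1 / p) (\<lambda>x. \<Sum>i. ennreal (a i) * U (A i) x)
    (weak_const (1 / p) * (c * (4 * enn2real (lorentz_norm (ennreal p) 1 lebesgue (magnitude f)))))"
    by (intro weak_bdd_majorant[OF Um wk _ _ c _ fa(5,4,6)]) (use p in auto)
  then show ?thesis using fa(1,2,3) by (auto simp: mult.assoc)
qed

text \<open>One layer suffices: the whole space with height the essential supremum. The weak bound
  with \<theta> = 0 is then a pointwise bound, which is why V must not exceed 1.\<close>

lemma majorant_infinite_exponent:
  fixes V :: "'a::euclidean_space set \<Rightarrow> 'a \<Rightarrow> ennreal"
  assumes f: "f \<in> clorentz_space \<infinity> 1 lebesgue" and V: "\<And>A x. V A x \<le> 1"
  shows "\<exists>f' a A. f' \<in> borel_measurable borel \<and> (AE x in lborel. f x = f' x) \<and> majorized f' a A \<and>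
      weak_bdd 0 (\<lambda>x. \<Sum>i. ennreal (a i) * V (A i) x) (1 * enn2real (lorentz_norm \<infinity> 1 lebesgue (magnitude f)))"
proof -
  have [measurable]: "f \<in> borel_measurable lebesgue" and fin: "esssup lebesgue (magnitude f) < \<infinity>"
    using f by (auto simp: clorentz_space_def lorentz_space_def lorentz_norm_def)
  define Y where "Y = enn2real (esssup lebesgue (magnitude f))"
  have Y: "esssup lebesgue (magnitude f) = ennreal Y" "Y \<ge> 0" using fin by (auto simp: Y_def)
  have norm: "enn2real (lorentz_norm \<infinity> 1 lebesgue (magnitude f)) = Y" by (simp add: lorentz_norm_def Y_def)
  obtain h where h[measurable]: "h \<in> borel_measurable borel" and hAE: "AE x in lborel. f x = h x"
    using lebesgue_complex_AE_borel[of f] by auto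
  have "AE x in lebesgue. magnitude f x \<le> ennreal Y" using esssup_AE[of "magnitude f" lebesgue] Y(1) by simp
  then have "AE x in lebesgue. norm (f x) \<le> Y" by eventually_elim (use Y(2) in simp)
  moreover have "AE x in lebesgue. f x = h x" by (rule AE_completion[OF hAE])
  ultimately have "AE x in lebesgue. norm (h x) \<le> Y" by eventually_elim simp
  then have hY: "AE x in lborel. norm (h x) \<le> Y" by (simp add: AE_completion_iff)
  define f' where "f' x = (if norm (h x) \<le> Y then h x else 0)" for x
  have "f' \<in> borel_measurable borel" unfolding f'_def by measurable
  moreover have "AE x in lborel. f x = f' x" using hAE hY by eventually_elim (simp add: f'_def)
  moreover have "majorized f' (\<lambda>i. if i = 0 then Y else 0) (\<lambda>i. if i = (0::nat) then UNIV else {})"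
    unfolding majorized_def
  proof (intro conjI allI ballI)
    fix x
    show "magnitude f' x \<le> (\<Sum>i. ennreal (if i = 0 then Y else 0) * indicator (if i = (0::nat) then UNIV else {}) x)"
    proof -
      have "magnitude f' x \<le> ennreal Y" using Y(2) by (intro ennreal_leI) (simp add: f'_def)
      also have "\<dots> = ennreal (if (0::nat) = 0 then Y else 0) * indicator (if (0::nat) = 0 then UNIV else {}) x" by simp
      also have "\<dots> \<le> (\<Sum>i. ennreal (if i = 0 then Y else 0) * indicator (if i = (0::nat) then UNIV else {}) x)"
        by (rule term_le_suminf)
      finally show ?thesis .
    qed
  qed (use Y in \<open>auto simp: f'_def split: if_splits\<close>)
  moreover have "weak_bdd 0 (\<lambda>x. \<Sum>i. ennreal (if i = 0 then Y else 0) * V (if i = (0::nat) then UNIV else {}) x) (1 * Y)"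
  proof -
    have "(\<Sum>i. ennreal (if i = 0 then Y else 0) * V (if i = (0::nat) then UNIV else {}) x) \<le> ennreal Y" for x
    proof -
      have "(\<Sum>i. ennreal (if i = 0 then Y else 0) * V (if i = (0::nat) then UNIV else {}) x)
        = (\<Sum>i\<in>{0}. ennreal (if i = 0 then Y else 0) * V (if i = (0::nat) then UNIV else {}) x)"
        by (rule suminf_finite) auto
      also have "\<dots> = ennreal Y * V UNIV x" by simp
      also have "\<dots> \<le> ennreal Y * 1" by (rule mult_left_mono[OF V]) simp
      finally show ?thesis by simp
    qed
    then have "{x. ennreal Y < (\<Sum>i. ennreal (if i = 0 then Y else 0) * V (if i = (0::nat) then UNIV else {}) x)} = {}"
      by (auto simp: not_less)
    then show ?thesis by (simp add: weak_bdd_def)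
  qed
  ultimately show ?thesis unfolding norm by blast
qed

section \<open>Polar coordinates derived from rotation invariance\<close>

section \<open>Polar coordinates in the plane\<close>

definition circ :: "real measure" where
  "circ = uniform_measure lborel {0..2 * pi}"

lemma prob_space_circ: "prob_space circ"
  unfolding circ_def by (rule prob_space_uniform_measure) auto

interpretation circ: prob_space circ by (rule prob_space_circ)

lemma sets_circ [simp, measurable_cong]: "sets circ = sets borel"
  by (simp add: circ_def)

lemma space_circ [simp]: "space circ = UNIV"
  by (simp add: circ_def)

lemma nn_integral_circ:
  assumes [measurable]: "f \<in> borel_measurable borel"
  shows "(\<integral>\<^sup>+\<theta>. f \<theta> \<partial>circ) = ennreal (1 / (2 * pi)) * (\<integral>\<^sup>+\<theta>\<in>{0..2 * pi}. f \<theta> \<partial>lborel)"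
proof -
  have "(\<integral>\<^sup>+\<theta>. f \<theta> \<partial>circ) = (\<integral>\<^sup>+\<theta>\<in>{0..2 * pi}. f \<theta> \<partial>lborel) / emeasure lborel {0..2 * pi}"
    unfolding circ_def by (rule nn_integral_uniform_measure) auto
  also have "\<dots> = (\<integral>\<^sup>+\<theta>\<in>{0..2 * pi}. f \<theta> \<partial>lborel) * inverse (ennreal (2 * pi))"
    by (simp add: divide_ennreal_def)
  also have "inverse (ennreal (2 * pi)) = ennreal (1 / (2 * pi))"
    by (simp add: inverse_ennreal inverse_eq_divide)
  finally show ?thesis by (simp add: mult.commute)
qed

text \<open>Rotation invariance: the part of the shifted period beyond 2 pi is moved back by
  periodicity, and the pieces overlap only in null sets.\<close>

lemma nn_integral_circ_shift:
  assumes [measurable]: "f \<in> borel_measurable borel" and per: "\<And>\<theta>. f (\<theta> + 2 * pi) = f \<theta>"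
    and \<omega>: "0 \<le> \<omega>" "\<omega> \<le> 2 * pi"
  shows "(\<integral>\<^sup>+\<theta>. f (\<theta> + \<omega>) \<partial>circ) = (\<integral>\<^sup>+\<theta>. f \<theta> \<partial>circ)"
proof -
  have shift: "(\<integral>\<^sup>+\<theta>. g (\<theta> + c) \<partial>lborel) = (\<integral>\<^sup>+\<theta>. g \<theta> \<partial>lborel)"
    if "g \<in> borel_measurable borel" for g :: "real \<Rightarrow> ennreal" and c
    using nn_integral_real_affine[OF that, of 1 c] by (simp add: add.commute)
  have "(\<integral>\<^sup>+\<theta>\<in>{0..2 * pi}. f (\<theta> + \<omega>) \<partial>lborel) = (\<integral>\<^sup>+\<theta>. f (\<theta> + \<omega>) * indicator {\<omega>..2 * pi + \<omega>} (\<theta> + \<omega>) \<partial>lborel)"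
    by (intro nn_integral_cong) (simp split: split_indicator)
  also have "\<dots> = (\<integral>\<^sup>+\<theta>\<in>{\<omega>..2 * pi + \<omega>}. f \<theta> \<partial>lborel)"
    by (rule shift) measurable
  also have "\<dots> = (\<integral>\<^sup>+\<theta>. f \<theta> * indicator {\<omega>..<2 * pi} \<theta> + f \<theta> * indicator {2 * pi..2 * pi + \<omega>} \<theta> \<partial>lborel)"
    using \<omega> by (intro nn_integral_cong) (auto split: split_indicator)
  also have "\<dots> = (\<integral>\<^sup>+\<theta>\<in>{\<omega>..<2 * pi}. f \<theta> \<partial>lborel) + (\<integral>\<^sup>+\<theta>\<in>{2 * pi..2 * pi + \<omega>}. f \<theta> \<partial>lborel)"
    by (rule nn_integral_add) measurable
  also have "(\<integral>\<^sup>+\<theta>\<in>{2 * pi..2 * pi + \<omega>}. f \<theta> \<partial>lborel) = (\<integral>\<^sup>+\<theta>. f (\<theta> + 2 * pi) * indicator {2 * pi..2 * pi + \<omega>} (\<theta> + 2 *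
      pi) \<partial>lborel)"
    by (rule shift[symmetric]) measurable
  also have "\<dots> = (\<integral>\<^sup>+\<theta>\<in>{0..\<omega>}. f \<theta> \<partial>lborel)"
    by (intro nn_integral_cong) (simp add: per split: split_indicator)
  also have "(\<integral>\<^sup>+\<theta>\<in>{\<omega>..<2 * pi}. f \<theta> \<partial>lborel) + (\<integral>\<^sup>+\<theta>\<in>{0..\<omega>}. f \<theta> \<partial>lborel)
      = (\<integral>\<^sup>+\<theta>. f \<theta> * indicator {\<omega>..<2 * pi} \<theta> + f \<theta> * indicator {0..\<omega>} \<theta> \<partial>lborel)"
    by (rule nn_integral_add[symmetric]) measurable
  also have "\<dots> = (\<integral>\<^sup>+\<theta>\<in>{0..2 * pi}. f \<theta> \<partial>lborel)"
  proof (rule nn_integral_cong_AE)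
    show "AE \<theta> in lborel. f \<theta> * indicator {\<omega>..<2 * pi} \<theta> + f \<theta> * indicator {0..\<omega>} \<theta> = f \<theta> * indicator {0..2 * pi} \<theta>"
      using AE_lborel_singleton[of \<omega>] AE_lborel_singleton[of "2 * pi"]
      by eventually_elim (use \<omega> in \<open>auto split: split_indicator\<close>)
  qed
  finally show ?thesis by (subst (1 2) nn_integral_circ) simp_all
qed

lemma shear_fst:
  assumes [measurable]: "h \<in> borel_measurable (borel :: (real \<times> real) measure)"
  shows "(\<integral>\<^sup>+z. h (fst z + k * snd z, snd z) \<partial>lborel) = (\<integral>\<^sup>+z. h z \<partial>lborel)"
proof -
  have m: "(\<lambda>(a, b). h (a + k * b, b)) \<in> borel_measurable (lborel \<Otimes>\<^sub>M lborel)" "(\<lambda>(a, b). h (a, b)) \<in> borel_measurable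
      (lborel \<Otimes>\<^sub>M lborel)"
    by (simp_all add: lborel_prod split_beta')
  have "(\<integral>\<^sup>+z. h (fst z + k * snd z, snd z) \<partial>lborel) = (\<integral>\<^sup>+z. (\<lambda>(a, b). h (a + k * b, b)) z \<partial>(lborel \<Otimes>\<^sub>M lborel))"
    by (simp add: lborel_prod split_beta')
  also have "\<dots> = (\<integral>\<^sup>+b. \<integral>\<^sup>+a. h (a + k * b, b) \<partial>lborel \<partial>lborel)"
    by (subst lborel_pair.nn_integral_snd[symmetric]) (use m in auto)
  also have "\<dots> = (\<integral>\<^sup>+b. \<integral>\<^sup>+a. h (a, b) \<partial>lborel \<partial>lborel)"
  proof (rule nn_integral_cong)
    fix b :: real
    have "(\<lambda>a. h (a, b)) \<in> borel_measurable borel" by measurable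
    from nn_integral_real_affine[OF this, of 1 "k * b"]
    show "(\<integral>\<^sup>+a. h (a + k * b, b) \<partial>lborel) = (\<integral>\<^sup>+a. h (a, b) \<partial>lborel)" by (simp add: add.commute)
  qed
  also have "\<dots> = (\<integral>\<^sup>+z. (\<lambda>(a, b). h (a, b)) z \<partial>(lborel \<Otimes>\<^sub>M lborel))"
    by (subst lborel_pair.nn_integral_snd[symmetric]) (use m in auto)
  also have "\<dots> = (\<integral>\<^sup>+z. h z \<partial>lborel)" by (simp add: lborel_prod)
  finally show ?thesis .
qed

lemma shear_snd:
  assumes [measurable]: "h \<in> borel_measurable (borel :: (real \<times> real) measure)"
  shows "(\<integral>\<^sup>+z. h (fst z, snd z + k * fst z) \<partial>lborel) = (\<integral>\<^sup>+z. h z \<partial>lborel)"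
proof -
  have m: "(\<lambda>(a, b). h (a, b + k * a)) \<in> borel_measurable (lborel \<Otimes>\<^sub>M lborel)" "(\<lambda>(a, b). h (a, b)) \<in> borel_measurable
      (lborel \<Otimes>\<^sub>M lborel)"
    by (simp_all add: lborel_prod split_beta')
  have "(\<integral>\<^sup>+z. h (fst z, snd z + k * fst z) \<partial>lborel) = (\<integral>\<^sup>+z. (\<lambda>(a, b). h (a, b + k * a)) z \<partial>(lborel \<Otimes>\<^sub>M lborel))"
    by (simp add: lborel_prod split_beta')
  also have "\<dots> = (\<integral>\<^sup>+a. \<integral>\<^sup>+b. h (a, b + k * a) \<partial>lborel \<partial>lborel)"
    by (subst lborel.nn_integral_fst[symmetric]) (use m in auto)
  also have "\<dots> = (\<integral>\<^sup>+a. \<integral>\<^sup>+b. h (a, b) \<partial>lborel \<partial>lborel)"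
  proof (rule nn_integral_cong)
    fix a :: real
    have "(\<lambda>b. h (a, b)) \<in> borel_measurable borel" by measurable
    from nn_integral_real_affine[OF this, of 1 "k * a"]
    show "(\<integral>\<^sup>+b. h (a, b + k * a) \<partial>lborel) = (\<integral>\<^sup>+b. h (a, b) \<partial>lborel)" by (simp add: add.commute)
  qed
  also have "\<dots> = (\<integral>\<^sup>+z. (\<lambda>(a, b). h (a, b)) z \<partial>(lborel \<Otimes>\<^sub>M lborel))"
    by (subst lborel.nn_integral_fst[symmetric]) (use m in auto)
  also have "\<dots> = (\<integral>\<^sup>+z. h z \<partial>lborel)" by (simp add: lborel_prod)
  finally show ?thesis .
qed

definition rot :: "real \<Rightarrow> real \<times> real \<Rightarrow> real \<times> real" where
  "rot \<omega> z = (fst z * cos \<omega> - snd z * sin \<omega>, fst z * sin \<omega> + snd z * cos \<omega>)"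

text \<open>A rotation by \<open>\<omega> \<noteq> \<pi>\<close> is the product of three shears.\<close>

lemma nn_integral_rot:
  assumes h[measurable]: "h \<in> borel_measurable borel" and \<omega>: "cos (\<omega> / 2) \<noteq> 0"
  shows "(\<integral>\<^sup>+z. h (rot \<omega> z) \<partial>lborel) = (\<integral>\<^sup>+z. h z \<partial>lborel)"
proof -
  \<comment> \<open>The shears have parameters c, sin \<omega>, c; the half-angle identities
    \<open>cs\<close> and \<open>c2\<close> say that their product has the entries of the rotation
    matrix.\<close>
  define c where "c = - tan (\<omega> / 2)"
  define s where "s = sin \<omega>"
  have sin: "sin \<omega> = 2 * sin (\<omega> / 2) * cos (\<omega> / 2)" using sin_double[of "\<omega> / 2"] by simp
  have cos: "cos \<omega> = 1 - 2 * sin (\<omega> / 2) ^ 2" using cos_double_sin[of "\<omega> / 2"] by simp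
  have cs: "1 + c * s = cos \<omega>" using \<omega> by (simp add: c_def s_def sin cos tan_def power2_eq_square)
  have c2: "c + c * cos \<omega> = - sin \<omega>"
  proof -
    have "1 + cos \<omega> = 2 * cos (\<omega> / 2) ^ 2" using cos_double_cos[of "\<omega> / 2"] by simp
    then have "c * (1 + cos \<omega>) = - sin \<omega>" using \<omega> by (simp add: c_def sin tan_def power2_eq_square)
    then show ?thesis by (simp add: algebra_simps)
  qed
  define h1 where "h1 z = h (fst z + c * snd z, snd z)" for z
  define h2 where "h2 z = h1 (fst z, snd z + s * fst z)" for z
  have [measurable]: "h1 \<in> borel_measurable borel" unfolding h1_def by measurable
  have [measurable]: "h2 \<in> borel_measurable borel" unfolding h2_def by measurable
  have "h (rot \<omega> z) = h2 (fst z + c * snd z, snd z)" for z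
  proof -
    obtain a b where z: "z = (a, b)" by (cases z)
    have 1: "b + s * (a + c * b) = a * sin \<omega> + b * cos \<omega>"
      using cs by (simp add: s_def algebra_simps flip: cs)
    have "a + c * b + c * (a * sin \<omega> + b * cos \<omega>) = a * (1 + c * s) + b * (c + c * cos \<omega>)"
      by (simp add: s_def algebra_simps)
    then have 2: "a + c * b + c * (a * sin \<omega> + b * cos \<omega>) = a * cos \<omega> - b * sin \<omega>"
      by (simp add: cs c2)
    show ?thesis by (simp add: h1_def h2_def rot_def z 1 2)
  qed
  then have "(\<integral>\<^sup>+z. h (rot \<omega> z) \<partial>lborel) = (\<integral>\<^sup>+z. h2 (fst z + c * snd z, snd z) \<partial>lborel)" by simp
  also have "\<dots> = (\<integral>\<^sup>+z. h2 z \<partial>lborel)" by (rule shear_fst) measurable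
  also have "\<dots> = (\<integral>\<^sup>+z. h1 z \<partial>lborel)" unfolding h2_def by (rule shear_snd) measurable
  also have "\<dots> = (\<integral>\<^sup>+z. h z \<partial>lborel)" unfolding h1_def by (rule shear_fst) measurable
  finally show ?thesis .
qed

text \<open>A disc of squared radius u has area pi u, so the squared radius has constant density.
  This is why squared radii, not radii, parametrise circles from here on.\<close>

lemma distr_norm_power2:
  "distr lborel borel (\<lambda>z::real \<times> real. (norm z)\<^sup>2) = density lborel (\<lambda>u. ennreal pi * indicator {0<..} u)"
proof (rule measure_eqI_generator_eq)
  show "Int_stable (range (\<lambda>u::real. {..u}))"
    by (auto simp: Int_stable_def)
  show "range (\<lambda>u::real. {..u}) \<subseteq> Pow UNIV" by simp
  have eq: "emeasure (distr lborel borel (\<lambda>z::real \<times> real. (norm z)\<^sup>2)) {..u} = ennreal (pi * max 0 u)" for u :: real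
  proof -
    have "emeasure (distr lborel borel (\<lambda>z::real \<times> real. (norm z)\<^sup>2)) {..u} = emeasure lborel {z::real \<times> real. (norm z)\<^sup>2 \<le> u}"
      by (subst emeasure_distr) (auto simp: vimage_def)
    also have "\<dots> = ennreal (pi * max 0 u)"
    proof (cases "u \<ge> 0")
      case True
      have "{z::real \<times> real. (norm z)\<^sup>2 \<le> u} = cball 0 (sqrt u)"
        using True real_le_rsqrt real_sqrt_ge_zero by (auto simp: real_le_rsqrt abs_le_square_iff[symmetric] dest:
            sqrt_le_D intro: real_le_rsqrt) (metis norm_ge_zero power_mono real_sqrt_pow2)
      then show ?thesis using True emeasure_cball[of "sqrt u" "0::real \<times> real"]
        by (simp add: unit_ball_vol_numeral max_def)
    next
      case False
      then have empty: "{z::real \<times> real. (norm z)\<^sup>2 \<le> u} = {}" by (auto simp: not_le intro: less_le_trans)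
      show ?thesis unfolding empty using False by (simp add: max_def)
    qed
    finally show ?thesis .
  qed
  show "emeasure (distr lborel borel (\<lambda>z::real \<times> real. (norm z)\<^sup>2)) X = emeasure (density lborel (\<lambda>u. ennreal pi *
      indicator {0<..} u)) X"
    if X: "X \<in> range (\<lambda>u::real. {..u})" for X
  proof -
    from X obtain u where X: "X = {..u}" by (elim rangeE)
    have "emeasure (density lborel (\<lambda>u. ennreal pi * indicator {0<..} u)) {..u} = (\<integral>\<^sup>+v. ennreal pi * indicator {0<..u}
        v \<partial>lborel)"
      by (subst emeasure_density) (auto intro!: nn_integral_cong split: split_indicator)
    also have "\<dots> = ennreal pi * emeasure lborel {0<..u}" by (rule nn_integral_cmult_indicator) simp
    also have "\<dots> = ennreal (pi * max 0 u)"
      by (cases "u \<ge> 0") (auto simp: ennreal_mult max_def)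
    finally show ?thesis using eq X by simp
  qed
  show "sets (distr lborel borel (\<lambda>z::real \<times> real. (norm z)\<^sup>2)) = sigma_sets UNIV (range (\<lambda>u::real. {..u}))"
    "sets (density lborel (\<lambda>u. ennreal pi * indicator {0<..} u)) = sigma_sets UNIV (range (\<lambda>u::real. {..u}))"
    by (simp_all add: borel_eq_atMost)
  show "range (\<lambda>n. {..real n}) \<subseteq> range (\<lambda>u::real. {..u})" by auto
  show "(\<Union>n. {..real n}) = UNIV" by (auto intro: real_arch_simple)
  show "emeasure (distr lborel borel (\<lambda>z::real \<times> real. (norm z)\<^sup>2)) {..real i} \<noteq> \<infinity>" for i
    by (simp add: eq)
qed

theorem nn_integral_polar:
  assumes h[measurable]: "h \<in> borel_measurable (borel :: (real \<times> real) measure)"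
  shows "(\<integral>\<^sup>+z. h z \<partial>lborel) = ennreal pi * (\<integral>\<^sup>+u\<in>{0<..}. (\<integral>\<^sup>+\<theta>. h (sqrt u * cos \<theta>, sqrt u * sin \<theta>) \<partial>circ) \<partial>lborel)"
proof -
  interpret cl: pair_sigma_finite circ "lborel :: (real \<times> real) measure" ..
  define H where "H r = (\<integral>\<^sup>+\<theta>. h (r * cos \<theta>, r * sin \<theta>) \<partial>circ)" for r
  have [measurable]: "H \<in> borel_measurable borel" unfolding H_def by measurable
  \<comment> \<open>The half turn has no decomposition into three shears because tan(\<omega>/2) is
    undefined; it is a single angle.\<close>
  have AE: "AE \<omega> in circ. cos (\<omega> / 2) \<noteq> 0"
  proof -
    have "AE \<omega> in lborel. \<omega> \<in> {0..2 * pi} \<longrightarrow> cos (\<omega> / 2) \<noteq> 0"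
      using AE_lborel_singleton[of pi]
    proof eventually_elim
      case (elim \<omega>)
      have "\<omega> / 2 = pi / 2" if "0 \<le> \<omega>" "\<omega> \<le> 2 * pi" "cos (\<omega> / 2) = 0"
        using cos_zero_iff_int2[of "\<omega>/2"] cos_inj_pi[of "\<omega> / 2" "pi / 2"] that by simp
      then show ?case using elim by auto
    qed
    then show ?thesis unfolding circ_def by (intro AE_uniform_measureI) auto
  qed
  have "(\<integral>\<^sup>+z. h z \<partial>lborel) = (\<integral>\<^sup>+\<omega>. (\<integral>\<^sup>+z. h z \<partial>lborel) \<partial>circ)"
    by (simp add: circ.emeasure_space_1[simplified])
  also have "\<dots> = (\<integral>\<^sup>+\<omega>. (\<integral>\<^sup>+z. h (rot \<omega> z) \<partial>lborel) \<partial>circ)"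
    by (rule nn_integral_cong_AE) (use AE in \<open>eventually_elim, simp add: nn_integral_rot\<close>)
  also have "\<dots> = (\<integral>\<^sup>+z. (\<integral>\<^sup>+\<omega>. h (rot \<omega> z) \<partial>circ) \<partial>lborel)"
    by (rule cl.Fubini'[symmetric]) (simp add: rot_def split_beta')
  also have "\<dots> = (\<integral>\<^sup>+z. H (norm z) \<partial>(lborel :: (real \<times> real) measure))"
  proof (rule nn_integral_cong)
    fix z :: "real \<times> real"
    obtain a b where z: "z = (a, b)" by (cases z)
    show "(\<integral>\<^sup>+\<omega>. h (rot \<omega> z) \<partial>circ) = H (norm z)"
    proof (cases "z = 0")
      case False
      then have n: "norm z > 0" by simp
      have nz: "norm z ^ 2 = a\<^sup>2 + b\<^sup>2" by (simp add: z norm_Pair)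
      have "(a / norm z)\<^sup>2 + (b / norm z)\<^sup>2 = 1"
        using n unfolding power_divide add_divide_distrib[symmetric] nz[symmetric] by simp
      then obtain t where t: "0 \<le> t" "t < 2 * pi" "a / norm z = cos t" "b / norm z = sin t"
        by (rule sincos_total_2pi)
      have ab: "a = norm z * cos t" "b = norm z * sin t" using t n by (simp_all add: field_simps)
      have "(\<integral>\<^sup>+\<omega>. h (rot \<omega> z) \<partial>circ) = (\<integral>\<^sup>+\<omega>. (\<lambda>\<theta>. h (norm z * cos \<theta>, norm z * sin \<theta>)) (\<omega> + t) \<partial>circ)"
      proof (rule nn_integral_cong)
        fix \<omega>
        have "rot \<omega> z = (norm z * cos (\<omega> + t), norm z * sin (\<omega> + t))"
          unfolding rot_def z fst_conv snd_conv by (subst (1 2) ab(1), subst (1 2) ab(2)) (simp add: cos_add sin_add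
              algebra_simps z)
        then show "h (rot \<omega> z) = (\<lambda>\<theta>. h (norm z * cos \<theta>, norm z * sin \<theta>)) (\<omega> + t)" by simp
      qed
      also have "\<dots> = H (norm z)"
        unfolding H_def by (rule nn_integral_circ_shift) (use t in \<open>auto simp: cos_periodic sin_periodic\<close>)
      finally show ?thesis .
    qed (simp add: H_def rot_def zero_prod_def)
  qed
  also have "\<dots> = (\<integral>\<^sup>+z. H (sqrt ((norm z)\<^sup>2)) \<partial>(lborel :: (real \<times> real) measure))" by simp
  also have "\<dots> = (\<integral>\<^sup>+u. H (sqrt u) \<partial>distr lborel borel (\<lambda>z::real \<times> real. (norm z)\<^sup>2))"
    by (subst nn_integral_distr) auto
  also have "\<dots> = (\<integral>\<^sup>+u. ennreal pi * indicator {0<..} u * H (sqrt u) \<partial>lborel)"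
    unfolding distr_norm_power2 by (rule nn_integral_density) measurable
  also have "\<dots> = (\<integral>\<^sup>+u. ennreal pi * (H (sqrt u) * indicator {0<..} u) \<partial>lborel)"
    by (simp add: mult_ac)
  also have "\<dots> = ennreal pi * (\<integral>\<^sup>+u\<in>{0<..}. H (sqrt u) \<partial>lborel)"
    by (rule nn_integral_cmult) measurable
  finally show ?thesis unfolding H_def .
qed


lemma sph_plane:
  assumes F[measurable]: "F \<in> borel_measurable (borel :: (real \<times> real) measure)"
  shows "(\<integral>\<^sup>+y. F y \<partial>sph) = ennreal (2 * pi) * (\<integral>\<^sup>+\<theta>. F (cos \<theta>, sin \<theta>) \<partial>circ)"
proof -
  have inner: "(\<integral>\<^sup>+\<theta>. F (sgn (sqrt u * cos \<theta>, sqrt u * sin \<theta>)) * indicator (cball 0 1 - {0}) (sqrt u * cos \<theta>, sqrt u *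
      sin \<theta>) \<partial>circ) * indicator {0<..} u
      = (\<integral>\<^sup>+\<theta>. F (cos \<theta>, sin \<theta>) \<partial>circ) * indicator {0<..1} u" for u
  proof (cases "u > 0")
    case True
    have n: "norm (sqrt u * cos \<theta>, sqrt u * sin \<theta>) = sqrt u" for \<theta>
      using True by (simp add: norm_Pair power_mult_distrib distrib_left[symmetric])
    have s: "sgn (sqrt u * cos \<theta>, sqrt u * sin \<theta>) = (cos \<theta>, sin \<theta>)" for \<theta>
      unfolding sgn_div_norm n using True by simp
    have ne: "(sqrt u * cos \<theta>, sqrt u * sin \<theta>) \<noteq> 0" for \<theta>
    proof
      assume "(sqrt u * cos \<theta>, sqrt u * sin \<theta>) = 0"
      then have "norm (sqrt u * cos \<theta>, sqrt u * sin \<theta>) = 0" by simp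
      then show False using True by (simp only: n) simp
    qed
    have i: "indicator (cball 0 1 - {0}) (sqrt u * cos \<theta>, sqrt u * sin \<theta>) = (indicator {0<..1} u :: ennreal)" for \<theta>
      using ne[of \<theta>] n[of \<theta>] True by (simp add: indicator_def)
    show ?thesis unfolding s i using True by (subst nn_integral_multc) auto
  qed simp
  have "(\<integral>\<^sup>+z\<in>cball 0 1 - {0}. F (sgn z) \<partial>lborel) = ennreal pi * (\<integral>\<^sup>+u\<in>{0<..}.
      (\<integral>\<^sup>+\<theta>. F (sgn (sqrt u * cos \<theta>, sqrt u * sin \<theta>)) * indicator (cball 0 1 - {0}) (sqrt u * cos \<theta>, sqrt u * sin \<theta>)
          \<partial>circ) \<partial>lborel)"
  proof (rule nn_integral_polar)
    have "(\<lambda>z. F (sgn z)) \<in> borel_measurable borel" by measurable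
    then show "(\<lambda>z. F (sgn z) * indicator (cball 0 1 - {0}) z) \<in> borel_measurable borel"
      by (intro borel_measurable_times_ennreal borel_measurable_indicator) simp_all
  qed
  also have "\<dots> = ennreal pi * (\<integral>\<^sup>+u. (\<integral>\<^sup>+\<theta>. F (cos \<theta>, sin \<theta>) \<partial>circ) * indicator {0<..1::real} u \<partial>lborel)"
    by (simp only: inner)
  also have "(\<integral>\<^sup>+u. (\<integral>\<^sup>+\<theta>. F (cos \<theta>, sin \<theta>) \<partial>circ) * indicator {0<..1::real} u \<partial>lborel) = (\<integral>\<^sup>+\<theta>. F (cos \<theta>, sin \<theta>) \<partial>circ)"
    by (subst nn_integral_cmult_indicator) simp_all
  finally show ?thesis by (simp add: nn_integral_sph ennreal_mult mult.assoc)
qed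

text \<open>Each half of the circle projects one-to-one onto [-1, 1] with Jacobian \<bar>sin\<bar>;
  two halves, divided by 2 pi, give 1/pi.\<close>

lemma circ_cos_sin:
  assumes f[measurable]: "f \<in> borel_measurable borel"
  shows "(\<integral>\<^sup>+\<theta>. f (cos \<theta>) * ennreal \<bar>sin \<theta>\<bar> \<partial>circ) = ennreal (1 / pi) * (\<integral>\<^sup>+y\<in>{-1..1}. f y \<partial>lborel)"
proof -
  have I1: "(\<integral>\<^sup>+\<theta>. f (cos \<theta>) * ennreal \<bar>sin \<theta>\<bar> * indicator {0..pi} \<theta> \<partial>lborel) = (\<integral>\<^sup>+y\<in>{-1..1}. f y \<partial>lborel)"
  proof -
    \<comment> \<open>The substitution rule wants an increasing function. On the upper half this is
      -cos, undone afterwards by a reflection; on the lower half cos itself increases.\<close>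
    have "(\<integral>\<^sup>+y. f (- y) * indicator {- cos 0..- cos pi} y \<partial>lborel) = (\<integral>\<^sup>+\<theta>. f (- (- cos \<theta>)) * ennreal (sin \<theta>) *
        indicator {0..pi} \<theta> \<partial>lborel)"
      by (rule nn_integral_substitution_aux)
         (auto intro!: derivative_eq_intros continuous_intros simp: sin_ge_zero)
    also have "\<dots> = (\<integral>\<^sup>+\<theta>. f (cos \<theta>) * ennreal \<bar>sin \<theta>\<bar> * indicator {0..pi} \<theta> \<partial>lborel)"
      by (intro nn_integral_cong) (auto simp: sin_ge_zero split: split_indicator)
    finally have "(\<integral>\<^sup>+\<theta>. f (cos \<theta>) * ennreal \<bar>sin \<theta>\<bar> * indicator {0..pi} \<theta> \<partial>lborel) = (\<integral>\<^sup>+y. f (0 + (-1) * y) *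
        indicator {-1..1} (0 + (-1) * y) \<partial>lborel)"
      by (simp add: indicator_def conj_commute)
    also have "\<dots> = (\<integral>\<^sup>+y\<in>{-1..1}. f y \<partial>lborel)"
      using nn_integral_real_affine[of "\<lambda>y. f y * indicator {-1..1} y" "-1" 0] by simp
    finally show ?thesis .
  qed
  have I2: "(\<integral>\<^sup>+\<theta>. f (cos \<theta>) * ennreal \<bar>sin \<theta>\<bar> * indicator {pi..2 * pi} \<theta> \<partial>lborel) = (\<integral>\<^sup>+y\<in>{-1..1}. f y \<partial>lborel)"
  proof -
    have neg: "sin \<theta> \<le> 0" if "pi \<le> \<theta>" "\<theta> \<le> 2 * pi" for \<theta>
      using sin_ge_zero[of "\<theta> - pi"] that by (simp add: sin_diff)
    have "(\<integral>\<^sup>+y. f y * indicator {cos pi..cos (2 * pi)} y \<partial>lborel) = (\<integral>\<^sup>+\<theta>. f (cos \<theta>) * ennreal (- sin \<theta>) * indicator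
        {pi..2 * pi} \<theta> \<partial>lborel)"
      by (rule nn_integral_substitution_aux)
         (auto intro!: derivative_eq_intros continuous_intros simp: neg)
    also have "\<dots> = (\<integral>\<^sup>+\<theta>. f (cos \<theta>) * ennreal \<bar>sin \<theta>\<bar> * indicator {pi..2 * pi} \<theta> \<partial>lborel)"
      by (intro nn_integral_cong) (auto simp: neg abs_of_nonpos split: split_indicator)
    finally show ?thesis by simp
  qed
  have "(\<integral>\<^sup>+\<theta>\<in>{0..2 * pi}. f (cos \<theta>) * ennreal \<bar>sin \<theta>\<bar> \<partial>lborel) =
    (\<integral>\<^sup>+\<theta>. f (cos \<theta>) * ennreal \<bar>sin \<theta>\<bar> * indicator {0..pi} \<theta> + f (cos \<theta>) * ennreal \<bar>sin \<theta>\<bar> * indicator {pi..2 * pi} \<theta> \<partial>lborel)"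
  proof (rule nn_integral_cong_AE)
    show "AE \<theta> in lborel. f (cos \<theta>) * ennreal \<bar>sin \<theta>\<bar> * indicator {0..2 * pi} \<theta> = f (cos \<theta>) * ennreal \<bar>sin \<theta>\<bar> *
        indicator {0..pi} \<theta> + f (cos \<theta>) * ennreal \<bar>sin \<theta>\<bar> * indicator {pi..2 * pi} \<theta>"
      using AE_lborel_singleton[of pi] by eventually_elim (auto split: split_indicator)
  qed
  also have "\<dots> = (\<integral>\<^sup>+\<theta>. f (cos \<theta>) * ennreal \<bar>sin \<theta>\<bar> * indicator {0..pi} \<theta> \<partial>lborel) + (\<integral>\<^sup>+\<theta>. f (cos \<theta>) * ennreal \<bar>sin \<theta>\<bar>
      * indicator {pi..2 * pi} \<theta> \<partial>lborel)"
    by (rule nn_integral_add) measurable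
  also have "\<dots> = 2 * (\<integral>\<^sup>+y\<in>{-1..1}. f y \<partial>lborel)"
    unfolding I1 I2 by (rule mult_2[symmetric])
  finally have "(\<integral>\<^sup>+\<theta>. f (cos \<theta>) * ennreal \<bar>sin \<theta>\<bar> \<partial>circ) = ennreal (1 / (2 * pi)) * (2 * (\<integral>\<^sup>+y\<in>{-1..1}. f y \<partial>lborel))"
    by (subst nn_integral_circ) simp_all
  also have "\<dots> = (ennreal (1 / (2 * pi)) * ennreal 2) * (\<integral>\<^sup>+y\<in>{-1..1}. f y \<partial>lborel)" by (simp add: mult.assoc)
  also have "ennreal (1 / (2 * pi)) * ennreal 2 = ennreal (1 / pi)" by (subst ennreal_mult[symmetric]) auto
  finally show ?thesis .
qed

text \<open>A rotation by 3 pi/2 carries cos to sin and sin to -cos.\<close>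

lemma circ_sin_cos:
  assumes f[measurable]: "f \<in> borel_measurable borel"
  shows "(\<integral>\<^sup>+\<theta>. f (sin \<theta>) * ennreal \<bar>cos \<theta>\<bar> \<partial>circ) = ennreal (1 / pi) * (\<integral>\<^sup>+y\<in>{-1..1}. f y \<partial>lborel)"
proof -
  have c: "cos (\<theta> + 3 / 2 * pi) = sin \<theta>" and s: "sin (\<theta> + 3 / 2 * pi) = - cos \<theta>" for \<theta>
    unfolding cos_add sin_add cos_3over2_pi sin_3over2_pi by simp_all
  have "(\<integral>\<^sup>+\<theta>. f (cos (\<theta> + 3 / 2 * pi)) * ennreal \<bar>sin (\<theta> + 3 / 2 * pi)\<bar> \<partial>circ) = (\<integral>\<^sup>+\<theta>. f (cos \<theta>) * ennreal \<bar>sin \<theta>\<bar> \<partial>circ)"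
    by (rule nn_integral_circ_shift) (auto simp: cos_periodic sin_periodic)
  then show ?thesis unfolding c s circ_cos_sin[OF f] by simp
qed

section \<open>Pointwise control of averages over the unit circle by the maximal function\<close>

section \<open>Dimension one\<close>

text \<open>Where \<bar>q\<bar> > r, the coordinate p has density at most of order 1/r and k is
  replaced by 1. Where \<bar>q\<bar> \<le> r \<le> 1/2, necessarily \<bar>p\<bar> \<ge> 1/2, so q
  has bounded density and h is replaced by 1. The short range of q keeps the second term small.
  Abstract coordinates p, q let sine and cosine exchange roles.\<close>

lemma circ_split:
  assumes [measurable]: "p \<in> borel_measurable borel" "q \<in> borel_measurable borel"
    and pq: "\<And>\<theta>. (p \<theta>)\<^sup>2 + (q \<theta>)\<^sup>2 = 1"
    and P: "\<And>f. f \<in> borel_measurable borel \<Longrightarrow>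
      (\<integral>\<^sup>+\<theta>. f (p \<theta>) * ennreal \<bar>q \<theta>\<bar> \<partial>circ) = ennreal (1 / pi) * (\<integral>\<^sup>+y\<in>{-1..1}. f y \<partial>lborel)"
    and Q: "\<And>f. f \<in> borel_measurable borel \<Longrightarrow>
      (\<integral>\<^sup>+\<theta>. f (q \<theta>) * ennreal \<bar>p \<theta>\<bar> \<partial>circ) = ennreal (1 / pi) * (\<integral>\<^sup>+y\<in>{-1..1}. f y \<partial>lborel)"
    and [measurable]: "h \<in> borel_measurable borel" "k \<in> borel_measurable borel"
    and h1: "\<And>z. h z \<le> 1" and k1: "\<And>z. k z \<le> 1" and r: "0 < r" "r \<le> 1 / 2"
  shows "ennreal (2 * pi) * (\<integral>\<^sup>+\<theta>. h (p \<theta>) * k (q \<theta>) \<partial>circ)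
    \<le> ennreal (2 / r) * (\<integral>\<^sup>+y\<in>{-1..1}. h y \<partial>lborel) + ennreal 4 * (\<integral>\<^sup>+y\<in>{-r..r}. k y \<partial>lborel)"
proof -
  have "(\<integral>\<^sup>+\<theta>. h (p \<theta>) * k (q \<theta>) \<partial>circ) \<le> (\<integral>\<^sup>+\<theta>. ennreal (1 / r) * (h (p \<theta>) * ennreal \<bar>q \<theta>\<bar>) +
      ennreal 2 * ((k (q \<theta>) * indicator {-r..r} (q \<theta>)) * ennreal \<bar>p \<theta>\<bar>) \<partial>circ)"
  proof (rule nn_integral_mono)
    fix \<theta>
    show "h (p \<theta>) * k (q \<theta>) \<le> ennreal (1 / r) * (h (p \<theta>) * ennreal \<bar>q \<theta>\<bar>) +
      ennreal 2 * ((k (q \<theta>) * indicator {-r..r} (q \<theta>)) * ennreal \<bar>p \<theta>\<bar>)"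
    proof (cases "\<bar>q \<theta>\<bar> \<le> r")
      case False
      have "h (p \<theta>) * k (q \<theta>) \<le> h (p \<theta>) * 1" by (rule mult_left_mono[OF k1]) simp
      also have "\<dots> \<le> h (p \<theta>) * ennreal (1 / r * \<bar>q \<theta>\<bar>)"
      proof (rule mult_left_mono)
        have "1 \<le> 1 / r * \<bar>q \<theta>\<bar>" using False r by (simp add: field_simps)
        then have "ennreal 1 \<le> ennreal (1 / r * \<bar>q \<theta>\<bar>)" by (rule ennreal_leI)
        then show "1 \<le> ennreal (1 / r * \<bar>q \<theta>\<bar>)" by simp
      qed simp
      also have "\<dots> = ennreal (1 / r) * (h (p \<theta>) * ennreal \<bar>q \<theta>\<bar>)"
        using r by (subst ennreal_mult) (auto simp: mult_ac)
      finally show ?thesis by (rule add_increasing2[OF zero_le])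
    next
      case True
      have "(q \<theta>)\<^sup>2 \<le> (1 / 2)\<^sup>2" using True r by (intro abs_le_square_iff[THEN iffD1]) simp
      then have "(1 / 2)\<^sup>2 \<le> (p \<theta>)\<^sup>2" using pq[of \<theta>] by (simp add: power2_eq_square)
      then have p2: "\<bar>1 / 2\<bar> \<le> \<bar>p \<theta>\<bar>" by (simp only: abs_le_square_iff)
      have "h (p \<theta>) * k (q \<theta>) \<le> 1 * k (q \<theta>)" by (rule mult_right_mono[OF h1]) simp
      also have "\<dots> \<le> ennreal (2 * \<bar>p \<theta>\<bar>) * k (q \<theta>)"
      proof (rule mult_right_mono)
        have "ennreal 1 \<le> ennreal (2 * \<bar>p \<theta>\<bar>)" using p2 by (intro ennreal_leI) simp
        then show "1 \<le> ennreal (2 * \<bar>p \<theta>\<bar>)" by simp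
      qed simp
      also have "\<dots> = ennreal 2 * ((k (q \<theta>) * indicator {-r..r} (q \<theta>)) * ennreal \<bar>p \<theta>\<bar>)"
        using True by (subst ennreal_mult) (auto simp: mult_ac abs_le_iff)
      finally show ?thesis by (rule add_increasing[OF zero_le])
    qed
  qed
  also have "\<dots> = ennreal (1 / r) * (\<integral>\<^sup>+\<theta>. h (p \<theta>) * ennreal \<bar>q \<theta>\<bar> \<partial>circ) + ennreal 2 * (\<integral>\<^sup>+\<theta>. (k (q \<theta>) * indicator
      {-r..r} (q \<theta>)) * ennreal \<bar>p \<theta>\<bar> \<partial>circ)"
    by (subst nn_integral_add) (simp_all add: nn_integral_cmult)
  also have "(\<integral>\<^sup>+\<theta>. h (p \<theta>) * ennreal \<bar>q \<theta>\<bar> \<partial>circ) = ennreal (1 / pi) * (\<integral>\<^sup>+y\<in>{-1..1}. h y \<partial>lborel)"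
    by (rule P) measurable
  also have "(\<integral>\<^sup>+\<theta>. (k (q \<theta>) * indicator {-r..r} (q \<theta>)) * ennreal \<bar>p \<theta>\<bar> \<partial>circ) = ennreal (1 / pi) * (\<integral>\<^sup>+y\<in>{-1..1}. k y *
      indicator {-r..r} y \<partial>lborel)"
    by (rule Q) measurable
  also have "(\<integral>\<^sup>+y\<in>{-1..1}. k y * indicator {-r..r} y \<partial>lborel) = (\<integral>\<^sup>+y\<in>{-r..r}. k y \<partial>lborel)"
    using r by (intro nn_integral_cong) (auto split: split_indicator)
  finally have "ennreal (2 * pi) * (\<integral>\<^sup>+\<theta>. h (p \<theta>) * k (q \<theta>) \<partial>circ) \<le> ennreal (2 * pi) *
     (ennreal (1 / r) * (ennreal (1 / pi) * (\<integral>\<^sup>+y\<in>{-1..1}. h y \<partial>lborel)) + ennreal 2 * (ennreal (1 / pi) *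
         (\<integral>\<^sup>+y\<in>{-r..r}. k y \<partial>lborel)))"
    by (rule mult_left_mono) simp
  also have "\<dots> = (ennreal (2 * pi) * ennreal (1 / r) * ennreal (1 / pi)) * (\<integral>\<^sup>+y\<in>{-1..1}. h y \<partial>lborel) + (ennreal (2 *
      pi) * ennreal 2 * ennreal (1 / pi)) * (\<integral>\<^sup>+y\<in>{-r..r}. k y \<partial>lborel)"
    by (simp only: distrib_left mult.assoc)
  also have "ennreal (2 * pi) * ennreal (1 / r) * ennreal (1 / pi) = ennreal (2 / r)"
    using r by (simp flip: ennreal_mult)
  also have "ennreal (2 * pi) * ennreal 2 * ennreal (1 / pi) = ennreal 4"
    by (simp del: ennreal_numeral flip: ennreal_mult)
  finally show ?thesis .
qed

text \<open>The arcs near the points where the projected density is unbounded contribute at most 8 r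
  whatever h is; r is chosen so that this is at most e, and away from them the density is at most
  2/r.\<close>

lemma ac_proj_planeI:
  fixes \<pi> :: "real \<times> real \<Rightarrow> real"
  assumes [measurable]: "\<pi> \<in> borel_measurable borel"
    and split: "\<And>h r. h \<in> borel_measurable borel \<Longrightarrow> (\<And>z. h z \<le> 1) \<Longrightarrow> 0 < r \<Longrightarrow> r \<le> 1 / 2 \<Longrightarrow>
      ennreal (2 * pi) * (\<integral>\<^sup>+\<theta>. h (\<pi> (cos \<theta>, sin \<theta>)) \<partial>circ) \<le> ennreal (2 / r) * (\<integral>\<^sup>+y\<in>{-1..1}. h y \<partial>lborel) + ennreal (8 * r)"
  shows "ac_proj \<pi>"
  unfolding ac_proj_def
proof (intro conjI allI impI)
  fix e :: real assume e: "e > 0"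
  define r where "r = min (1 / 2) (e / 8)"
  have r: "0 < r" "r \<le> 1 / 2" "8 * r \<le> e" using e by (auto simp: r_def)
  show "\<exists>C\<ge>0. \<forall>h\<in>borel_measurable borel. (\<forall>z. h z \<le> 1) \<longrightarrow>
      (\<integral>\<^sup>+y. h (\<pi> y) \<partial>sph) \<le> ennreal e + ennreal C * (\<integral>\<^sup>+z\<in>cball 0 1. h z \<partial>lborel)"
  proof (intro exI[of _ "2 / r"] conjI ballI impI)
    fix h :: "real \<Rightarrow> ennreal" assume h[measurable]: "h \<in> borel_measurable borel" and h1: "\<forall>z. h z \<le> 1"
    have "(\<integral>\<^sup>+y. h (\<pi> y) \<partial>sph) = ennreal (2 * pi) * (\<integral>\<^sup>+\<theta>. h (\<pi> (cos \<theta>, sin \<theta>)) \<partial>circ)"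
      by (rule sph_plane) measurable
    also have "\<dots> \<le> ennreal (2 / r) * (\<integral>\<^sup>+y\<in>{-1..1}. h y \<partial>lborel) + ennreal (8 * r)"
      by (rule split[OF h _ r(1,2)]) (use h1 in auto)
    also have "\<dots> \<le> ennreal (2 / r) * (\<integral>\<^sup>+y\<in>{-1..1}. h y \<partial>lborel) + ennreal e"
      by (intro add_left_mono ennreal_leI r)
    finally show "(\<integral>\<^sup>+y. h (\<pi> y) \<partial>sph) \<le> ennreal e + ennreal (2 / r) * (\<integral>\<^sup>+z\<in>cball 0 1. h z \<partial>lborel)"
      by (simp add: add.commute cball_eq_atLeastAtMost)
  qed (use r in auto)
qed simp

lemma nn_integral_one_le:
  assumes "0 < r"
  shows "ennreal 4 * (\<integral>\<^sup>+y\<in>{-r..r}. 1 \<partial>lborel) = ennreal (8 * r)"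
proof -
  have "(\<integral>\<^sup>+y\<in>{-r..r}. 1 \<partial>lborel) = ennreal (2 * r)" using assms by simp
  then show ?thesis using assms by (simp only:) (subst ennreal_mult[symmetric], auto)
qed

lemma ac_proj_fst_real: "ac_proj (fst :: real \<times> real \<Rightarrow> real)"
proof (rule ac_proj_planeI)
  fix h :: "real \<Rightarrow> ennreal" and r :: real
  assume h: "h \<in> borel_measurable borel" "\<And>z. h z \<le> 1" and r: "0 < r" "r \<le> 1 / 2"
  show "ennreal (2 * pi) * (\<integral>\<^sup>+\<theta>. h (fst (cos \<theta>, sin \<theta>)) \<partial>circ) \<le> ennreal (2 / r) * (\<integral>\<^sup>+y\<in>{-1..1}. h y \<partial>lborel) + ennreal (8 * r)"
  proof -
    have "ennreal (2 * pi) * (\<integral>\<^sup>+\<theta>. h (cos \<theta>) * (\<lambda>_. 1) (sin \<theta>) \<partial>circ)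
      \<le> ennreal (2 / r) * (\<integral>\<^sup>+y\<in>{-1..1}. h y \<partial>lborel) + ennreal 4 * (\<integral>\<^sup>+y\<in>{-r..r}. (\<lambda>_. 1) y \<partial>lborel)"
      by (rule circ_split[where p = cos and q = sin and h = h and k = "\<lambda>_. 1"]; (rule circ_cos_sin circ_sin_cos h r)?) simp_all
    then show ?thesis using nn_integral_one_le[OF r(1)] by simp
  qed
qed simp

lemma ac_proj_snd_real: "ac_proj (snd :: real \<times> real \<Rightarrow> real)"
proof (rule ac_proj_planeI)
  fix h :: "real \<Rightarrow> ennreal" and r :: real
  assume h: "h \<in> borel_measurable borel" "\<And>z. h z \<le> 1" and r: "0 < r" "r \<le> 1 / 2"
  show "ennreal (2 * pi) * (\<integral>\<^sup>+\<theta>. h (snd (cos \<theta>, sin \<theta>)) \<partial>circ) \<le> ennreal (2 / r) * (\<integral>\<^sup>+y\<in>{-1..1}. h y \<partial>lborel) + ennreal (8 * r)"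
  proof -
    have "ennreal (2 * pi) * (\<integral>\<^sup>+\<theta>. h (sin \<theta>) * (\<lambda>_. 1) (cos \<theta>) \<partial>circ)
      \<le> ennreal (2 / r) * (\<integral>\<^sup>+y\<in>{-1..1}. h y \<partial>lborel) + ennreal 4 * (\<integral>\<^sup>+y\<in>{-r..r}. (\<lambda>_. 1) y \<partial>lborel)"
      by (rule circ_split[where p = sin and q = cos and h = h and k = "\<lambda>_. 1"]; (rule circ_sin_cos circ_cos_sin h r)?) simp_all
    then show ?thesis using nn_integral_one_le[OF r(1)] by simp
  qed
qed simp

lemma nn_integral_segment_le_hl_max:
  fixes A :: "real set"
  assumes A[measurable]: "A \<in> sets borel" and t: "t > 0" and s: "s > 0"
  shows "(\<integral>\<^sup>+y\<in>{-s..s}. indicator A (x - t * y) \<partial>lborel) \<le> ennreal (2 * s * hl_max A x)"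
proof -
  have ts: "t * s > 0" using t s by simp
  have "(\<integral>\<^sup>+y\<in>{-s..s}. indicator A (x - t * y) \<partial>lborel) = (\<integral>\<^sup>+y. indicator (A \<inter> ball x (t * s)) (x + (-t) * y) \<partial>lborel)"
  proof (rule nn_integral_cong_AE)
    show "AE y in lborel. indicator A (x - t * y) * indicator {-s..s} y = (indicator (A \<inter> ball x (t * s)) (x + (-t) * y)
        :: ennreal)"
      using AE_lborel_singleton[of s] AE_lborel_singleton[of "-s"]
    proof eventually_elim
      case (elim y)
      have "\<bar>t * y\<bar> < t * s \<longleftrightarrow> \<bar>y\<bar> < s" using t by (simp add: abs_mult)
      moreover have "\<bar>y\<bar> < s \<longleftrightarrow> y \<in> {-s..s}" using elim by auto
      ultimately show ?case by (simp add: indicator_def dist_real_def)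
    qed
  qed
  also have "\<dots> = ennreal (1 / t) * (ennreal \<bar>-t\<bar> * (\<integral>\<^sup>+y. indicator (A \<inter> ball x (t * s)) (x + (-t) * y) \<partial>lborel))"
    using t by (simp add: mult.assoc[symmetric] ennreal_mult[symmetric])
  also have "ennreal \<bar>-t\<bar> * (\<integral>\<^sup>+y. indicator (A \<inter> ball x (t * s)) (x + (-t) * y) \<partial>lborel) = (\<integral>\<^sup>+y. indicator (A \<inter> ball x
      (t * s)) y \<partial>lborel)"
  proof (rule nn_integral_real_affine[symmetric])
    have "A \<inter> ball x (t * s) \<in> sets borel" by simp
    then show "indicator (A \<inter> ball x (t * s)) \<in> borel_measurable borel" by (rule borel_measurable_indicator)
  qed (use t in simp)
  finally have eq: "(\<integral>\<^sup>+y\<in>{-s..s}. indicator A (x - t * y) \<partial>lborel) = ennreal (1 / t) * emeasure lborel (A \<inter> ball x (t * s))"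
    by simp
  have "emeasure lborel (A \<inter> ball x (t * s)) = ennreal (measure lborel (A \<inter> ball x (t * s)))"
    using finite_lborel_Int_ball[OF A, of x "t * s"] by (simp add: emeasure_eq_measure2)
  also have "\<dots> \<le> ennreal (hl_max A x * (2 * (t * s)))"
    using measure_Int_ball_le_hl_max[OF A ts, of x] ts by (intro ennreal_leI) (simp add: ball_eq_greaterThanLessThan mult_ac)
  finally have "ennreal (1 / t) * emeasure lborel (A \<inter> ball x (t * s)) \<le> ennreal (1 / t) * ennreal (hl_max A x * (2 * (t * s)))"
    by (rule mult_left_mono) simp
  also have "\<dots> = ennreal (2 * s * hl_max A x)"
    using t s hl_max_nonneg[OF A, of x] by (subst ennreal_mult[symmetric]) auto
  finally show ?thesis unfolding eq .
qed


lemma sph_form_real: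
  assumes [measurable]: "h \<in> borel_measurable borel" "k \<in> borel_measurable borel"
  shows "sph_form h k t x = ennreal (2 * pi) * (\<integral>\<^sup>+\<theta>. h (x - t * cos \<theta>) * k (x - t * sin \<theta>) \<partial>circ)"
  unfolding sph_form_def by (subst sph_plane) simp_all

text \<open>\<open>circ_split\<close> gives 4 \<alpha>/r + 8 r \<beta>, and the best r yields the
  geometric mean. Both orders of the coordinates are prepared, because r \<le> 1/2 is compatible
  with the best r only if the term with 1/r carries the smaller maximal function.\<close>

lemma sph_form_real_le:
  fixes A B :: "real set"
  assumes A[measurable]: "A \<in> sets borel" and B[measurable]: "B \<in> sets borel" and t: "t > 0"
  shows "sph_form (indicator A) (indicator B) t x \<le> ennreal (16 * (sqrt (hl_max A x) * sqrt (hl_max B x)))"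
proof -
  define \<alpha> where "\<alpha> = hl_max A x"
  define \<beta> where "\<beta> = hl_max B x"
  have \<alpha>\<beta>: "\<alpha> \<ge> 0" "\<beta> \<ge> 0" using hl_max_nonneg[OF A] hl_max_nonneg[OF B] by (auto simp: \<alpha>_def \<beta>_def)
  let ?K = "sph_form (indicator A) (indicator B) t x"
  define h :: "real \<Rightarrow> ennreal" where "h y = indicator A (x - t * y)" for y
  define k :: "real \<Rightarrow> ennreal" where "k y = indicator B (x - t * y)" for y
  have [measurable]: "h \<in> borel_measurable borel" "k \<in> borel_measurable borel" unfolding h_def k_def by measurable
  have hk1: "h z \<le> 1" "k z \<le> 1" for z by (auto simp: h_def k_def indicator_def)
  have K: "?K = ennreal (2 * pi) * (\<integral>\<^sup>+\<theta>. h (cos \<theta>) * k (sin \<theta>) \<partial>circ)"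
    by (subst sph_form_real) (simp_all add: h_def k_def)
  have seg: "(\<integral>\<^sup>+y\<in>{-s..s}. h y \<partial>lborel) \<le> ennreal (2 * s * \<alpha>)" "(\<integral>\<^sup>+y\<in>{-s..s}. k y \<partial>lborel) \<le> ennreal (2 * s * \<beta>)" if
      "s > 0" for s
    unfolding h_def k_def \<alpha>_def \<beta>_def by (rule nn_integral_segment_le_hl_max[OF _ t that], simp)+
  have le1: "?K \<le> ennreal (4 / r * \<alpha> + 8 * r * \<beta>)" if r: "0 < r" "r \<le> 1 / 2" for r
  proof -
    have "?K \<le> ennreal (2 / r) * (\<integral>\<^sup>+y\<in>{-1..1}. h y \<partial>lborel) + ennreal 4 * (\<integral>\<^sup>+y\<in>{-r..r}. k y \<partial>lborel)"
      unfolding K by (rule circ_split[where p = cos and q = sin and h = h and k = k]; (rule circ_cos_sin circ_sin_cos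
          hk1 r)?) simp_all
    also have "\<dots> \<le> ennreal (2 / r) * ennreal (2 * 1 * \<alpha>) + ennreal 4 * ennreal (2 * r * \<beta>)"
      by (intro add_mono mult_left_mono seg) (use r in auto)
    also have "\<dots> = ennreal (4 / r * \<alpha> + 8 * r * \<beta>)"
      using r \<alpha>\<beta> by (simp del: ennreal_numeral flip: ennreal_mult ennreal_plus add: mult_ac)
    finally show ?thesis .
  qed
  have le2: "?K \<le> ennreal (4 / r * \<beta> + 8 * r * \<alpha>)" if r: "0 < r" "r \<le> 1 / 2" for r
  proof -
    have "?K = ennreal (2 * pi) * (\<integral>\<^sup>+\<theta>. k (sin \<theta>) * h (cos \<theta>) \<partial>circ)" unfolding K by (simp add: mult.commute)
    also have "\<dots> \<le> ennreal (2 / r) * (\<integral>\<^sup>+y\<in>{-1..1}. k y \<partial>lborel) + ennreal 4 * (\<integral>\<^sup>+y\<in>{-r..r}. h y \<partial>lborel)"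
      by (rule circ_split[where p = sin and q = cos and h = k and k = h]; (rule circ_cos_sin circ_sin_cos hk1 r)?) simp_all
    also have "\<dots> \<le> ennreal (2 / r) * ennreal (2 * 1 * \<beta>) + ennreal 4 * ennreal (2 * r * \<alpha>)"
      by (intro add_mono mult_left_mono seg) (use r in auto)
    also have "\<dots> = ennreal (4 / r * \<beta> + 8 * r * \<alpha>)"
      using r \<alpha>\<beta> by (simp del: ennreal_numeral flip: ennreal_mult ennreal_plus add: mult_ac)
    finally show ?thesis .
  qed
  have opt: "?K \<le> ennreal (16 * (sqrt a * sqrt b))"
    if ab: "0 \<le> a" "a \<le> b" and le: "\<And>r. 0 < r \<Longrightarrow> r \<le> 1 / 2 \<Longrightarrow> ?K \<le> ennreal (4 / r * a + 8 * r * b)" for a b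
  proof (cases "a = 0")
    \<comment> \<open>With a = 0 the best r degenerates, and r is sent to 0 instead.\<close>
    case True
    have "?K \<le> 0"
    proof (rule ennreal_le_epsilon)
      fix e :: real assume e: "e > 0"
      define r where "r = min (1 / 2) (e / (8 * (b + 1)))"
      have r: "0 < r" using e ab by (simp add: r_def)
      have r2: "r \<le> 1 / 2" unfolding r_def by (rule min.cobounded1)
      have "8 * r * b \<le> 8 * (e / (8 * (b + 1))) * b" by (intro mult_left_mono mult_right_mono) (use ab in \<open>auto simp: r_def\<close>)
      also have "\<dots> \<le> e" using e ab by (simp add: field_simps)
      finally show "?K \<le> 0 + ennreal e" using order_trans[OF le[OF r r2] ennreal_leI] True by simp
    qed
    then show ?thesis by simp
  next
    case False
    then have a: "a > 0" "b > 0" using ab by auto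
    \<comment> \<open>The two terms become 8 and 4 times sqrt a sqrt b; a \<le> b ensures r \<le>
      1/2.\<close>
    define r where "r = sqrt a / (2 * sqrt b)"
    have r: "0 < r" "r \<le> 1 / 2" using a ab by (simp_all add: r_def)
    have "4 / r * a = 8 * (sqrt a * sqrt b)"
      using a by (simp add: r_def field_simps)
    moreover have "8 * r * b = 4 * (sqrt a * sqrt b)"
      using a real_sqrt_mult_self[of b] by (simp add: r_def field_simps)
    ultimately have "4 / r * a + 8 * r * b = 12 * (sqrt a * sqrt b)" by simp
    then have "?K \<le> ennreal (12 * (sqrt a * sqrt b))" using le[OF r] by simp
    also have "\<dots> \<le> ennreal (16 * (sqrt a * sqrt b))" using a by (intro ennreal_leI) simp
    finally show ?thesis .
  qed
  show ?thesis
  proof (cases "\<alpha> \<le> \<beta>")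
    case True
    then show ?thesis using opt[OF \<alpha>\<beta>(1) _ le1] by (simp add: \<alpha>_def \<beta>_def)
  next
    case False
    then show ?thesis using opt[OF \<alpha>\<beta>(2) _ le2] by (simp add: \<alpha>_def \<beta>_def mult.commute)
  qed
qed

lemma weak_bdd_hl_max_powr:
  fixes A :: "'a::euclidean_space set"
  assumes A: "A \<in> sets borel" "emeasure lborel A < \<infinity>" and \<theta>: "\<theta> > 0" and K: "K > 0"
  shows "weak_bdd \<theta> (\<lambda>x. ennreal (K * hl_max A x powr \<theta>)) (K * (5 ^ DIM('a)) powr \<theta> * measure lborel A powr \<theta>)"
  unfolding weak_bdd_def
proof (intro allI impI)
  fix m :: real assume m: "m > 0"
  let ?M = "measure lborel A" and ?d = "5 ^ DIM('a) :: real"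
  \<comment> \<open>The level at which the weak-type bound for the maximal function equals m. If A
    is null, then l = 0 and that bound does not apply, but the maximal function vanishes.\<close>
  define l where "l = ?d * ?M / m"
  have l: "K * ?d powr \<theta> * ?M powr \<theta> * m powr -\<theta> = K * l powr \<theta>"
    using m by (simp add: l_def powr_divide powr_mult powr_minus_divide)
  have sub: "{x. ennreal (K * ?d powr \<theta> * ?M powr \<theta> * m powr -\<theta>) < ennreal (K * hl_max A x powr \<theta>)} \<subseteq> {x. l < hl_max A x}"
  proof
    fix x assume "x \<in> {x. ennreal (K * ?d powr \<theta> * ?M powr \<theta> * m powr -\<theta>) < ennreal (K * hl_max A x powr \<theta>)}"
    then have "K * l powr \<theta> < K * hl_max A x powr \<theta>" unfolding l using K by (simp add: ennreal_less_iff)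
    then have *: "l powr \<theta> < hl_max A x powr \<theta>" using K by simp
    have "\<not> hl_max A x \<le> l" using powr_mono2[of \<theta> "hl_max A x" l] \<theta> hl_max_nonneg[OF A(1), of x] * by auto
    then show "x \<in> {x. l < hl_max A x}" by simp
  qed
  have o: "{x. l < hl_max A x} \<in> sets lborel" using open_less_hl_max[OF A(1)] by simp
  have "emeasure lborel {x. ennreal (K * ?d powr \<theta> * ?M powr \<theta> * m powr -\<theta>) < ennreal (K * hl_max A x powr \<theta>)} \<le>
      emeasure lborel {x. l < hl_max A x}"
    by (rule emeasure_mono[OF sub o])
  also have "\<dots> \<le> ennreal m"
  proof (cases "?M = 0")
    case False
    then have M: "?M > 0" using measure_nonneg[of lborel A] by linarith
    then have "l > 0" using m by (simp add: l_def)
    from hl_max_weak_type[OF A this] have "emeasure lborel {x. l < hl_max A x} \<le> ennreal (?d * ?M / l)" .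
    also have "?d * ?M / l = m" using M m by (simp add: l_def)
    finally show ?thesis .
  next
    case True
    have "hl_max A x \<le> 0" for x
      unfolding hl_max_def
    proof (rule cSUP_least)
      fix r :: real assume "r \<in> {0<..}"
      have "measure lborel (A \<inter> ball x r) \<le> measure lborel A"
        by (rule measure_mono_fmeasurable) (use A in \<open>auto simp: fmeasurable_def\<close>)
      then show "measure lborel (A \<inter> ball x r) / measure lborel (ball x r) \<le> 0" using True measure_nonneg[of lborel "A \<inter>
          ball x r"] by simp
    qed simp
    then have "{x. l < hl_max A x} = {}" using True by (auto simp: l_def not_less)
    then show ?thesis by simp
  qed
  finally show "emeasure lborel {x. ennreal (K * ?d powr \<theta> * ?M powr \<theta> * m powr -\<theta>) < ennreal (K * hl_max A x powr \<theta>)} \<le>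
      ennreal m" .
qed

section \<open>Slicing the three-sphere into pairs of circles\<close>

definition plane :: "real \<times> real \<Rightarrow> real ^ 2" where
  "plane z = fst z *\<^sub>R axis 1 1 + snd z *\<^sub>R axis 2 1"

lemma plane_nth [simp]: "plane z $ 1 = fst z" "plane z $ 2 = snd z"
  by (simp_all add: plane_def axis_def)

lemma borel_measurable_plane [measurable]: "plane \<in> borel_measurable borel"
  unfolding plane_def by (intro borel_measurable_continuous_onI continuous_intros)

lemma distr_plane: "lborel = distr lborel borel plane"
proof (rule lborel_eqI)
  fix l u :: "real ^ 2" assume "\<And>b. b \<in> Basis \<Longrightarrow> l \<bullet> b \<le> u \<bullet> b"
  from this[of "axis 1 1"] this[of "axis 2 1"] have lu: "l $ 1 \<le> u $ 1" "l $ 2 \<le> u $ 2"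
    by (simp_all add: axis_in_Basis_iff inner_axis)
  have "plane -` box l u = {l $ 1<..<u $ 1} \<times> {l $ 2<..<u $ 2}"
    by (auto simp: mem_box_cart forall_2)
  then have "emeasure (distr lborel borel plane) (box l u) = emeasure (lborel \<Otimes>\<^sub>M lborel) ({l $ 1<..<u $ 1} \<times> {l $ 2<..<u $ 2})"
    by (simp add: emeasure_distr lborel_prod)
  also have "\<dots> = ennreal ((u $ 1 - l $ 1) * (u $ 2 - l $ 2))"
    using lu by (simp add: lborel.emeasure_pair_measure_Times ennreal_mult)
  also have "(u $ 1 - l $ 1) * (u $ 2 - l $ 2) = (\<Prod>b\<in>Basis. (u - l) \<bullet> b)"
  proof -
    have B: "(Basis :: (real ^ 2) set) = (\<lambda>i. axis i 1) ` UNIV" by (auto simp: Basis_vec_def)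
    have "(\<Prod>b\<in>Basis. (u - l) \<bullet> b) = (\<Prod>i\<in>UNIV. (u - l) \<bullet> axis i 1)"
      unfolding B by (subst prod.reindex) (auto simp: inj_on_def axis_eq_axis)
    then show ?thesis by (simp add: inner_axis UNIV_2)
  qed
  finally show "emeasure (distr lborel borel plane) (box l u) = ennreal (\<Prod>b\<in>Basis. (u - l) \<bullet> b)" .
qed simp

definition cis2 :: "real \<Rightarrow> real ^ 2" where
  "cis2 \<theta> = plane (cos \<theta>, sin \<theta>)"

lemma borel_measurable_cis2 [measurable]: "cis2 \<in> borel_measurable borel"
  unfolding cis2_def by measurable

lemma norm_cis2 [simp]: "norm (cis2 \<theta>) = 1"
  by (simp add: norm_vec_def L2_set_def UNIV_2 cis2_def)

lemma scaleR_cis2: "r *\<^sub>R cis2 \<theta> = plane (r * cos \<theta>, r * sin \<theta>)"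
  by (simp add: cis2_def plane_def scaleR_add_right)

lemma cis2_periodic: "cis2 (\<theta> + 2 * pi) = cis2 \<theta>"
  by (simp add: cis2_def)

lemma nn_integral_polar2:
  assumes [measurable]: "h \<in> borel_measurable (borel :: (real ^ 2) measure)"
  shows "(\<integral>\<^sup>+z. h z \<partial>lborel) = ennreal pi * (\<integral>\<^sup>+u\<in>{0<..}. (\<integral>\<^sup>+\<theta>. h (sqrt u *\<^sub>R cis2 \<theta>) \<partial>circ) \<partial>lborel)"
  by (subst distr_plane, subst nn_integral_distr, simp, simp, subst nn_integral_polar) (simp_all add: scaleR_cis2)

text \<open>The argument u is the squared radius, with respect to which plane polar coordinates have
  constant density.\<close>

definition cavg :: "(real ^ 2 \<Rightarrow> ennreal) \<Rightarrow> real ^ 2 \<Rightarrow> real \<Rightarrow> ennreal" where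
  "cavg h x u = (\<integral>\<^sup>+\<theta>. h (x - sqrt u *\<^sub>R cis2 \<theta>) \<partial>circ)"

lemma borel_measurable_cavg [measurable (raw)]:
  assumes [measurable]: "h \<in> borel_measurable borel" "f \<in> M \<rightarrow>\<^sub>M borel" "g \<in> M \<rightarrow>\<^sub>M borel"
  shows "(\<lambda>y. cavg h (f y) (g y)) \<in> borel_measurable M"
  unfolding cavg_def by measurable

text \<open>Substitute w = u + v and then s = u/w: the Jacobian is w, the integrand depends on s
  alone, and the integral of w over [0, 1] is 1/2.\<close>

lemma nn_integral_triangle:
  fixes Q :: "real \<Rightarrow> ennreal"
  assumes [measurable]: "Q \<in> borel_measurable borel"
  shows "(\<integral>\<^sup>+u\<in>{0<..}. (\<integral>\<^sup>+v\<in>{0<..}. Q (u / (u + v)) * indicator {..1} (u + v) \<partial>lborel) \<partial>lborel)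
    = ennreal (1 / 2) * (\<integral>\<^sup>+s\<in>{0<..<1}. Q s \<partial>lborel)"
proof -
  have "(\<integral>\<^sup>+u\<in>{0<..}. (\<integral>\<^sup>+v\<in>{0<..}. Q (u / (u + v)) * indicator {..1} (u + v) \<partial>lborel) \<partial>lborel)
    = (\<integral>\<^sup>+u. (\<integral>\<^sup>+w. Q (u / w) * indicator {..1} w * (if 0 < u \<and> u < w then 1 else 0) \<partial>lborel) \<partial>lborel)"
  proof (rule nn_integral_cong)
    fix u :: real
    have "(\<integral>\<^sup>+w. Q (u / w) * indicator {..1} w * (if 0 < u \<and> u < w then 1 else 0) \<partial>lborel)
      = (\<integral>\<^sup>+v. Q (u / (u + 1 * v)) * indicator {..1} (u + 1 * v) * (if 0 < u \<and> u < u + 1 * v then 1 else 0) \<partial>lborel)"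
      by (subst nn_integral_real_affine[where c = 1 and t = u]) simp_all
    also have "\<dots> = (\<integral>\<^sup>+v\<in>{0<..}. Q (u / (u + v)) * indicator {..1} (u + v) \<partial>lborel) * indicator {0<..} u"
      by (subst nn_integral_multc[symmetric], measurable, intro nn_integral_cong) (auto split: split_indicator)
    finally show "(\<integral>\<^sup>+v\<in>{0<..}. Q (u / (u + v)) * indicator {..1} (u + v) \<partial>lborel) * indicator {0<..} u
      = (\<integral>\<^sup>+w. Q (u / w) * indicator {..1} w * (if 0 < u \<and> u < w then 1 else 0) \<partial>lborel)" by simp
  qed
  also have "\<dots> = (\<integral>\<^sup>+w. (\<integral>\<^sup>+u. Q (u / w) * indicator {..1} w * (if 0 < u \<and> u < w then 1 else 0) \<partial>lborel) \<partial>lborel)"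
    by (rule lborel_pair.Fubini') measurable
  also have "\<dots> = (\<integral>\<^sup>+w. ennreal w * indicator {0..1} w * (\<integral>\<^sup>+s\<in>{0<..<1}. Q s \<partial>lborel) \<partial>lborel)"
  proof (rule nn_integral_cong)
    fix w :: real
    show "(\<integral>\<^sup>+u. Q (u / w) * indicator {..1} w * (if 0 < u \<and> u < w then 1 else 0) \<partial>lborel) = ennreal w * indicator
        {0..1} w * (\<integral>\<^sup>+s\<in>{0<..<1}. Q s \<partial>lborel)"
    proof (cases "w > 0")
      case True
      have "(\<integral>\<^sup>+u. Q (u / w) * indicator {..1} w * (if 0 < u \<and> u < w then 1 else 0) \<partial>lborel)
        = ennreal \<bar>w\<bar> * (\<integral>\<^sup>+s. Q ((0 + w * s) / w) * indicator {..1} w * (if 0 < 0 + w * s \<and> 0 + w * s < w then 1 else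
            0) \<partial>lborel)"
        by (rule nn_integral_real_affine) (use True in auto)
      also have "(\<integral>\<^sup>+s. Q ((0 + w * s) / w) * indicator {..1} w * (if 0 < 0 + w * s \<and> 0 + w * s < w then 1 else 0) \<partial>lborel)
        = (\<integral>\<^sup>+s. indicator {0..1} w * (Q s * indicator {0<..<1} s) \<partial>lborel)"
        using True by (intro nn_integral_cong) (auto simp: zero_less_mult_iff split: split_indicator)
      also have "\<dots> = indicator {0..1} w * (\<integral>\<^sup>+s\<in>{0<..<1}. Q s \<partial>lborel)"
        by (rule nn_integral_cmult) measurable
      finally show ?thesis using True by (simp add: mult.assoc)
    next
      case False
      then have "(if 0 < u \<and> u < w then 1 else 0) = (0::ennreal)" for u by auto
      then show ?thesis using False by (simp add: ennreal_neg)
    qed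
  qed
  also have "\<dots> = (\<integral>\<^sup>+w. ennreal w * indicator {0..1} w \<partial>lborel) * (\<integral>\<^sup>+s\<in>{0<..<1}. Q s \<partial>lborel)"
    by (rule nn_integral_multc) measurable
  also have "(\<integral>\<^sup>+w. ennreal w * indicator {0..1} w \<partial>lborel) = ennreal (1\<^sup>2 / 2 - 0\<^sup>2 / 2)"
    by (rule nn_integral_FTC_Icc) (auto intro!: derivative_eq_intros)
  finally show ?thesis by simp
qed

text \<open>Polar coordinates are used in both planes of the unit ball of dimension four. After
  radial projection, the two circles depend on the squared radii u, v only through s = u/(u + v),
  and \<open>nn_integral_triangle\<close> shows that s is uniform. The constant is 4 pi pi/2:
  dimension, two polar factors, area of the triangle.\<close>

lemma sph_form_plane:
  assumes [measurable]: "h \<in> borel_measurable borel" "k \<in> borel_measurable borel" and t: "t > 0"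
  shows "sph_form h k t x = ennreal (2 * pi\<^sup>2) * (\<integral>\<^sup>+s\<in>{0<..<1}. cavg h x (t\<^sup>2 * s) * cavg k x (t\<^sup>2 * (1 - s)) \<partial>lborel)"
proof -
  define D :: "((real ^ 2) \<times> (real ^ 2)) set" where "D = cball 0 1 - {0}"
  have D[measurable]: "D \<in> sets borel" by (simp add: D_def)
  define G where "G z1 z2 = h (x - (t / norm (z1, z2)) *\<^sub>R z1) * k (x - (t / norm (z1, z2)) *\<^sub>R z2) * indicator D (z1,
      z2)" for z1 z2
  have "sph_form h k t x = of_nat 4 * (\<integral>\<^sup>+z\<in>D. h (x - t *\<^sub>R fst (sgn z)) * k (x - t *\<^sub>R snd (sgn z)) \<partial>lborel)"
    unfolding sph_form_def D_def by (subst nn_integral_sph) simp_all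
  also have "(\<integral>\<^sup>+z\<in>D. h (x - t *\<^sub>R fst (sgn z)) * k (x - t *\<^sub>R snd (sgn z)) \<partial>lborel) = (\<integral>\<^sup>+z. G (fst z) (snd z) \<partial>(lborel
      \<Otimes>\<^sub>M lborel))"
    unfolding lborel_prod
    by (intro nn_integral_cong) (simp add: G_def sgn_div_norm divide_inverse)
  also have "\<dots> = (\<integral>\<^sup>+z1. (\<integral>\<^sup>+z2. G z1 z2 \<partial>lborel) \<partial>lborel)"
  proof (subst lborel.nn_integral_fst[symmetric])
    show "(\<lambda>z. G (fst z) (snd z)) \<in> borel_measurable (lborel \<Otimes>\<^sub>M lborel)"
      unfolding G_def lborel_prod by measurable
  qed simp
  also have "\<dots> = (\<integral>\<^sup>+z1. ennreal pi * (\<integral>\<^sup>+v\<in>{0<..}. h (x - (t / sqrt ((norm z1)\<^sup>2 + v)) *\<^sub>R z1) * indicator {..1} ((norm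
      z1)\<^sup>2 + v)
      * cavg k x (t\<^sup>2 * (v / ((norm z1)\<^sup>2 + v))) \<partial>lborel) \<partial>lborel)"
  proof (rule nn_integral_cong)
    fix z1 :: "real ^ 2"
    have [measurable]: "G z1 \<in> borel_measurable borel" unfolding G_def by measurable
    have "(\<integral>\<^sup>+z2. G z1 z2 \<partial>lborel) = ennreal pi * (\<integral>\<^sup>+v\<in>{0<..}. (\<integral>\<^sup>+\<theta>. G z1 (sqrt v *\<^sub>R cis2 \<theta>) \<partial>circ) \<partial>lborel)"
      by (rule nn_integral_polar2) measurable
    also have "(\<integral>\<^sup>+v\<in>{0<..}. (\<integral>\<^sup>+\<theta>. G z1 (sqrt v *\<^sub>R cis2 \<theta>) \<partial>circ) \<partial>lborel) = (\<integral>\<^sup>+v\<in>{0<..}. h (x - (t / sqrt ((norm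
        z1)\<^sup>2 + v)) *\<^sub>R z1) * indicator {..1} ((norm z1)\<^sup>2 + v)
      * cavg k x (t\<^sup>2 * (v / ((norm z1)\<^sup>2 + v))) \<partial>lborel)"
    proof (rule nn_integral_cong)
      fix v :: real
      show "(\<integral>\<^sup>+\<theta>. G z1 (sqrt v *\<^sub>R cis2 \<theta>) \<partial>circ) * indicator {0<..} v = h (x - (t / sqrt ((norm z1)\<^sup>2 + v)) *\<^sub>R z1) *
          indicator {..1} ((norm z1)\<^sup>2 + v)
        * cavg k x (t\<^sup>2 * (v / ((norm z1)\<^sup>2 + v))) * indicator {0<..} v"
      proof (cases "v > 0")
        case True
        let ?w = "(norm z1)\<^sup>2 + v"
        have w: "?w > 0" using True by (simp add: add_nonneg_pos)
        have n: "norm (z1, sqrt v *\<^sub>R cis2 \<theta>) = sqrt ?w" for \<theta>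
          using True by (simp add: norm_Pair)
        have sq: "sqrt (t\<^sup>2 * (v / ?w)) = t / sqrt ?w * sqrt v"
          using t True w by (simp add: real_sqrt_mult real_sqrt_divide)
        have i: "indicator D (z1, sqrt v *\<^sub>R cis2 \<theta>) = (indicator {..1} ?w :: ennreal)" for \<theta>
        proof -
          have "(z1, sqrt v *\<^sub>R cis2 \<theta>) \<noteq> 0" using n[of \<theta>] w by (metis norm_zero real_sqrt_gt_zero less_irrefl)
          then show ?thesis using n[of \<theta>] by (simp add: indicator_def D_def)
        qed
        have "(\<integral>\<^sup>+\<theta>. G z1 (sqrt v *\<^sub>R cis2 \<theta>) \<partial>circ) = (\<integral>\<^sup>+\<theta>. (h (x - (t / sqrt ?w) *\<^sub>R z1) * indicator {..1} ?w) * k (x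
            - sqrt (t\<^sup>2 * (v / ?w)) *\<^sub>R cis2 \<theta>) \<partial>circ)"
          unfolding G_def n i sq by (simp add: mult_ac)
        also have "\<dots> = (h (x - (t / sqrt ?w) *\<^sub>R z1) * indicator {..1} ?w) * cavg k x (t\<^sup>2 * (v / ?w))"
          unfolding cavg_def by (rule nn_integral_cmult) measurable
        finally show ?thesis by simp
      qed simp
    qed
    finally show "(\<integral>\<^sup>+z2. G z1 z2 \<partial>lborel) = ennreal pi * (\<integral>\<^sup>+v\<in>{0<..}. h (x - (t / sqrt ((norm z1)\<^sup>2 + v)) *\<^sub>R z1) *
        indicator {..1} ((norm z1)\<^sup>2 + v)
      * cavg k x (t\<^sup>2 * (v / ((norm z1)\<^sup>2 + v))) \<partial>lborel)" .
  qed
  also have "\<dots> = ennreal pi * (\<integral>\<^sup>+z1. (\<integral>\<^sup>+v\<in>{0<..}. h (x - (t / sqrt ((norm z1)\<^sup>2 + v)) *\<^sub>R z1) * indicator {..1} ((norm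
      z1)\<^sup>2 + v)
      * cavg k x (t\<^sup>2 * (v / ((norm z1)\<^sup>2 + v))) \<partial>lborel) \<partial>lborel)"
    by (rule nn_integral_cmult) measurable
  also have "(\<integral>\<^sup>+z1. (\<integral>\<^sup>+v\<in>{0<..}. h (x - (t / sqrt ((norm z1)\<^sup>2 + v)) *\<^sub>R z1) * indicator {..1} ((norm z1)\<^sup>2 + v)
      * cavg k x (t\<^sup>2 * (v / ((norm z1)\<^sup>2 + v))) \<partial>lborel) \<partial>lborel) = ennreal pi * (\<integral>\<^sup>+u\<in>{0<..}. (\<integral>\<^sup>+\<theta>. (\<integral>\<^sup>+v\<in>{0<..}. h
          (x - (t / sqrt ((norm (sqrt u *\<^sub>R cis2 \<theta>))\<^sup>2 + v)) *\<^sub>R (sqrt u *\<^sub>R cis2 \<theta>)) * indicator {..1} ((norm (sqrt u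
          *\<^sub>R cis2 \<theta>))\<^sup>2 + v)
      * cavg k x (t\<^sup>2 * (v / ((norm (sqrt u *\<^sub>R cis2 \<theta>))\<^sup>2 + v))) \<partial>lborel) \<partial>circ) \<partial>lborel)"
    by (rule nn_integral_polar2) measurable
  also have "(\<integral>\<^sup>+u\<in>{0<..}. (\<integral>\<^sup>+\<theta>. (\<integral>\<^sup>+v\<in>{0<..}. h (x - (t / sqrt ((norm (sqrt u *\<^sub>R cis2 \<theta>))\<^sup>2 + v)) *\<^sub>R (sqrt u *\<^sub>R
      cis2 \<theta>)) * indicator {..1} ((norm (sqrt u *\<^sub>R cis2 \<theta>))\<^sup>2 + v)
      * cavg k x (t\<^sup>2 * (v / ((norm (sqrt u *\<^sub>R cis2 \<theta>))\<^sup>2 + v))) \<partial>lborel) \<partial>circ) \<partial>lborel)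
    = (\<integral>\<^sup>+u\<in>{0<..}. (\<integral>\<^sup>+v\<in>{0<..}. (\<lambda>s. cavg h x (t\<^sup>2 * s) * cavg k x (t\<^sup>2 * (1 - s))) (u / (u + v)) * indicator {..1} (u
        + v) \<partial>lborel) \<partial>lborel)"
  proof (rule nn_integral_cong)
    interpret cl: pair_sigma_finite circ "lborel :: real measure" ..
    fix u :: real
    show "(\<integral>\<^sup>+\<theta>. (\<integral>\<^sup>+v\<in>{0<..}. h (x - (t / sqrt ((norm (sqrt u *\<^sub>R cis2 \<theta>))\<^sup>2 + v)) *\<^sub>R (sqrt u *\<^sub>R cis2 \<theta>)) * indicator
        {..1} ((norm (sqrt u *\<^sub>R cis2 \<theta>))\<^sup>2 + v)
      * cavg k x (t\<^sup>2 * (v / ((norm (sqrt u *\<^sub>R cis2 \<theta>))\<^sup>2 + v))) \<partial>lborel) \<partial>circ) * indicator {0<..} u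
      = (\<integral>\<^sup>+v\<in>{0<..}. (\<lambda>s. cavg h x (t\<^sup>2 * s) * cavg k x (t\<^sup>2 * (1 - s))) (u / (u + v)) * indicator {..1} (u + v)
          \<partial>lborel) * indicator {0<..} u"
    proof (cases "u > 0")
      case True
      have n: "(norm (sqrt u *\<^sub>R cis2 \<theta>))\<^sup>2 = u" for \<theta> using True by simp
      have "(\<integral>\<^sup>+\<theta>. (\<integral>\<^sup>+v\<in>{0<..}. h (x - (t / sqrt (u + v)) *\<^sub>R (sqrt u *\<^sub>R cis2 \<theta>)) * indicator {..1} (u + v) * cavg k x
          (t\<^sup>2 * (v / (u + v))) \<partial>lborel) \<partial>circ)
        = (\<integral>\<^sup>+v. (\<integral>\<^sup>+\<theta>. h (x - (t / sqrt (u + v)) *\<^sub>R (sqrt u *\<^sub>R cis2 \<theta>)) * indicator {..1} (u + v) * cavg k x (t\<^sup>2 *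
            (v / (u + v))) * indicator {0<..} v \<partial>circ) \<partial>lborel)"
        by (rule cl.Fubini'[symmetric]) measurable
      also have "\<dots> = (\<integral>\<^sup>+v\<in>{0<..}. (\<lambda>s. cavg h x (t\<^sup>2 * s) * cavg k x (t\<^sup>2 * (1 - s))) (u / (u + v)) * indicator {..1}
          (u + v) \<partial>lborel)"
      proof (rule nn_integral_cong)
        fix v :: real
        show "(\<integral>\<^sup>+\<theta>. h (x - (t / sqrt (u + v)) *\<^sub>R (sqrt u *\<^sub>R cis2 \<theta>)) * indicator {..1} (u + v) * cavg k x (t\<^sup>2 * (v /
            (u + v))) * indicator {0<..} v \<partial>circ)
          = (\<lambda>s. cavg h x (t\<^sup>2 * s) * cavg k x (t\<^sup>2 * (1 - s))) (u / (u + v)) * indicator {..1} (u + v) * indicator {0<..} v"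
        proof (cases "v > 0")
          case v: True
          have sq: "sqrt (t\<^sup>2 * (u / (u + v))) = t / sqrt (u + v) * sqrt u"
            using t True v by (simp add: real_sqrt_mult real_sqrt_divide)
          have sv: "1 - u / (u + v) = v / (u + v)" using True v by (simp add: field_simps)
          have "(\<integral>\<^sup>+\<theta>. h (x - (t / sqrt (u + v)) *\<^sub>R (sqrt u *\<^sub>R cis2 \<theta>)) * indicator {..1} (u + v) * cavg k x (t\<^sup>2 * (v
              / (u + v))) * indicator {0<..} v \<partial>circ)
            = (\<integral>\<^sup>+\<theta>. h (x - sqrt (t\<^sup>2 * (u / (u + v))) *\<^sub>R cis2 \<theta>) * (indicator {..1} (u + v) * cavg k x (t\<^sup>2 * (v / (u
                + v)))) \<partial>circ)"
            unfolding sq using v by (simp add: mult.assoc)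
          also have "\<dots> = cavg h x (t\<^sup>2 * (u / (u + v))) * (indicator {..1} (u + v) * cavg k x (t\<^sup>2 * (v / (u + v))))"
            unfolding cavg_def[of h] by (rule nn_integral_multc) measurable
          finally show ?thesis using v by (simp add: sv mult_ac)
        qed simp
      qed
      finally show ?thesis unfolding n by simp
    qed simp
  qed
  also have "\<dots> = ennreal (1 / 2) * (\<integral>\<^sup>+s\<in>{0<..<1}. cavg h x (t\<^sup>2 * s) * cavg k x (t\<^sup>2 * (1 - s)) \<partial>lborel)"
    by (rule nn_integral_triangle) measurable
  finally have "sph_form h k t x = (ennreal 4 * ennreal pi * ennreal pi * ennreal (1 / 2)) * (\<integral>\<^sup>+s\<in>{0<..<1}. cavg h x
      (t\<^sup>2 * s) * cavg k x (t\<^sup>2 * (1 - s)) \<partial>lborel)"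
    by (simp add: mult.assoc)
  also have "ennreal 4 * ennreal pi * ennreal pi * ennreal (1 / 2) = ennreal (4 * pi * pi * (1 / 2))"
    by (simp only: ennreal_mult pi_ge_zero mult_nonneg_nonneg zero_le_numeral zero_le_divide_1_iff)
  also have "4 * pi * pi * (1 / 2) = 2 * pi\<^sup>2" by (simp add: power2_eq_square)
  finally show ?thesis .
qed

section \<open>Exact correlation formula and the modulus of the logarithmic chord\<close>

section \<open>Circular averages and their correlations\<close>

text \<open>The logarithm of the squared radius is the variable in which dilations become translations.\<close>

definition ring_avg :: "(real ^ 2) set \<Rightarrow> real ^ 2 \<Rightarrow> real \<Rightarrow> real" where
  "ring_avg A x \<tau> = enn2real (cavg (indicator A) x (exp \<tau>))"

lemma cavg_indicator_le_1: "cavg (indicator A) x u \<le> 1"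
proof -
  have "cavg (indicator A) x u \<le> (\<integral>\<^sup>+\<theta>. 1 \<partial>circ)"
    unfolding cavg_def by (rule nn_integral_mono) (simp add: indicator_def)
  also have "\<dots> = 1" using circ.emeasure_space_1 by simp
  finally show ?thesis .
qed

lemma ennreal_ring_avg: "ennreal (ring_avg A x \<tau>) = cavg (indicator A) x (exp \<tau>)"
  unfolding ring_avg_def using cavg_indicator_le_1[of A x "exp \<tau>"] by (intro ennreal_enn2real) (auto intro: le_less_trans)

lemma ring_avg_nonneg [simp]: "0 \<le> ring_avg A x \<tau>"
  by (simp add: ring_avg_def)

lemma ring_avg_le_1: "ring_avg A x \<tau> \<le> 1"
  using cavg_indicator_le_1[of A x "exp \<tau>"] by (simp flip: ennreal_ring_avg)

lemma borel_measurable_ring_avg [measurable (raw)]: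
  assumes [measurable]: "A \<in> sets borel" "f \<in> M \<rightarrow>\<^sub>M borel" "g \<in> M \<rightarrow>\<^sub>M borel"
  shows "(\<lambda>y. ring_avg A (f y) (g y)) \<in> borel_measurable M"
  unfolding ring_avg_def by measurable

definition autocorr :: "(real ^ 2) set \<Rightarrow> real ^ 2 \<Rightarrow> ennreal" where
  "autocorr A z = (\<integral>\<^sup>+y. indicator A y * indicator A (y + z) \<partial>lborel)"

lemma borel_measurable_autocorr [measurable (raw)]:
  assumes [measurable]: "A \<in> sets borel" "f \<in> M \<rightarrow>\<^sub>M borel"
  shows "(\<lambda>y. autocorr A (f y)) \<in> borel_measurable M"
  unfolding autocorr_def by measurable

lemma autocorr_le: "A \<in> sets borel \<Longrightarrow> autocorr A z \<le> emeasure lborel A"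
proof -
  assume A: "A \<in> sets borel"
  have "autocorr A z \<le> (\<integral>\<^sup>+y. indicator A y \<partial>lborel)"
    unfolding autocorr_def by (rule nn_integral_mono) (simp add: indicator_def)
  then show ?thesis using A by simp
qed

text \<open>The difference of two points on concentric circles at fixed angle \<psi> turns rigidly
  with \<theta>. Its length is given by the law of cosines, and its phase \<omega> relative to
  \<theta> does not depend on \<theta>.\<close>

lemma cis2_polar: "\<exists>\<omega>. 0 \<le> \<omega> \<and> \<omega> \<le> 2 * pi \<and> (\<forall>\<theta>. cis2 \<theta> - \<rho> *\<^sub>R cis2 (\<theta> + \<psi>) = sqrt ((\<rho> - 1)\<^sup>2 + \<rho> * (2 * (1 - cos \<psi>)))
    *\<^sub>R cis2 (\<theta> + \<omega>))"
proof -
  define d where "d = sqrt ((\<rho> - 1)\<^sup>2 + \<rho> * (2 * (1 - cos \<psi>)))"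
  have sq: "(1 - \<rho> * cos \<psi>)\<^sup>2 + (- \<rho> * sin \<psi>)\<^sup>2 = (\<rho> - 1)\<^sup>2 + \<rho> * (2 * (1 - cos \<psi>))"
  proof -
    have e1: "(1 - \<rho> * cos \<psi>)\<^sup>2 + (- \<rho> * sin \<psi>)\<^sup>2 = 1 - 2 * \<rho> * cos \<psi> + (\<rho>\<^sup>2 * (sin \<psi>)\<^sup>2 + \<rho>\<^sup>2 * (cos \<psi>)\<^sup>2)"
      by (simp add: power2_eq_square algebra_simps)
    have e3: "\<rho>\<^sup>2 * (sin \<psi>)\<^sup>2 + \<rho>\<^sup>2 * (cos \<psi>)\<^sup>2 = \<rho>\<^sup>2"
      by (simp only: distrib_left[symmetric] sin_cos_squared_add mult_1_right)
    have e2: "(\<rho> - 1)\<^sup>2 + \<rho> * (2 * (1 - cos \<psi>)) = 1 - 2 * \<rho> * cos \<psi> + \<rho>\<^sup>2"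
      by (simp add: power2_eq_square algebra_simps)
    show ?thesis unfolding e1 e2 e3 ..
  qed
  then have d2: "d\<^sup>2 = (1 - \<rho> * cos \<psi>)\<^sup>2 + (- \<rho> * sin \<psi>)\<^sup>2"
    unfolding d_def sq[symmetric] by (intro real_sqrt_pow2) simp
  obtain \<omega> where \<omega>: "0 \<le> \<omega>" "\<omega> \<le> 2 * pi" "1 - \<rho> * cos \<psi> = d * cos \<omega>" "- \<rho> * sin \<psi> = d * sin \<omega>"
  proof (cases "d = 0")
    case True
    then have "(1 - \<rho> * cos \<psi>)\<^sup>2 + (- \<rho> * sin \<psi>)\<^sup>2 = 0" using d2 by simp
    then have "1 - \<rho> * cos \<psi> = 0" "- \<rho> * sin \<psi> = 0" by (simp_all only: sum_power2_eq_zero_iff)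
    then show ?thesis using that[of 0] True by simp
  next
    case False
    have "((1 - \<rho> * cos \<psi>) / d)\<^sup>2 + ((- \<rho> * sin \<psi>) / d)\<^sup>2 = 1"
      unfolding power_divide add_divide_distrib[symmetric] d2[symmetric] using False by simp
    then obtain t where t: "0 \<le> t" "t < 2 * pi" "(1 - \<rho> * cos \<psi>) / d = cos t" "(- \<rho> * sin \<psi>) / d = sin t"
      by (rule sincos_total_2pi)
    then show ?thesis using that[of t] False by (simp add: field_simps)
  qed
  have "cis2 \<theta> - \<rho> *\<^sub>R cis2 (\<theta> + \<psi>) = d *\<^sub>R cis2 (\<theta> + \<omega>)" for \<theta>
  proof -
    have "cos \<theta> - \<rho> * cos (\<theta> + \<psi>) = cos \<theta> * (1 - \<rho> * cos \<psi>) - sin \<theta> * (- \<rho> * sin \<psi>)"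
      by (simp add: cos_add algebra_simps)
    also have "\<dots> = d * cos (\<theta> + \<omega>)" unfolding \<omega> by (simp add: cos_add algebra_simps)
    finally have c: "cos \<theta> - \<rho> * cos (\<theta> + \<psi>) = d * cos (\<theta> + \<omega>)" .
    have "sin \<theta> - \<rho> * sin (\<theta> + \<psi>) = sin \<theta> * (1 - \<rho> * cos \<psi>) + cos \<theta> * (- \<rho> * sin \<psi>)"
      by (simp add: sin_add algebra_simps)
    also have "\<dots> = d * sin (\<theta> + \<omega>)" unfolding \<omega> by (simp add: sin_add algebra_simps)
    finally have s: "sin \<theta> - \<rho> * sin (\<theta> + \<psi>) = d * sin (\<theta> + \<omega>)" .
    show ?thesis by (simp add: vec_eq_iff forall_2 cis2_def c s)
  qed
  then show ?thesis using \<omega> unfolding d_def by blast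
qed

lemma AE_circ_range: "AE \<theta> in circ. 0 \<le> \<theta> \<and> \<theta> \<le> 2 * pi"
  unfolding circ_def by (rule AE_uniform_measureI) auto

lemma sqrt_exp: "sqrt (exp x) = exp (x / 2)"
  by (rule real_sqrt_unique) (simp_all add: power2_eq_square exp_add[symmetric])

text \<open>Logarithm of the squared distance between points at angle \<psi> on concentric circles
  of squared radii 1 and e^\<eta>. For \<eta> = 0 and cos \<psi> = 1 it is ln 0 = 0, a meaningless
  value avoided by \<open>AE_circ_cos\<close>.\<close>

definition chord_log :: "real \<Rightarrow> real \<Rightarrow> real" where
  "chord_log \<eta> \<psi> = ln ((exp (\<eta> / 2) - 1)\<^sup>2 + exp (\<eta> / 2) * (2 * (1 - cos \<psi>)))"

lemma borel_measurable_chord_log [measurable]: "chord_log \<eta> \<in> borel_measurable borel"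
  unfolding chord_log_def by measurable

definition circ_autocorr :: "(real ^ 2) set \<Rightarrow> real \<Rightarrow> ennreal" where
  "circ_autocorr A s = (\<integral>\<^sup>+\<theta>. autocorr A (exp (s / 2) *\<^sub>R cis2 \<theta>) \<partial>circ)"

lemma borel_measurable_circ_autocorr [measurable (raw)]:
  assumes [measurable]: "A \<in> sets borel" "f \<in> M \<rightarrow>\<^sub>M borel"
  shows "(\<lambda>y. circ_autocorr A (f y)) \<in> borel_measurable M"
  unfolding circ_autocorr_def by measurable

lemma circ_autocorr_le: "A \<in> sets borel \<Longrightarrow> circ_autocorr A s \<le> emeasure lborel A"
proof -
  assume A: "A \<in> sets borel"
  have "circ_autocorr A s \<le> (\<integral>\<^sup>+\<theta>. emeasure lborel A \<partial>circ)"
    unfolding circ_autocorr_def by (rule nn_integral_mono) (rule autocorr_le[OF A])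
  then show ?thesis using circ.emeasure_space_1 by simp
qed

lemma AE_circ_cos: "AE \<psi> in circ. cos \<psi> \<noteq> 1"
proof -
  have "AE \<psi> in lborel. \<psi> \<in> {0..2 * pi} \<longrightarrow> cos \<psi> \<noteq> 1"
    using AE_lborel_singleton[of 0] AE_lborel_singleton[of "2 * pi"]
  proof eventually_elim
    case (elim \<psi>)
    show ?case
    proof (intro impI notI)
      assume \<psi>: "\<psi> \<in> {0..2 * pi}" "cos \<psi> = 1"
      then obtain n :: int where n: "\<psi> = of_int n * 2 * pi" by (auto simp: cos_one_2pi_int)
      have p: "2 * pi > 0" using pi_gt_zero by simp
      have "0 < \<psi>" "\<psi> < 2 * pi" using \<psi>(1) elim by auto
      then have "0 < of_int n * (2 * pi)" "of_int n * (2 * pi) < 1 * (2 * pi)" unfolding n by (simp_all add: mult.assoc)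
      then have "0 < real_of_int n" "real_of_int n < 1" using p by (simp_all only: zero_less_mult_pos2 mult_less_cancel_right_pos)
      then show False by simp
    qed
  qed
  then show ?thesis unfolding circ_def by (intro AE_uniform_measureI) auto
qed

lemma sqrt_chord:
  assumes "cos \<psi> \<noteq> 1"
  shows "sqrt ((exp (\<eta> / 2) - 1)\<^sup>2 + exp (\<eta> / 2) * (2 * (1 - cos \<psi>))) = exp (chord_log \<eta> \<psi> / 2)"
proof -
  let ?c = "(exp (\<eta> / 2) - 1)\<^sup>2 + exp (\<eta> / 2) * (2 * (1 - cos \<psi>))"
  have "cos \<psi> < 1" using assms cos_le_one[of \<psi>] by linarith
  then have c: "?c > 0" by (intro add_nonneg_pos) auto
  have "exp (chord_log \<eta> \<psi> / 2) ^ 2 = exp (chord_log \<eta> \<psi>)" by (simp flip: exp_of_nat_mult)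
  also have "\<dots> = ?c" unfolding chord_log_def using c by simp
  finally show ?thesis by (intro real_sqrt_unique) auto
qed

text \<open>Integration in x comes first and gives the autocorrelation of A at the chord between the
  two points on the circles. Write the second angle as \<theta> + \<psi>: for fixed \<psi> the chord
  runs uniformly over a circle as \<theta> varies, by \<open>cis2_polar\<close>. So \<tau> enters
  only as a translation by \<open>chord_log\<close>.\<close>

lemma correlation_ring_avg:
  assumes A[measurable]: "A \<in> sets borel"
  shows "(\<integral>\<^sup>+x. (\<integral>\<^sup>+\<tau>\<in>{c..d}. ennreal (ring_avg A x \<tau> * ring_avg A x (\<tau> + \<eta>)) \<partial>lborel) \<partial>lborel)
    = (\<integral>\<^sup>+\<psi>. (\<integral>\<^sup>+\<tau>\<in>{c..d}. circ_autocorr A (\<tau> + chord_log \<eta> \<psi>) \<partial>lborel) \<partial>circ)"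
proof -
  interpret cc: pair_sigma_finite circ circ ..
  interpret cl: pair_sigma_finite circ "lborel :: real measure" ..
  interpret lc2: pair_sigma_finite "lborel :: (real ^ 2) measure" circ ..
  define \<rho> where "\<rho> = exp (\<eta> / 2)"
  have inner: "(\<integral>\<^sup>+x. ennreal (ring_avg A x \<tau> * ring_avg A x (\<tau> + \<eta>)) \<partial>lborel) = (\<integral>\<^sup>+\<psi>. circ_autocorr A (\<tau> + chord_log \<eta>
      \<psi>) \<partial>circ)" for \<tau>
  proof -
    define r where "r = exp (\<tau> / 2)"
    have r: "sqrt (exp \<tau>) = r" "sqrt (exp (\<tau> + \<eta>)) = r * \<rho>"
      by (simp_all add: r_def \<rho>_def exp_add real_sqrt_mult sqrt_exp)
    have "(\<integral>\<^sup>+x. ennreal (ring_avg A x \<tau> * ring_avg A x (\<tau> + \<eta>)) \<partial>lborel)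
      = (\<integral>\<^sup>+x. (\<integral>\<^sup>+\<theta>. (\<integral>\<^sup>+\<phi>. indicator A (x - r *\<^sub>R cis2 \<theta>) * indicator A (x - (r * \<rho>) *\<^sub>R cis2 \<phi>) \<partial>circ) \<partial>circ) \<partial>lborel)"
    proof (rule nn_integral_cong)
      fix x
      have "ennreal (ring_avg A x \<tau> * ring_avg A x (\<tau> + \<eta>)) = cavg (indicator A) x (exp \<tau>) * cavg (indicator A) x (exp (\<tau> + \<eta>))"
        by (simp add: ennreal_mult ennreal_ring_avg)
      also have "\<dots> = (\<integral>\<^sup>+\<theta>. indicator A (x - r *\<^sub>R cis2 \<theta>) * cavg (indicator A) x (exp (\<tau> + \<eta>)) \<partial>circ)"
        unfolding cavg_def[of _ _ "exp \<tau>"] r by (rule nn_integral_multc[symmetric]) measurable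
      also have "\<dots> = (\<integral>\<^sup>+\<theta>. (\<integral>\<^sup>+\<phi>. indicator A (x - r *\<^sub>R cis2 \<theta>) * indicator A (x - (r * \<rho>) *\<^sub>R cis2 \<phi>) \<partial>circ) \<partial>circ)"
        unfolding cavg_def r by (intro nn_integral_cong nn_integral_cmult[symmetric]) measurable
      finally show "ennreal (ring_avg A x \<tau> * ring_avg A x (\<tau> + \<eta>)) = (\<integral>\<^sup>+\<theta>. (\<integral>\<^sup>+\<phi>. indicator A (x - r *\<^sub>R cis2 \<theta>) *
          indicator A (x - (r * \<rho>) *\<^sub>R cis2 \<phi>) \<partial>circ) \<partial>circ)" .
    qed
    also have "\<dots> = (\<integral>\<^sup>+\<theta>. (\<integral>\<^sup>+x. (\<integral>\<^sup>+\<phi>. indicator A (x - r *\<^sub>R cis2 \<theta>) * indicator A (x - (r * \<rho>) *\<^sub>R cis2 \<phi>) \<partial>circ)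
        \<partial>lborel) \<partial>circ)"
      by (rule lc2.Fubini'[symmetric]) measurable
    also have "\<dots> = (\<integral>\<^sup>+\<theta>. (\<integral>\<^sup>+\<phi>. (\<integral>\<^sup>+x. indicator A (x - r *\<^sub>R cis2 \<theta>) * indicator A (x - (r * \<rho>) *\<^sub>R cis2 \<phi>) \<partial>lborel)
        \<partial>circ) \<partial>circ)"
      by (intro nn_integral_cong lc2.Fubini'[symmetric]) measurable
    also have "\<dots> = (\<integral>\<^sup>+\<theta>. (\<integral>\<^sup>+\<phi>. autocorr A (r *\<^sub>R (cis2 \<theta> - \<rho> *\<^sub>R cis2 \<phi>)) \<partial>circ) \<partial>circ)"
    proof (intro nn_integral_cong)
      fix \<theta> \<phi>
      have "(\<integral>\<^sup>+x. indicator A (x - r *\<^sub>R cis2 \<theta>) * indicator A (x - (r * \<rho>) *\<^sub>R cis2 \<phi>) \<partial>lborel :: ennreal)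
        = ennreal (\<bar>1\<bar> ^ DIM(real ^ 2)) * (\<integral>\<^sup>+y. indicator A ((r *\<^sub>R cis2 \<theta> + 1 *\<^sub>R y) - r *\<^sub>R cis2 \<theta>) * indicator A ((r
            *\<^sub>R cis2 \<theta> + 1 *\<^sub>R y) - (r * \<rho>) *\<^sub>R cis2 \<phi>) \<partial>lborel)"
      proof (rule nn_integral_affine)
        show "(\<lambda>x. indicator A (x - r *\<^sub>R cis2 \<theta>) * indicator A (x - (r * \<rho>) *\<^sub>R cis2 \<phi>) :: ennreal) \<in> borel_measurable borel"
          by measurable
      qed simp
      then show "(\<integral>\<^sup>+x. indicator A (x - r *\<^sub>R cis2 \<theta>) * indicator A (x - (r * \<rho>) *\<^sub>R cis2 \<phi>) \<partial>lborel) = autocorr A (r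
          *\<^sub>R (cis2 \<theta> - \<rho> *\<^sub>R cis2 \<phi>))"
        by (simp add: autocorr_def algebra_simps)
    qed
    also have "\<dots> = (\<integral>\<^sup>+\<theta>. (\<integral>\<^sup>+\<psi>. autocorr A (r *\<^sub>R (cis2 \<theta> - \<rho> *\<^sub>R cis2 (\<theta> + \<psi>))) \<partial>circ) \<partial>circ)"
    proof (rule nn_integral_cong_AE)
      show "AE \<theta> in circ. (\<integral>\<^sup>+\<phi>. autocorr A (r *\<^sub>R (cis2 \<theta> - \<rho> *\<^sub>R cis2 \<phi>)) \<partial>circ) = (\<integral>\<^sup>+\<psi>. autocorr A (r *\<^sub>R (cis2 \<theta> -
          \<rho> *\<^sub>R cis2 (\<theta> + \<psi>))) \<partial>circ)"
        using AE_circ_range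
      proof eventually_elim
        case (elim \<theta>)
        have "(\<integral>\<^sup>+\<psi>. (\<lambda>\<phi>. autocorr A (r *\<^sub>R (cis2 \<theta> - \<rho> *\<^sub>R cis2 \<phi>))) (\<psi> + \<theta>) \<partial>circ) = (\<integral>\<^sup>+\<phi>. autocorr A (r *\<^sub>R (cis2 \<theta>
            - \<rho> *\<^sub>R cis2 \<phi>)) \<partial>circ)"
          by (rule nn_integral_circ_shift) (use elim in \<open>auto simp: cis2_periodic\<close>)
        then show ?case by (simp add: add.commute)
      qed
    qed
    also have "\<dots> = (\<integral>\<^sup>+\<psi>. (\<integral>\<^sup>+\<theta>. autocorr A (r *\<^sub>R (cis2 \<theta> - \<rho> *\<^sub>R cis2 (\<theta> + \<psi>))) \<partial>circ) \<partial>circ)"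
      by (rule cc.Fubini') measurable
    also have "\<dots> = (\<integral>\<^sup>+\<psi>. circ_autocorr A (\<tau> + chord_log \<eta> \<psi>) \<partial>circ)"
    proof (rule nn_integral_cong_AE)
      show "AE \<psi> in circ. (\<integral>\<^sup>+\<theta>. autocorr A (r *\<^sub>R (cis2 \<theta> - \<rho> *\<^sub>R cis2 (\<theta> + \<psi>))) \<partial>circ) = circ_autocorr A (\<tau> + chord_log \<eta> \<psi>)"
        using AE_circ_cos
      proof eventually_elim
        case (elim \<psi>)
        obtain \<omega> where \<omega>: "0 \<le> \<omega>" "\<omega> \<le> 2 * pi" "\<And>\<theta>. cis2 \<theta> - \<rho> *\<^sub>R cis2 (\<theta> + \<psi>) = exp (chord_log \<eta> \<psi> / 2) *\<^sub>R cis2 (\<theta> + \<omega>)"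
          using cis2_polar[of \<rho> \<psi>] sqrt_chord[OF elim, of \<eta>] unfolding \<rho>_def by auto
        have rr: "r * exp (chord_log \<eta> \<psi> / 2) = exp ((\<tau> + chord_log \<eta> \<psi>) / 2)"
          by (simp add: r_def add_divide_distrib exp_add)
        have "(\<integral>\<^sup>+\<theta>. autocorr A (r *\<^sub>R (cis2 \<theta> - \<rho> *\<^sub>R cis2 (\<theta> + \<psi>))) \<partial>circ)
          = (\<integral>\<^sup>+\<theta>. (\<lambda>\<theta>. autocorr A (exp ((\<tau> + chord_log \<eta> \<psi>) / 2) *\<^sub>R cis2 \<theta>)) (\<theta> + \<omega>) \<partial>circ)"
          unfolding \<omega>(3) scaleR_scaleR rr ..
        also have "\<dots> = circ_autocorr A (\<tau> + chord_log \<eta> \<psi>)"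
          unfolding circ_autocorr_def by (rule nn_integral_circ_shift) (use \<omega> in \<open>auto simp: cis2_periodic\<close>)
        finally show ?case .
      qed
    qed
    finally show ?thesis .
  qed
  have "(\<integral>\<^sup>+x. (\<integral>\<^sup>+\<tau>\<in>{c..d}. ennreal (ring_avg A x \<tau> * ring_avg A x (\<tau> + \<eta>)) \<partial>lborel) \<partial>lborel)
    = (\<integral>\<^sup>+\<tau>. (\<integral>\<^sup>+x. ennreal (ring_avg A x \<tau> * ring_avg A x (\<tau> + \<eta>)) * indicator {c..d} \<tau> \<partial>lborel) \<partial>lborel)"
    by (rule lborel_pair.Fubini'[symmetric]) measurable
  also have "\<dots> = (\<integral>\<^sup>+\<tau>. (\<integral>\<^sup>+\<psi>. circ_autocorr A (\<tau> + chord_log \<eta> \<psi>) * indicator {c..d} \<tau> \<partial>circ) \<partial>lborel)"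
    by (intro nn_integral_cong, subst (1 2) nn_integral_multc) (measurable, simp add: inner)
  also have "\<dots> = (\<integral>\<^sup>+\<psi>. (\<integral>\<^sup>+\<tau>\<in>{c..d}. circ_autocorr A (\<tau> + chord_log \<eta> \<psi>) \<partial>lborel) \<partial>circ)"
    by (rule cl.Fubini') measurable
  finally show ?thesis .
qed


text \<open>The two shifted windows differ, on the side that matters, by one interval of length
  \<bar>a - b\<bar>, where f is at most M. No smoothness of f is needed, so nothing has to be known
  about the autocorrelation beyond its size.\<close>

lemma nn_integral_interval_shift_le:
  assumes [measurable]: "f \<in> borel_measurable borel" and f: "\<And>x. f x \<le> M"
  shows "(\<integral>\<^sup>+\<tau>\<in>{c..d}. f (\<tau> + a) \<partial>lborel) \<le> (\<integral>\<^sup>+\<tau>\<in>{c..d}. f (\<tau> + b) \<partial>lborel) + M * ennreal \<bar>a - b\<bar>"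
proof -
  have shift: "(\<integral>\<^sup>+\<tau>\<in>{c..d}. f (\<tau> + a) \<partial>lborel) = (\<integral>\<^sup>+s\<in>{c + a..d + a}. f s \<partial>lborel)" for a
    by (subst (2) nn_integral_real_affine[where c = 1 and t = a])
       (auto intro!: nn_integral_cong simp: add.commute split: split_indicator)
  have "(\<integral>\<^sup>+s\<in>{c + a..d + a}. f s \<partial>lborel) \<le> (\<integral>\<^sup>+s. f s * indicator {c + b..d + b} s + M * (indicator {c + a..<c + b} s
      + indicator {d + b<..d + a} s) \<partial>lborel)"
  proof (rule nn_integral_mono)
    fix s
    show "f s * indicator {c + a..d + a} s \<le> f s * indicator {c + b..d + b} s + M * (indicator {c + a..<c + b} s +
        indicator {d + b<..d + a} s)"
    proof (cases "s \<in> {c + b..d + b} \<or> s \<notin> {c + a..d + a}")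
      case True
      then show ?thesis by (auto split: split_indicator)
    next
      case False
      then have "s \<in> {c + a..<c + b} \<or> s \<in> {d + b<..d + a}" by auto
      then have "1 \<le> (indicator {c + a..<c + b} s + indicator {d + b<..d + a} s :: ennreal)"
        by (auto simp: indicator_def)
      then have "M * 1 \<le> M * (indicator {c + a..<c + b} s + indicator {d + b<..d + a} s)" by (rule mult_left_mono) simp
      then show ?thesis using f[of s] False by (auto intro: order_trans)
    qed
  qed
  also have "\<dots> = (\<integral>\<^sup>+s\<in>{c + b..d + b}. f s \<partial>lborel) + M * (emeasure lborel {c + a..<c + b} + emeasure lborel {d + b<..d + a})"
    by (simp add: nn_integral_add nn_integral_cmult)
  also have "emeasure lborel {c + a..<c + b} + emeasure lborel {d + b<..d + a} = ennreal \<bar>a - b\<bar>"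
    by (cases "a \<le> b") auto
  finally show ?thesis unfolding shift .
qed

text \<open>With y = x/4, the double angle formula reduces this to sin y \<ge> y cos y and cos^2 y
  \<ge> 1/2, both valid on [0, pi/4].\<close>

lemma sin_half_ge:
  assumes "0 \<le> x" "x \<le> pi"
  shows "x / 4 \<le> sin (x / 2)"
proof -
  define y where "y = x / 4"
  have y: "0 \<le> y" "y \<le> pi / 4" using assms by (auto simp: y_def)
  have "(\<lambda>y. sin y - y * cos y) 0 \<le> (\<lambda>y. sin y - y * cos y) y"
  proof (rule DERIV_nonneg_imp_nondecreasing[OF y(1)])
    fix t assume t: "0 \<le> t" "t \<le> y"
    have "((\<lambda>y. sin y - y * cos y) has_real_derivative t * sin t) (at t)"
      by (auto intro!: derivative_eq_intros simp: algebra_simps)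
    moreover have "0 \<le> t * sin t" using t y pi_gt_zero by (intro mult_nonneg_nonneg sin_ge_zero) linarith+
    ultimately show "\<exists>z. ((\<lambda>y. sin y - y * cos y) has_real_derivative z) (at t) \<and> 0 \<le> z" by blast
  qed
  then have 1: "y * cos y \<le> sin y" by simp
  have c: "cos (pi / 4) \<le> cos y" using y pi_gt_zero by (intro cos_monotone_0_pi_le) auto
  then have c0: "sqrt 2 / 2 \<le> cos y" by (simp add: cos_45)
  have "(sqrt 2 / 2) * (sqrt 2 / 2) \<le> cos y * cos y" by (intro mult_mono c0 order_trans[OF _ c0]) auto
  then have "1 / 2 \<le> cos y * cos y" by simp
  then have "y * (1 / 2) \<le> y * (cos y * cos y)" using y(1) by (rule mult_left_mono)
  also have "\<dots> = (y * cos y) * cos y" by simp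
  also have "\<dots> \<le> sin y * cos y" by (rule mult_right_mono[OF 1]) (use c0 order_trans[of 0 "sqrt 2 / 2"] in auto)
  finally have "y \<le> 2 * sin y * cos y" by simp
  also have "\<dots> = sin (2 * y)" by (rule sin_double[symmetric])
  finally show ?thesis by (simp add: y_def)
qed

lemma one_minus_cos_ge:
  assumes "0 \<le> x" "x \<le> pi"
  shows "x\<^sup>2 / 4 \<le> 2 * (1 - cos x)"
proof -
  have "(x / 4)\<^sup>2 \<le> (sin (x / 2))\<^sup>2" by (rule power_mono[OF sin_half_ge[OF assms]]) (use assms in auto)
  moreover have "cos x = 1 - 2 * (sin (x / 2))\<^sup>2" using cos_double_sin[of "x / 2"] by simp
  ultimately show ?thesis by (simp add: power2_eq_square)
qed

text \<open>Explicit integration. What matters is that the bound is linear in b for small b,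
  although the integrand is singular at 0; the singularity is reached by monotone limits from
  [1/(n+1), pi].\<close>

lemma nn_integral_log_le:
  assumes b: "b > 0"
  shows "(\<integral>\<^sup>+x\<in>{0<..pi}. ennreal (ln (1 + b\<^sup>2 / x\<^sup>2)) \<partial>lborel) \<le> ennreal (b\<^sup>2 / pi + pi * b)"
proof -
  define f where "f x = ln (1 + b\<^sup>2 / x\<^sup>2)" for x
  have [measurable]: "f \<in> borel_measurable borel" unfolding f_def by measurable
  have f0: "0 \<le> f x" for x unfolding f_def by (intro ln_ge_zero) simp
  define F where "F x = x * ln (1 + b\<^sup>2 / x\<^sup>2) + 2 * b * arctan (x / b)" for x
  have le: "(\<integral>\<^sup>+x. ennreal (f x) * indicator {1 / real (Suc n)..pi} x \<partial>lborel) \<le> ennreal (b\<^sup>2 / pi + pi * b)" for n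
  proof -
    let ?e = "1 / real (Suc n)"
    have e: "0 < ?e" "?e \<le> 1" by auto
    have ep: "?e \<le> pi" using e(2) pi_ge_two by linarith
    have "(\<integral>\<^sup>+x. ennreal (f x) * indicator {?e..pi} x \<partial>lborel) = ennreal (F pi - F ?e)"
    proof (rule nn_integral_FTC_Icc)
      fix x assume "x \<in> {?e..pi}"
      then have x: "x > 0" using e(1) unfolding atLeastAtMost_iff by linarith
      have p: "1 + b\<^sup>2 / x\<^sup>2 > 0" by (intro add_pos_nonneg) auto
      have xb: "x\<^sup>2 + b\<^sup>2 > 0" using x by (intro add_pos_nonneg) auto
      have d1: "((\<lambda>x. 1 + b\<^sup>2 / x\<^sup>2) has_real_derivative (- (2 * b\<^sup>2) / x ^ 3)) (at x)"
        using x by (auto intro!: derivative_eq_intros simp: power2_eq_square power3_eq_cube field_simps)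
      have d2: "((\<lambda>x. ln (1 + b\<^sup>2 / x\<^sup>2)) has_real_derivative (inverse (1 + b\<^sup>2 / x\<^sup>2) * (- (2 * b\<^sup>2) / x ^ 3))) (at x)"
        by (rule DERIV_chain2[OF DERIV_ln[OF p] d1])
      have d0: "((\<lambda>x. x / b) has_real_derivative (1 / b)) (at x)" using b by (auto intro!: derivative_eq_intros)
      have d3: "((\<lambda>x. arctan (x / b)) has_real_derivative (inverse (1 + (x / b)\<^sup>2) * (1 / b))) (at x)"
        by (rule DERIV_chain2[OF DERIV_arctan d0])
      have "(F has_real_derivative (1 * ln (1 + b\<^sup>2 / x\<^sup>2) + (inverse (1 + b\<^sup>2 / x\<^sup>2) * (- (2 * b\<^sup>2) / x ^ 3)) * x + (2
          * b) * (inverse (1 + (x / b)\<^sup>2) * (1 / b)))) (at x)"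
        unfolding F_def by (intro DERIV_add DERIV_mult DERIV_ident DERIV_cmult d2 d3)
      moreover have "(inverse (1 + b\<^sup>2 / x\<^sup>2) * (- (2 * b\<^sup>2) / x ^ 3)) * x = - (2 * b\<^sup>2 / (x\<^sup>2 + b\<^sup>2))"
      proof -
        have "1 + b\<^sup>2 / x\<^sup>2 = (x\<^sup>2 + b\<^sup>2) / x\<^sup>2" using x by (simp add: field_simps)
        then show ?thesis using x by (simp add: power2_eq_square power3_eq_cube)
      qed
      moreover have "(2 * b) * (inverse (1 + (x / b)\<^sup>2) * (1 / b)) = 2 * b\<^sup>2 / (x\<^sup>2 + b\<^sup>2)"
      proof -
        have "1 + (x / b)\<^sup>2 = (x\<^sup>2 + b\<^sup>2) / b\<^sup>2" using b by (simp add: field_simps)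
        then show ?thesis using b by (simp add: power2_eq_square)
      qed
      ultimately show "(F has_real_derivative f x) (at x)" unfolding f_def by simp
    qed (use f0 ep in auto)
    also have "\<dots> \<le> ennreal (b\<^sup>2 / pi + pi * b)"
    proof (rule ennreal_leI)
      have "0 \<le> F ?e" unfolding F_def using e b f0[of ?e] by (intro add_nonneg_nonneg mult_nonneg_nonneg) (auto simp: f_def)
      moreover have "pi * ln (1 + b\<^sup>2 / pi\<^sup>2) \<le> b\<^sup>2 / pi"
      proof -
        have "pi * ln (1 + b\<^sup>2 / pi\<^sup>2) \<le> pi * (b\<^sup>2 / pi\<^sup>2)" by (intro mult_left_mono ln_add_one_self_le_self) auto
        also have "\<dots> = b\<^sup>2 / pi" by (simp add: power2_eq_square)
        finally show ?thesis .
      qed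
      moreover have "2 * b * arctan (pi / b) \<le> pi * b"
      proof -
        have "2 * b * arctan (pi / b) \<le> 2 * b * (pi / 2)" by (intro mult_left_mono less_imp_le[OF arctan_ubound]) (use b in auto)
        then show ?thesis by (simp add: mult.commute)
      qed
      moreover have "F pi = pi * ln (1 + b\<^sup>2 / pi\<^sup>2) + 2 * b * arctan (pi / b)" by (simp only: F_def)
      ultimately show "F pi - F ?e \<le> b\<^sup>2 / pi + pi * b" by linarith
    qed
    finally show ?thesis .
  qed
  have sup: "ennreal (f x) * indicator {0<..pi} x = (SUP n. ennreal (f x) * indicator {1 / real (Suc n)..pi} x)" for x
  proof (rule antisym)
    show "ennreal (f x) * indicator {0<..pi} x \<le> (SUP n. ennreal (f x) * indicator {1 / real (Suc n)..pi} x)"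
    proof (cases "x \<in> {0<..pi}")
      case True
      then obtain n where "1 / real (Suc n) < x" using nat_approx_posE[of x] by auto
      then show ?thesis using True by (intro SUP_upper2[of n]) auto
    qed simp
    show "(SUP n. ennreal (f x) * indicator {1 / real (Suc n)..pi} x) \<le> ennreal (f x) * indicator {0<..pi} x"
    proof (rule SUP_least)
      fix n
      have "0 < 1 / real (Suc n)" by simp
      then have "x \<in> {0<..pi}" if "x \<in> {1 / real (Suc n)..pi}"
        using that unfolding atLeastAtMost_iff greaterThanAtMost_iff by linarith
      then show "ennreal (f x) * indicator {1 / real (Suc n)..pi} x \<le> ennreal (f x) * indicator {0<..pi} x"
        by (simp split: split_indicator)
    qed
  qed
  have "(\<integral>\<^sup>+x\<in>{0<..pi}. ennreal (f x) \<partial>lborel) = (SUP n. \<integral>\<^sup>+x. ennreal (f x) * indicator {1 / real (Suc n)..pi} x \<partial>lborel)"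
    unfolding sup
  proof (rule nn_integral_monotone_convergence_SUP)
    have "indicator {1 / real (Suc n)..pi} x \<le> (indicator {1 / real (Suc (Suc n))..pi} x :: ennreal)" for n x
    proof (cases "x \<in> {1 / real (Suc n)..pi}")
      case True
      moreover have "1 / real (Suc (Suc n)) \<le> 1 / real (Suc n)" by (rule divide_left_mono) auto
      ultimately have "x \<in> {1 / real (Suc (Suc n))..pi}" unfolding atLeastAtMost_iff by linarith
      then show ?thesis using True by (simp only: indicator_simps order_refl)
    next
      case False
      show ?thesis by (subst indicator_simps(2)[OF False]) (rule zero_le)
    qed
    then show "incseq (\<lambda>n x. ennreal (f x) * indicator {1 / real (Suc n)..pi} x)"
      unfolding incseq_Suc_iff le_fun_def by (blast intro: mult_left_mono zero_le)
  qed measurable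
  also have "\<dots> \<le> ennreal (b\<^sup>2 / pi + pi * b)" by (rule SUP_least) (rule le)
  finally show ?thesis by (simp add: f_def)
qed

section \<open>Mean-square translation estimate in the logarithmic radius\<close>

section \<open>Smoothness of circular averages in the logarithmic radius\<close>

text \<open>With c = 2 (1 - cos \<psi>) and \<rho> = e^(\<eta>/2), the mixed log chord is exactly ln
  c + \<eta>/2 + ln(1 + (\<rho> - 1)^2/(\<rho> c)). The chords within the smaller and within the
  larger circle give ln c and ln c + \<eta>, so the mixed one sits at their midpoint up to the last
  term.\<close>

lemma chord_log_diff:
  assumes \<eta>: "0 \<le> \<eta>" "\<eta> \<le> 1" and \<psi>: "cos \<psi> \<noteq> 1"
  defines "L \<equiv> ln (1 + \<eta>\<^sup>2 / (2 * (1 - cos \<psi>)))"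
  shows "\<bar>chord_log 0 \<psi> - chord_log \<eta> \<psi>\<bar> \<le> \<eta> / 2 + L" "\<bar>chord_log 0 \<psi> + \<eta> - chord_log \<eta> \<psi>\<bar> \<le> \<eta> / 2 + L"
proof -
  define c where "c = 2 * (1 - cos \<psi>)"
  define \<rho> where "\<rho> = exp (\<eta> / 2)"
  have "cos \<psi> < 1" using \<psi> cos_le_one[of \<psi>] by linarith
  then have c: "c > 0" by (simp add: c_def)
  have \<rho>: "\<rho> \<ge> 1" using \<eta> by (simp add: \<rho>_def)
  \<comment> \<open>The aim of the following lines is (\<rho> - 1)^2/\<rho> \<le> \<eta>^2; it uses
    \<rho> - 1 \<le> \<eta> \<rho>/2 and hence \<rho> \<le> 2.\<close>
  have e: "1 - \<eta> / 2 \<le> inverse \<rho>" using exp_ge_add_one_self[of "- (\<eta> / 2)"] by (simp add: \<rho>_def exp_minus)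
  then have "\<rho> * (1 - \<eta> / 2) \<le> \<rho> * inverse \<rho>" by (rule mult_left_mono) (use \<rho> in simp)
  then have r1: "\<rho> - 1 \<le> \<eta> / 2 * \<rho>" using \<rho> by (simp add: algebra_simps)
  also have "\<eta> / 2 * \<rho> \<le> 1 / 2 * \<rho>" using \<eta> \<rho> by (intro mult_right_mono) auto
  finally have r2: "\<rho> \<le> 2" by simp
  have "(\<rho> - 1)\<^sup>2 \<le> (\<eta> / 2 * \<rho>)\<^sup>2" by (rule power_mono[OF r1]) (use \<rho> in simp)
  also have "\<dots> = \<eta>\<^sup>2 * \<rho> * (\<rho> / 4)" by (simp add: power2_eq_square)
  also have "\<dots> \<le> \<eta>\<^sup>2 * \<rho> * 1" using r2 \<rho> by (intro mult_left_mono) auto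
  finally have k: "(\<rho> - 1)\<^sup>2 / \<rho> \<le> \<eta>\<^sup>2" using \<rho> by (simp add: field_simps)
  define l where "l = ln (1 + (\<rho> - 1)\<^sup>2 / \<rho> / c)"
  have l0: "0 \<le> l" unfolding l_def using c \<rho> by (intro ln_ge_zero) simp
  have lL: "l \<le> L"
  proof -
    have "1 + (\<rho> - 1)\<^sup>2 / \<rho> / c \<le> 1 + \<eta>\<^sup>2 / c" using divide_right_mono[OF k, of c] c by simp
    moreover have "0 < 1 + (\<rho> - 1)\<^sup>2 / \<rho> / c" using c \<rho> by (intro add_pos_nonneg) auto
    ultimately show ?thesis unfolding l_def L_def c_def[symmetric] by (subst ln_le_cancel_iff) auto
  qed
  have c0: "chord_log 0 \<psi> = ln c" by (simp add: chord_log_def c_def)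
  have "(\<rho> - 1)\<^sup>2 + \<rho> * c = (\<rho> * c) * (1 + (\<rho> - 1)\<^sup>2 / \<rho> / c)" using \<rho> c by (simp add: field_simps)
  moreover have "0 < 1 + (\<rho> - 1)\<^sup>2 / \<rho> / c" using c \<rho> by (intro add_pos_nonneg) auto
  ultimately have "ln ((\<rho> - 1)\<^sup>2 + \<rho> * c) = ln (\<rho> * c) + l"
    unfolding l_def using \<rho> c by (simp add: ln_mult)
  moreover have "ln (\<rho> * c) = \<eta> / 2 + ln c" using \<rho> c by (subst ln_mult) (auto simp: \<rho>_def)
  ultimately have c\<eta>: "chord_log \<eta> \<psi> = \<eta> / 2 + ln c + l" by (simp add: chord_log_def c_def \<rho>_def)
  show "\<bar>chord_log 0 \<psi> - chord_log \<eta> \<psi>\<bar> \<le> \<eta> / 2 + L" "\<bar>chord_log 0 \<psi> + \<eta> - chord_log \<eta> \<psi>\<bar> \<le> \<eta> / 2 + L"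
    unfolding c0 c\<eta> using l0 lL \<eta> by auto
qed

text \<open>The quadratic lower bound for 1 - cos reduces the integrand to ln(1 + (2
  \<eta>)^2/\<psi>^2). By symmetry the half period is enough, and 4/pi^2 + 2 \<le> 3 rounds the
  constant.\<close>

lemma circ_log_le:
  assumes \<eta>: "0 < \<eta>" "\<eta> \<le> 1"
  shows "(\<integral>\<^sup>+\<psi>. ennreal (ln (1 + \<eta>\<^sup>2 / (2 * (1 - cos \<psi>)))) \<partial>circ) \<le> ennreal (3 * \<eta>)"
proof -
  define f where "f \<psi> = ennreal (ln (1 + \<eta>\<^sup>2 / (2 * (1 - cos \<psi>))))" for \<psi>
  have [measurable]: "f \<in> borel_measurable borel" unfolding f_def by measurable
  have half: "(\<integral>\<^sup>+\<psi>\<in>{0..pi}. f \<psi> \<partial>lborel) \<le> ennreal ((4 / pi + 2 * pi) * \<eta>)"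
  proof -
    have "(\<integral>\<^sup>+\<psi>\<in>{0..pi}. f \<psi> \<partial>lborel) \<le> (\<integral>\<^sup>+x\<in>{0<..pi}. ennreal (ln (1 + (2 * \<eta>)\<^sup>2 / x\<^sup>2)) \<partial>lborel)"
    proof (rule nn_integral_mono_AE)
      show "AE x in lborel. f x * indicator {0..pi} x \<le> ennreal (ln (1 + (2 * \<eta>)\<^sup>2 / x\<^sup>2)) * indicator {0<..pi} x"
        using AE_lborel_singleton[of 0]
      proof eventually_elim
        case (elim x)
        show ?case
        proof (cases "x \<in> {0..pi}")
          case True
          then have x: "0 < x" "x \<le> pi" using elim by auto
          have "x\<^sup>2 / 4 \<le> 2 * (1 - cos x)" by (rule one_minus_cos_ge) (use x in auto)
          moreover have "x\<^sup>2 / 4 > 0" using x by simp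
          moreover from calculation have "2 * (1 - cos x) > 0" by linarith
          ultimately have "\<eta>\<^sup>2 / (2 * (1 - cos x)) \<le> \<eta>\<^sup>2 / (x\<^sup>2 / 4)"
            by (intro divide_left_mono mult_pos_pos) simp_all
          also have "\<dots> = (2 * \<eta>)\<^sup>2 / x\<^sup>2" by (simp add: power_mult_distrib)
          finally have le: "\<eta>\<^sup>2 / (2 * (1 - cos x)) \<le> (2 * \<eta>)\<^sup>2 / x\<^sup>2" .
          have p1: "0 < 1 + \<eta>\<^sup>2 / (2 * (1 - cos x))" using cos_le_one[of x] by (intro add_pos_nonneg) auto
          have p2: "0 < 1 + (2 * \<eta>)\<^sup>2 / x\<^sup>2" by (intro add_pos_nonneg) auto
          have "ln (1 + \<eta>\<^sup>2 / (2 * (1 - cos x))) \<le> ln (1 + (2 * \<eta>)\<^sup>2 / x\<^sup>2)"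
            unfolding ln_le_cancel_iff[OF p1 p2] using le by linarith
          then show ?thesis using x by (simp add: f_def ennreal_leI)
        qed simp
      qed
    qed
    also have "\<dots> \<le> ennreal ((2 * \<eta>)\<^sup>2 / pi + pi * (2 * \<eta>))" by (rule nn_integral_log_le) (use \<eta> in simp)
    also have "\<dots> \<le> ennreal ((4 / pi + 2 * pi) * \<eta>)"
    proof (rule ennreal_leI)
      have "(2 * \<eta>)\<^sup>2 \<le> 4 * \<eta>" using \<eta> by (simp add: power2_eq_square)
      then have "(2 * \<eta>)\<^sup>2 / pi \<le> 4 * \<eta> / pi" by (rule divide_right_mono) simp
      moreover have "(4 / pi + 2 * pi) * \<eta> = 4 * \<eta> / pi + pi * (2 * \<eta>)" by (simp add: distrib_right)
      ultimately show "(2 * \<eta>)\<^sup>2 / pi + pi * (2 * \<eta>) \<le> (4 / pi + 2 * pi) * \<eta>" by (simp only: add_right_mono)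
    qed
    finally show ?thesis .
  qed
  have refl: "(\<integral>\<^sup>+\<psi>\<in>{pi..2 * pi}. f \<psi> \<partial>lborel) = (\<integral>\<^sup>+\<psi>\<in>{0..pi}. f \<psi> \<partial>lborel)"
  proof -
    have "(\<integral>\<^sup>+\<psi>. f \<psi> * indicator {pi..2 * pi} \<psi> \<partial>lborel) = ennreal \<bar>-1\<bar> * (\<integral>\<^sup>+\<psi>. f (2 * pi + (-1) * \<psi>) * indicator
        {pi..2 * pi} (2 * pi + (-1) * \<psi>) \<partial>lborel)"
      by (rule nn_integral_real_affine) auto
    also have "\<dots> = (\<integral>\<^sup>+\<psi>\<in>{0..pi}. f \<psi> \<partial>lborel)"
    proof -
      have "f (2 * pi + (-1) * \<psi>) * indicator {pi..2 * pi} (2 * pi + (-1) * \<psi>) = f \<psi> * indicator {0..pi} \<psi>" for \<psi>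
        by (auto simp: f_def cos_diff split: split_indicator)
      then show ?thesis by simp
    qed
    finally show ?thesis .
  qed
  have "(\<integral>\<^sup>+\<psi>\<in>{0..2 * pi}. f \<psi> \<partial>lborel) \<le> (\<integral>\<^sup>+\<psi>. f \<psi> * indicator {0..pi} \<psi> + f \<psi> * indicator {pi..2 * pi} \<psi> \<partial>lborel)"
    by (rule nn_integral_mono) (auto split: split_indicator)
  also have "\<dots> = (\<integral>\<^sup>+\<psi>\<in>{0..pi}. f \<psi> \<partial>lborel) + (\<integral>\<^sup>+\<psi>\<in>{pi..2 * pi}. f \<psi> \<partial>lborel)"
    by (rule nn_integral_add) measurable
  also have "\<dots> \<le> ennreal ((4 / pi + 2 * pi) * \<eta>) + ennreal ((4 / pi + 2 * pi) * \<eta>)"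
    unfolding refl by (rule add_mono[OF half half])
  also have "\<dots> = ennreal (2 * ((4 / pi + 2 * pi) * \<eta>))" using \<eta> by (simp flip: ennreal_plus)
  finally have "(\<integral>\<^sup>+\<psi>. f \<psi> \<partial>circ) \<le> ennreal (1 / (2 * pi)) * ennreal (2 * ((4 / pi + 2 * pi) * \<eta>))"
    by (subst nn_integral_circ) (auto intro: mult_left_mono)
  also have "\<dots> = ennreal ((4 / pi\<^sup>2 + 2) * \<eta>)"
  proof -
    have "1 / (2 * pi) * (2 * ((4 / pi + 2 * pi) * \<eta>)) = (4 / pi\<^sup>2 + 2) * \<eta>" by (simp add: field_simps power2_eq_square)
    then show ?thesis using \<eta> by (subst ennreal_mult[symmetric]) auto
  qed
  also have "\<dots> \<le> ennreal (3 * \<eta>)"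
  proof (rule ennreal_leI, rule mult_right_mono)
    have "2\<^sup>2 \<le> pi\<^sup>2" by (rule power_mono[OF pi_ge_two]) simp
    then have "4 / pi\<^sup>2 \<le> 1" by simp
    then show "4 / pi\<^sup>2 + 2 \<le> 3" by simp
  qed (use \<eta> in simp)
  finally show ?thesis by (simp add: f_def)
qed

text \<open>Expanding the square leaves two self-correlations minus twice the mixed one. By the
  correlation formula all three are window integrals of the same function, shifted by log chords
  that \<open>chord_log_diff\<close> compares. The 7 is 1 + 2 * 3: two shifts of \<eta>/2 and twice
  the logarithmic mean.\<close>

lemma ring_diff_interval:
  assumes A[measurable]: "A \<in> sets borel" and fin: "emeasure lborel A < \<infinity>" and \<eta>: "0 < \<eta>" "\<eta> \<le> 1"
  shows "(\<integral>\<^sup>+x. (\<integral>\<^sup>+\<tau>\<in>{c..d}. ennreal ((ring_avg A x \<tau> - ring_avg A x (\<tau> + \<eta>))\<^sup>2) \<partial>lborel) \<partial>lborel)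
    \<le> ennreal (7 * \<eta>) * emeasure lborel A"
proof -
  define J where "J = (\<integral>\<^sup>+x. (\<integral>\<^sup>+\<tau>\<in>{c..d}. ennreal ((ring_avg A x \<tau> - ring_avg A x (\<tau> + \<eta>))\<^sup>2) \<partial>lborel) \<partial>lborel)"
  define P1 where "P1 = (\<integral>\<^sup>+x. (\<integral>\<^sup>+\<tau>\<in>{c..d}. ennreal (ring_avg A x \<tau> * ring_avg A x (\<tau> + 0)) \<partial>lborel) \<partial>lborel)"
  define P2 where "P2 = (\<integral>\<^sup>+x. (\<integral>\<^sup>+\<tau>\<in>{c + \<eta>..d + \<eta>}. ennreal (ring_avg A x \<tau> * ring_avg A x (\<tau> + 0)) \<partial>lborel) \<partial>lborel)"
  define P3 where "P3 = (\<integral>\<^sup>+x. (\<integral>\<^sup>+\<tau>\<in>{c..d}. ennreal (ring_avg A x \<tau> * ring_avg A x (\<tau> + \<eta>)) \<partial>lborel) \<partial>lborel)"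
  let ?m = "circ_autocorr A" and ?M = "emeasure lborel A"
  define I where "I a = (\<integral>\<^sup>+\<tau>\<in>{c..d}. ?m (\<tau> + a) \<partial>lborel)" for a
  have [measurable]: "I \<in> borel_measurable borel" unfolding I_def by measurable
  have P2': "P2 = (\<integral>\<^sup>+x. (\<integral>\<^sup>+\<tau>\<in>{c..d}. ennreal (ring_avg A x (\<tau> + \<eta>) * ring_avg A x (\<tau> + \<eta>)) \<partial>lborel) \<partial>lborel)"
  proof -
    have "(\<integral>\<^sup>+\<tau>\<in>{c + \<eta>..d + \<eta>}. ennreal (ring_avg A x \<tau> * ring_avg A x (\<tau> + 0)) \<partial>lborel)
      = (\<integral>\<^sup>+\<tau>\<in>{c..d}. ennreal (ring_avg A x (\<tau> + \<eta>) * ring_avg A x (\<tau> + \<eta>)) \<partial>lborel)" for x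
      by (subst nn_integral_real_affine[where c = 1 and t = \<eta>])
         (auto intro!: nn_integral_cong simp: add.commute split: split_indicator)
    then show ?thesis unfolding P2_def by simp
  qed
  \<comment> \<open>The expansion is stated additively, since subtraction of extended nonnegative
    numbers truncates.\<close>
  have "J + 2 * P3 = P1 + P2"
  proof -
    have "J + 2 * P3 = (\<integral>\<^sup>+x. (\<integral>\<^sup>+\<tau>\<in>{c..d}. (ennreal ((ring_avg A x \<tau> - ring_avg A x (\<tau> + \<eta>))\<^sup>2) + 2 * ennreal (ring_avg
        A x \<tau> * ring_avg A x (\<tau> + \<eta>))) \<partial>lborel) \<partial>lborel)"
      unfolding J_def P3_def by (simp add: nn_integral_add nn_integral_cmult distrib_right mult.assoc)
    also have "\<dots> = (\<integral>\<^sup>+x. (\<integral>\<^sup>+\<tau>\<in>{c..d}. (ennreal (ring_avg A x \<tau> * ring_avg A x (\<tau> + 0)) + ennreal (ring_avg A x (\<tau> + \<eta>)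
        * ring_avg A x (\<tau> + \<eta>))) \<partial>lborel) \<partial>lborel)"
    proof -
      have "ennreal ((a - b)\<^sup>2) + 2 * ennreal (a * b) = ennreal (a * a) + ennreal (b * b)" if "0 \<le> a" "0 \<le> b" for a b :: real
      proof -
        have "ennreal ((a - b)\<^sup>2) + ennreal 2 * ennreal (a * b) = ennreal ((a - b)\<^sup>2 + 2 * (a * b))"
          using that by (simp only: ennreal_plus ennreal_mult zero_le_power2 mult_nonneg_nonneg zero_le_numeral)
        also have "(a - b)\<^sup>2 + 2 * (a * b) = a * a + b * b" by (simp add: power2_eq_square algebra_simps)
        finally show ?thesis using that by simp
      qed
      then show ?thesis by simp
    qed
    also have "\<dots> = P1 + P2"
      unfolding P1_def P2' by (simp add: nn_integral_add distrib_right)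
    finally show ?thesis .
  qed
  moreover have "P1 + P2 \<le> 2 * P3 + ?M * ennreal (7 * \<eta>)"
  proof -
    have I2: "(\<integral>\<^sup>+\<tau>\<in>{c + \<eta>..d + \<eta>}. ?m (\<tau> + chord_log 0 \<psi>) \<partial>lborel) = I (chord_log 0 \<psi> + \<eta>)" for \<psi>
      unfolding I_def by (subst nn_integral_real_affine[where c = 1 and t = \<eta>])
         (auto intro!: nn_integral_cong simp: add_ac split: split_indicator)
    have "P1 + P2 = (\<integral>\<^sup>+\<psi>. I (chord_log 0 \<psi>) + I (chord_log 0 \<psi> + \<eta>) \<partial>circ)"
      unfolding P1_def P2_def correlation_ring_avg[OF A] I2 unfolding I_def[symmetric] by (rule
          nn_integral_add[symmetric]) measurable
    also have "\<dots> \<le> (\<integral>\<^sup>+\<psi>. 2 * I (chord_log \<eta> \<psi>) + ?M * (ennreal \<eta> + 2 * ennreal (ln (1 + \<eta>\<^sup>2 / (2 * (1 - cos \<psi>))))) \<partial>circ)"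
    proof (rule nn_integral_mono_AE)
      show "AE \<psi> in circ. I (chord_log 0 \<psi>) + I (chord_log 0 \<psi> + \<eta>) \<le> 2 * I (chord_log \<eta> \<psi>) + ?M * (ennreal \<eta> + 2 *
          ennreal (ln (1 + \<eta>\<^sup>2 / (2 * (1 - cos \<psi>)))))"
        using AE_circ_cos
      proof eventually_elim
        case (elim \<psi>)
        define L where "L = ln (1 + \<eta>\<^sup>2 / (2 * (1 - cos \<psi>)))"
        have L: "0 \<le> L" unfolding L_def using cos_le_one[of \<psi>] by (intro ln_ge_zero) simp
        have d: "\<bar>chord_log 0 \<psi> - chord_log \<eta> \<psi>\<bar> \<le> \<eta> / 2 + L" "\<bar>chord_log 0 \<psi> + \<eta> - chord_log \<eta> \<psi>\<bar> \<le> \<eta> / 2 + L"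
          unfolding L_def by (rule chord_log_diff; use \<eta> elim in simp)+
        have sh: "I a \<le> I b + ?M * ennreal \<bar>a - b\<bar>" for a b
          unfolding I_def by (rule nn_integral_interval_shift_le) (simp_all add: circ_autocorr_le)
        have "I (chord_log 0 \<psi>) + I (chord_log 0 \<psi> + \<eta>) \<le> (I (chord_log \<eta> \<psi>) + ?M * ennreal (\<eta> / 2 + L)) + (I (chord_log
            \<eta> \<psi>) + ?M * ennreal (\<eta> / 2 + L))"
          by (intro add_mono order_trans[OF sh[of _ "chord_log \<eta> \<psi>"]] order_refl mult_left_mono ennreal_leI d) simp_all
        also have "\<dots> = 2 * I (chord_log \<eta> \<psi>) + ?M * (ennreal (\<eta> / 2 + L) + ennreal (\<eta> / 2 + L))"
          by (simp add: mult_2 distrib_left add_ac)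
        also have "ennreal (\<eta> / 2 + L) + ennreal (\<eta> / 2 + L) = ennreal \<eta> + 2 * ennreal L"
        proof -
          have "ennreal (\<eta> / 2 + L) = ennreal (\<eta> / 2) + ennreal L" using \<eta> L by (intro ennreal_plus) auto
          moreover have "ennreal \<eta> = ennreal (\<eta> / 2) + ennreal (\<eta> / 2)" using \<eta> ennreal_plus[of "\<eta> / 2" "\<eta> / 2"] by simp
          ultimately show ?thesis by (simp only: mult_2 add_ac)
        qed
        finally show ?case unfolding L_def .
      qed
    qed
    also have "\<dots> = 2 * (\<integral>\<^sup>+\<psi>. I (chord_log \<eta> \<psi>) \<partial>circ) + ?M * (ennreal \<eta> + 2 * (\<integral>\<^sup>+\<psi>. ennreal (ln (1 + \<eta>\<^sup>2 / (2 * (1 -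
        cos \<psi>)))) \<partial>circ))"
    proof -
      define l where "l \<psi> = ennreal (ln (1 + \<eta>\<^sup>2 / (2 * (1 - cos \<psi>))))" for \<psi>
      have [measurable]: "l \<in> borel_measurable borel" unfolding l_def by measurable
      have "(\<integral>\<^sup>+\<psi>. 2 * I (chord_log \<eta> \<psi>) + ?M * (ennreal \<eta> + 2 * l \<psi>) \<partial>circ)
        = (\<integral>\<^sup>+\<psi>. 2 * I (chord_log \<eta> \<psi>) \<partial>circ) + (\<integral>\<^sup>+\<psi>. ?M * (ennreal \<eta> + 2 * l \<psi>) \<partial>circ)"
        by (rule nn_integral_add) measurable
      also have "(\<integral>\<^sup>+\<psi>. 2 * I (chord_log \<eta> \<psi>) \<partial>circ) = 2 * (\<integral>\<^sup>+\<psi>. I (chord_log \<eta> \<psi>) \<partial>circ)"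
        by (rule nn_integral_cmult) measurable
      also have "(\<integral>\<^sup>+\<psi>. ?M * (ennreal \<eta> + 2 * l \<psi>) \<partial>circ) = ?M * (\<integral>\<^sup>+\<psi>. ennreal \<eta> + 2 * l \<psi> \<partial>circ)"
        by (rule nn_integral_cmult) measurable
      also have "(\<integral>\<^sup>+\<psi>. ennreal \<eta> + 2 * l \<psi> \<partial>circ) = (\<integral>\<^sup>+\<psi>. ennreal \<eta> \<partial>circ) + (\<integral>\<^sup>+\<psi>. 2 * l \<psi> \<partial>circ)"
        by (rule nn_integral_add) measurable
      also have "(\<integral>\<^sup>+\<psi>. 2 * l \<psi> \<partial>circ) = 2 * (\<integral>\<^sup>+\<psi>. l \<psi> \<partial>circ)"
        by (rule nn_integral_cmult) measurable
      also have "(\<integral>\<^sup>+\<psi>. ennreal \<eta> \<partial>circ) = ennreal \<eta>"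
        using circ.emeasure_space_1 by simp
      finally show ?thesis unfolding l_def .
    qed
    also have "(\<integral>\<^sup>+\<psi>. I (chord_log \<eta> \<psi>) \<partial>circ) = P3"
      unfolding P3_def correlation_ring_avg[OF A] I_def ..
    also have "2 * P3 + ?M * (ennreal \<eta> + 2 * (\<integral>\<^sup>+\<psi>. ennreal (ln (1 + \<eta>\<^sup>2 / (2 * (1 - cos \<psi>)))) \<partial>circ)) \<le> 2 * P3 + ?M *
        (ennreal \<eta> + 2 * ennreal (3 * \<eta>))"
      by (intro add_left_mono mult_left_mono circ_log_le \<eta>) simp_all
    also have "ennreal \<eta> + 2 * ennreal (3 * \<eta>) = ennreal (7 * \<eta>)"
      using \<eta> by (simp add: mult_2 flip: ennreal_plus)
    finally show ?thesis .
  qed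
  \<comment> \<open>The bounded window makes the mixed correlation finite, so it can be
    cancelled.\<close>
  moreover have "2 * P3 \<noteq> \<infinity>"
  proof -
    have "P3 \<le> (\<integral>\<^sup>+\<psi>. (\<integral>\<^sup>+\<tau>\<in>{c..d}. ?M \<partial>lborel) \<partial>circ)"
      unfolding P3_def correlation_ring_avg[OF A] by (intro nn_integral_mono mult_right_mono circ_autocorr_le A) simp
    also have "\<dots> = ?M * emeasure lborel {c..d}" using circ.emeasure_space_1 by (simp add: nn_integral_cmult_indicator)
    also have "\<dots> < \<infinity>" using fin by (cases "c \<le> d") (auto simp: ennreal_mult_less_top)
    finally show ?thesis by (auto simp: ennreal_mult_eq_top_iff)
  qed
  ultimately have "J \<le> ?M * ennreal (7 * \<eta>)"
    by (metis add.commute ennreal_add_left_cancel_le infinity_ennreal_def)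
  then show ?thesis by (simp add: J_def mult.commute)
qed

text \<open>Growth linear in \<eta> of the mean-square translation difference is the half derivative
  of the overview. The window bound does not depend on the window, so monotone convergence reaches
  the whole line.\<close>

theorem ring_diff:
  assumes A[measurable]: "A \<in> sets borel" and fin: "emeasure lborel A < \<infinity>" and \<eta>: "0 \<le> \<eta>" "\<eta> \<le> 1"
  shows "(\<integral>\<^sup>+x. (\<integral>\<^sup>+\<tau>. ennreal ((ring_avg A x \<tau> - ring_avg A x (\<tau> + \<eta>))\<^sup>2) \<partial>lborel) \<partial>lborel)
    \<le> ennreal (7 * \<eta>) * emeasure lborel A"
proof (cases "\<eta> = 0")
  case False
  define f where "f x \<tau> = ennreal ((ring_avg A x \<tau> - ring_avg A x (\<tau> + \<eta>))\<^sup>2)" for x \<tau>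
  have [measurable]: "case_prod f \<in> borel_measurable (borel \<Otimes>\<^sub>M borel)" unfolding f_def by measurable
  have ind: "indicator {- real n..real n} \<tau> \<le> (indicator {- real (Suc n)..real (Suc n)} \<tau> :: ennreal)" for n \<tau>
    by (auto split: split_indicator)
  have s: "(\<integral>\<^sup>+\<tau>. f x \<tau> \<partial>lborel) = (SUP n. \<integral>\<^sup>+\<tau>\<in>{- real n..real n}. f x \<tau> \<partial>lborel)" for x
  proof -
    have "f x \<tau> = (SUP n. f x \<tau> * indicator {- real n..real n} \<tau>)" for \<tau>
    proof (rule antisym)
      obtain n where "\<bar>\<tau>\<bar> \<le> real n" using real_arch_simple by blast
      then show "f x \<tau> \<le> (SUP n. f x \<tau> * indicator {- real n..real n} \<tau>)" by (intro SUP_upper2[of n]) (auto simp: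
          indicator_def abs_le_iff)
    qed (auto intro!: SUP_least split: split_indicator)
    then have "(\<integral>\<^sup>+\<tau>. f x \<tau> \<partial>lborel) = (\<integral>\<^sup>+\<tau>. (SUP n. f x \<tau> * indicator {- real n..real n} \<tau>) \<partial>lborel)" by simp
    also have "\<dots> = (SUP n. \<integral>\<^sup>+\<tau>\<in>{- real n..real n}. f x \<tau> \<partial>lborel)"
      by (rule nn_integral_monotone_convergence_SUP) (auto simp: incseq_Suc_iff le_fun_def intro!: mult_left_mono ind)
    finally show ?thesis .
  qed
  have "(\<integral>\<^sup>+x. (\<integral>\<^sup>+\<tau>. f x \<tau> \<partial>lborel) \<partial>lborel) = (SUP n. \<integral>\<^sup>+x. (\<integral>\<^sup>+\<tau>\<in>{- real n..real n}. f x \<tau> \<partial>lborel) \<partial>lborel)"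
    unfolding s by (rule nn_integral_monotone_convergence_SUP)
      (auto simp: incseq_Suc_iff le_fun_def intro!: nn_integral_mono mult_left_mono ind)
  also have "\<dots> \<le> ennreal (7 * \<eta>) * emeasure lborel A"
    by (rule SUP_least) (use ring_diff_interval[OF A fin, of \<eta>] \<eta> False in \<open>simp add: f_def\<close>)
  finally show ?thesis by (simp add: f_def)
qed simp

section \<open>Dyadic averages of circular averages\<close>

definition unif :: "real measure" where
  "unif = uniform_measure lborel {0..1}"

lemma prob_space_unif: "prob_space unif"
  unfolding unif_def by (rule prob_space_uniform_measure) auto

interpretation unif: prob_space unif by (rule prob_space_unif)

lemma sets_unif [simp, measurable_cong]: "sets unif = sets borel"
  by (simp add: unif_def)

lemma space_unif [simp]: "space unif = UNIV"
  by (simp add: unif_def)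

lemma AE_unif: "AE s in unif. 0 \<le> s \<and> s \<le> 1"
  unfolding unif_def by (rule AE_uniform_measureI) auto

lemma nn_integral_unif:
  assumes [measurable]: "f \<in> borel_measurable borel"
  shows "(\<integral>\<^sup>+s. f s \<partial>unif) = (\<integral>\<^sup>+s\<in>{0..1}. f s \<partial>lborel)"
  unfolding unif_def by (subst nn_integral_uniform_measure) (auto simp: divide_ennreal_def)

lemma unif_integrable:
  fixes f :: "real \<Rightarrow> real"
  assumes [measurable]: "f \<in> borel_measurable borel" and "\<And>s. \<bar>f s\<bar> \<le> B"
  shows "integrable unif f"
  by (rule unif.integrable_const_bound[of _ B]) (use assms in auto)

text \<open>Jensen's inequality in the form that the variance is nonnegative.\<close>

lemma unif_square_le:
  fixes f :: "real \<Rightarrow> real"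
  assumes [measurable]: "f \<in> borel_measurable borel" and B: "\<And>s. \<bar>f s\<bar> \<le> 1"
  shows "ennreal ((LINT s|unif. f s)\<^sup>2) \<le> (\<integral>\<^sup>+s. ennreal ((f s)\<^sup>2) \<partial>unif)"
proof -
  have B2: "\<bar>(f s)\<^sup>2\<bar> \<le> 1" for s using B[of s] by (simp add: abs_square_le_1)
  have i: "integrable unif f" by (rule unif_integrable[OF _ B]) measurable
  have i2: "integrable unif (\<lambda>s. (f s)\<^sup>2)" by (rule unif_integrable[OF _ B2]) measurable
  have "0 \<le> unif.variance f" by (rule unif.variance_positive)
  then have "(LINT s|unif. f s)\<^sup>2 \<le> (LINT s|unif. (f s)\<^sup>2)" using unif.variance_eq[OF i i2] by simp
  then have "ennreal ((LINT s|unif. f s)\<^sup>2) \<le> ennreal (LINT s|unif. (f s)\<^sup>2)" by (rule ennreal_leI)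
  also have "\<dots> = (\<integral>\<^sup>+s. ennreal ((f s)\<^sup>2) \<partial>unif)" by (rule nn_integral_eq_integral[symmetric, OF i2]) simp
  finally show ?thesis .
qed

text \<open>Forward means starting at \<tau>, in place of means over a fixed dyadic grid:
  differences between scales are then averages of translation differences, to which
  \<open>ring_diff\<close> applies.\<close>

definition pavg :: "nat \<Rightarrow> (real ^ 2) set \<Rightarrow> real ^ 2 \<Rightarrow> real \<Rightarrow> real" where
  "pavg N A x \<tau> = (LINT s|unif. ring_avg A x (\<tau> + s / 2 ^ N))"

lemma ring_avg_abs_le: "\<bar>ring_avg A x \<tau>\<bar> \<le> 1"
  by (simp add: ring_avg_le_1)

lemma ring_avg_diff_abs_le: "\<bar>ring_avg A x \<sigma> - ring_avg A x \<tau>\<bar> \<le> 1"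
  using ring_avg_le_1[of A x \<sigma>] ring_avg_le_1[of A x \<tau>] ring_avg_nonneg[of A x \<sigma>] ring_avg_nonneg[of A x \<tau>] by linarith

text \<open>The image of the uniform measure on (0, 1) under s \<mapsto> T + ln s, hence the uniform
  law of the slicing variable seen in the logarithmic squared radius.\<close>

definition exp_measure :: "real \<Rightarrow> real measure" where
  "exp_measure T = density lborel (\<lambda>\<tau>. ennreal (exp (\<tau> - T) * indicator {..T} \<tau>))"

lemma sets_exp_measure [simp, measurable_cong]: "sets (exp_measure T) = sets borel"
  by (simp add: exp_measure_def)

lemma space_exp_measure [simp]: "space (exp_measure T) = UNIV"
  by (simp add: exp_measure_def)

lemma nn_integral_exp_measure:
  assumes [measurable]: "f \<in> borel_measurable borel"
  shows "(\<integral>\<^sup>+\<tau>. f \<tau> \<partial>exp_measure T) = (\<integral>\<^sup>+\<tau>. f \<tau> * ennreal (exp (\<tau> - T) * indicator {..T} \<tau>) \<partial>lborel)"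
  unfolding exp_measure_def by (subst nn_integral_density) (auto simp: mult.commute)

text \<open>The density is at most 1. This makes bounds over the whole \<tau>-axis uniform in T, so
  that the supremum over dilations costs nothing.\<close>

lemma nn_integral_exp_measure_le:
  assumes [measurable]: "f \<in> borel_measurable borel"
  shows "(\<integral>\<^sup>+\<tau>. f \<tau> \<partial>exp_measure T) \<le> (\<integral>\<^sup>+\<tau>. f \<tau> \<partial>lborel)"
  unfolding nn_integral_exp_measure[OF assms]
proof (rule nn_integral_mono)
  fix \<tau> :: real
  have "ennreal (exp (\<tau> - T) * indicator {..T} \<tau>) \<le> 1" by (simp split: split_indicator)
  then show "f \<tau> * ennreal (exp (\<tau> - T) * indicator {..T} \<tau>) \<le> f \<tau>"
    using mult_left_mono[of "ennreal (exp (\<tau> - T) * indicator {..T} \<tau>)" 1 "f \<tau>"] by simp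
qed

context
  fixes A :: "(real ^ 2) set"
  assumes A[measurable]: "A \<in> sets borel"
begin

lemma borel_measurable_ennreal_ring_avg: "(\<lambda>\<tau>. ennreal (ring_avg A x \<tau>)) \<in> borel_measurable borel"
  by measurable

lemma ring_avg_integrable: "integrable unif (\<lambda>s. ring_avg A x (\<tau> + s / c))"
  by (rule unif_integrable[OF _ ring_avg_abs_le]) measurable

lemma borel_measurable_pavg [measurable (raw)]:
  assumes [measurable]: "f \<in> M \<rightarrow>\<^sub>M borel" "g \<in> M \<rightarrow>\<^sub>M borel"
  shows "(\<lambda>y. pavg N A (f y) (g y)) \<in> borel_measurable M"
  unfolding pavg_def by measurable

lemma ennreal_pavg: "ennreal (pavg N A x \<tau>) = (\<integral>\<^sup>+s. ennreal (ring_avg A x (\<tau> + s / 2 ^ N)) \<partial>unif)"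
  unfolding pavg_def by (rule nn_integral_eq_integral[symmetric, OF ring_avg_integrable]) simp

lemma pavg_nonneg: "0 \<le> pavg N A x \<tau>"
  unfolding pavg_def by (rule integral_nonneg_AE) simp

lemma pavg_le_1: "pavg N A x \<tau> \<le> 1"
proof -
  have "(\<integral>\<^sup>+s. ennreal (ring_avg A x (\<tau> + s / 2 ^ N)) \<partial>unif) \<le> (\<integral>\<^sup>+s. 1 \<partial>unif)"
    by (rule nn_integral_mono) (simp add: ring_avg_le_1)
  then have "ennreal (pavg N A x \<tau>) \<le> 1" unfolding ennreal_pavg using unif.emeasure_space_1 by simp
  then show ?thesis by simp
qed

definition ring_sq :: "real \<Rightarrow> real ^ 2 \<Rightarrow> ennreal" where
  "ring_sq \<epsilon> x = (\<integral>\<^sup>+\<tau>. ennreal ((ring_avg A x \<tau> - ring_avg A x (\<tau> + \<epsilon>))\<^sup>2) \<partial>lborel)"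

lemma borel_measurable_ring_sq [measurable]: "ring_sq \<epsilon> \<in> borel_measurable borel"
  unfolding ring_sq_def by measurable

definition pavg_err :: "nat \<Rightarrow> real ^ 2 \<Rightarrow> ennreal" where
  "pavg_err N x = (\<integral>\<^sup>+\<tau>. ennreal ((ring_avg A x \<tau> - pavg N A x \<tau>)\<^sup>2) \<partial>lborel)"

lemma borel_measurable_pavg_err [measurable]: "pavg_err N \<in> borel_measurable borel"
  unfolding pavg_err_def by measurable

text \<open>By Jensen the squared error is at most an average of squared translation differences
  with shifts s/2^N, s in [0, 1]; each is controlled by \<open>ring_diff\<close>.\<close>

lemma nn_integral_pavg_err:
  assumes fin: "emeasure lborel A < \<infinity>"
  shows "(\<integral>\<^sup>+x. pavg_err N x \<partial>lborel) \<le> ennreal (7 / 2 ^ N) * emeasure lborel A"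
proof -
  interpret ul: pair_sigma_finite unif "lborel :: real measure" ..
  interpret ul2: pair_sigma_finite unif "lborel :: (real ^ 2) measure" ..
  have "(\<integral>\<^sup>+x. pavg_err N x \<partial>lborel) \<le> (\<integral>\<^sup>+x. (\<integral>\<^sup>+\<tau>. (\<integral>\<^sup>+s. ennreal ((ring_avg A x \<tau> - ring_avg A x (\<tau> + s / 2 ^ N))\<^sup>2)
      \<partial>unif) \<partial>lborel) \<partial>lborel)"
    unfolding pavg_err_def
  proof (intro nn_integral_mono)
    fix x \<tau>
    have "ring_avg A x \<tau> - pavg N A x \<tau> = (LINT s|unif. ring_avg A x \<tau> - ring_avg A x (\<tau> + s / 2 ^ N))"
      unfolding pavg_def by (subst Bochner_Integration.integral_diff) (simp_all add: ring_avg_integrable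
          unif.prob_space[simplified])
    then show "ennreal ((ring_avg A x \<tau> - pavg N A x \<tau>)\<^sup>2) \<le> (\<integral>\<^sup>+s. ennreal ((ring_avg A x \<tau> - ring_avg A x (\<tau> + s / 2 ^
        N))\<^sup>2) \<partial>unif)"
      using unif_square_le[of "\<lambda>s. ring_avg A x \<tau> - ring_avg A x (\<tau> + s / 2 ^ N)"] ring_avg_diff_abs_le by simp
  qed
  also have "\<dots> = (\<integral>\<^sup>+x. (\<integral>\<^sup>+s. ring_sq (s / 2 ^ N) x \<partial>unif) \<partial>lborel)"
    unfolding ring_sq_def by (intro nn_integral_cong ul.Fubini') measurable
  also have "\<dots> = (\<integral>\<^sup>+s. (\<integral>\<^sup>+x. ring_sq (s / 2 ^ N) x \<partial>lborel) \<partial>unif)"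
    unfolding ring_sq_def by (rule ul2.Fubini') measurable
  also have "\<dots> \<le> (\<integral>\<^sup>+s. ennreal (7 / 2 ^ N) * emeasure lborel A \<partial>unif)"
  proof (rule nn_integral_mono_AE)
    show "AE s in unif. (\<integral>\<^sup>+x. ring_sq (s / 2 ^ N) x \<partial>lborel) \<le> ennreal (7 / 2 ^ N) * emeasure lborel A"
      using AE_unif
    proof eventually_elim
      case (elim s)
      have s1: "s / 2 ^ N \<le> 1 / 2 ^ N" using elim by (intro divide_right_mono) auto
      also have "1 / 2 ^ N \<le> (1::real)" by simp
      finally have "s / 2 ^ N \<le> 1" .
      then have "(\<integral>\<^sup>+x. ring_sq (s / 2 ^ N) x \<partial>lborel) \<le> ennreal (7 * (s / 2 ^ N)) * emeasure lborel A"
        unfolding ring_sq_def by (intro ring_diff[OF A fin]) (use elim in auto)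
      also have "\<dots> \<le> ennreal (7 / 2 ^ N) * emeasure lborel A"
        by (intro mult_right_mono ennreal_leI) (use s1 in auto)
      finally show ?case .
    qed
  qed
  also have "\<dots> = ennreal (7 / 2 ^ N) * emeasure lborel A" using unif.emeasure_space_1 by simp
  finally show ?thesis .
qed

lemma pavg_halves:
  "pavg N A x \<tau> = (pavg (Suc N) A x \<tau> + pavg (Suc N) A x (\<tau> + 1 / 2 ^ Suc N)) / 2"
proof -
  define g where "g s = ennreal (ring_avg A x (\<tau> + s / 2 ^ N))" for s
  have [measurable]: "g \<in> borel_measurable borel" unfolding g_def by measurable
  have h1: "(\<integral>\<^sup>+s\<in>{0..1/2}. g s \<partial>lborel) = ennreal (1 / 2) * ennreal (pavg (Suc N) A x \<tau>)"
  proof -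
    have "(\<integral>\<^sup>+s\<in>{0..1/2}. g s \<partial>lborel) = ennreal \<bar>1 / 2\<bar> * (\<integral>\<^sup>+s. g (0 + (1 / 2) * s) * indicator {0..1/2} (0 + (1 / 2)
        * s) \<partial>lborel)"
      by (rule nn_integral_real_affine) auto
    also have "(\<integral>\<^sup>+s. g (0 + (1 / 2) * s) * indicator {0..1/2} (0 + (1 / 2) * s) \<partial>lborel) = (\<integral>\<^sup>+s\<in>{0..1}. g (s / 2) \<partial>lborel)"
      by (intro nn_integral_cong) (auto split: split_indicator)
    also have "\<dots> = (\<integral>\<^sup>+s. g (s / 2) \<partial>unif)" by (rule nn_integral_unif[symmetric]) measurable
    also have "\<dots> = ennreal (pavg (Suc N) A x \<tau>)" unfolding ennreal_pavg g_def by simp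
    finally show ?thesis by simp
  qed
  have h2: "(\<integral>\<^sup>+s\<in>{1/2..1}. g s \<partial>lborel) = ennreal (1 / 2) * ennreal (pavg (Suc N) A x (\<tau> + 1 / 2 ^ Suc N))"
  proof -
    have "(\<integral>\<^sup>+s\<in>{1/2..1}. g s \<partial>lborel) = ennreal \<bar>1 / 2\<bar> * (\<integral>\<^sup>+s. g (1 / 2 + (1 / 2) * s) * indicator {1/2..1} (1 / 2 +
        (1 / 2) * s) \<partial>lborel)"
      by (rule nn_integral_real_affine) auto
    also have "(\<integral>\<^sup>+s. g (1 / 2 + (1 / 2) * s) * indicator {1/2..1} (1 / 2 + (1 / 2) * s) \<partial>lborel) = (\<integral>\<^sup>+s\<in>{0..1}. g (1 /
        2 + s / 2) \<partial>lborel)"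
      by (intro nn_integral_cong) (auto split: split_indicator)
    also have "\<dots> = (\<integral>\<^sup>+s. g (1 / 2 + s / 2) \<partial>unif)" by (rule nn_integral_unif[symmetric]) measurable
    also have "\<dots> = ennreal (pavg (Suc N) A x (\<tau> + 1 / 2 ^ Suc N))"
      unfolding ennreal_pavg g_def by (simp add: add_divide_distrib add.assoc)
    finally show ?thesis by simp
  qed
  have "ennreal (pavg N A x \<tau>) = (\<integral>\<^sup>+s\<in>{0..1}. g s \<partial>lborel)"
    unfolding ennreal_pavg g_def[symmetric] by (rule nn_integral_unif) measurable
  also have "\<dots> = (\<integral>\<^sup>+s. g s * indicator {0..1/2} s + g s * indicator {1/2..1} s \<partial>lborel)"
  proof (rule nn_integral_cong_AE)
    show "AE s in lborel. g s * indicator {0..1} s = g s * indicator {0..1/2} s + g s * indicator {1/2..1} s"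
      using AE_lborel_singleton[of "1 / 2"] by eventually_elim (auto split: split_indicator)
  qed
  also have "\<dots> = (\<integral>\<^sup>+s\<in>{0..1/2}. g s \<partial>lborel) + (\<integral>\<^sup>+s\<in>{1/2..1}. g s \<partial>lborel)"
    by (rule nn_integral_add) measurable
  also have "\<dots> = ennreal (1 / 2 * pavg (Suc N) A x \<tau> + 1 / 2 * pavg (Suc N) A x (\<tau> + 1 / 2 ^ Suc N))"
  proof -
    have "ennreal (1 / 2 * u + 1 / 2 * v) = ennreal (1 / 2) * ennreal u + ennreal (1 / 2) * ennreal v" if "0 \<le> u" "0 \<le>
        v" for u v :: real
      using that by (subst ennreal_plus, simp, simp) (subst (1 2) ennreal_mult, simp_all)
    then show ?thesis unfolding h1 h2 by (simp only: pavg_nonneg)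
  qed
  finally show ?thesis
    using pavg_nonneg by (subst (asm) ennreal_inj) (auto intro!: add_nonneg_nonneg)
qed

text \<open>By \<open>pavg_halves\<close> the difference of consecutive means is half the difference
  of the means over the two halves, which is a mean of translation differences by \<epsilon>. The
  factor 1/4 after squaring is given away.\<close>

lemma pavg_Suc_diff:
  fixes N x \<tau>
  defines "\<epsilon> \<equiv> 1 / 2 ^ Suc N"
  shows "ennreal ((pavg (Suc N) A x \<tau> - pavg N A x \<tau>)\<^sup>2) \<le> (\<integral>\<^sup>+s. ennreal ((ring_avg A x (\<tau> + s * \<epsilon>) - ring_avg A x (\<tau> +
      s * \<epsilon> + \<epsilon>))\<^sup>2) \<partial>unif)"
proof -
  let ?f = "\<lambda>s. ring_avg A x (\<tau> + s * \<epsilon>) - ring_avg A x (\<tau> + s * \<epsilon> + \<epsilon>)"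
  have sN: "s * \<epsilon> = s / 2 ^ Suc N" for s by (simp add: \<epsilon>_def)
  have "pavg (Suc N) A x \<tau> - pavg N A x \<tau> = (pavg (Suc N) A x \<tau> - pavg (Suc N) A x (\<tau> + \<epsilon>)) / 2"
    unfolding pavg_halves[of N] \<epsilon>_def by (simp add: field_simps)
  also have "pavg (Suc N) A x \<tau> - pavg (Suc N) A x (\<tau> + \<epsilon>) = (LINT s|unif. ?f s)"
    unfolding pavg_def sN by (subst Bochner_Integration.integral_diff) (use ring_avg_integrable[of x "\<tau> + \<epsilon>" "2 ^ Suc
        N"] ring_avg_integrable in \<open>simp_all add: add_ac\<close>)
  finally have eq: "pavg (Suc N) A x \<tau> - pavg N A x \<tau> = (LINT s|unif. ?f s) / 2" .
  have "(pavg (Suc N) A x \<tau> - pavg N A x \<tau>)\<^sup>2 = (LINT s|unif. ?f s)\<^sup>2 / 4" unfolding eq by (simp add: power_divide)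
  also have "\<dots> \<le> (LINT s|unif. ?f s)\<^sup>2" by simp
  finally have "ennreal ((pavg (Suc N) A x \<tau> - pavg N A x \<tau>)\<^sup>2) \<le> ennreal ((LINT s|unif. ?f s)\<^sup>2)" by (rule ennreal_leI)
  also have "\<dots> \<le> (\<integral>\<^sup>+s. ennreal ((?f s)\<^sup>2) \<partial>unif)" by (rule unif_square_le) (simp_all add: ring_avg_diff_abs_le)
  finally show ?thesis .
qed

text \<open>A mean over an interval of length \<epsilon> is at most 1/\<epsilon> times the integral
  over the line. This supremum bound, next to the mean-square bound \<open>pavg_Suc_diff_L2\<close>,
  is what exponents above 2 need.\<close>

lemma pavg_Suc_diff_sup:
  "ennreal ((pavg (Suc N) A x \<tau> - pavg N A x \<tau>)\<^sup>2) \<le> ennreal (2 ^ Suc N) * ring_sq (1 / 2 ^ Suc N) x"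
proof -
  define \<epsilon> :: real where "\<epsilon> = 1 / 2 ^ Suc N"
  define f where "f t = ennreal ((ring_avg A x t - ring_avg A x (t + \<epsilon>))\<^sup>2)" for t
  have [measurable]: "f \<in> borel_measurable borel" unfolding f_def by measurable
  have "ennreal ((pavg (Suc N) A x \<tau> - pavg N A x \<tau>)\<^sup>2) \<le> (\<integral>\<^sup>+s. f (\<tau> + s * \<epsilon>) \<partial>unif)"
    unfolding f_def \<epsilon>_def by (rule pavg_Suc_diff)
  also have "\<dots> = (\<integral>\<^sup>+s\<in>{0..1}. f (\<tau> + s * \<epsilon>) \<partial>lborel)" by (rule nn_integral_unif) measurable
  also have "\<dots> \<le> (\<integral>\<^sup>+s. f (\<tau> + \<epsilon> * s) \<partial>lborel)" by (rule nn_integral_mono) (simp add: mult.commute split: split_indicator)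
  also have "\<dots> = ennreal (2 ^ Suc N) * (ennreal \<bar>\<epsilon>\<bar> * (\<integral>\<^sup>+s. f (\<tau> + \<epsilon> * s) \<partial>lborel))"
  proof -
    have "ennreal (2 ^ Suc N) * ennreal \<bar>\<epsilon>\<bar> = ennreal (2 ^ Suc N * \<bar>\<epsilon>\<bar>)" by (rule ennreal_mult[symmetric]) auto
    also have "2 ^ Suc N * \<bar>\<epsilon>\<bar> = 1" by (simp add: \<epsilon>_def)
    finally show ?thesis by (simp add: mult.assoc[symmetric])
  qed
  also have "ennreal \<bar>\<epsilon>\<bar> * (\<integral>\<^sup>+s. f (\<tau> + \<epsilon> * s) \<partial>lborel) = (\<integral>\<^sup>+t. f t \<partial>lborel)"
    by (rule nn_integral_real_affine[symmetric]) (auto simp: \<epsilon>_def)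
  finally show ?thesis by (simp add: f_def ring_sq_def \<epsilon>_def)
qed

lemma pavg_Suc_diff_L2:
  "(\<integral>\<^sup>+\<tau>. ennreal ((pavg (Suc N) A x \<tau> - pavg N A x \<tau>)\<^sup>2) \<partial>lborel) \<le> ring_sq (1 / 2 ^ Suc N) x"
proof -
  interpret ul: pair_sigma_finite unif "lborel :: real measure" ..
  define \<epsilon> :: real where "\<epsilon> = 1 / 2 ^ Suc N"
  define f where "f t = ennreal ((ring_avg A x t - ring_avg A x (t + \<epsilon>))\<^sup>2)" for t
  have [measurable]: "f \<in> borel_measurable borel" unfolding f_def by measurable
  have "(\<integral>\<^sup>+\<tau>. ennreal ((pavg (Suc N) A x \<tau> - pavg N A x \<tau>)\<^sup>2) \<partial>lborel) \<le> (\<integral>\<^sup>+\<tau>. (\<integral>\<^sup>+s. f (\<tau> + s * \<epsilon>) \<partial>unif) \<partial>lborel)"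
    unfolding f_def \<epsilon>_def by (intro nn_integral_mono pavg_Suc_diff)
  also have "\<dots> = (\<integral>\<^sup>+s. (\<integral>\<^sup>+\<tau>. f (\<tau> + s * \<epsilon>) \<partial>lborel) \<partial>unif)" by (rule ul.Fubini') measurable
  also have "\<dots> = (\<integral>\<^sup>+s. (\<integral>\<^sup>+\<tau>. f \<tau> \<partial>lborel) \<partial>unif)"
  proof (rule nn_integral_cong)
    fix s :: real
    have "(\<integral>\<^sup>+\<tau>. f \<tau> \<partial>lborel) = ennreal \<bar>1\<bar> * (\<integral>\<^sup>+\<tau>. f (s * \<epsilon> + 1 * \<tau>) \<partial>lborel)" by (rule nn_integral_real_affine) auto
    then show "(\<integral>\<^sup>+\<tau>. f (\<tau> + s * \<epsilon>) \<partial>lborel) = (\<integral>\<^sup>+\<tau>. f \<tau> \<partial>lborel)" by (simp add: add.commute)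
  qed
  also have "\<dots> = (\<integral>\<^sup>+\<tau>. f \<tau> \<partial>lborel)" using unif.emeasure_space_1 by simp
  finally show ?thesis by (simp add: f_def ring_sq_def \<epsilon>_def)
qed

text \<open>The substitution u = e^\<tau> turns the left side into 1/pi times the measure of A in
  the closed disc of squared radius e^c. The 4 comes from passing to the open ball of twice the
  radius, for which the maximal function is defined.\<close>

lemma nn_integral_exp_cavg:
  "(\<integral>\<^sup>+\<tau>\<in>{..c}. ennreal (ring_avg A x \<tau> * exp \<tau>) \<partial>lborel) \<le> ennreal (4 * hl_max A x * exp c)"
proof -
  define f where "f u = cavg (indicator A) x u" for u
  have [measurable]: "f \<in> borel_measurable borel" unfolding f_def by measurable
  have le: "(\<integral>\<^sup>+\<tau>. ennreal (ring_avg A x \<tau> * exp \<tau>) * indicator {c - real (Suc n)..c} \<tau> \<partial>lborel) \<le> (\<integral>\<^sup>+u\<in>{0<..exp c}. f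
      u \<partial>lborel)" for n
  proof -
    have "(\<integral>\<^sup>+\<tau>. ennreal (ring_avg A x \<tau> * exp \<tau>) * indicator {c - real (Suc n)..c} \<tau> \<partial>lborel)
      = (\<integral>\<^sup>+\<tau>. f (exp \<tau>) * ennreal (exp \<tau>) * indicator {c - real (Suc n)..c} \<tau> \<partial>lborel)"
      by (simp add: ennreal_mult ennreal_ring_avg f_def)
    also have "\<dots> = (\<integral>\<^sup>+u. f u * indicator {exp (c - real (Suc n))..exp c} u \<partial>lborel)"
      by (rule nn_integral_substitution_aux[symmetric]) (auto intro!: derivative_eq_intros continuous_intros)
    also have "\<dots> \<le> (\<integral>\<^sup>+u\<in>{0<..exp c}. f u \<partial>lborel)"
    proof (rule nn_integral_mono)
      fix u
      have "u \<in> {0<..exp c}" if "u \<in> {exp (c - real (Suc n))..exp c}"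
        using that exp_gt_zero[of "c - real (Suc n)"] unfolding atLeastAtMost_iff greaterThanAtMost_iff by linarith
      then show "f u * indicator {exp (c - real (Suc n))..exp c} u \<le> f u * indicator {0<..exp c} u"
        by (simp split: split_indicator)
    qed
    finally show ?thesis .
  qed
  have "(\<integral>\<^sup>+\<tau>\<in>{..c}. ennreal (ring_avg A x \<tau> * exp \<tau>) \<partial>lborel) = (\<integral>\<^sup>+\<tau>. (SUP n. ennreal (ring_avg A x \<tau> * exp \<tau>) *
      indicator {c - real (Suc n)..c} \<tau>) \<partial>lborel)"
  proof (intro nn_integral_cong antisym)
    fix \<tau>
    show "ennreal (ring_avg A x \<tau> * exp \<tau>) * indicator {..c} \<tau> \<le> (SUP n. ennreal (ring_avg A x \<tau> * exp \<tau>) * indicator {c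
        - real (Suc n)..c} \<tau>)"
    proof (cases "\<tau> \<le> c")
      case True
      obtain n where "c - \<tau> \<le> real n" using real_arch_simple by blast
      then have "\<tau> \<in> {c - real (Suc n)..c}" using True by simp
      then show ?thesis using True by (intro SUP_upper2[of n]) auto
    qed simp
  qed (auto intro!: SUP_least split: split_indicator)
  also have "\<dots> = (SUP n. \<integral>\<^sup>+\<tau>. ennreal (ring_avg A x \<tau> * exp \<tau>) * indicator {c - real (Suc n)..c} \<tau> \<partial>lborel)"
    by (rule nn_integral_monotone_convergence_SUP)
       (auto simp: incseq_Suc_iff le_fun_def intro!: mult_left_mono split: split_indicator)
  also have "\<dots> \<le> (\<integral>\<^sup>+u\<in>{0<..exp c}. f u \<partial>lborel)" by (rule SUP_least) (rule le)
  also have "\<dots> \<le> ennreal (4 * hl_max A x * exp c)"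
  proof -
    define r where "r = exp (c / 2)"
    have r: "r > 0" "r\<^sup>2 = exp c" by (simp_all add: r_def power2_eq_square exp_add[symmetric])
    define h where "h z = (indicator A (x + (-1) *\<^sub>R z) * indicator {..r} (norm z) :: ennreal)" for z
    have [measurable]: "h \<in> borel_measurable borel" unfolding h_def by measurable
    have "ennreal pi * (\<integral>\<^sup>+u\<in>{0<..exp c}. f u \<partial>lborel) = ennreal pi * (\<integral>\<^sup>+u\<in>{0<..}. (\<integral>\<^sup>+\<theta>. h (sqrt u *\<^sub>R cis2 \<theta>) \<partial>circ) \<partial>lborel)"
    proof (intro arg_cong[where f = "\<lambda>y. ennreal pi * y"] nn_integral_cong)
      fix u :: real
      show "f u * indicator {0<..exp c} u = (\<integral>\<^sup>+\<theta>. h (sqrt u *\<^sub>R cis2 \<theta>) \<partial>circ) * indicator {0<..} u"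
      proof (cases "u > 0")
        case True
        have "sqrt u \<le> r \<longleftrightarrow> u \<le> exp c" using r True by (metis real_sqrt_le_iff real_sqrt_unique less_imp_le)
        then have "h (sqrt u *\<^sub>R cis2 \<theta>) = indicator A (x - sqrt u *\<^sub>R cis2 \<theta>) * indicator {..exp c} u" for \<theta>
          using True by (simp add: h_def indicator_def)
        then have "(\<integral>\<^sup>+\<theta>. h (sqrt u *\<^sub>R cis2 \<theta>) \<partial>circ) = f u * indicator {..exp c} u"
          unfolding f_def cavg_def by (simp add: nn_integral_multc)
        then show ?thesis using True by (simp add: indicator_def)
      qed simp
    qed
    also have "\<dots> = (\<integral>\<^sup>+z. h z \<partial>lborel)" by (rule nn_integral_polar2[symmetric]) measurable
    also have "\<dots> \<le> (\<integral>\<^sup>+z. indicator (A \<inter> ball x (2 * r)) (x + (-1) *\<^sub>R z) \<partial>lborel)"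
      by (rule nn_integral_mono) (use r in \<open>auto simp: h_def indicator_def dist_norm\<close>)
    also have "\<dots> = emeasure lborel (A \<inter> ball x (2 * r))"
    proof -
      have "(\<integral>\<^sup>+y. indicator (A \<inter> ball x (2 * r)) y \<partial>lborel) = ennreal (\<bar>-1\<bar> ^ DIM(real ^ 2)) * (\<integral>\<^sup>+z. indicator (A \<inter>
          ball x (2 * r)) (x + (-1) *\<^sub>R z) \<partial>lborel)"
        by (rule nn_integral_affine) (rule borel_measurable_indicator, simp_all)
      then show ?thesis by simp
    qed
    also have "\<dots> = ennreal (measure lborel (A \<inter> ball x (2 * r)))"
      using finite_lborel_Int_ball[OF A, of x "2 * r"] by (simp add: emeasure_eq_measure2)
    also have "\<dots> \<le> ennreal (hl_max A x * (pi * (4 * exp c)))"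
    proof (rule ennreal_leI)
      have "measure lborel (ball x (2 * r)) = pi * (4 * exp c)"
      proof -
        have "measure lborel (ball x (2 * r)) = unit_ball_vol 2 * (2 * r) ^ 2"
          using content_ball[of "2 * r" x] r by (simp add: measure_completion)
        then show ?thesis by (simp add: unit_ball_vol_numeral power_mult_distrib r)
      qed
      then show "measure lborel (A \<inter> ball x (2 * r)) \<le> hl_max A x * (pi * (4 * exp c))"
        using measure_Int_ball_le_hl_max[OF A, of "2 * r" x] r by simp
    qed
    also have "\<dots> = ennreal pi * ennreal (4 * hl_max A x * exp c)"
      using hl_max_nonneg[OF A, of x] by (subst ennreal_mult[symmetric]) (auto simp: mult_ac)
    finally show ?thesis by (simp add: ennreal_mult_le_mult_iff)
  qed
  finally show ?thesis .
qed

lemma nn_integral_exp_measure_ring_avg: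
  "(\<integral>\<^sup>+\<tau>. ennreal (ring_avg A x \<tau>) \<partial>exp_measure T) \<le> ennreal (4 * hl_max A x)"
proof -
  have "(\<integral>\<^sup>+\<tau>. ennreal (ring_avg A x \<tau>) \<partial>exp_measure T) = (\<integral>\<^sup>+\<tau>. ennreal (exp (- T)) * (ennreal (ring_avg A x \<tau> * exp \<tau>)
      * indicator {..T} \<tau>) \<partial>lborel)"
    unfolding nn_integral_exp_measure[OF borel_measurable_ennreal_ring_avg]
    by (intro nn_integral_cong) (simp add: ennreal_mult[symmetric] exp_diff exp_minus field_simps split: split_indicator)
  also have "\<dots> = ennreal (exp (- T)) * (\<integral>\<^sup>+\<tau>\<in>{..T}. ennreal (ring_avg A x \<tau> * exp \<tau>) \<partial>lborel)"
    by (rule nn_integral_cmult) measurable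
  also have "\<dots> \<le> ennreal (exp (- T)) * ennreal (4 * hl_max A x * exp T)"
    by (rule mult_left_mono[OF nn_integral_exp_cavg]) simp
  also have "\<dots> = ennreal (4 * hl_max A x)"
    using hl_max_nonneg[OF A, of x] by (subst ennreal_mult[symmetric]) (simp_all add: exp_minus)
  finally show ?thesis .
qed

text \<open>A translation of \<tau> by b changes \<open>exp_measure T\<close> into
  \<open>exp_measure (T + b)\<close>, and the bound for the unsmoothed average does not depend on
  T.\<close>

lemma nn_integral_exp_measure_pavg:
  "(\<integral>\<^sup>+\<tau>. ennreal (pavg N A x \<tau>) \<partial>exp_measure T) \<le> ennreal (4 * hl_max A x)"
proof -
  interpret ul: pair_sigma_finite unif "lborel :: real measure" ..
  define f where "f \<tau> = ennreal (ring_avg A x \<tau>)" for \<tau>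
  have [measurable]: "f \<in> borel_measurable borel" unfolding f_def by measurable
  have "(\<integral>\<^sup>+\<tau>. ennreal (pavg N A x \<tau>) \<partial>exp_measure T) = (\<integral>\<^sup>+\<tau>. (\<integral>\<^sup>+s. f (\<tau> + s / 2 ^ N) \<partial>unif) * ennreal (exp (\<tau> - T) *
      indicator {..T} \<tau>) \<partial>lborel)"
    unfolding f_def ennreal_pavg by (rule nn_integral_exp_measure) measurable
  also have "\<dots> = (\<integral>\<^sup>+\<tau>. (\<integral>\<^sup>+s. f (\<tau> + s / 2 ^ N) * ennreal (exp (\<tau> - T) * indicator {..T} \<tau>) \<partial>unif) \<partial>lborel)"
    by (intro nn_integral_cong nn_integral_multc[symmetric]) measurable
  also have "\<dots> = (\<integral>\<^sup>+s. (\<integral>\<^sup>+\<tau>. f (\<tau> + s / 2 ^ N) * ennreal (exp (\<tau> - T) * indicator {..T} \<tau>) \<partial>lborel) \<partial>unif)"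
    by (rule ul.Fubini') measurable
  also have "\<dots> \<le> (\<integral>\<^sup>+s. ennreal (4 * hl_max A x) \<partial>unif)"
  proof (rule nn_integral_mono)
    fix s :: real
    define b where "b = s / 2 ^ N"
    have "(\<integral>\<^sup>+\<tau>. f \<tau> \<partial>exp_measure (T + b)) = (\<integral>\<^sup>+\<tau>. f \<tau> * ennreal (exp (\<tau> - (T + b)) * indicator {..T + b} \<tau>) \<partial>lborel)"
      by (rule nn_integral_exp_measure) measurable
    also have "\<dots> = ennreal \<bar>1\<bar> * (\<integral>\<^sup>+\<tau>. f (b + 1 * \<tau>) * ennreal (exp ((b + 1 * \<tau>) - (T + b)) * indicator {..T + b} (b +
        1 * \<tau>)) \<partial>lborel)"
      by (rule nn_integral_real_affine) auto
    also have "\<dots> = (\<integral>\<^sup>+\<tau>. f (\<tau> + b) * ennreal (exp (\<tau> - T) * indicator {..T} \<tau>) \<partial>lborel)"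
      by (simp add: add.commute indicator_def)
    finally show "(\<integral>\<^sup>+\<tau>. f (\<tau> + s / 2 ^ N) * ennreal (exp (\<tau> - T) * indicator {..T} \<tau>) \<partial>lborel) \<le> ennreal (4 * hl_max A x)"
      using nn_integral_exp_measure_ring_avg[where x = x and T = "T + b"] by (simp add: f_def b_def)
  qed
  also have "\<dots> = ennreal (4 * hl_max A x)" using unif.emeasure_space_1 by simp
  finally show ?thesis .
qed

text \<open>The interval of averaging lies in [\<tau>, \<tau> + 1], where
  \<open>exp_measure (\<tau> + 1)\<close> has density at least 1/e. Normalising by the length of the
  interval costs 2^N.\<close>

lemma pavg_le_hl_max: "pavg N A x \<tau> \<le> 4 * exp 1 * 2 ^ N * hl_max A x"
proof -
  define g where "g t = ennreal (ring_avg A x t * indicator {\<tau>..\<tau> + 1} t)" for t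
  have [measurable]: "g \<in> borel_measurable borel" unfolding g_def by measurable
  have "ennreal (pavg N A x \<tau>) = (\<integral>\<^sup>+s\<in>{0..1}. ennreal (ring_avg A x (\<tau> + s / 2 ^ N)) \<partial>lborel)"
    unfolding ennreal_pavg by (rule nn_integral_unif) measurable
  also have "\<dots> \<le> (\<integral>\<^sup>+s. g (\<tau> + (1 / 2 ^ N) * s) \<partial>lborel)"
  proof (rule nn_integral_mono)
    fix s :: real
    have "s / 2 ^ N \<le> 1 \<and> 0 \<le> s / 2 ^ N" if "0 \<le> s" "s \<le> 1"
    proof -
      have "s \<le> 2 ^ N" using that(2) one_le_power[of "2::real" N] by linarith
      then show ?thesis using that by simp
    qed
    then show "ennreal (ring_avg A x (\<tau> + s / 2 ^ N)) * indicator {0..1} s \<le> g (\<tau> + (1 / 2 ^ N) * s)"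
      by (auto simp: g_def split: split_indicator)
  qed
  also have "\<dots> = ennreal (2 ^ N) * (ennreal \<bar>1 / 2 ^ N\<bar> * (\<integral>\<^sup>+s. g (\<tau> + (1 / 2 ^ N) * s) \<partial>lborel))"
  proof -
    have "ennreal (2 ^ N) * ennreal \<bar>1 / 2 ^ N\<bar> = ennreal (2 ^ N * \<bar>1 / 2 ^ N\<bar>)" by (rule ennreal_mult[symmetric]) auto
    also have "2 ^ N * \<bar>1 / 2 ^ N\<bar> = (1::real)" by simp
    finally show ?thesis by (simp add: mult.assoc[symmetric])
  qed
  also have "ennreal \<bar>1 / 2 ^ N\<bar> * (\<integral>\<^sup>+s. g (\<tau> + (1 / 2 ^ N) * s) \<partial>lborel) = (\<integral>\<^sup>+t. g t \<partial>lborel)"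
    by (rule nn_integral_real_affine[symmetric]) auto
  also have "(\<integral>\<^sup>+t. g t \<partial>lborel) \<le> (\<integral>\<^sup>+t. ennreal (exp 1) * (ennreal (ring_avg A x t) * ennreal (exp (t - (\<tau> + 1)) *
      indicator {..\<tau> + 1} t)) \<partial>lborel)"
  proof (rule nn_integral_mono)
    fix t
    show "g t \<le> ennreal (exp 1) * (ennreal (ring_avg A x t) * ennreal (exp (t - (\<tau> + 1)) * indicator {..\<tau> + 1} t))"
    proof (cases "t \<in> {\<tau>..\<tau> + 1}")
      case True
      have "ring_avg A x t * 1 \<le> ring_avg A x t * exp (t - \<tau>)" using True by (intro mult_left_mono) auto
      also have "\<dots> = exp 1 * (ring_avg A x t * exp (t - (\<tau> + 1)))" by (simp add: exp_diff exp_add field_simps)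
      finally have "ennreal (ring_avg A x t) \<le> ennreal (exp 1 * (ring_avg A x t * exp (t - (\<tau> + 1))))" by (intro ennreal_leI) simp
      then show ?thesis using True by (simp add: g_def ennreal_mult)
    qed (simp add: g_def)
  qed
  also have "\<dots> = ennreal (exp 1) * (\<integral>\<^sup>+t. ennreal (ring_avg A x t) \<partial>exp_measure (\<tau> + 1))"
    unfolding nn_integral_exp_measure[OF borel_measurable_ennreal_ring_avg] by (rule nn_integral_cmult) measurable
  also have "\<dots> \<le> ennreal (exp 1) * ennreal (4 * hl_max A x)"
    by (rule mult_left_mono[OF nn_integral_exp_measure_ring_avg]) simp
  finally have "ennreal (pavg N A x \<tau>) \<le> ennreal (2 ^ N) * (ennreal (exp 1) * ennreal (4 * hl_max A x))"
    by (simp add: mult_left_mono)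
  also have "\<dots> = ennreal (4 * exp 1 * 2 ^ N * hl_max A x)"
    using hl_max_nonneg[OF A, of x] by (simp add: ennreal_mult[symmetric] mult_ac)
  finally show ?thesis using hl_max_nonneg[OF A, of x] by (subst (asm) ennreal_le_iff) auto
qed

end

section \<open>Power means of circular averages away from exceptional sets\<close>

section \<open>Powers of circular averages\<close>

lemma nn_integral_le_add3:
  fixes f g e F :: "real \<Rightarrow> real"
  assumes [measurable]: "f \<in> borel_measurable M" "g \<in> borel_measurable M" "e \<in> borel_measurable M"
    and nn: "\<And>\<tau>. 0 \<le> f \<tau>" "\<And>\<tau>. 0 \<le> g \<tau>" "\<And>\<tau>. 0 \<le> e \<tau>" and K: "0 \<le> K" and abc: "0 \<le> a" "0 \<le> b" "0 \<le> c"
    and F: "\<And>\<tau>. F \<tau> \<le> K * (f \<tau> + g \<tau> + e \<tau>)"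
    and le: "(\<integral>\<^sup>+\<tau>. ennreal (f \<tau>) \<partial>M) \<le> ennreal a" "(\<integral>\<^sup>+\<tau>. ennreal (g \<tau>) \<partial>M) \<le> ennreal b" "(\<integral>\<^sup>+\<tau>. ennreal (e \<tau>) \<partial>M) \<le> ennreal c"
  shows "(\<integral>\<^sup>+\<tau>. ennreal (F \<tau>) \<partial>M) \<le> ennreal (K * (a + b + c))"
proof -
  have "(\<integral>\<^sup>+\<tau>. ennreal (F \<tau>) \<partial>M) \<le> (\<integral>\<^sup>+\<tau>. ennreal K * (ennreal (f \<tau>) + ennreal (g \<tau>) + ennreal (e \<tau>)) \<partial>M)"
  proof (rule nn_integral_mono)
    fix \<tau>
    have "ennreal (F \<tau>) \<le> ennreal (K * (f \<tau> + g \<tau> + e \<tau>))" by (rule ennreal_leI[OF F])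
    also have "\<dots> = ennreal K * (ennreal (f \<tau>) + ennreal (g \<tau>) + ennreal (e \<tau>))"
      using nn K by (simp add: ennreal_mult ennreal_plus)
    finally show "ennreal (F \<tau>) \<le> ennreal K * (ennreal (f \<tau>) + ennreal (g \<tau>) + ennreal (e \<tau>))" .
  qed
  also have "\<dots> = ennreal K * ((\<integral>\<^sup>+\<tau>. ennreal (f \<tau>) \<partial>M) + (\<integral>\<^sup>+\<tau>. ennreal (g \<tau>) \<partial>M) + (\<integral>\<^sup>+\<tau>. ennreal (e \<tau>) \<partial>M))"
    by (subst nn_integral_cmult, measurable, subst nn_integral_add, measurable, subst nn_integral_add, measurable)
  also have "\<dots> \<le> ennreal K * (ennreal a + ennreal b + ennreal c)" by (intro mult_left_mono add_mono le) simp
  also have "\<dots> = ennreal (K * (a + b + c))" using abc K by (simp add: ennreal_mult ennreal_plus)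
  finally show ?thesis .
qed

lemma nn_integral_le_sum:
  fixes g :: "nat \<Rightarrow> real \<Rightarrow> real" and F :: "real \<Rightarrow> real"
  assumes [measurable]: "\<And>j. g j \<in> borel_measurable M"
    and nn: "\<And>j \<tau>. 0 \<le> g j \<tau>" "\<And>j. 0 \<le> b j" "0 \<le> K"
    and F: "\<And>\<tau>. F \<tau> \<le> K * (\<Sum>j<n. g j \<tau>)"
    and le: "\<And>j. j < n \<Longrightarrow> (\<integral>\<^sup>+\<tau>. ennreal (g j \<tau>) \<partial>M) \<le> ennreal (b j)"
  shows "(\<integral>\<^sup>+\<tau>. ennreal (F \<tau>) \<partial>M) \<le> ennreal (K * (\<Sum>j<n. b j))"
proof -
  have "(\<integral>\<^sup>+\<tau>. ennreal (F \<tau>) \<partial>M) \<le> (\<integral>\<^sup>+\<tau>. ennreal K * (\<Sum>j<n. ennreal (g j \<tau>)) \<partial>M)"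
  proof (rule nn_integral_mono)
    fix \<tau>
    have "ennreal (F \<tau>) \<le> ennreal (K * (\<Sum>j<n. g j \<tau>))" by (rule ennreal_leI[OF F])
    also have "\<dots> = ennreal K * (\<Sum>j<n. ennreal (g j \<tau>))"
      using nn by (simp add: ennreal_mult sum_nonneg)
    finally show "ennreal (F \<tau>) \<le> ennreal K * (\<Sum>j<n. ennreal (g j \<tau>))" .
  qed
  also have "\<dots> = ennreal K * (\<Sum>j<n. \<integral>\<^sup>+\<tau>. ennreal (g j \<tau>) \<partial>M)"
    by (subst nn_integral_cmult, measurable, subst nn_integral_sum, measurable)
  also have "\<dots> \<le> ennreal K * (\<Sum>j<n. ennreal (b j))" by (intro mult_left_mono sum_mono le) auto
  also have "\<dots> = ennreal (K * (\<Sum>j<n. b j))" using nn by (simp add: ennreal_mult sum_nonneg)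
  finally show ?thesis .
qed

lemma powr_add3_le:
  fixes u v w q :: real
  assumes "0 \<le> u" "0 \<le> v" "0 \<le> w" "0 \<le> q"
  shows "(u + v + w) powr q \<le> 3 powr q * (u powr q + v powr q + w powr q)"
proof -
  define m where "m = max u (max v w)"
  have m: "0 \<le> m" "u + v + w \<le> 3 * m" using assms by (auto simp: m_def)
  have "(u + v + w) powr q \<le> (3 * m) powr q" using assms m by (intro powr_mono2) auto
  also have "\<dots> = 3 powr q * m powr q" using m by (simp add: powr_mult)
  also have "\<dots> \<le> 3 powr q * (u powr q + v powr q + w powr q)"
    by (intro mult_left_mono) (auto simp: m_def max_def)
  finally show ?thesis .
qed

text \<open>The sum of the \<open>d j\<close> is at most S times the largest ratio
  \<open>d j / w j\<close>, and the power of the largest ratio is one of the terms on the right.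
  With summable weights this replaces Minkowski's inequality for the chain of scales.\<close>

lemma powr_sum_le_weighted:
  fixes d w :: "nat \<Rightarrow> real"
  assumes d: "\<And>j. 0 \<le> d j" and w: "\<And>j. 0 < w j" and S: "(\<Sum>j<n. w j) \<le> S" and q: "0 < q"
  shows "(\<Sum>j<n. d j) powr q \<le> S powr q * (\<Sum>j<n. (d j / w j) powr q)"
proof (cases "n = 0")
  case False
  define m where "m = Max ((\<lambda>j. d j / w j) ` {..<n})"
  have "m \<in> (\<lambda>j. d j / w j) ` {..<n}" unfolding m_def using False by (intro Max_in) auto
  then obtain i where i: "i < n" "m = d i / w i" by auto
  have le: "d j / w j \<le> m" if "j < n" for j unfolding m_def using that by (intro Max_ge) auto
  have m0: "0 \<le> m" using i d[of i] w[of i] by simp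
  have "(\<Sum>j<n. d j) \<le> (\<Sum>j<n. w j * m)"
  proof (rule sum_mono)
    fix j assume "j \<in> {..<n}"
    then have "d j / w j \<le> m" using le by simp
    then show "d j \<le> w j * m" using w[of j] by (simp add: field_simps)
  qed
  also have "\<dots> = (\<Sum>j<n. w j) * m" by (simp add: sum_distrib_right)
  also have "\<dots> \<le> S * m" by (rule mult_right_mono[OF S m0])
  finally have 1: "(\<Sum>j<n. d j) \<le> S * m" .
  have S0: "0 \<le> S" using sum_nonneg[of "{..<n}" w] w S by (meson less_imp_le order_trans)
  have "(\<Sum>j<n. d j) powr q \<le> (S * m) powr q" using 1 d q by (intro powr_mono2) (auto intro: sum_nonneg)
  also have "\<dots> = S powr q * m powr q" using S0 m0 by (simp add: powr_mult)
  also have "\<dots> \<le> S powr q * (\<Sum>j<n. (d j / w j) powr q)"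
    unfolding i(2) by (intro mult_left_mono member_le_sum) (use i in auto)
  finally show ?thesis .
qed simp

lemma sum_powr_geometric_le:
  fixes c :: real
  assumes "0 < c"
  shows "(\<Sum>j<n. 2 powr (- (c * real j))) \<le> 1 / (1 - 2 powr (- c))"
proof -
  define r :: real where "r = 2 powr (- c)"
  have r: "0 < r" "r < 1" using assms powr_less_mono[of "- c" 0 2] by (auto simp: r_def)
  have "2 powr (- (c * real j)) = r ^ j" for j
    by (simp add: r_def powr_realpow[symmetric] powr_powr)
  then have "(\<Sum>j<n. 2 powr (- (c * real j))) = (\<Sum>j<n. r ^ j)" by simp
  also have "\<dots> \<le> suminf (\<lambda>j. r ^ j)" using r by (intro sum_le_suminf summable_geometric) auto
  also have "\<dots> = 1 / (1 - r)" using r by (intro suminf_geometric) auto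
  finally show ?thesis by (simp add: r_def)
qed

text \<open>Interpolation between L^1 and L^2 by a threshold: below \<delta> the first term
  suffices, above \<delta> the second.\<close>

lemma powr_le_linear_quadratic:
  fixes b \<delta> q :: real
  assumes "0 \<le> b" "0 < \<delta>" "1 \<le> q" "q \<le> 2"
  shows "b powr q \<le> \<delta> powr (q - 1) * b + \<delta> powr (q - 2) * b\<^sup>2"
proof (cases "b = 0")
  case False
  then have b: "b > 0" using assms by simp
  show ?thesis
  proof (cases "b \<le> \<delta>")
    case True
    have "b powr q = b powr (q - 1) * b" using b by (simp add: powr_diff)
    also have "\<dots> \<le> \<delta> powr (q - 1) * b" using True b assms by (intro mult_right_mono powr_mono2) auto
    finally show ?thesis by (simp add: add_increasing2)
  next
    case False
    have "b powr q = b powr (q - 2) * b\<^sup>2" using b by (simp add: powr_diff)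
    also have "\<dots> \<le> \<delta> powr (q - 2) * b\<^sup>2" using False b assms by (intro mult_right_mono powr_mono2') auto
    finally show ?thesis using b by (simp add: add_increasing)
  qed
qed simp

lemma emeasure_Markov_less:
  assumes [measurable]: "f \<in> borel_measurable borel"
    and I: "(\<integral>\<^sup>+x. f x \<partial>lborel) \<le> ennreal I" "0 \<le> I" and c: "0 < c"
  shows "emeasure lborel {x. ennreal c < f x} \<le> ennreal (I / c)"
proof -
  have S: "{x. ennreal c < f x} \<in> sets lborel"
    using measurable_sets[of f lborel borel "{ennreal c<..}"] by (simp add: vimage_def)
  have "ennreal c * emeasure lborel {x. ennreal c < f x} = (\<integral>\<^sup>+x. ennreal c * indicator {x. ennreal c < f x} x \<partial>lborel)"
    by (rule nn_integral_cmult_indicator[OF S, symmetric])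
  also have "\<dots> \<le> (\<integral>\<^sup>+x. f x \<partial>lborel)" by (rule nn_integral_mono) (auto split: split_indicator)
  also have "\<dots> \<le> ennreal (c * (I / c))" using I c by simp
  also have "\<dots> = ennreal c * ennreal (I / c)" using I c by (simp only: ennreal_mult less_imp_le divide_nonneg_pos)
  finally show ?thesis using c by (subst (asm) ennreal_mult_le_mult_iff) auto
qed

text \<open>Integer endpoints make the supremum countable and hence measurable. A real endpoint is
  compared with the next integer at the cost of a factor e in
  \<open>nn_integral_ln_ring_avg_powr\<close>.\<close>

definition ring_pow :: "real \<Rightarrow> (real ^ 2) set \<Rightarrow> real ^ 2 \<Rightarrow> ennreal" where
  "ring_pow q A x = (SUP k::int. \<integral>\<^sup>+\<tau>. ennreal (ring_avg A x \<tau> powr q) \<partial>exp_measure (of_int k))"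

lemma borel_measurable_ring_pow:
  assumes [measurable]: "A \<in> sets borel"
  shows "ring_pow q A \<in> borel_measurable borel"
proof -
  have [measurable]: "(\<lambda>x. \<integral>\<^sup>+\<tau>. ennreal (ring_avg A x \<tau> powr q) \<partial>exp_measure (of_int k)) \<in> borel_measurable borel" for k :: int
  proof -
    have "(\<integral>\<^sup>+\<tau>. ennreal (ring_avg A x \<tau> powr q) \<partial>exp_measure (of_int k))
      = (\<integral>\<^sup>+\<tau>. ennreal (ring_avg A x \<tau> powr q) * ennreal (exp (\<tau> - of_int k) * indicator {..of_int k} \<tau>) \<partial>lborel)" for x
      by (rule nn_integral_exp_measure) measurable
    then show ?thesis by simp measurable
  qed
  show ?thesis unfolding ring_pow_def[abs_def] by (intro borel_measurable_SUP) auto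
qed

text \<open>The choice of N makes the mean at most a constant times 2^(\<eta>/2) everywhere. Using
  this for q - 1 of the powers and the L^1 bound of order 2^\<eta> for the last gives the exponent
  \<eta> (q - 1)/2 + \<eta>.\<close>

lemma nn_integral_pavg_powr:
  assumes A[measurable]: "A \<in> sets borel" and q: "1 < q"
    and hl: "hl_max A x \<le> 2 powr \<eta>" and N: "real N \<le> 1 - \<eta> / 2"
  shows "(\<integral>\<^sup>+\<tau>. ennreal (pavg N A x \<tau> powr q) \<partial>exp_measure T) \<le> ennreal (4 * (8 * exp 1) powr (q - 1) * 2 powr (\<eta> * (q + 1) / 2))"
proof -
  define K where "K = (8 * exp 1) powr (q - 1) * 2 powr (\<eta> * (q - 1) / 2)"
  have p: "pavg N A x \<tau> \<le> 8 * exp 1 * 2 powr (\<eta> / 2)" for \<tau>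
  proof -
    have "(2::real) ^ N = 2 powr real N" by (simp add: powr_realpow)
    also have "\<dots> \<le> 2 powr (1 - \<eta> / 2)" using N by simp
    finally have N2: "(2::real) ^ N \<le> 2 powr (1 - \<eta> / 2)" .
    have "pavg N A x \<tau> \<le> 4 * exp 1 * 2 ^ N * hl_max A x" by (rule pavg_le_hl_max[OF A])
    also have "\<dots> \<le> 4 * exp 1 * 2 powr (1 - \<eta> / 2) * 2 powr \<eta>"
      by (intro mult_mono mult_left_mono N2 hl) (auto simp: hl_max_nonneg[OF A])
    also have "\<dots> = 4 * exp 1 * 2 powr ((1 - \<eta> / 2) + \<eta>)" unfolding powr_add by (simp add: mult_ac)
    also have "(1 - \<eta> / 2) + \<eta> = 1 + \<eta> / 2" by simp
    also have "4 * exp 1 * 2 powr (1 + \<eta> / 2) = 8 * exp 1 * 2 powr (\<eta> / 2)" unfolding powr_add by simp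
    finally show ?thesis .
  qed
  have "(\<integral>\<^sup>+\<tau>. ennreal (pavg N A x \<tau> powr q) \<partial>exp_measure T) \<le> (\<integral>\<^sup>+\<tau>. ennreal K * ennreal (pavg N A x \<tau>) \<partial>exp_measure T)"
  proof (rule nn_integral_mono)
    fix \<tau>
    let ?p = "pavg N A x \<tau>"
    have p0: "0 \<le> ?p" by (rule pavg_nonneg[OF A])
    have "?p powr q = ?p powr (q - 1) * ?p" using p0 by (cases "?p = 0") (auto simp: powr_diff)
    also have "\<dots> \<le> (8 * exp 1 * 2 powr (\<eta> / 2)) powr (q - 1) * ?p"
      using p[of \<tau>] p0 q by (intro mult_right_mono powr_mono2) auto
    also have "(8 * exp 1 * 2 powr (\<eta> / 2)) powr (q - 1) = K" by (simp add: K_def powr_mult powr_powr)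
    finally have "ennreal (?p powr q) \<le> ennreal (K * ?p)" by (rule ennreal_leI)
    also have "\<dots> = ennreal K * ennreal ?p" by (rule ennreal_mult) (auto simp: K_def p0)
    finally show "ennreal (?p powr q) \<le> ennreal K * ennreal ?p" .
  qed
  also have "\<dots> = ennreal K * (\<integral>\<^sup>+\<tau>. ennreal (pavg N A x \<tau>) \<partial>exp_measure T)" by (rule nn_integral_cmult) measurable
  also have "\<dots> \<le> ennreal K * ennreal (4 * 2 powr \<eta>)"
    by (intro mult_left_mono order_trans[OF nn_integral_exp_measure_pavg[OF A]] ennreal_leI) (use hl in auto)
  also have "\<dots> = ennreal (K * (4 * 2 powr \<eta>))" by (rule ennreal_mult[symmetric]) (auto simp: K_def)
  also have "K * (4 * 2 powr \<eta>) = 4 * (8 * exp 1) powr (q - 1) * 2 powr (\<eta> * (q - 1) / 2 + \<eta>)"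
    unfolding K_def powr_add by simp
  also have "\<eta> * (q - 1) / 2 + \<eta> = \<eta> * (q + 1) / 2" by (simp add: field_simps)
  finally show ?thesis .
qed

text \<open>Split the error at the height 2^(\<eta>/2) of the means. Small errors are paid for by
  the L^1 bounds of the average and its mean (the 8), large ones by the mean-square hypothesis
  \<open>E\<close> (the 1).\<close>

lemma nn_integral_pavg_err_powr_le_2:
  assumes A[measurable]: "A \<in> sets borel" and q: "1 < q" "q \<le> 2"
    and hl: "hl_max A x \<le> 2 powr \<eta>" and E: "pavg_err A N x \<le> ennreal (2 powr (3 * \<eta> / 2))"
  shows "(\<integral>\<^sup>+\<tau>. ennreal (\<bar>ring_avg A x \<tau> - pavg N A x \<tau>\<bar> powr q) \<partial>exp_measure T) \<le> ennreal (9 * 2 powr (\<eta> * (q + 1) / 2))"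
proof -
  define \<delta> :: real where "\<delta> = 2 powr (\<eta> / 2)"
  define f where "f \<tau> = \<delta> powr (q - 1) * (ring_avg A x \<tau> + pavg N A x \<tau>)" for \<tau>
  define g where "g \<tau> = \<delta> powr (q - 2) * (ring_avg A x \<tau> - pavg N A x \<tau>)\<^sup>2" for \<tau>
  have "\<delta> > 0" by (simp add: \<delta>_def)
  have [measurable]: "f \<in> borel_measurable borel" "g \<in> borel_measurable borel" unfolding f_def g_def by measurable
  have "(\<integral>\<^sup>+\<tau>. ennreal (\<bar>ring_avg A x \<tau> - pavg N A x \<tau>\<bar> powr q) \<partial>exp_measure T) \<le> (\<integral>\<^sup>+\<tau>. ennreal (f \<tau>) + ennreal (g \<tau>)
      \<partial>exp_measure T)"
  proof (rule nn_integral_mono)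
    fix \<tau>
    have nn: "0 \<le> ring_avg A x \<tau>" "0 \<le> pavg N A x \<tau>" by (auto simp: pavg_nonneg[OF A])
    have "\<bar>ring_avg A x \<tau> - pavg N A x \<tau>\<bar> powr q \<le> \<delta> powr (q - 1) * \<bar>ring_avg A x \<tau> - pavg N A x \<tau>\<bar> + \<delta> powr (q - 2) *
        \<bar>ring_avg A x \<tau> - pavg N A x \<tau>\<bar>\<^sup>2"
      by (rule powr_le_linear_quadratic) (use q \<open>\<delta> > 0\<close> in auto)
    also have "\<dots> \<le> f \<tau> + g \<tau>" unfolding f_def g_def power2_abs
    proof (intro add_mono mult_left_mono order_refl)
      show "\<bar>ring_avg A x \<tau> - pavg N A x \<tau>\<bar> \<le> ring_avg A x \<tau> + pavg N A x \<tau>" using nn by linarith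
    qed simp_all
    finally have "ennreal (\<bar>ring_avg A x \<tau> - pavg N A x \<tau>\<bar> powr q) \<le> ennreal (f \<tau> + g \<tau>)" by (rule ennreal_leI)
    also have "\<dots> = ennreal (f \<tau>) + ennreal (g \<tau>)"
      by (rule ennreal_plus) (use nn in \<open>auto simp: f_def g_def\<close>)
    finally show "ennreal (\<bar>ring_avg A x \<tau> - pavg N A x \<tau>\<bar> powr q) \<le> ennreal (f \<tau>) + ennreal (g \<tau>)" .
  qed
  also have "\<dots> = (\<integral>\<^sup>+\<tau>. ennreal (f \<tau>) \<partial>exp_measure T) + (\<integral>\<^sup>+\<tau>. ennreal (g \<tau>) \<partial>exp_measure T)"
    by (rule nn_integral_add) measurable
  also have "\<dots> \<le> ennreal (8 * 2 powr (\<eta> * (q + 1) / 2)) + ennreal (2 powr (\<eta> * (q + 1) / 2))"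
  proof (rule add_mono)
    have "(\<integral>\<^sup>+\<tau>. ennreal (f \<tau>) \<partial>exp_measure T) = (\<integral>\<^sup>+\<tau>. ennreal (\<delta> powr (q - 1)) * (ennreal (ring_avg A x \<tau>) + ennreal
        (pavg N A x \<tau>)) \<partial>exp_measure T)"
      unfolding f_def by (simp add: ennreal_mult ennreal_plus pavg_nonneg[OF A])
    also have "\<dots> = ennreal (\<delta> powr (q - 1)) * ((\<integral>\<^sup>+\<tau>. ennreal (ring_avg A x \<tau>) \<partial>exp_measure T) + (\<integral>\<^sup>+\<tau>. ennreal (pavg N
        A x \<tau>) \<partial>exp_measure T))"
      by (subst nn_integral_cmult, measurable, subst nn_integral_add, measurable)
    also have "\<dots> \<le> ennreal (\<delta> powr (q - 1)) * (ennreal (4 * 2 powr \<eta>) + ennreal (4 * 2 powr \<eta>))"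
      by (intro mult_left_mono add_mono order_trans[OF nn_integral_exp_measure_pavg[OF A]] order_trans[OF
          nn_integral_exp_measure_ring_avg[OF A]] ennreal_leI) (use hl in auto)
    also have "\<dots> = ennreal (\<delta> powr (q - 1) * (4 * 2 powr \<eta> + 4 * 2 powr \<eta>))"
      by (subst ennreal_plus[symmetric], simp, simp) (rule ennreal_mult[symmetric], auto)
    also have "\<delta> powr (q - 1) * (4 * 2 powr \<eta> + 4 * 2 powr \<eta>) = 8 * 2 powr (\<eta> / 2 * (q - 1) + \<eta>)"
      unfolding \<delta>_def powr_powr powr_add by simp
    also have "\<eta> / 2 * (q - 1) + \<eta> = \<eta> * (q + 1) / 2" by (simp add: field_simps)
    finally show "(\<integral>\<^sup>+\<tau>. ennreal (f \<tau>) \<partial>exp_measure T) \<le> ennreal (8 * 2 powr (\<eta> * (q + 1) / 2))" .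
    have "(\<integral>\<^sup>+\<tau>. ennreal (g \<tau>) \<partial>exp_measure T) \<le> (\<integral>\<^sup>+\<tau>. ennreal (g \<tau>) \<partial>lborel)"
      by (rule nn_integral_exp_measure_le) measurable
    also have "\<dots> = ennreal (\<delta> powr (q - 2)) * pavg_err A N x"
      unfolding g_def pavg_err_def[OF A] by (subst nn_integral_cmult[symmetric]) (auto simp: ennreal_mult)
    also have "\<dots> \<le> ennreal (\<delta> powr (q - 2)) * ennreal (2 powr (3 * \<eta> / 2))" by (intro mult_left_mono E) simp
    also have "\<dots> = ennreal (\<delta> powr (q - 2) * 2 powr (3 * \<eta> / 2))" by (rule ennreal_mult[symmetric]) auto
    also have "\<delta> powr (q - 2) * 2 powr (3 * \<eta> / 2) = 2 powr (\<eta> / 2 * (q - 2) + 3 * \<eta> / 2)"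
      unfolding \<delta>_def powr_powr powr_add by simp
    also have "\<eta> / 2 * (q - 2) + 3 * \<eta> / 2 = \<eta> * (q + 1) / 2" by (simp add: field_simps)
    finally show "(\<integral>\<^sup>+\<tau>. ennreal (g \<tau>) \<partial>exp_measure T) \<le> ennreal (2 powr (\<eta> * (q + 1) / 2))" .
  qed
  also have "\<dots> = ennreal (9 * 2 powr (\<eta> * (q + 1) / 2))" by (subst ennreal_plus[symmetric]) auto
  finally show ?thesis .
qed

lemma nn_integral_pavg_err_powr_ge_2:
  assumes A[measurable]: "A \<in> sets borel" and q: "2 \<le> q"
  shows "(\<integral>\<^sup>+\<tau>. ennreal (\<bar>ring_avg A x \<tau> - pavg N A x \<tau>\<bar> powr q) \<partial>exp_measure T) \<le> pavg_err A N x"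
proof -
  have "(\<integral>\<^sup>+\<tau>. ennreal (\<bar>ring_avg A x \<tau> - pavg N A x \<tau>\<bar> powr q) \<partial>exp_measure T) \<le> (\<integral>\<^sup>+\<tau>. ennreal (\<bar>ring_avg A x \<tau> - pavg
      N A x \<tau>\<bar> powr q) \<partial>lborel)"
    by (rule nn_integral_exp_measure_le) measurable
  also have "\<dots> \<le> pavg_err A N x"
    unfolding pavg_err_def[OF A]
  proof (intro nn_integral_mono ennreal_leI)
    fix \<tau>
    let ?b = "\<bar>ring_avg A x \<tau> - pavg N A x \<tau>\<bar>"
    have "?b \<le> 1" using ring_avg_nonneg[of A x \<tau>] ring_avg_le_1[of A x \<tau>] pavg_nonneg[OF A, of N x \<tau>] pavg_le_1[OF A, of
        N x \<tau>] by linarith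
    then have "?b powr q \<le> ?b powr 2" using q by (intro powr_mono') auto
    also have "\<dots> = ?b\<^sup>2" by simp
    finally show "?b powr q \<le> (ring_avg A x \<tau> - pavg N A x \<tau>)\<^sup>2" by simp
  qed
  finally show ?thesis .
qed

text \<open>For q \<ge> 2 the excess power q - 2 is taken from the supremum bound, the remaining
  square from the mean-square bound; both are controlled by the same quantity
  \<open>ring_sq\<close>.\<close>

lemma nn_integral_pavg_Suc_diff_powr:
  assumes A[measurable]: "A \<in> sets borel" and q: "2 \<le> q" and J: "ring_sq A (1 / 2 ^ Suc l) x \<le> ennreal B" and B: "0 < B"
  shows "(\<integral>\<^sup>+\<tau>. ennreal (\<bar>pavg (Suc l) A x \<tau> - pavg l A x \<tau>\<bar> powr q) \<partial>exp_measure T) \<le> ennreal ((2 ^ Suc l * B) powr ((q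
      - 2) / 2) * B)"
proof -
  define D where "D \<tau> = \<bar>pavg (Suc l) A x \<tau> - pavg l A x \<tau>\<bar>" for \<tau>
  define K where "K = (2 ^ Suc l * B) powr ((q - 2) / 2)"
  have [measurable]: "D \<in> borel_measurable borel" unfolding D_def by measurable
  have D2: "(D \<tau>)\<^sup>2 \<le> 2 ^ Suc l * B" for \<tau>
  proof -
    have "ennreal ((D \<tau>)\<^sup>2) \<le> ennreal (2 ^ Suc l) * ring_sq A (1 / 2 ^ Suc l) x" unfolding D_def power2_abs by (rule
        pavg_Suc_diff_sup[OF A])
    also have "\<dots> \<le> ennreal (2 ^ Suc l) * ennreal B" by (rule mult_left_mono[OF J]) simp
    also have "\<dots> = ennreal (2 ^ Suc l * B)" using B by (subst ennreal_mult) auto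
    finally show ?thesis using B by (subst (asm) ennreal_le_iff) auto
  qed
  have "(\<integral>\<^sup>+\<tau>. ennreal (D \<tau> powr q) \<partial>exp_measure T) \<le> (\<integral>\<^sup>+\<tau>. ennreal (D \<tau> powr q) \<partial>lborel)"
    by (rule nn_integral_exp_measure_le) measurable
  also have "\<dots> \<le> (\<integral>\<^sup>+\<tau>. ennreal K * ennreal ((D \<tau>)\<^sup>2) \<partial>lborel)"
  proof (rule nn_integral_mono)
    fix \<tau>
    have "D \<tau> powr q \<le> K * (D \<tau>)\<^sup>2"
    proof (cases "D \<tau> = 0")
      case False
      then have D0: "D \<tau> > 0" unfolding D_def by simp
      have "D \<tau> powr q = D \<tau> powr (q - 2) * (D \<tau>)\<^sup>2" using D0 by (simp add: powr_diff)
      also have "D \<tau> powr (q - 2) = (D \<tau> powr 2) powr ((q - 2) / 2)" unfolding powr_powr by (rule arg_cong) simp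
      also have "D \<tau> powr 2 = (D \<tau>)\<^sup>2" using D0 by simp
      also have "((D \<tau>)\<^sup>2) powr ((q - 2) / 2) * (D \<tau>)\<^sup>2 \<le> K * (D \<tau>)\<^sup>2"
        unfolding K_def using D2 q by (intro mult_right_mono powr_mono2) auto
      finally show ?thesis .
    qed simp
    then have "ennreal (D \<tau> powr q) \<le> ennreal (K * (D \<tau>)\<^sup>2)" by (rule ennreal_leI)
    then show "ennreal (D \<tau> powr q) \<le> ennreal K * ennreal ((D \<tau>)\<^sup>2)" by (simp add: ennreal_mult K_def)
  qed
  also have "\<dots> = ennreal K * (\<integral>\<^sup>+\<tau>. ennreal ((D \<tau>)\<^sup>2) \<partial>lborel)" by (rule nn_integral_cmult) measurable
  also have "\<dots> \<le> ennreal K * ennreal B"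
    by (intro mult_left_mono order_trans[OF _ J]) (auto simp: D_def intro: pavg_Suc_diff_L2[OF A, unfolded power_Suc])
  also have "\<dots> = ennreal (K * B)" using B by (intro ennreal_mult[symmetric]) (auto simp: K_def)
  finally show ?thesis by (simp only: D_def K_def)
qed

text \<open>One constant for both ranges of q. The summands belong to the coarsest mean, the
  weighted chain of differences and the remaining error; the 9 is the error constant for q \<le>
  2.\<close>

definition ring_const :: "real \<Rightarrow> real" where
  "ring_const q = 3 powr q * (4 * (8 * exp 1) powr (q - 1)
    + (1 / (1 - 2 powr (- (1 / (4 * q))))) powr q * (2 powr ((q - 2) / 2) * (1 / (1 - 2 powr (- (1 / 4))))) + 9)"

lemma geometric_const_nonneg: "0 < c \<Longrightarrow> 0 \<le> 1 / (1 - 2 powr (- c :: real))"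
  using powr_less_mono[of "- c" 0 "2::real"] by simp

text \<open>The exponents \<open>E j\<close> give the difference at scale \<open>2\<^bsup>-(N+j)\<^esup>\<close> a share of the total that decays
  geometrically in \<open>j\<close>, while the measures of the sets excluded by the premise on \<open>ring_sq\<close> still sum
  to a multiple of \<open>|A| / 2\<^bsup>\<eta>\<^esup>\<close>.\<close>

lemma ring_pow_le_ge_2:
  fixes q \<eta> :: real and N M :: nat
  defines "E \<equiv> \<lambda>j::nat. - (real (N + j) * (1 - 2 / q)) - real j / q + \<eta> * (1 + 1 / q)"
  assumes A[measurable]: "A \<in> sets borel" and q: "2 \<le> q"
    and hl: "hl_max A x \<le> 2 powr \<eta>" and N: "real N \<le> 1 - \<eta> / 2"
    and J: "\<And>j. j < M \<Longrightarrow> ring_sq A (1 / 2 ^ Suc (N + j)) x \<le> ennreal (2 powr E j)"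
    and err: "pavg_err A (N + M) x \<le> ennreal (2 powr (\<eta> * (q + 1) / 2))"
  shows "ring_pow q A x \<le> ennreal (ring_const q * 2 powr (\<eta> * (q + 1) / 2))"
  unfolding ring_pow_def
proof (rule SUP_least)
  fix k :: int
  define \<mu> where "\<mu> = exp_measure (of_int k)"
  have [measurable_cong]: "sets \<mu> = sets borel" by (simp add: \<mu>_def)
  define Y where "Y j \<tau> = pavg (N + j) A x \<tau>" for j \<tau>
  define S where "S = 1 / (1 - 2 powr (- (1 / (4 * q))))"
  define G where "G = 1 / (1 - 2 powr (- (1 / 4 :: real)))"
  define H where "H = 2 powr (\<eta> * (q + 1) / 2)"
  \<comment> \<open>The exponents \<open>E j\<close> yield a gain of 2^(-j/2) at the j-th scale;
    these weights, raised to the power q, spend 2^(j/4) of it and leave the summable 2^(-j/4) seen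
    in \<open>b\<close>.\<close>
  define w where "w j = 2 powr (- (1 / (4 * q) * real j))" for j :: nat
  define b where "b j = 2 powr ((q - 2) / 2) * H * 2 powr (- (1 / 4 * real j))" for j :: nat
  define D where "D j \<tau> = \<bar>Y (Suc j) \<tau> - Y j \<tau>\<bar>" for j \<tau>
  have [measurable]: "D j \<in> borel_measurable borel" "Y j \<in> borel_measurable borel" for j unfolding D_def Y_def by measurable
  have Ws: "(\<Sum>j<M. w j) \<le> S" unfolding w_def S_def by (rule sum_powr_geometric_le) (use q in simp)
  have SG: "0 \<le> S" "0 \<le> G" unfolding S_def G_def by (rule geometric_const_nonneg, use q in simp)+
  have tele: "(\<integral>\<^sup>+\<tau>. ennreal ((\<Sum>j<M. D j \<tau>) powr q) \<partial>\<mu>) \<le> ennreal (S powr q * (\<Sum>j<M. b j))"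
  proof (rule nn_integral_le_sum)
    show "(\<lambda>\<tau>. (D j \<tau> / w j) powr q) \<in> borel_measurable \<mu>" for j by measurable
    show "(\<Sum>j<M. D j \<tau>) powr q \<le> S powr q * (\<Sum>j<M. (D j \<tau> / w j) powr q)" for \<tau>
      by (rule powr_sum_le_weighted[OF _ _ Ws]) (use q in \<open>auto simp: D_def w_def\<close>)
    show "(\<integral>\<^sup>+\<tau>. ennreal ((D j \<tau> / w j) powr q) \<partial>\<mu>) \<le> ennreal (b j)" if j: "j < M" for j
    proof -
      have wq: "(D j \<tau> / w j) powr q = 2 powr (real j / 4) * D j \<tau> powr q" for \<tau>
      proof -
        have "(D j \<tau> / w j) powr q = D j \<tau> powr q / w j powr q" by (rule powr_divide)
        also have "w j powr q = 2 powr (- (real j / 4))" unfolding w_def powr_powr using q by (intro arg_cong[where f =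
            "\<lambda>z. 2 powr z"]) (simp add: field_simps)
        finally show ?thesis by (simp add: powr_minus divide_simps)
      qed
      have "(\<integral>\<^sup>+\<tau>. ennreal ((D j \<tau> / w j) powr q) \<partial>\<mu>) = ennreal (2 powr (real j / 4)) * (\<integral>\<^sup>+\<tau>. ennreal (D j \<tau> powr q) \<partial>\<mu>)"
        unfolding wq by (subst nn_integral_cmult[symmetric]) (auto simp: ennreal_mult)
      also have "\<dots> \<le> ennreal (2 powr (real j / 4)) * ennreal ((2 ^ Suc (N + j) * 2 powr E j) powr ((q - 2) / 2) * 2 powr E j)"
        unfolding D_def Y_def add_Suc_right \<mu>_def
        by (intro mult_left_mono nn_integral_pavg_Suc_diff_powr[OF A q J[OF j]]) auto
      also have "\<dots> = ennreal (2 powr (real j / 4) * ((2 ^ Suc (N + j) * 2 powr E j) powr ((q - 2) / 2) * 2 powr E j))"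
        by (rule ennreal_mult[symmetric]) auto
      also have "2 powr (real j / 4) * ((2 ^ Suc (N + j) * 2 powr E j) powr ((q - 2) / 2) * 2 powr E j) = b j"
      proof -
        \<comment> \<open>In this form the term (N + j)(q - 2) cancels against the growth of the
          supremum bound with the scale.\<close>
        have Eq: "E j * q = - (real (N + j) * (q - 2)) - real j + \<eta> * (q + 1)"
          using q by (simp add: E_def field_simps)
        have p: "(2::real) ^ Suc (N + j) = 2 powr (real (N + j) + 1)" by (simp add: powr_realpow[symmetric] powr_add)
        have "2 powr (real j / 4) * ((2 ^ Suc (N + j) * 2 powr E j) powr ((q - 2) / 2) * 2 powr E j)
          = 2 powr (real j / 4 + (((real (N + j) + 1) + E j) * ((q - 2) / 2) + E j))"
          by (simp only: p powr_add[symmetric] powr_powr)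
        also have "real j / 4 + (((real (N + j) + 1) + E j) * ((q - 2) / 2) + E j) = (q - 2) / 2 + \<eta> * (q + 1) / 2 + -
            (1 / 4 * real j)"
          using Eq by (simp add: field_simps)
        finally show ?thesis unfolding b_def H_def powr_add .
      qed
      finally show ?thesis .
    qed
  qed (auto simp: b_def H_def)
  have bs: "(\<Sum>j<M. b j) \<le> 2 powr ((q - 2) / 2) * G * H"
  proof -
    have "(\<Sum>j<M. b j) = 2 powr ((q - 2) / 2) * H * (\<Sum>j<M. 2 powr (- (1 / 4 * real j)))"
      unfolding b_def by (rule sum_distrib_left[symmetric])
    also have "\<dots> \<le> 2 powr ((q - 2) / 2) * H * G"
      unfolding G_def by (intro mult_left_mono sum_powr_geometric_le) (auto simp: H_def)
    finally show ?thesis by (simp add: mult_ac)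
  qed
  have "(\<integral>\<^sup>+\<tau>. ennreal (ring_avg A x \<tau> powr q) \<partial>\<mu>)
    \<le> ennreal (3 powr q * (4 * (8 * exp 1) powr (q - 1) * H + S powr q * (2 powr ((q - 2) / 2) * G * H) + H))"
  proof (rule nn_integral_le_add3)
    show "ring_avg A x \<tau> powr q \<le> 3 powr q * (Y 0 \<tau> powr q + (\<Sum>j<M. D j \<tau>) powr q + \<bar>ring_avg A x \<tau> - Y M \<tau>\<bar> powr q)" for \<tau>
    proof -
      have "Y M \<tau> - Y 0 \<tau> = (\<Sum>j<M. Y (Suc j) \<tau> - Y j \<tau>)" by (rule sum_lessThan_telescope[symmetric])
      also have "\<dots> \<le> (\<Sum>j<M. D j \<tau>)" by (rule sum_mono) (simp add: D_def)
      finally have "ring_avg A x \<tau> \<le> Y 0 \<tau> + (\<Sum>j<M. D j \<tau>) + \<bar>ring_avg A x \<tau> - Y M \<tau>\<bar>" by linarith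
      then have "ring_avg A x \<tau> powr q \<le> (Y 0 \<tau> + (\<Sum>j<M. D j \<tau>) + \<bar>ring_avg A x \<tau> - Y M \<tau>\<bar>) powr q"
        using q by (intro powr_mono2) auto
      also have "\<dots> \<le> 3 powr q * (Y 0 \<tau> powr q + (\<Sum>j<M. D j \<tau>) powr q + \<bar>ring_avg A x \<tau> - Y M \<tau>\<bar> powr q)"
        using q by (intro powr_add3_le) (auto simp: D_def Y_def pavg_nonneg[OF A] sum_nonneg)
      finally show ?thesis .
    qed
    show "(\<integral>\<^sup>+\<tau>. ennreal (Y 0 \<tau> powr q) \<partial>\<mu>) \<le> ennreal (4 * (8 * exp 1) powr (q - 1) * H)"
      unfolding Y_def \<mu>_def H_def add_0_right by (rule nn_integral_pavg_powr[OF A _ hl N]) (use q in simp)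
    show "(\<integral>\<^sup>+\<tau>. ennreal ((\<Sum>j<M. D j \<tau>) powr q) \<partial>\<mu>) \<le> ennreal (S powr q * (2 powr ((q - 2) / 2) * G * H))"
      by (rule order_trans[OF tele]) (intro ennreal_leI mult_left_mono bs, simp)
    show "(\<integral>\<^sup>+\<tau>. ennreal (\<bar>ring_avg A x \<tau> - Y M \<tau>\<bar> powr q) \<partial>\<mu>) \<le> ennreal H"
      unfolding Y_def \<mu>_def H_def by (rule order_trans[OF nn_integral_pavg_err_powr_ge_2[OF A q] err])
    show "0 \<le> S powr q * (2 powr ((q - 2) / 2) * G * H)" using SG by (simp add: H_def)
  qed (auto simp: H_def)
  also have "\<dots> \<le> ennreal (ring_const q * H)"
  proof (rule ennreal_leI)
    have "3 powr q * (4 * (8 * exp 1) powr (q - 1) * H + S powr q * (2 powr ((q - 2) / 2) * G * H) + H)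
      \<le> 3 powr q * (4 * (8 * exp 1) powr (q - 1) * H + S powr q * (2 powr ((q - 2) / 2) * G * H) + 9 * H)"
      by (intro mult_left_mono add_left_mono) (auto simp: H_def)
    also have "\<dots> = ring_const q * H" unfolding ring_const_def S_def[symmetric] G_def[symmetric] by (simp add: algebra_simps)
    finally show "3 powr q * (4 * (8 * exp 1) powr (q - 1) * H + S powr q * (2 powr ((q - 2) / 2) * G * H) + H) \<le>
        ring_const q * H" .
  qed
  finally show "(\<integral>\<^sup>+\<tau>. ennreal (ring_avg A x \<tau> powr q) \<partial>exp_measure (of_int k)) \<le> ennreal (ring_const q * 2 powr (\<eta> * (q
      + 1) / 2))"
    by (simp add: \<mu>_def H_def)
qed

text \<open>For q \<le> 2 the error at the single scale N is already small enough, so the middle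
  term of the three-term bound is 0.\<close>

lemma ring_pow_le_le_2:
  assumes A[measurable]: "A \<in> sets borel" and q: "1 < q" "q \<le> 2"
    and hl: "hl_max A x \<le> 2 powr \<eta>" and N: "real N \<le> 1 - \<eta> / 2"
    and err: "pavg_err A N x \<le> ennreal (2 powr (3 * \<eta> / 2))"
  shows "ring_pow q A x \<le> ennreal (ring_const q * 2 powr (\<eta> * (q + 1) / 2))"
  unfolding ring_pow_def
proof (rule SUP_least)
  fix k :: int
  define H where "H = 2 powr (\<eta> * (q + 1) / 2)"
  have "(\<integral>\<^sup>+\<tau>. ennreal (ring_avg A x \<tau> powr q) \<partial>exp_measure (of_int k))
    \<le> ennreal (3 powr q * (4 * (8 * exp 1) powr (q - 1) * H + 0 + 9 * H))"
  proof (rule nn_integral_le_add3)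
    show "ring_avg A x \<tau> powr q \<le> 3 powr q * (pavg N A x \<tau> powr q + 0 powr q + \<bar>ring_avg A x \<tau> - pavg N A x \<tau>\<bar> powr q)" for \<tau>
    proof -
      have "ring_avg A x \<tau> \<le> pavg N A x \<tau> + 0 + \<bar>ring_avg A x \<tau> - pavg N A x \<tau>\<bar>" by linarith
      then have "ring_avg A x \<tau> powr q \<le> (pavg N A x \<tau> + 0 + \<bar>ring_avg A x \<tau> - pavg N A x \<tau>\<bar>) powr q"
        using q by (intro powr_mono2) auto
      also have "\<dots> \<le> 3 powr q * (pavg N A x \<tau> powr q + 0 powr q + \<bar>ring_avg A x \<tau> - pavg N A x \<tau>\<bar> powr q)"
        using q by (intro powr_add3_le) (auto simp: pavg_nonneg[OF A])
      finally show ?thesis .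
    qed
    show "(\<integral>\<^sup>+\<tau>. ennreal (pavg N A x \<tau> powr q) \<partial>exp_measure (of_int k)) \<le> ennreal (4 * (8 * exp 1) powr (q - 1) * H)"
      unfolding H_def by (rule nn_integral_pavg_powr[OF A q(1) hl N])
    show "(\<integral>\<^sup>+\<tau>. ennreal (\<bar>ring_avg A x \<tau> - pavg N A x \<tau>\<bar> powr q) \<partial>exp_measure (of_int k)) \<le> ennreal (9 * H)"
      unfolding H_def by (rule nn_integral_pavg_err_powr_le_2[OF A q hl err])
  qed (auto simp: H_def)
  also have "\<dots> \<le> ennreal (ring_const q * H)"
  proof (rule ennreal_leI)
    have "0 \<le> (1 / (1 - 2 powr (- (1 / (4 * q))))) powr q * (2 powr ((q - 2) / 2) * (1 / (1 - 2 powr (- (1 / 4 ::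
        real)))))" (is "0 \<le> ?c")
      using geometric_const_nonneg[of "1 / 4"] by (intro mult_nonneg_nonneg) auto
    then have "3 powr q * (4 * (8 * exp 1) powr (q - 1) + 0 + 9) * H \<le> 3 powr q * (4 * (8 * exp 1) powr (q - 1) + ?c + 9) * H"
      by (intro mult_left_mono mult_right_mono add_mono) (auto simp: H_def)
    then show "3 powr q * (4 * (8 * exp 1) powr (q - 1) * H + 0 + 9 * H) \<le> ring_const q * H"
      unfolding ring_const_def by (simp add: algebra_simps)
  qed
  finally show "(\<integral>\<^sup>+\<tau>. ennreal (ring_avg A x \<tau> powr q) \<partial>exp_measure (of_int k)) \<le> ennreal (ring_const q * 2 powr (\<eta> * (q
      + 1) / 2))"
    by (simp add: H_def)
qed

section \<open>The weak-type estimate for powers of circular averages\<close>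

lemma emeasure_ring_sq_large:
  assumes A: "A \<in> sets borel" "emeasure lborel A < \<infinity>" and c: "0 < c" and \<epsilon>: "0 \<le> \<epsilon>" "\<epsilon> \<le> 1"
  shows "emeasure lborel {x. ennreal c < ring_sq A \<epsilon> x} \<le> ennreal (7 * \<epsilon> * measure lborel A / c)"
proof (rule emeasure_Markov_less[OF borel_measurable_ring_sq[OF A(1)] _ _ c])
  have "(\<integral>\<^sup>+x. ring_sq A \<epsilon> x \<partial>lborel) \<le> ennreal (7 * \<epsilon>) * emeasure lborel A"
    unfolding ring_sq_def[OF A(1)] by (rule ring_diff[OF A \<epsilon>])
  also have "emeasure lborel A = ennreal (measure lborel A)" using A by (intro emeasure_eq_ennreal_measure) auto
  also have "ennreal (7 * \<epsilon>) * ennreal (measure lborel A) = ennreal (7 * \<epsilon> * measure lborel A)"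
    using \<epsilon> by (intro ennreal_mult[symmetric]) auto
  finally show "(\<integral>\<^sup>+x. ring_sq A \<epsilon> x \<partial>lborel) \<le> ennreal (7 * \<epsilon> * measure lborel A)" .
qed (use \<epsilon> in auto)

lemma emeasure_pavg_err_large:
  assumes A: "A \<in> sets borel" "emeasure lborel A < \<infinity>" and c: "0 < c"
  shows "emeasure lborel {x. ennreal c < pavg_err A N x} \<le> ennreal (7 / 2 ^ N * measure lborel A / c)"
proof (rule emeasure_Markov_less[OF borel_measurable_pavg_err[OF A(1)] _ _ c])
  have "(\<integral>\<^sup>+x. pavg_err A N x \<partial>lborel) \<le> ennreal (7 / 2 ^ N) * emeasure lborel A" by (rule nn_integral_pavg_err[OF A])
  also have "emeasure lborel A = ennreal (measure lborel A)" using A by (intro emeasure_eq_ennreal_measure) auto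
  also have "ennreal (7 / 2 ^ N) * ennreal (measure lborel A) = ennreal (7 / 2 ^ N * measure lborel A)"
    by (intro ennreal_mult[symmetric]) auto
  finally show "(\<integral>\<^sup>+x. pavg_err A N x \<partial>lborel) \<le> ennreal (7 / 2 ^ N * measure lborel A)" .
qed auto

lemma sets_ennreal_less:
  fixes f :: "'a::euclidean_space \<Rightarrow> ennreal"
  assumes "f \<in> borel_measurable borel"
  shows "{x. c < f x} \<in> sets lborel"
  using measurable_sets[of f lborel borel "{c<..}"] assms by (simp add: vimage_def)

text \<open>25 from the weak type of the maximal function in the plane and 7 from the mean-square
  error make 32; the other term sums the geometric series over the scales, with 7/2 rounded up to
  4.\<close>

definition ring_weak_const :: "real \<Rightarrow> real" where
  "ring_weak_const q = 32 + 4 * (1 / (1 - 2 powr (- (1 / q))))"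

text \<open>Outside the sets where the maximal function, the error of the means, or one of the
  squared differences is large, the pointwise bounds apply. By weak type and Markov's inequality
  each of these sets has measure at most a multiple of the measure of A over 2^\<eta>, and those for
  the differences are summable over the scales.\<close>

lemma ring_pow_weak_type_less_1:
  fixes A :: "(real ^ 2) set"
  assumes A: "A \<in> sets borel" "emeasure lborel A < \<infinity>" and q: "1 < q" and \<eta>: "\<eta> < 0"
  shows "emeasure lborel {x. ennreal (ring_const q * 2 powr (\<eta> * (q + 1) / 2)) < ring_pow q A x}
    \<le> ennreal (ring_weak_const q * measure lborel A / 2 powr \<eta>)"
proof -
  define m where "m = measure lborel A"
  define bad where "bad = {x. ennreal (ring_const q * 2 powr (\<eta> * (q + 1) / 2)) < ring_pow q A x}"
  have m0: "0 \<le> m" by (simp add: m_def)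
  \<comment> \<open>2^(-N) is within a factor 2 of 2^(\<eta>/2). The lower bound on N serves the
    measure of the exceptional sets, the upper bound serves the size of the means.\<close>
  define N where "N = nat \<lceil>- \<eta> / 2\<rceil>"
  have N: "- \<eta> / 2 \<le> real N" "real N \<le> 1 - \<eta> / 2"
  proof -
    show "- \<eta> / 2 \<le> real N" unfolding N_def by (rule real_nat_ceiling_ge)
    have "0 \<le> \<lceil>- \<eta> / 2\<rceil>" using \<eta> by simp
    then have "real N = of_int \<lceil>- \<eta> / 2\<rceil>" by (simp add: N_def)
    then show "real N \<le> 1 - \<eta> / 2" using of_int_ceiling_le_add_one[of "- \<eta> / 2"] by linarith
  qed
  define Hs where "Hs = {x. 2 powr \<eta> < hl_max A x}"
  have HsS: "Hs \<in> sets lborel" unfolding Hs_def sets_lborel by (rule borel_open[OF open_less_hl_max[OF A(1)]])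
  have Hsm: "emeasure lborel Hs \<le> ennreal (25 * m / 2 powr \<eta>)"
    using hl_max_weak_type[OF A, of "2 powr \<eta>"] unfolding Hs_def m_def by simp
  have two: "7 / 2 ^ n * m / 2 powr z = 7 * m * 2 powr (- real n - z)" for n z
  proof -
    have "2 powr (- real n - z) = 1 / (2 ^ n * 2 powr z)" by (simp add: powr_diff powr_minus_divide powr_realpow)
    then show ?thesis by simp
  qed
  have geo: "0 \<le> 1 / (1 - 2 powr (- (1 / q)))" by (rule geometric_const_nonneg) (use q in simp)
  show ?thesis
  proof (cases "q \<le> 2")
    case True
    \<comment> \<open>With this threshold Markov's inequality gives the exponent -N - 3 \<eta>/2,
      which is at most -\<eta> by the choice of N.\<close>
    define Es where "Es = {x. ennreal (2 powr (3 * \<eta> / 2)) < pavg_err A N x}"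
    have EsS: "Es \<in> sets lborel" unfolding Es_def by (rule sets_ennreal_less[OF borel_measurable_pavg_err[OF A(1)]])
    have "bad \<subseteq> Hs \<union> Es"
    proof
      fix x assume x: "x \<in> bad"
      show "x \<in> Hs \<union> Es"
      proof (rule ccontr)
        assume "x \<notin> Hs \<union> Es"
        then have "hl_max A x \<le> 2 powr \<eta>" "pavg_err A N x \<le> ennreal (2 powr (3 * \<eta> / 2))" by (auto simp: Hs_def Es_def not_less)
        from ring_pow_le_le_2[OF A(1) q True this(1) N(2) this(2)] show False using x by (simp add: bad_def)
      qed
    qed
    then have "emeasure lborel bad \<le> emeasure lborel (Hs \<union> Es)" by (rule emeasure_mono) (use HsS EsS in simp)
    also have "\<dots> \<le> emeasure lborel Hs + emeasure lborel Es" by (rule emeasure_subadditive[OF HsS EsS])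
    also have "\<dots> \<le> ennreal (25 * m / 2 powr \<eta>) + ennreal (7 * m / 2 powr \<eta>)"
    proof (intro add_mono Hsm)
      have "emeasure lborel Es \<le> ennreal (7 / 2 ^ N * m / 2 powr (3 * \<eta> / 2))"
        unfolding Es_def m_def by (rule emeasure_pavg_err_large[OF A]) simp
      also have "\<dots> \<le> ennreal (7 * m * 2 powr (- \<eta>))"
        unfolding two using N(1) m0 by (intro ennreal_leI mult_left_mono powr_mono) auto
      finally show "emeasure lborel Es \<le> ennreal (7 * m / 2 powr \<eta>)" by (simp add: powr_minus divide_inverse)
    qed
    also have "\<dots> = ennreal (32 * m / 2 powr \<eta>)" using m0 by (subst ennreal_plus[symmetric]) (auto simp:
        add_divide_distrib[symmetric])
    also have "\<dots> \<le> ennreal (ring_weak_const q * m / 2 powr \<eta>)"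
      using m0 geo by (intro ennreal_leI divide_right_mono mult_right_mono) (auto simp: ring_weak_const_def)
    finally show ?thesis by (simp only: bad_def m_def)
  next
    case False
    then have q2: "2 \<le> q" by simp
    \<comment> \<open>Enough further scales for the error at scale N + M to exceed 2^(\<eta> (q +
      1)/2) only on a set of admissible measure.\<close>
    define M where "M = nat \<lceil>- \<eta> * (q - 1) / 2\<rceil>"
    have M: "- \<eta> * (q - 1) / 2 \<le> real M" unfolding M_def by (rule real_nat_ceiling_ge)
    define E where "E j = - (real (N + j) * (1 - 2 / q)) - real j / q + \<eta> * (1 + 1 / q)" for j :: nat
    define Es where "Es = {x. ennreal (2 powr (\<eta> * (q + 1) / 2)) < pavg_err A (N + M) x}"
    define Js where "Js j = {x. ennreal (2 powr E j) < ring_sq A (1 / 2 ^ Suc (N + j)) x}" for j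
    have EsS: "Es \<in> sets lborel" unfolding Es_def by (rule sets_ennreal_less[OF borel_measurable_pavg_err[OF A(1)]])
    have JsS: "Js j \<in> sets lborel" for j unfolding Js_def by (rule sets_ennreal_less[OF borel_measurable_ring_sq[OF A(1)]])
    have JsU: "(\<Union>j<M. Js j) \<in> sets lborel" using JsS by blast
    have "bad \<subseteq> (Hs \<union> Es) \<union> (\<Union>j<M. Js j)"
    proof
      fix x assume x: "x \<in> bad"
      show "x \<in> (Hs \<union> Es) \<union> (\<Union>j<M. Js j)"
      proof (rule ccontr)
        assume nx: "x \<notin> (Hs \<union> Es) \<union> (\<Union>j<M. Js j)"
        then have hl: "hl_max A x \<le> 2 powr \<eta>" and er: "pavg_err A (N + M) x \<le> ennreal (2 powr (\<eta> * (q + 1) / 2))" by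
            (auto simp: Hs_def Es_def not_less)
        have J: "ring_sq A (1 / 2 ^ Suc (N + j)) x \<le> ennreal (2 powr E j)" if "j < M" for j
          using nx that unfolding Js_def by (auto simp del: power_Suc simp: not_less)
        from ring_pow_le_ge_2[OF A(1) q2 hl N(2) J[unfolded E_def] er] show False using x by (simp add: bad_def)
      qed
    qed
    then have "emeasure lborel bad \<le> emeasure lborel ((Hs \<union> Es) \<union> (\<Union>j<M. Js j))" by (rule emeasure_mono) (use HsS EsS JsU in simp)
    also have "\<dots> \<le> emeasure lborel (Hs \<union> Es) + emeasure lborel (\<Union>j<M. Js j)"
      by (rule emeasure_subadditive[OF _ JsU]) (use HsS EsS in simp)
    also have "\<dots> \<le> (emeasure lborel Hs + emeasure lborel Es) + (\<Sum>j<M. emeasure lborel (Js j))"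
      by (intro add_mono emeasure_subadditive[OF HsS EsS] emeasure_subadditive_finite) (use JsS in auto)
    also have "\<dots> \<le> (ennreal (25 * m / 2 powr \<eta>) + ennreal (7 * m / 2 powr \<eta>)) + ennreal (4 * (1 / (1 - 2 powr (- (1 /
        q)))) * m / 2 powr \<eta>)"
    proof (intro add_mono Hsm)
      have "emeasure lborel Es \<le> ennreal (7 / 2 ^ (N + M) * m / 2 powr (\<eta> * (q + 1) / 2))"
        unfolding Es_def m_def by (rule emeasure_pavg_err_large[OF A]) simp
      also have "\<dots> \<le> ennreal (7 * m * 2 powr (- \<eta>))"
      proof -
        have "- real (N + M) - \<eta> * (q + 1) / 2 \<le> - \<eta>" using M by (simp add: field_simps)
        then show ?thesis unfolding two using m0 by (intro ennreal_leI mult_left_mono powr_mono) auto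
      qed
      finally show "emeasure lborel Es \<le> ennreal (7 * m / 2 powr \<eta>)" by (simp add: powr_minus divide_inverse)
      have "(\<Sum>j<M. emeasure lborel (Js j)) \<le> (\<Sum>j<M. ennreal (4 * m / 2 powr \<eta> * 2 powr (- (1 / q * real j))))"
      proof (rule sum_mono)
        fix j
        have "emeasure lborel (Js j) \<le> ennreal (7 * (1 / 2 ^ Suc (N + j)) * m / 2 powr E j)"
          unfolding Js_def m_def
        proof (rule emeasure_ring_sq_large[OF A])
          show "1 / 2 ^ Suc (N + j) \<le> (1::real)" by (simp del: power_Suc)
        qed auto
        also have "7 * (1 / 2 ^ Suc (N + j)) * m / 2 powr E j = 7 * m * 2 powr (- real (Suc (N + j)) - E j)"
          using two[of "Suc (N + j)" "E j"] by (simp del: power_Suc)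
        also have "\<dots> \<le> 7 * m * 2 powr (- 1 - \<eta> - 1 / q * real j)"
        proof (intro mult_left_mono powr_mono)
          have "- real (Suc (N + j)) - E j = - 1 - real j / q - \<eta> - (2 * real N + \<eta>) / q"
            using q by (simp add: E_def field_simps)
          moreover have "0 \<le> (2 * real N + \<eta>) / q" using N(1) q by simp
          ultimately show "- real (Suc (N + j)) - E j \<le> - 1 - \<eta> - 1 / q * real j" by simp
        qed (use m0 in auto)
        also have "\<dots> = 7 / 2 * m / 2 powr \<eta> * 2 powr (- (1 / q * real j))"
        proof -
          have e: "- 1 - \<eta> - 1 / q * real j = - (1 / q * real j) - (\<eta> + 1)" by simp
          show ?thesis unfolding e powr_diff powr_add by simp
        qed
        also have "\<dots> \<le> 4 * m / 2 powr \<eta> * 2 powr (- (1 / q * real j))"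
          using m0 by (intro mult_right_mono divide_right_mono) auto
        finally show "emeasure lborel (Js j) \<le> ennreal (4 * m / 2 powr \<eta> * 2 powr (- (1 / q * real j)))"
          by (simp add: ennreal_leI)
      qed
      also have "\<dots> = ennreal (\<Sum>j<M. 4 * m / 2 powr \<eta> * 2 powr (- (1 / q * real j)))"
        by (rule sum_ennreal) (use m0 in auto)
      also have "\<dots> = ennreal (4 * m / 2 powr \<eta> * (\<Sum>j<M. 2 powr (- (1 / q * real j))))" by (simp only: sum_distrib_left)
      also have "\<dots> \<le> ennreal (4 * m / 2 powr \<eta> * (1 / (1 - 2 powr (- (1 / q)))))"
        using m0 q by (intro ennreal_leI mult_left_mono sum_powr_geometric_le) auto
      also have "4 * m / 2 powr \<eta> * (1 / (1 - 2 powr (- (1 / q)))) = 4 * (1 / (1 - 2 powr (- (1 / q)))) * m / 2 powr \<eta>"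
        by (simp only: times_divide_eq_left times_divide_eq_right mult_ac)
      finally show "(\<Sum>j<M. emeasure lborel (Js j)) \<le> ennreal (4 * (1 / (1 - 2 powr (- (1 / q)))) * m / 2 powr \<eta>)" .
    qed
    also have "\<dots> = ennreal (25 * m / 2 powr \<eta> + 7 * m / 2 powr \<eta> + 4 * (1 / (1 - 2 powr (- (1 / q)))) * m / 2 powr \<eta>)"
    proof -
      have g: "0 \<le> 4 * (1 / (1 - 2 powr (- (1 / q)))) * m / 2 powr \<eta>" using geo m0 by (intro divide_nonneg_nonneg
          mult_nonneg_nonneg) auto
      have "0 \<le> 25 * m / 2 powr \<eta>" "0 \<le> 7 * m / 2 powr \<eta>" using m0 by auto
      then show ?thesis using g by (simp only: ennreal_plus add_nonneg_nonneg)
    qed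
    also have "25 * m / 2 powr \<eta> + 7 * m / 2 powr \<eta> + 4 * (1 / (1 - 2 powr (- (1 / q)))) * m / 2 powr \<eta> =
        ring_weak_const q * m / 2 powr \<eta>"
      unfolding ring_weak_const_def add_divide_distrib[symmetric] by (simp add: algebra_simps)
    finally show ?thesis by (simp only: bad_def m_def)
  qed
qed

text \<open>The average is at most 1, so raising it to a power q > 1 decreases it. This crude bound
  gives finiteness and settles levels of order 1 and above.\<close>

lemma ring_pow_le_hl_max:
  assumes A[measurable]: "A \<in> sets borel" and q: "1 < q"
  shows "ring_pow q A x \<le> ennreal (4 * hl_max A x)"
  unfolding ring_pow_def
proof (rule SUP_least)
  fix k :: int
  have "(\<integral>\<^sup>+\<tau>. ennreal (ring_avg A x \<tau> powr q) \<partial>exp_measure (of_int k)) \<le> (\<integral>\<^sup>+\<tau>. ennreal (ring_avg A x \<tau>) \<partial>exp_measure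
      (of_int k))"
  proof (intro nn_integral_mono ennreal_leI)
    fix \<tau>
    have "ring_avg A x \<tau> powr q \<le> ring_avg A x \<tau> powr 1"
      by (rule powr_mono') (use q in \<open>auto simp: ring_avg_le_1\<close>)
    then show "ring_avg A x \<tau> powr q \<le> ring_avg A x \<tau>" by simp
  qed
  also have "\<dots> \<le> ennreal (4 * hl_max A x)" by (rule nn_integral_exp_measure_ring_avg[OF A])
  finally show "(\<integral>\<^sup>+\<tau>. ennreal (ring_avg A x \<tau> powr q) \<partial>exp_measure (of_int k)) \<le> ennreal (4 * hl_max A x)" .
qed

text \<open>The conversion to a real loses nothing for Borel A and q > 1, where
  \<open>ring_pow\<close> is finite by \<open>ring_pow_le_hl_max\<close>.\<close>

definition ring_root :: "real \<Rightarrow> (real ^ 2) set \<Rightarrow> real ^ 2 \<Rightarrow> ennreal" where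
  "ring_root q A x = ennreal (enn2real (ring_pow q A x) powr (1 / q))"

lemma borel_measurable_ring_root:
  assumes "A \<in> sets borel"
  shows "ring_root q A \<in> borel_measurable borel"
proof -
  note [measurable] = borel_measurable_ring_pow[OF assms]
  show ?thesis unfolding ring_root_def[abs_def] by measurable
qed

lemma ennreal_ring_pow:
  assumes "A \<in> sets borel" "1 < q"
  shows "ring_pow q A x = ennreal (enn2real (ring_pow q A x))"
  using ring_pow_le_hl_max[OF assms, of x] by (subst ennreal_enn2real) (auto intro: le_less_trans)

text \<open>Taking the q-th root of the level h^((q + 1)/2) gives the power (q + 1)/(2 q) of h,
  where h is proportional to the measure of A over m.\<close>

lemma weak_bdd_ring_root:
  assumes q: "1 < q"
  obtains c where "0 \<le> c"
    "\<And>A. A \<in> sets borel \<Longrightarrow> emeasure lborel A < \<infinity> \<Longrightarrow>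
      weak_bdd ((q + 1) / (2 * q)) (ring_root q A) (c * measure lborel A powr ((q + 1) / (2 * q)))"
proof -
  define \<theta> where "\<theta> = (q + 1) / (2 * q)"
  define D where "D = ring_weak_const q"
  \<comment> \<open>The 4 makes the bound trivially true for h \<ge> 1, since
    \<open>ring_pow\<close> never exceeds 4.\<close>
  define K where "K = max 4 (ring_const q)"
  define c where "c = K powr (1 / q) * D powr \<theta>"
  have D: "D > 0" using geometric_const_nonneg[of "1 / q"] q by (auto simp: D_def ring_weak_const_def intro!: add_pos_nonneg)
  have K: "K \<ge> 4" "K \<ge> ring_const q" by (auto simp: K_def)
  have \<theta>q: "\<theta> * q = (q + 1) / 2" using q by (simp add: \<theta>_def)
  have "weak_bdd \<theta> (ring_root q A) (c * measure lborel A powr \<theta>)" if A: "A \<in> sets borel" "emeasure lborel A < \<infinity>" for A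
    unfolding weak_bdd_def
  proof (intro allI impI)
    fix m :: real assume m: "m > 0"
    \<comment> \<open>The level whose exceptional set has measure exactly m in
      \<open>ring_pow_weak_type_less_1\<close>.\<close>
    define h where "h = D * measure lborel A / m"
    have h0: "h \<ge> 0" using D m by (simp add: h_def)
    have thr: "c * measure lborel A powr \<theta> * m powr - \<theta> = K powr (1 / q) * h powr \<theta>"
      using m D by (simp add: h_def c_def powr_divide powr_mult powr_minus_divide)
    have big: "K * h powr ((q + 1) / 2) < enn2real (ring_pow q A x)" if "ennreal (c * measure lborel A powr \<theta> * m powr -
        \<theta>) < ring_root q A x" for x
    proof -
      let ?w = "enn2real (ring_pow q A x)"
      have lt: "K powr (1 / q) * h powr \<theta> < ?w powr (1 / q)" using that K unfolding thr ring_root_def by (simp add: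
          ennreal_less_iff)
      have "(K powr (1 / q) * h powr \<theta>) powr q < (?w powr (1 / q)) powr q"
        by (rule powr_less_mono2) (use lt q K in auto)
      moreover have "(K powr (1 / q) * h powr \<theta>) powr q = K * h powr ((q + 1) / 2)" unfolding \<theta>q[symmetric] using K q by
          (simp add: powr_mult powr_powr)
      moreover have "(?w powr (1 / q)) powr q = ?w" using q by (simp add: powr_powr)
      ultimately show ?thesis by simp
    qed
    show "emeasure lborel {x. ennreal (c * measure lborel A powr \<theta> * m powr - \<theta>) < ring_root q A x} \<le> ennreal m"
    proof (cases "measure lborel A = 0")
      case True
      have "enn2real (ring_pow q A x) \<le> 0" for x
      proof -
        have "hl_max A x \<le> 0"
          unfolding hl_max_def
        proof (rule cSUP_least)
          fix r :: real assume "r \<in> {0<..}"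
          have "measure lborel (A \<inter> ball x r) \<le> measure lborel A"
            by (rule measure_mono_fmeasurable) (use A in \<open>auto simp: fmeasurable_def\<close>)
          then show "measure lborel (A \<inter> ball x r) / measure lborel (ball x r) \<le> 0" using True measure_nonneg[of lborel
              "A \<inter> ball x r"] by simp
        qed simp
        then have "ennreal (4 * hl_max A x) = 0" by (simp add: ennreal_neg)
        then have "ring_pow q A x = 0" using ring_pow_le_hl_max[OF A(1) q, of x] by simp
        then show ?thesis by simp
      qed
      moreover have "0 \<le> K * h powr ((q + 1) / 2)" using K by simp
      ultimately have "{x. ennreal (c * measure lborel A powr \<theta> * m powr - \<theta>) < ring_root q A x} = {}"
        using big by (fastforce dest: order_trans less_le_trans)
      then show ?thesis by simp
    next
      case False
      then have M: "measure lborel A > 0" using measure_nonneg[of lborel A] by linarith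
      then have h: "h > 0" using D m by (simp add: h_def)
      show ?thesis
      proof (cases "h < 1")
        case True
        define \<eta> where "\<eta> = log 2 h"
        have h\<eta>: "2 powr \<eta> = h" "\<eta> < 0" using h True by (auto simp: \<eta>_def)
        have hp: "h powr ((q + 1) / 2) = 2 powr (\<eta> * (q + 1) / 2)" unfolding h\<eta>(1)[symmetric] powr_powr by simp
        have "{x. ennreal (c * measure lborel A powr \<theta> * m powr - \<theta>) < ring_root q A x} \<subseteq> {x. ennreal (ring_const q * 2
            powr (\<eta> * (q + 1) / 2)) < ring_pow q A x}"
        proof
          fix x assume "x \<in> {x. ennreal (c * measure lborel A powr \<theta> * m powr - \<theta>) < ring_root q A x}"
          then have b: "K * h powr ((q + 1) / 2) < enn2real (ring_pow q A x)" by (intro big) simp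
          have "ring_const q * h powr ((q + 1) / 2) \<le> K * h powr ((q + 1) / 2)" using K by (intro mult_right_mono) auto
          also note b
          finally have "ring_const q * h powr ((q + 1) / 2) < enn2real (ring_pow q A x)" .
          moreover have "0 < enn2real (ring_pow q A x)" by (rule le_less_trans[OF _ b]) (use K in simp)
          ultimately have "ennreal (ring_const q * h powr ((q + 1) / 2)) < ennreal (enn2real (ring_pow q A x))"
            by (rule ennreal_lessI[rotated])
          then show "x \<in> {x. ennreal (ring_const q * 2 powr (\<eta> * (q + 1) / 2)) < ring_pow q A x}"
            unfolding hp ennreal_ring_pow[OF A(1) q, symmetric] by simp
        qed
        then have "emeasure lborel {x. ennreal (c * measure lborel A powr \<theta> * m powr - \<theta>) < ring_root q A x}
          \<le> emeasure lborel {x. ennreal (ring_const q * 2 powr (\<eta> * (q + 1) / 2)) < ring_pow q A x}"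
          by (rule emeasure_mono) (rule sets_ennreal_less[OF borel_measurable_ring_pow[OF A(1)]])
        also have "\<dots> \<le> ennreal (ring_weak_const q * measure lborel A / 2 powr \<eta>)"
          by (rule ring_pow_weak_type_less_1[OF A q h\<eta>(2)])
        also have "ring_weak_const q * measure lborel A / 2 powr \<eta> = m"
          unfolding h\<eta>(1) D_def[symmetric] using M D m by (simp add: h_def)
        finally show ?thesis .
      next
        case False
        then have h1: "1 \<le> h powr ((q + 1) / 2)" using q by (intro ge_one_powr_ge_zero) auto
        have "enn2real (ring_pow q A x) \<le> K * h powr ((q + 1) / 2)" for x
        proof -
          have "ring_pow q A x \<le> ennreal (4 * hl_max A x)" by (rule ring_pow_le_hl_max[OF A(1) q])
          also have "\<dots> \<le> ennreal 4" by (rule ennreal_leI) (use hl_max_le_1[OF A(1), of x] in simp)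
          finally have "enn2real (ring_pow q A x) \<le> 4" by (intro enn2real_leI) auto
          also have "4 * 1 \<le> K * h powr ((q + 1) / 2)" using K h1 by (intro mult_mono) auto
          finally show ?thesis by simp
        qed
        then have "{x. ennreal (c * measure lborel A powr \<theta> * m powr - \<theta>) < ring_root q A x} = {}"
          using big by (fastforce simp: not_less[symmetric])
        then show ?thesis by simp
      qed
    qed
  qed
  moreover have "0 \<le> c" by (simp add: c_def)
  ultimately show thesis using that unfolding \<theta>_def by blast
qed

section \<open>Hoelder's inequality over the slices and the final assembly\<close>

section \<open>Boundedness in dimensions one and two\<close>

text \<open>The substitution s = e^\<tau>/T carries the uniform measure on (0, 1) to
  \<open>exp_measure (ln T)\<close>. Intervals [e^(-n-1), 1] avoid the end s = 0, and monotone
  convergence recovers it.\<close>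

lemma nn_integral_ln_ring_avg_powr:
  fixes T :: real
  assumes A[measurable]: "A \<in> sets borel" and T: "T > 0"
  shows "(\<integral>\<^sup>+s\<in>{0<..<1}. ennreal (ring_avg A x (ln (T * s)) powr q) \<partial>lborel)
    \<le> ennreal (exp 1) * ring_pow q A x"
proof -
  define c where "c = ln T"
  define f where "f \<tau> = ennreal (ring_avg A x \<tau> powr q)" for \<tau>
  define F where "F s = f (ln (T * s))" for s
  have [measurable]: "f \<in> borel_measurable borel" unfolding f_def by measurable
  have [measurable]: "F \<in> borel_measurable borel" unfolding F_def by measurable
  have le: "(\<integral>\<^sup>+s. F s * indicator {exp (- real (Suc n))..1} s \<partial>lborel) \<le> (\<integral>\<^sup>+\<tau>. f \<tau> \<partial>exp_measure c)" for n
  proof -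
    have "(\<integral>\<^sup>+s. F s * indicator {exp (- real (Suc n))..1} s \<partial>lborel)
      = (\<integral>\<^sup>+s. F s * indicator {exp ((c - real (Suc n)) - c)..exp (c - c)} s \<partial>lborel)" by simp
    also have "\<dots> = (\<integral>\<^sup>+\<tau>. F (exp (\<tau> - c)) * ennreal (exp (\<tau> - c)) * indicator {c - real (Suc n)..c} \<tau> \<partial>lborel)"
      by (rule nn_integral_substitution_aux[where g = "\<lambda>\<tau>. exp (\<tau> - c)"]) (auto intro!: derivative_eq_intros continuous_intros)
    also have "\<dots> \<le> (\<integral>\<^sup>+\<tau>. f \<tau> * ennreal (exp (\<tau> - c) * indicator {..c} \<tau>) \<partial>lborel)"
    proof (rule nn_integral_mono)
      fix \<tau>
      have "T * exp (\<tau> - c) = exp \<tau>" using T by (simp add: c_def exp_diff)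
      then have "F (exp (\<tau> - c)) = f \<tau>" by (simp add: F_def)
      then show "F (exp (\<tau> - c)) * ennreal (exp (\<tau> - c)) * indicator {c - real (Suc n)..c} \<tau> \<le> f \<tau> * ennreal (exp (\<tau> -
          c) * indicator {..c} \<tau>)"
        by (simp split: split_indicator)
    qed
    also have "\<dots> = (\<integral>\<^sup>+\<tau>. f \<tau> \<partial>exp_measure c)" by (rule nn_integral_exp_measure[symmetric]) measurable
    finally show ?thesis .
  qed
  have "(\<integral>\<^sup>+s\<in>{0<..<1}. ennreal (ring_avg A x (ln (T * s)) powr q) \<partial>lborel) \<le> (\<integral>\<^sup>+s. (SUP n. F s * indicator {exp (-
      real (Suc n))..1} s) \<partial>lborel)"
  proof (rule nn_integral_mono)
    fix s :: real
    show "ennreal (ring_avg A x (ln (T * s)) powr q) * indicator {0<..<1} s \<le> (SUP n. F s * indicator {exp (- real (Suc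
        n))..1} s)"
    proof (cases "0 < s \<and> s < 1")
      case True
      obtain n where n: "- ln s \<le> real n" using real_arch_simple by blast
      have "exp (- real (Suc n)) \<le> exp (ln s)" using n by simp
      then have "exp (- real (Suc n)) \<le> s" using True by simp
      then have "s \<in> {exp (- real (Suc n))..1}" using True by simp
      then show ?thesis using True by (intro SUP_upper2[of n]) (simp_all add: F_def f_def)
    next
      case False
      then have "s \<notin> {0<..<1}" by simp
      then show ?thesis by simp
    qed
  qed
  also have "\<dots> = (SUP n. \<integral>\<^sup>+s. F s * indicator {exp (- real (Suc n))..1} s \<partial>lborel)"
  proof (rule nn_integral_monotone_convergence_SUP)
    show "incseq (\<lambda>n s. F s * indicator {exp (- real (Suc n))..1} s)"
    proof (intro incseq_SucI le_funI mult_left_mono)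
      fix n and s :: real
      have "exp (- real (Suc (Suc n))) \<le> exp (- real (Suc n))" by simp
      then have "{exp (- real (Suc n))..1} \<subseteq> {exp (- real (Suc (Suc n)))..1}" by (intro atLeastatMost_subset_iff[THEN
          iffD2]) blast
      then show "(indicator {exp (- real (Suc n))..1} s :: ennreal) \<le> indicator {exp (- real (Suc (Suc n)))..1} s"
        unfolding indicator_def by (auto simp del: atLeastAtMost_iff atLeastatMost_subset_iff of_nat_Suc)
    qed simp
  qed measurable
  also have "\<dots> \<le> (\<integral>\<^sup>+\<tau>. f \<tau> \<partial>exp_measure c)" by (rule SUP_least) (rule le)
  \<comment> \<open>Moving the endpoint up to the next integer multiplies the density by no less
    than 1/e on the old half-line.\<close>
  also have "\<dots> \<le> ennreal (exp 1) * (\<integral>\<^sup>+\<tau>. f \<tau> \<partial>exp_measure (of_int \<lceil>c\<rceil>))"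
  proof -
    define k where "k = real_of_int \<lceil>c\<rceil>"
    have k: "c \<le> k" "k - c \<le> 1" using of_int_ceiling_le_add_one[of c] by (simp_all add: k_def algebra_simps)
    have "(\<integral>\<^sup>+\<tau>. f \<tau> \<partial>exp_measure c) = (\<integral>\<^sup>+\<tau>. f \<tau> * ennreal (exp (\<tau> - c) * indicator {..c} \<tau>) \<partial>lborel)" by (rule
        nn_integral_exp_measure) measurable
    also have "\<dots> \<le> (\<integral>\<^sup>+\<tau>. ennreal (exp 1) * (f \<tau> * ennreal (exp (\<tau> - k) * indicator {..k} \<tau>)) \<partial>lborel)"
    proof (rule nn_integral_mono)
      fix \<tau> :: real
      have "exp (\<tau> - c) * indicator {..c} \<tau> \<le> exp 1 * (exp (\<tau> - k) * indicator {..k} \<tau>)"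
      proof (cases "\<tau> \<le> c")
        case True
        have "exp (\<tau> - c) \<le> exp (1 + (\<tau> - k))" using k by simp
        then show ?thesis using True k by (simp add: exp_add)
      qed simp
      then have "ennreal (exp (\<tau> - c) * indicator {..c} \<tau>) \<le> ennreal (exp 1) * ennreal (exp (\<tau> - k) * indicator {..k} \<tau>)"
        by (subst ennreal_mult[symmetric]) (auto intro: ennreal_leI)
      then have "f \<tau> * ennreal (exp (\<tau> - c) * indicator {..c} \<tau>) \<le> f \<tau> * (ennreal (exp 1) * ennreal (exp (\<tau> - k) *
          indicator {..k} \<tau>))"
        by (rule mult_left_mono) simp
      then show "f \<tau> * ennreal (exp (\<tau> - c) * indicator {..c} \<tau>) \<le> ennreal (exp 1) * (f \<tau> * ennreal (exp (\<tau> - k) *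
          indicator {..k} \<tau>))"
        by (simp only: mult_ac)
    qed
    also have "\<dots> = ennreal (exp 1) * (\<integral>\<^sup>+\<tau>. f \<tau> * ennreal (exp (\<tau> - k) * indicator {..k} \<tau>) \<partial>lborel)" by (rule
        nn_integral_cmult) measurable
    also have "(\<integral>\<^sup>+\<tau>. f \<tau> * ennreal (exp (\<tau> - k) * indicator {..k} \<tau>) \<partial>lborel) = (\<integral>\<^sup>+\<tau>. f \<tau> \<partial>exp_measure k)" by (rule
        nn_integral_exp_measure[symmetric]) measurable
    finally show ?thesis by (simp only: k_def)
  qed
  also have "\<dots> \<le> ennreal (exp 1) * ring_pow q A x"
    unfolding ring_pow_def f_def by (intro mult_left_mono SUP_upper) auto
  finally show ?thesis .
qed

text \<open>Young's inequality after normalising by the bounds X and Y. If one of them is 0,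
  normalisation fails, but then one factor vanishes almost everywhere.\<close>

lemma nn_integral_Holder:
  fixes f g :: "real \<Rightarrow> real"
  assumes [measurable]: "f \<in> borel_measurable M" "g \<in> borel_measurable M"
    and nn: "\<And>s. 0 \<le> f s" "\<And>s. 0 \<le> g s" and q: "1 < q" "1 < q'" "1 / q + 1 / q' = 1" and XY: "0 \<le> X" "0 \<le> Y"
    and f: "(\<integral>\<^sup>+s. ennreal (f s powr q) \<partial>M) \<le> ennreal X" and g: "(\<integral>\<^sup>+s. ennreal (g s powr q') \<partial>M) \<le> ennreal Y"
  shows "(\<integral>\<^sup>+s. ennreal (f s * g s) \<partial>M) \<le> ennreal (X powr (1 / q) * Y powr (1 / q'))"
proof -
  have zero: "(\<integral>\<^sup>+s. ennreal (f' s * g' s) \<partial>M) = 0"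
    if [measurable]: "f' \<in> borel_measurable M" "g' \<in> borel_measurable M" and nn': "\<And>s. 0 \<le> f' s" and i: "(\<integral>\<^sup>+s. ennreal
        (f' s powr r) \<partial>M) \<le> 0" for f' g' :: "real \<Rightarrow> real" and r
  proof -
    have "(\<integral>\<^sup>+s. ennreal (f' s powr r) \<partial>M) = 0" using i by simp
    then have "AE s in M. ennreal (f' s powr r) = 0" by (subst (asm) nn_integral_0_iff_AE) auto
    then have "AE s in M. ennreal (f' s * g' s) = 0"
    proof eventually_elim
      case (elim s)
      then have "f' s powr r = 0" by (metis ennreal_eq_0_iff powr_ge_zero antisym)
      then show ?case by simp
    qed
    then show ?thesis by (subst nn_integral_0_iff_AE) auto
  qed
  consider "X = 0" | "Y = 0" | "X > 0" "Y > 0" using XY by linarith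
  then show ?thesis
  proof cases
    case 1
    then show ?thesis using zero[of f g q] f nn by simp
  next
    case 2
    then show ?thesis using zero[of g f q'] g nn by (simp add: mult.commute)
  next
    case 3
    define K where "K = X powr (1 / q) * Y powr (1 / q')"
    have K: "K > 0" using 3 by (simp add: K_def)
    have "(\<integral>\<^sup>+s. ennreal (f s * g s) \<partial>M) \<le> ennreal (K * (1 / q + 1 / q' + 0))"
    proof (rule nn_integral_le_add3)
      show "(\<lambda>s. f s powr q / (X * q)) \<in> borel_measurable M" "(\<lambda>s. g s powr q' / (Y * q')) \<in> borel_measurable M" by measurable
      show "(\<lambda>_. 0::real) \<in> borel_measurable M" by simp
      show "0 \<le> f s powr q / (X * q)" "0 \<le> g s powr q' / (Y * q')" for s using 3 q by auto
      show "f s * g s \<le> K * (f s powr q / (X * q) + g s powr q' / (Y * q') + 0)" for s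
      proof -
        have "(f s / X powr (1 / q)) * (g s / Y powr (1 / q')) \<le> (f s / X powr (1 / q)) powr q / q + (g s / Y powr (1 /
            q')) powr q' / q'"
          by (rule Youngs_inequality) (use q nn in auto)
        also have "(f s / X powr (1 / q)) powr q = f s powr q / X" using 3 q nn by (simp add: powr_divide powr_powr)
        also have "(g s / Y powr (1 / q')) powr q' = g s powr q' / Y" using 3 q nn by (simp add: powr_divide powr_powr)
        finally have "f s * g s / K \<le> f s powr q / (X * q) + g s powr q' / (Y * q')" by (simp add: K_def)
        then show ?thesis using K by (simp add: pos_divide_le_eq mult.commute)
      qed
      show "(\<integral>\<^sup>+s. ennreal (f s powr q / (X * q)) \<partial>M) \<le> ennreal (1 / q)"
      proof -
        have "(\<integral>\<^sup>+s. ennreal (f s powr q / (X * q)) \<partial>M) = (\<integral>\<^sup>+s. ennreal (1 / (X * q)) * ennreal (f s powr q) \<partial>M)"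
          using 3 q by (intro nn_integral_cong) (subst ennreal_mult[symmetric], auto)
        also have "\<dots> = ennreal (1 / (X * q)) * (\<integral>\<^sup>+s. ennreal (f s powr q) \<partial>M)" by (rule nn_integral_cmult) measurable
        also have "\<dots> \<le> ennreal (1 / (X * q)) * ennreal X" by (rule mult_left_mono[OF f]) simp
        also have "\<dots> = ennreal (1 / q)" using 3 q by (subst ennreal_mult[symmetric]) auto
        finally show ?thesis .
      qed
      show "(\<integral>\<^sup>+s. ennreal (g s powr q' / (Y * q')) \<partial>M) \<le> ennreal (1 / q')"
      proof -
        have "(\<integral>\<^sup>+s. ennreal (g s powr q' / (Y * q')) \<partial>M) = (\<integral>\<^sup>+s. ennreal (1 / (Y * q')) * ennreal (g s powr q') \<partial>M)"
          using 3 q by (intro nn_integral_cong) (subst ennreal_mult[symmetric], auto)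
        also have "\<dots> = ennreal (1 / (Y * q')) * (\<integral>\<^sup>+s. ennreal (g s powr q') \<partial>M)" by (rule nn_integral_cmult) measurable
        also have "\<dots> \<le> ennreal (1 / (Y * q')) * ennreal Y" by (rule mult_left_mono[OF g]) simp
        also have "\<dots> = ennreal (1 / q')" using 3 q by (subst ennreal_mult[symmetric]) auto
        finally show ?thesis .
      qed
    qed (use K q in auto)
    then show ?thesis using q(3) by (simp add: K_def)
  qed
qed

text \<open>The sets A and B meet the slices in circles of squared radii t^2 s and t^2 (1 - s).
  Hoelder in s separates them, and the power means no longer depend on t. The constant is 2 pi^2
  from slicing times e^(1/q) e^(1/q') = e.\<close>

lemma sph_form_le_ring_root:
  assumes A[measurable]: "A \<in> sets borel" and B[measurable]: "B \<in> sets borel" and t: "t > 0"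
    and q: "1 < q" "1 < q'" "1 / q + 1 / q' = 1"
  shows "sph_form (indicator A) (indicator B) t x \<le> (ennreal (2 * pi\<^sup>2 * exp 1) * ring_root q A x) * ring_root q' B x"
proof -
  define T where "T = t\<^sup>2"
  have T: "T > 0" using t by (simp add: T_def)
  define f where "f s = ring_avg A x (ln (T * s)) * indicator {0<..<1} s" for s :: real
  define g where "g s = ring_avg B x (ln (T * (1 - s))) * indicator {0<..<1} s" for s :: real
  have [measurable]: "f \<in> borel_measurable borel" "g \<in> borel_measurable borel" unfolding f_def g_def by measurable
  define X where "X = exp 1 * enn2real (ring_pow q A x)"
  define Y where "Y = exp 1 * enn2real (ring_pow q' B x)"
  have eX: "ennreal (exp 1) * ring_pow q A x = ennreal X"
    unfolding X_def by (subst ennreal_mult) (simp_all add: ennreal_ring_pow[OF A q(1), symmetric])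
  have eY: "ennreal (exp 1) * ring_pow q' B x = ennreal Y"
    unfolding Y_def by (subst ennreal_mult) (simp_all add: ennreal_ring_pow[OF B q(2), symmetric])
  have fX: "(\<integral>\<^sup>+s. ennreal (f s powr q) \<partial>lborel) \<le> ennreal X"
  proof -
    have "(\<integral>\<^sup>+s. ennreal (f s powr q) \<partial>lborel) = (\<integral>\<^sup>+s\<in>{0<..<1}. ennreal (ring_avg A x (ln (T * s)) powr q) \<partial>lborel)"
      by (intro nn_integral_cong) (simp add: f_def split: split_indicator)
    then show ?thesis using nn_integral_ln_ring_avg_powr[OF A T, of x q] eX by simp
  qed
  \<comment> \<open>The reflection s \<mapsto> 1 - s puts the second factor into the form treated
    for the first.\<close>
  have gY: "(\<integral>\<^sup>+s. ennreal (g s powr q') \<partial>lborel) \<le> ennreal Y"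
  proof -
    have "(\<integral>\<^sup>+s. ennreal (g s powr q') \<partial>lborel) = ennreal \<bar>-1\<bar> * (\<integral>\<^sup>+s. ennreal (g (1 + (-1) * s) powr q') \<partial>lborel)"
      by (rule nn_integral_real_affine) auto
    also have "\<dots> = (\<integral>\<^sup>+s\<in>{0<..<1}. ennreal (ring_avg B x (ln (T * s)) powr q') \<partial>lborel)"
      by (simp, intro nn_integral_cong) (simp add: g_def split: split_indicator)
    finally show ?thesis using nn_integral_ln_ring_avg_powr[OF B T, of x q'] eY by simp
  qed
  have cv: "cavg (indicator C) x (T * s) = ennreal (ring_avg C x (ln (T * s)))" if "0 < s" for C and s :: real
    unfolding ennreal_ring_avg using T that by simp
  have "(\<integral>\<^sup>+s\<in>{0<..<1}. cavg (indicator A) x (T * s) * cavg (indicator B) x (T * (1 - s)) \<partial>lborel) = (\<integral>\<^sup>+s. ennreal (f s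
      * g s) \<partial>lborel)"
  proof (rule nn_integral_cong)
    fix s :: real
    show "cavg (indicator A) x (T * s) * cavg (indicator B) x (T * (1 - s)) * indicator {0<..<1} s = ennreal (f s * g s)"
    proof (cases "0 < s \<and> s < 1")
      case True
      then show ?thesis using cv[of s A] cv[of "1 - s" B] by (simp add: f_def g_def ennreal_mult)
    qed (simp add: f_def)
  qed
  also have "\<dots> \<le> ennreal (X powr (1 / q) * Y powr (1 / q'))"
    by (rule nn_integral_Holder[OF _ _ _ _ q _ _ fX gY]) (auto simp: f_def g_def X_def Y_def)
  also have "X powr (1 / q) * Y powr (1 / q') = exp 1 * (enn2real (ring_pow q A x) powr (1 / q) * enn2real (ring_pow q'
      B x) powr (1 / q'))"
  proof -
    have "exp 1 powr (1 / q) * exp 1 powr (1 / q') = (exp 1 :: real)" unfolding powr_add[symmetric] q(3) by simp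
    then show ?thesis unfolding X_def Y_def by (simp add: powr_mult mult_ac)
  qed
  finally have le: "(\<integral>\<^sup>+s\<in>{0<..<1}. cavg (indicator A) x (T * s) * cavg (indicator B) x (T * (1 - s)) \<partial>lborel)
    \<le> ennreal (exp 1 * (enn2real (ring_pow q A x) powr (1 / q) * enn2real (ring_pow q' B x) powr (1 / q')))" .
  have "sph_form (indicator A) (indicator B) t x = ennreal (2 * pi\<^sup>2) * (\<integral>\<^sup>+s\<in>{0<..<1}. cavg (indicator A) x (T * s) *
      cavg (indicator B) x (T * (1 - s)) \<partial>lborel)"
    unfolding T_def by (rule sph_form_plane[OF _ _ t]) measurable
  also have "\<dots> \<le> ennreal (2 * pi\<^sup>2) * ennreal (exp 1 * (enn2real (ring_pow q A x) powr (1 / q) * enn2real (ring_pow q' B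
      x) powr (1 / q')))"
    by (rule mult_left_mono[OF le]) simp
  also have "\<dots> = ennreal ((2 * pi\<^sup>2 * exp 1 * enn2real (ring_pow q A x) powr (1 / q)) * enn2real (ring_pow q' B x) powr (1 / q'))"
    by (subst ennreal_mult[symmetric]) (auto simp: mult_ac)
  also have "\<dots> = (ennreal (2 * pi\<^sup>2 * exp 1) * ring_root q A x) * ring_root q' B x"
    unfolding ring_root_def by (subst ennreal_mult, simp, simp, subst ennreal_mult, simp, simp) simp
  finally show ?thesis .
qed

lemma nn_integral_unit_disc_polar:
  assumes [measurable]: "h \<in> borel_measurable borel"
  shows "ennreal pi * (\<integral>\<^sup>+u\<in>{0<..<1}. cavg (\<lambda>z. h (- z)) 0 u \<partial>lborel) \<le> (\<integral>\<^sup>+z\<in>cball 0 1. h z \<partial>lborel)"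
proof -
  define h1 :: "real ^ 2 \<Rightarrow> ennreal" where "h1 z = h z * indicator (cball 0 1) z" for z
  have [measurable]: "h1 \<in> borel_measurable borel" unfolding h1_def
    by (intro borel_measurable_times_ennreal borel_measurable_indicator) auto
  have "(\<integral>\<^sup>+u\<in>{0<..<1}. cavg (\<lambda>z. h (- z)) 0 u \<partial>lborel) \<le> (\<integral>\<^sup>+u\<in>{0<..}. (\<integral>\<^sup>+\<theta>. h1 (sqrt u *\<^sub>R cis2 \<theta>) \<partial>circ) \<partial>lborel)"
  proof (rule nn_integral_mono)
    fix u :: real
    show "cavg (\<lambda>z. h (- z)) 0 u * indicator {0<..<1} u \<le> (\<integral>\<^sup>+\<theta>. h1 (sqrt u *\<^sub>R cis2 \<theta>) \<partial>circ) * indicator {0<..} u"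
    proof (cases "0 < u \<and> u < 1")
      case True
      then have "h1 (sqrt u *\<^sub>R cis2 \<theta>) = h (sqrt u *\<^sub>R cis2 \<theta>)" for \<theta> by (simp add: h1_def indicator_def)
      then show ?thesis using True by (simp add: cavg_def)
    qed (auto simp: indicator_def)
  qed
  then have "ennreal pi * (\<integral>\<^sup>+u\<in>{0<..<1}. cavg (\<lambda>z. h (- z)) 0 u \<partial>lborel) \<le> ennreal pi * (\<integral>\<^sup>+u\<in>{0<..}. (\<integral>\<^sup>+\<theta>. h1 (sqrt u
      *\<^sub>R cis2 \<theta>) \<partial>circ) \<partial>lborel)"
    by (rule mult_left_mono) simp
  also have "\<dots> = (\<integral>\<^sup>+z. h1 z \<partial>lborel)" by (rule nn_integral_polar2[symmetric]) measurable
  finally show ?thesis by (simp add: h1_def)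
qed

lemma cavg_const: "cavg (\<lambda>_. 1) x u = 1"
  unfolding cavg_def using circ.emeasure_space_1 by simp

text \<open>The projection of the three-sphere to a coordinate plane has constant density 2 pi on
  the unit disc, an analogue of the hat-box theorem: the squared radius is uniform by
  \<open>sph_form_plane\<close>, and so it is on the disc.\<close>

lemma ac_proj_plane: "ac_proj (fst :: (real ^ 2) \<times> (real ^ 2) \<Rightarrow> real ^ 2)" "ac_proj (snd :: (real ^ 2) \<times> (real ^ 2) \<Rightarrow> real ^ 2)"
proof -
  have two: "ennreal (2 * pi\<^sup>2) = ennreal (2 * pi) * ennreal pi" by (simp add: ennreal_mult[symmetric] power2_eq_square)
  have fst: "(\<integral>\<^sup>+y. h (fst y) \<partial>(sph :: ((real ^ 2) \<times> (real ^ 2)) measure)) \<le> ennreal e + ennreal (2 * pi) * (\<integral>\<^sup>+z\<in>cball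
      0 1. h z \<partial>lborel)"
    if [measurable]: "h \<in> borel_measurable borel" for e and h :: "real ^ 2 \<Rightarrow> ennreal"
  proof -
    have "(\<integral>\<^sup>+y. h (fst y) \<partial>(sph :: ((real ^ 2) \<times> (real ^ 2)) measure)) = sph_form (\<lambda>z. h (- z)) (\<lambda>_. 1) 1 0" by (simp
        add: sph_form_def)
    also have "\<dots> = ennreal (2 * pi\<^sup>2) * (\<integral>\<^sup>+s\<in>{0<..<1}. cavg (\<lambda>z. h (- z)) 0 (1\<^sup>2 * s) * cavg (\<lambda>_. 1) 0 (1\<^sup>2 * (1 - s)) \<partial>lborel)"
      by (rule sph_form_plane) auto
    also have "\<dots> = ennreal (2 * pi) * (ennreal pi * (\<integral>\<^sup>+u\<in>{0<..<1}. cavg (\<lambda>z. h (- z)) 0 u \<partial>lborel))"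
      unfolding two by (simp add: cavg_const mult.assoc)
    also have "\<dots> \<le> ennreal (2 * pi) * (\<integral>\<^sup>+z\<in>cball 0 1. h z \<partial>lborel)"
      by (intro mult_left_mono nn_integral_unit_disc_polar) auto
    finally show ?thesis by (rule order_trans) (rule add_increasing, simp_all)
  qed
  have snd: "(\<integral>\<^sup>+y. h (snd y) \<partial>(sph :: ((real ^ 2) \<times> (real ^ 2)) measure)) \<le> ennreal e + ennreal (2 * pi) * (\<integral>\<^sup>+z\<in>cball
      0 1. h z \<partial>lborel)"
    if [measurable]: "h \<in> borel_measurable borel" for e and h :: "real ^ 2 \<Rightarrow> ennreal"
  proof -
    have r: "(\<integral>\<^sup>+s\<in>{0<..<1}. cavg (\<lambda>z. h (- z)) 0 (1 - s) \<partial>lborel) = (\<integral>\<^sup>+u\<in>{0<..<1}. cavg (\<lambda>z. h (- z)) 0 u \<partial>lborel)"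
    proof -
      have "(\<integral>\<^sup>+u\<in>{0<..<1}. cavg (\<lambda>z. h (- z)) 0 u \<partial>lborel) = ennreal \<bar>-1\<bar> * (\<integral>\<^sup>+s. cavg (\<lambda>z. h (- z)) 0 (1 + (-1) * s)
          * indicator {0<..<1} (1 + (-1) * s) \<partial>lborel)"
        by (rule nn_integral_real_affine) auto
      also have "\<dots> = (\<integral>\<^sup>+s\<in>{0<..<1}. cavg (\<lambda>z. h (- z)) 0 (1 - s) \<partial>lborel)"
        by (simp, intro nn_integral_cong) (simp split: split_indicator)
      finally show ?thesis by simp
    qed
    have "(\<integral>\<^sup>+y. h (snd y) \<partial>(sph :: ((real ^ 2) \<times> (real ^ 2)) measure)) = sph_form (\<lambda>_. 1) (\<lambda>z. h (- z)) 1 0" by (simp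
        add: sph_form_def)
    also have "\<dots> = ennreal (2 * pi\<^sup>2) * (\<integral>\<^sup>+s\<in>{0<..<1}. cavg (\<lambda>_. 1) 0 (1\<^sup>2 * s) * cavg (\<lambda>z. h (- z)) 0 (1\<^sup>2 * (1 - s)) \<partial>lborel)"
      by (rule sph_form_plane) auto
    also have "\<dots> = ennreal (2 * pi) * (ennreal pi * (\<integral>\<^sup>+u\<in>{0<..<1}. cavg (\<lambda>z. h (- z)) 0 u \<partial>lborel))"
      unfolding two using r by (simp add: cavg_const mult.assoc)
    also have "\<dots> \<le> ennreal (2 * pi) * (\<integral>\<^sup>+z\<in>cball 0 1. h z \<partial>lborel)"
      by (intro mult_left_mono nn_integral_unit_disc_polar) auto
    finally show ?thesis by (rule order_trans) (rule add_increasing, simp_all)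
  qed
  show "ac_proj (fst :: (real ^ 2) \<times> (real ^ 2) \<Rightarrow> real ^ 2)" "ac_proj (snd :: (real ^ 2) \<times> (real ^ 2) \<Rightarrow> real ^ 2)"
    unfolding ac_proj_def using fst snd by (auto intro!: exI[of _ "2 * pi"])
qed

text \<open>Reciprocal exponents turn the Hoelder relation into real addition; \<theta> = 0 stands
  for p = \<infinity>.\<close>

lemma ennreal_exponentE:
  fixes p :: ennreal
  assumes "1 \<le> p"
  obtains \<theta> where "0 \<le> \<theta>" "\<theta> \<le> 1" "1 / p = ennreal \<theta>" "p = (if \<theta> = 0 then \<infinity> else ennreal (1 / \<theta>))"
proof (cases p)
  case (real r)
  then have r: "r \<ge> 1" using assms by simp
  have "1 / p = ennreal (1 / r)" using real r divide_ennreal[of 1 r] by simp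
  then show ?thesis using that[of "1 / r"] real r by simp
next
  case top
  then show ?thesis using that[of 0] by simp
qed

text \<open>For \<theta> > 0 this is restricted weak type of powers of the maximal function. For
  \<theta> = 0 the power is at most 1, and K \<le> 1 keeps the operator below 1 as
  \<open>majorant_infinite_exponent\<close> demands.\<close>

lemma majorant_hl_max:
  assumes p: "p = (if \<theta> = 0 then \<infinity> else ennreal (1 / \<theta>))" and \<theta>: "0 \<le> \<theta>" "\<theta> \<le> 1 / 2" and K: "0 < K" "\<theta> = 0 \<Longrightarrow> K \<le> 1"
  shows "\<exists>c\<ge>0. \<forall>f\<in>clorentz_space p 1 (lebesgue :: real measure). \<exists>f' a A. f' \<in> borel_measurable borel \<and>
      (AE x in lborel. f x = f' x) \<and> majorized f' a A \<and>
      weak_bdd \<theta> (\<lambda>x. \<Sum>i. ennreal (a i) * ennreal (K * hl_max (A i) x powr \<theta>)) (c * enn2real (lorentz_norm p 1 lebesgue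
          (magnitude f)))"
proof (cases "\<theta> = 0")
  case True
  have le: "ennreal (K * hl_max A x powr 0) \<le> 1" for A :: "real set" and x
  proof -
    have "K * hl_max A x powr 0 \<le> 1 * 1" using K True by (intro mult_mono) auto
    then show ?thesis by simp
  qed
  have pinf: "p = \<infinity>" using p True by simp
  show ?thesis
    by (intro exI[of _ 1] conjI ballI, simp, unfold pinf True,
        rule majorant_infinite_exponent[where V = "\<lambda>A x. ennreal (K * hl_max A x powr 0)", OF _ le], assumption)
next
  case False
  then have \<theta>0: "\<theta> > 0" using \<theta> by simp
  define c where "c = weak_const \<theta> * (K * 5 powr \<theta> * 4)"
  have "\<exists>f' a A. f' \<in> borel_measurable borel \<and> (AE x in lborel. f x = f' x) \<and> majorized f' a A \<and>
      weak_bdd (1 / (1 / \<theta>)) (\<lambda>x. \<Sum>i. ennreal (a i) * ennreal (K * hl_max (A i) x powr \<theta>))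
        (weak_const (1 / (1 / \<theta>)) * (K * 5 powr \<theta> * 4) * enn2real (lorentz_norm (ennreal (1 / \<theta>)) 1 lebesgue (magnitude f)))"
    if f: "f \<in> clorentz_space p 1 lebesgue" for f :: "real \<Rightarrow> complex"
  proof (rule majorant_finite_exponent[where U = "\<lambda>A x. ennreal (K * hl_max A x powr \<theta>)"])
    show "1 < 1 / \<theta>" using \<theta> \<theta>0 by simp
    show "f \<in> clorentz_space (ennreal (1 / \<theta>)) 1 lebesgue" using f p False by simp
    show "0 \<le> K * 5 powr \<theta>" using K by simp
    show "(\<lambda>x. ennreal (K * hl_max A x powr \<theta>)) \<in> borel_measurable borel" if [measurable]: "A \<in> sets borel" for A ::
        "real set" by measurable
    show "weak_bdd (1 / (1 / \<theta>)) (\<lambda>x. ennreal (K * hl_max A x powr \<theta>)) (K * 5 powr \<theta> * measure lborel A powr (1 / (1 / \<theta>)))"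
      if "A \<in> sets borel" "emeasure lborel A < \<infinity>" for A :: "real set"
      using weak_bdd_hl_max_powr[OF that \<theta>0 K(1)] by simp
  qed
  note m = this
  have e: "1 / (1 / \<theta>) = \<theta>" by simp
  have pfin: "p = ennreal (1 / \<theta>)" using p False by simp
  have "weak_const \<theta> > 0" by (rule weak_const_pos) (use \<theta> \<theta>0 in auto)
  then have "0 \<le> c" using K by (simp add: c_def)
  then show ?thesis
    by (intro exI[of _ c] conjI ballI) (assumption, unfold c_def pfin, rule m[unfolded e pfin], assumption)
qed

lemma lorentz_bounded_real:
  fixes p1 p2 p :: ennreal and K1 K2 \<theta>1 \<theta>2 :: real
  assumes p1: "p1 = (if \<theta>1 = 0 then \<infinity> else ennreal (1 / \<theta>1))" "0 \<le> \<theta>1" "\<theta>1 \<le> 1 / 2" "0 < K1" "\<theta>1 = 0 \<Longrightarrow> K1 \<le> 1"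
    and p2: "p2 = (if \<theta>2 = 0 then \<infinity> else ennreal (1 / \<theta>2))" "0 \<le> \<theta>2" "\<theta>2 \<le> 1 / 2" "0 < K2" "\<theta>2 = 0 \<Longrightarrow> K2 \<le> 1"
    and K: "K1 * K2 = 16" and p: "p \<noteq> \<infinity>" "enn2real (1 / p) = \<theta>1 + \<theta>2"
  shows "lorentz_bounded (bilinear_sph_max :: (real \<Rightarrow> complex) \<Rightarrow> (real \<Rightarrow> complex) \<Rightarrow> real \<Rightarrow> ennreal) (p1, 1) (p2, 1) (p, \<infinity>)"
proof -
  let ?U = "\<lambda>K \<theta> (A :: real set) x. ennreal (K * hl_max A x powr \<theta>)"
  obtain c1 where c1: "0 \<le> c1" "\<And>f :: real \<Rightarrow> complex. f \<in> clorentz_space p1 1 lebesgue \<Longrightarrow> \<exists>f' a A. f' \<in> borel_measurable borel \<and>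
      (AE x in lborel. f x = f' x) \<and> majorized f' a A \<and>
      weak_bdd \<theta>1 (\<lambda>x. \<Sum>i. ennreal (a i) * ?U K1 \<theta>1 (A i) x) (c1 * enn2real (lorentz_norm p1 1 lebesgue (magnitude f)))"
    using majorant_hl_max[OF p1] by blast
  obtain c2 where c2: "0 \<le> c2" "\<And>f :: real \<Rightarrow> complex. f \<in> clorentz_space p2 1 lebesgue \<Longrightarrow> \<exists>f' a A. f' \<in> borel_measurable borel \<and>
      (AE x in lborel. f x = f' x) \<and> majorized f' a A \<and>
      weak_bdd \<theta>2 (\<lambda>x. \<Sum>i. ennreal (a i) * ?U K2 \<theta>2 (A i) x) (c2 * enn2real (lorentz_norm p2 1 lebesgue (magnitude f)))"
    using majorant_hl_max[OF p2] by blast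
  \<comment> \<open>The maximal function of a set is at most 1, so lowering the exponent from 1/2 to
    \<theta> only increases the power. This gives all exponents of at least 2 from one pointwise
    bound.\<close>
  have sq: "sqrt (hl_max A x) \<le> hl_max A x powr \<theta>" if "A \<in> sets borel" "\<theta> \<le> 1 / 2" for A :: "real set" and x \<theta>
    unfolding powr_half_sqrt[OF hl_max_nonneg[OF that(1)], symmetric]
    using that hl_max_nonneg[OF that(1)] hl_max_le_1[OF that(1)] by (intro powr_mono')
  show ?thesis
  proof (rule lorentz_bounded_bilinear_sph_max[where U = "?U K1 \<theta>1" and V = "?U K2 \<theta>2", OF ac_proj_fst_real
      ac_proj_snd_real _ _ _ c1(1) c2(1) c1(2) c2(2) p])
    fix A B :: "real set" and t x :: real
    assume A: "A \<in> sets borel" and B: "B \<in> sets borel" and t: "t > 0"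
    have "sph_form (indicator A) (indicator B) t x \<le> ennreal (16 * (sqrt (hl_max A x) * sqrt (hl_max B x)))" by (rule
        sph_form_real_le[OF A B t])
    also have "\<dots> \<le> ennreal (16 * (hl_max A x powr \<theta>1 * hl_max B x powr \<theta>2))"
      using hl_max_nonneg[OF A, of x] hl_max_nonneg[OF B, of x] p1 p2 by (intro ennreal_leI mult_left_mono mult_mono sq A B) auto
    also have "\<dots> = ennreal ((K1 * hl_max A x powr \<theta>1) * (K2 * hl_max B x powr \<theta>2))" unfolding K[symmetric] by (simp only: mult_ac)
    also have "\<dots> = ?U K1 \<theta>1 A x * ?U K2 \<theta>2 B x" by (rule ennreal_mult) (use p1 p2 in auto)
    finally show "sph_form (indicator A) (indicator B) t x \<le> ?U K1 \<theta>1 A x * ?U K2 \<theta>2 B x" .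
  next
    fix A :: "real set" assume [measurable]: "A \<in> sets borel"
    show "?U K1 \<theta>1 A \<in> borel_measurable borel" "?U K2 \<theta>2 A \<in> borel_measurable borel" by measurable
  qed
qed

lemma lorentz_bounded_plane:
  assumes \<theta>1: "1 / 2 < \<theta>1" "\<theta>1 < 1" and \<theta>2: "1 / 2 < \<theta>2" "\<theta>2 < 1" and sum: "\<theta>1 + \<theta>2 = 3 / 2"
  shows "lorentz_bounded (bilinear_sph_max :: (real ^ 2 \<Rightarrow> complex) \<Rightarrow> (real ^ 2 \<Rightarrow> complex) \<Rightarrow> real ^ 2 \<Rightarrow> ennreal)
    (ennreal (1 / \<theta>1), 1) (ennreal (1 / \<theta>2), 1) (2 / 3, \<infinity>)"
proof -
  \<comment> \<open>Solves (q + 1)/(2 q) = \<theta>, the exponent in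
    \<open>weak_bdd_ring_root\<close>. The reciprocals 2 \<theta>1 - 1 and 2 \<theta>2 - 1 add up to
    1 precisely because \<theta>1 + \<theta>2 = 3/2, so the exponents are conjugate.\<close>
  define q where "q \<theta> = 1 / (2 * \<theta> - 1)" for \<theta> :: real
  define C where "C = 2 * pi\<^sup>2 * exp 1"
  have C: "C > 0" by (simp add: C_def)
  have q1: "1 < q \<theta>" if "1 / 2 < \<theta>" "\<theta> < 1" for \<theta> using that by (simp add: q_def field_simps)
  have q\<theta>: "(q \<theta> + 1) / (2 * q \<theta>) = \<theta>" if "1 / 2 < \<theta>" for \<theta> using that by (simp add: q_def field_simps)
  have qs: "1 / q \<theta>1 + 1 / q \<theta>2 = 1" using \<theta>1 \<theta>2 sum by (simp add: q_def)
  have maj: "\<exists>c\<ge>0. \<forall>f\<in>clorentz_space (ennreal (1 / \<theta>)) 1 (lebesgue :: (real ^ 2) measure). \<exists>f' a A. f' \<in> borel_measurable borel \<and>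
      (AE x in lborel. f x = f' x) \<and> majorized f' a A \<and>
      weak_bdd \<theta> (\<lambda>x. \<Sum>i. ennreal (a i) * (ennreal K * ring_root (q \<theta>) (A i) x)) (c * enn2real (lorentz_norm (ennreal (1
          / \<theta>)) 1 lebesgue (magnitude f)))"
    if \<theta>: "1 / 2 < \<theta>" "\<theta> < 1" and K: "0 < K" for \<theta> K
  proof -
    obtain c where c: "0 \<le> c"
      "\<And>A. A \<in> sets borel \<Longrightarrow> emeasure lborel A < \<infinity> \<Longrightarrow> weak_bdd \<theta> (ring_root (q \<theta>) A) (c * measure lborel A powr \<theta>)"
      using weak_bdd_ring_root[OF q1[OF \<theta>]] unfolding q\<theta>[OF \<theta>(1)] by metis
    have "\<exists>f' a A. f' \<in> borel_measurable borel \<and> (AE x in lborel. f x = f' x) \<and> majorized f' a A \<and>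
      weak_bdd (1 / (1 / \<theta>)) (\<lambda>x. \<Sum>i. ennreal (a i) * (ennreal K * ring_root (q \<theta>) (A i) x))
        (weak_const (1 / (1 / \<theta>)) * (K * c * 4) * enn2real (lorentz_norm (ennreal (1 / \<theta>)) 1 lebesgue (magnitude f)))"
      if f: "f \<in> clorentz_space (ennreal (1 / \<theta>)) 1 lebesgue" for f :: "real ^ 2 \<Rightarrow> complex"
    proof (rule majorant_finite_exponent[where U = "\<lambda>A x. ennreal K * ring_root (q \<theta>) A x", OF _ f])
      show "1 < 1 / \<theta>" using \<theta> by simp
      show "0 \<le> K * c" using K c by simp
      show "(\<lambda>x. ennreal K * ring_root (q \<theta>) A x) \<in> borel_measurable borel" if "A \<in> sets borel" for A
        using borel_measurable_ring_root[OF that] by measurable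
      show "weak_bdd (1 / (1 / \<theta>)) (\<lambda>x. ennreal K * ring_root (q \<theta>) A x) (K * c * measure lborel A powr (1 / (1 / \<theta>)))"
        if "A \<in> sets borel" "emeasure lborel A < \<infinity>" for A
        using weak_bdd_cmult[OF c(2)[OF that] K] c(1) by (simp add: mult.assoc)
    qed
    moreover have "0 \<le> weak_const \<theta> * (K * c * 4)" using K c \<theta> weak_const_pos[of \<theta>] by simp
    ultimately show ?thesis by (intro exI[of _ "weak_const \<theta> * (K * c * 4)"]) simp
  qed
  obtain c1 where c1: "0 \<le> c1" "\<And>f :: real ^ 2 \<Rightarrow> complex. f \<in> clorentz_space (ennreal (1 / \<theta>1)) 1 lebesgue \<Longrightarrow> \<exists>f' a A. f'
      \<in> borel_measurable borel \<and>
      (AE x in lborel. f x = f' x) \<and> majorized f' a A \<and>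
      weak_bdd \<theta>1 (\<lambda>x. \<Sum>i. ennreal (a i) * (ennreal C * ring_root (q \<theta>1) (A i) x)) (c1 * enn2real (lorentz_norm (ennreal
          (1 / \<theta>1)) 1 lebesgue (magnitude f)))"
    using maj[OF \<theta>1 C] by blast
  obtain c2 where c2: "0 \<le> c2" "\<And>f :: real ^ 2 \<Rightarrow> complex. f \<in> clorentz_space (ennreal (1 / \<theta>2)) 1 lebesgue \<Longrightarrow> \<exists>f' a A. f'
      \<in> borel_measurable borel \<and>
      (AE x in lborel. f x = f' x) \<and> majorized f' a A \<and>
      weak_bdd \<theta>2 (\<lambda>x. \<Sum>i. ennreal (a i) * ring_root (q \<theta>2) (A i) x) (c2 * enn2real (lorentz_norm (ennreal (1 / \<theta>2)) 1
          lebesgue (magnitude f)))"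
    using maj[OF \<theta>2 zero_less_one] unfolding ennreal_1 mult_1 by blast
  have "(2 / 3 :: ennreal) = ennreal (2 / 3)" using divide_ennreal[of 2 3] by simp
  then have p: "(2 / 3 :: ennreal) \<noteq> \<infinity>" "enn2real (1 / (2 / 3)) = \<theta>1 + \<theta>2"
    using divide_ennreal[of 1 "2 / 3"] sum by simp_all
  show ?thesis
  proof (rule lorentz_bounded_bilinear_sph_max[where U = "\<lambda>A x. ennreal C * ring_root (q \<theta>1) A x" and V = "ring_root (q \<theta>2)",
      OF ac_proj_plane _ _ _ c1(1) c2(1) c1(2) c2(2) p])
    fix A B :: "(real ^ 2) set" and t :: real and x
    assume "A \<in> sets borel" "B \<in> sets borel" "t > 0"
    then show "sph_form (indicator A) (indicator B) t x \<le> ennreal C * ring_root (q \<theta>1) A x * ring_root (q \<theta>2) B x"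
      unfolding C_def by (rule sph_form_le_ring_root) (intro q1 \<theta>1 \<theta>2 qs)+
  next
    fix A :: "(real ^ 2) set" assume A: "A \<in> sets borel"
    show "(\<lambda>x. ennreal C * ring_root (q \<theta>1) A x) \<in> borel_measurable borel" using borel_measurable_ring_root[OF A] by measurable
    show "ring_root (q \<theta>2) A \<in> borel_measurable borel" by (rule borel_measurable_ring_root[OF A])
  qed
qed

theorem theorem1p1:
  fixes p1 p2 p :: ennreal
  assumes "1 \<le> p1" and "1 \<le> p2" and "1 / p = 1 / p1 + 1 / p2"
  shows "(1 \<le> p \<and> (p1 = 2 \<or> p2 = 2) \<longrightarrow>
            lorentz_bounded
              (bilinear_sph_max :: (real \<Rightarrow> complex) \<Rightarrow> (real \<Rightarrow> complex) \<Rightarrow> real \<Rightarrow> ennreal)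
              (p1, 1) (p2, 1) (p, \<infinity>)) \<and>
         (1 < p1 \<and> p1 < 2 \<and> 1 < p2 \<and> p2 < 2 \<and> p = 2 / 3 \<longrightarrow>
            lorentz_bounded
              (bilinear_sph_max :: (real^2 \<Rightarrow> complex) \<Rightarrow> (real^2 \<Rightarrow> complex) \<Rightarrow> real^2 \<Rightarrow> ennreal)
              (p1, 1) (p2, 1) (2 / 3, \<infinity>))"
proof -
  obtain \<theta>1 where \<theta>1: "0 \<le> \<theta>1" "\<theta>1 \<le> 1" "1 / p1 = ennreal \<theta>1" "p1 = (if \<theta>1 = 0 then \<infinity> else ennreal (1 / \<theta>1))"
    using ennreal_exponentE[OF assms(1)] .
  obtain \<theta>2 where \<theta>2: "0 \<le> \<theta>2" "\<theta>2 \<le> 1" "1 / p2 = ennreal \<theta>2" "p2 = (if \<theta>2 = 0 then \<infinity> else ennreal (1 / \<theta>2))"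
    using ennreal_exponentE[OF assms(2)] .
  have sum: "1 / p = ennreal (\<theta>1 + \<theta>2)" using assms(3) \<theta>1 \<theta>2 by simp
  have half: "\<theta> = 1 / 2" if "2 = (if \<theta> = 0 then \<infinity> else ennreal (1 / \<theta>))" "0 \<le> \<theta>" for \<theta>
  proof -
    have "\<theta> \<noteq> 0" using that(1) by auto
    then have "ennreal 2 = ennreal (1 / \<theta>)" using that(1) by simp
    then have "2 = 1 / \<theta>" using that(2) by (subst (asm) ennreal_inj) auto
    then show ?thesis using \<open>\<theta> \<noteq> 0\<close> by (simp add: field_simps)
  qed
  show ?thesis
  proof (intro conjI impI; elim conjE)
    assume p: "1 \<le> p" and "p1 = 2 \<or> p2 = 2"
    then have h: "\<theta>1 = 1 / 2 \<or> \<theta>2 = 1 / 2" using half \<theta>1(1,4) \<theta>2(1,4) by metis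
    obtain \<theta> where \<theta>: "0 \<le> \<theta>" "\<theta> \<le> 1" "1 / p = ennreal \<theta>" "p = (if \<theta> = 0 then \<infinity> else ennreal (1 / \<theta>))"
      using ennreal_exponentE[OF p] .
    have \<theta>s: "\<theta> = \<theta>1 + \<theta>2"
      using \<theta>(3) \<theta>1(1) \<theta>2(1) unfolding sum by (subst (asm) ennreal_inj) (auto simp: \<theta>(1))
    have pp: "p \<noteq> \<infinity>" "enn2real (1 / p) = \<theta>1 + \<theta>2"
      using \<theta>(4) \<theta>s h \<theta>1(1) \<theta>2(1) sum by auto
    \<comment> \<open>From p \<ge> 1 the reciprocals sum to at most 1; as one of them is 1/2, the
      other is at most 1/2.\<close>
    have le: "\<theta>1 \<le> 1 / 2" "\<theta>2 \<le> 1 / 2" using h \<theta>s \<theta>(2) \<theta>1(1) \<theta>2(1) by auto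
    \<comment> \<open>The constant 16 goes to the factor with exponent 2, because the other exponent
      may be infinite and then admits only a constant up to 1.\<close>
    from h show "lorentz_bounded (bilinear_sph_max :: (real \<Rightarrow> complex) \<Rightarrow> (real \<Rightarrow> complex) \<Rightarrow> real \<Rightarrow> ennreal) (p1, 1) (p2,
        1) (p, \<infinity>)"
    proof
      assume "\<theta>1 = 1 / 2"
      then show ?thesis by (intro lorentz_bounded_real[OF \<theta>1(4,1) le(1), of 16 p2 \<theta>2 1] \<theta>2 le pp) auto
    next
      assume "\<theta>2 = 1 / 2"
      then show ?thesis by (intro lorentz_bounded_real[OF \<theta>1(4,1) le(1), of 1 p2 \<theta>2 16] \<theta>2 le pp) auto
    qed
  next
    assume "1 < p1" "p1 < 2" "1 < p2" "p2 < 2" and p: "p = 2 / 3"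
    have "1 / 2 < \<theta> \<and> \<theta> < 1" if "1 < r" "r < 2" "r = (if \<theta> = 0 then \<infinity> else ennreal (1 / \<theta>))" "0 \<le> \<theta>" for \<theta> and r :: ennreal
    proof -
      have "\<theta> > 0" using that by (cases "\<theta> = 0") auto
      then have "ennreal 1 < ennreal (1 / \<theta>)" "ennreal (1 / \<theta>) < ennreal 2" using that by simp_all
      then have "1 < 1 / \<theta>" "1 / \<theta> < 2" using \<open>\<theta> > 0\<close> by (simp_all only: ennreal_less_iff zero_le_one
          zero_le_divide_1_iff less_imp_le)
      then show ?thesis using \<open>\<theta> > 0\<close> by (simp add: field_simps)
    qed
    then have t1: "1 / 2 < \<theta>1" "\<theta>1 < 1" and t2: "1 / 2 < \<theta>2" "\<theta>2 < 1"
      using \<open>1 < p1\<close> \<open>p1 < 2\<close> \<open>1 < p2\<close> \<open>p2 < 2\<close> \<theta>1(1,4) \<theta>2(1,4) by blast+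
    have "(2 / 3 :: ennreal) = ennreal (2 / 3)" using divide_ennreal[of 2 3] by simp
    then have "1 / p = ennreal (3 / 2)" using divide_ennreal[of 1 "2 / 3"] p by simp
    then have "ennreal (\<theta>1 + \<theta>2) = ennreal (3 / 2)" unfolding sum .
    then have "\<theta>1 + \<theta>2 = 3 / 2" using \<theta>1(1) \<theta>2(1) by (subst (asm) ennreal_inj) auto
    from lorentz_bounded_plane[OF t1 t2 this]
    show "lorentz_bounded (bilinear_sph_max :: (real^2 \<Rightarrow> complex) \<Rightarrow> (real^2 \<Rightarrow> complex) \<Rightarrow> real^2 \<Rightarrow> ennreal) (p1, 1) (p2,
        1) (2 / 3, \<infinity>)"
      using \<theta>1(4) \<theta>2(4) t1 t2 by simp
  qed
qed

end
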